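(* The normed algebra $(L(Z_2)/S(Z_2),\|\cdot\|_S)$ is not complete. Equivalently, the image of $L(Z_2)$ by the Kalton--Swanson map $\Lambda$ is not closed in $L(H)$.
   Context: The scalar field is either $\mathbb{R}$ or $\mathbb{C}$. The Kalton--Peck space $Z_2$ is the twisted sum $\ell_2\oplus_{\Omega}\ell_2$, where $\Omega=\Omega_2$ is the quasi-linear map given on finitely supported vectors by $\Omega(x)(n)=x(n)\log\frac{\|x\|_2}{|x(n)|}$ (with value $0$ where $x(n)=0$); i.e. $Z_2$ is the space of pairs $(x,y)$ of sequences with $y\in\ell_2$, $x-\Omega y\in\ell_2$, with quasi-norm $\|(x,y)\|=\|x-\Omega y\|_2+\|y\|_2$ (equivalent to a Banach space norm). $L(Z_2)$ is the algebra of bounded linear operators on $Z_2$ and $S(Z_2)$ the ideal of strictly singular operators (operators whose restriction to any infinite dimensional closed subspace is not an isomorphism onto its range). For an operator $T$ on $Z_2$, $\|T\|_S$ is the infimum of those $\varepsilon>0$ such that every infinite dimensional closed subspace of $Z_2$ contains a further infinite dimensional closed subspace $Z$ with $\|T_{|Z}\|\le\varepsilon$; it vanishes exactly on $S(Z_2)$ and induces a norm, still denoted $\|\cdot\|_S$, on $L(Z_2)/S(Z_2)$. Let $\mathcal U$ be a non-trivial ultrafilter on $\mathbb{N}$ and $(e_n)$ the canonical basis of $\ell_2$. There is a symmetric bilinear (Hermitian sesquilinear in the complex case) positive form $(\cdot,\cdot)$ on $L(Z_2)$ determined by $(T,T)=\lim_{\mathcal U}\|T(e_n,0)\|_{Z_2}^2$.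 The Hilbert space $H$ is the completion of the quotient of $L(Z_2)$ by $\{T:(T,T)=0\}$, and $\widetilde T\in H$ denotes the element corresponding to $T$. For $A\in L(Z_2)$, $\Lambda(A)\in L(H)$ is the bounded operator determined by $\Lambda(A)\widetilde T=\widetilde{AT}$ for $T\in L(Z_2)$ (well defined by a result of Kalton--Swanson). *)

theory Defs
  imports "HOL-Analysis.Analysis"
begin

section \<open>The scalar field\<close>

text \<open>
  The class \<open>rc_field\<close> treats the real and the complex scalars simultaneously. Lemma
  \<open>rc_field_real_or_complex\<close> below shows that it has no other members than these two fields.
\<close>

class rc_field = real_normed_field +
  fixes sconj :: "'a \<Rightarrow> 'a"
  assumes sconj_add: "sconj (x + y) = sconj x + sconj y"
    and mult_sconj_scaleR: "x * sconj x = (norm x * norm x) *\<^sub>R 1"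

instantiation real :: rc_field
begin
definition sconj_real :: "real \<Rightarrow> real" where "sconj_real x = x"
instance by standard (auto simp: sconj_real_def)
end

instantiation complex :: rc_field
begin
definition sconj_complex :: "complex \<Rightarrow> complex" where "sconj_complex z = cnj z"
instance
  by standard (auto simp: sconj_complex_def scaleR_conv_of_real complex_norm_square[symmetric] power2_eq_square
      simp del: of_real_mult)
end

lemma mult_sconj: "x * sconj x = of_real ((norm (x::'k::rc_field))\<^sup>2)"
  by (simp add: mult_sconj_scaleR scaleR_conv_of_real power2_eq_square)

lemma sconj_zero: "sconj (0::'k::rc_field) = 0"
  using sconj_add[of "0::'k" 0] by simp

lemma norm_sconj: "norm (sconj x) = norm (x::'k::rc_field)"
proof (cases "x = 0")
  case False
  have "norm x * norm (sconj x) = norm x * norm x"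
    using arg_cong[OF mult_sconj[of x], of norm] by (simp add: norm_mult power2_eq_square)
  with False show ?thesis by simp
qed (simp add: sconj_zero)

lemma sconj_sconj: "sconj (sconj x) = (x::'k::rc_field)"
proof (cases "x = 0")
  case False
  then have "sconj x \<noteq> 0" by (metis norm_sconj norm_eq_zero)
  moreover have "sconj x * sconj (sconj x) = sconj x * x"
    using mult_sconj[of x] mult_sconj[of "sconj x"] by (simp add: norm_sconj mult.commute)
  ultimately show ?thesis by simp
qed (simp add: sconj_zero)

lemma sconj_minus: "sconj (- x) = - sconj (x::'k::rc_field)"
  using sconj_add[of x "- x"] by (simp add: sconj_zero eq_neg_iff_add_eq_0 add.commute)

lemma sconj_fixed_real:
  assumes "sconj x = (x::'k::rc_field)"
  shows "x \<in> \<real>"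
proof -
  have "x * x = of_real (norm x) * of_real (norm x)"
    using mult_sconj[of x] assms by (simp add: power2_eq_square)
  then have "x = of_real (norm x) \<or> x = - of_real (norm x)"
    by (simp add: square_eq_iff)
  then show ?thesis by (metis Reals_minus Reals_of_real)
qed

lemma sconj_of_real: "sconj (of_real r :: 'k::rc_field) = of_real r"
proof (cases "r = 0")
  case False
  have "of_real r * sconj (of_real r) = of_real r * (of_real r :: 'k)"
    using mult_sconj[of "of_real r :: 'k"] by (simp add: power2_eq_square)
  with False show ?thesis by simp
qed (simp add: sconj_zero)

lemma sconj_mult: "sconj (x * y) = sconj x * sconj (y::'k::rc_field)"
proof (cases "x * y = 0")
  case False
  have "x * y * sconj (x * y) = x * y * (sconj x * sconj y)"
    using mult_sconj[of x] mult_sconj[of y] mult_sconj[of "x * y"]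
    by (simp add: norm_mult power_mult_distrib algebra_simps)
  with False show ?thesis by simp
next
  case True
  then show ?thesis by (auto simp: sconj_zero)
qed

lemma rc_field_real_or_complex:
  "(\<forall>z::'k::rc_field. z \<in> \<real>) \<or>
   (\<exists>i::'k. i * i = -1 \<and> sconj i = - i \<and> (\<forall>z. \<exists>a b. z = of_real a + of_real b * i))"
proof (cases "\<forall>z::'k. z \<in> \<real>")
  case False
  then obtain z :: 'k where z: "z \<notin> \<real>" by blast
  define w where "w = z - sconj z"
  have w: "w \<noteq> 0" using z sconj_fixed_real[of z] by (auto simp: w_def)
  have cw: "sconj w = - w"
    using sconj_add[of z "- sconj z"] by (simp add: w_def sconj_minus sconj_sconj)
  define j where "j = w * of_real (inverse (norm w))"
  have cj: "sconj j = - j" by (simp add: j_def sconj_mult sconj_of_real cw del: of_real_inverse)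
  have "w * w = - (of_real (norm w) * of_real (norm w))"
    using mult_sconj[of w] cw by (simp add: power2_eq_square) (metis minus_minus)
  then have jj: "j * j = -1"
    using w by (simp add: j_def field_simps power2_eq_square)
  have "\<exists>a b. v = of_real a + of_real b * j" for v
  proof -
    define u where "u = v - sconj v"
    have cu: "sconj u = - u"
      using sconj_add[of v "- sconj v"] by (simp add: u_def sconj_minus sconj_sconj)
    have "v + sconj v \<in> \<real>"
      by (rule sconj_fixed_real) (simp add: sconj_add sconj_sconj add.commute)
    then obtain a where a: "v + sconj v = of_real a" by (auto elim: Reals_cases)
    have "u * j \<in> \<real>" by (rule sconj_fixed_real) (simp add: sconj_mult cu cj)
    then obtain b where b: "u * j = of_real b" by (auto elim: Reals_cases)
    have "u = - (u * j) * j" using jj by (simp add: mult.assoc)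
    then have u: "u = - (of_real b * j)" using b by simp
    have "2 * v = of_real a + u" using a by (simp add: u_def algebra_simps flip: a)
    then have "v = of_real (a / 2) + of_real (- b / 2) * j" using u by (simp add: field_simps)
    then show ?thesis by blast
  qed
  with jj cj show ?thesis by blast
qed simp

section \<open>The sequence space \<open>\<ell>\<^sub>2\<close> and the Kalton--Peck map\<close>

definition square_summable :: "(nat \<Rightarrow> 'k::real_normed_field) \<Rightarrow> bool"
  where "square_summable x \<longleftrightarrow> summable (\<lambda>n. (norm (x n))\<^sup>2)"

definition l2_norm :: "(nat \<Rightarrow> 'k::real_normed_field) \<Rightarrow> real"
  where "l2_norm x = sqrt (\<Sum>n. (norm (x n))\<^sup>2)"

definition Omega :: "(nat \<Rightarrow> 'k::real_normed_field) \<Rightarrow> nat \<Rightarrow> 'k"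
  where "Omega x n = (if x n = 0 then 0 else x n * of_real (ln (l2_norm x / norm (x n))))"


lemma square_summable_zero: "square_summable (\<lambda>n. 0)"
  by (simp add: square_summable_def)

lemma square_summable_scale:
  assumes "square_summable x"
  shows "square_summable (\<lambda>n. c * x n)"
  using summable_mult[OF assms[unfolded square_summable_def], of "(norm c)\<^sup>2"]
  by (simp add: square_summable_def norm_mult power_mult_distrib)

lemma square_summable_dominated:
  assumes "square_summable x" "\<And>n. norm (y n) \<le> norm (x n)"
  shows "square_summable y"
  using assms unfolding square_summable_def
  by (intro summable_comparison_test[OF _ assms(1)[unfolded square_summable_def]])
     (auto intro!: exI[of _ 0] power_mono)

lemma square_summable_add:
  assumes "square_summable x" "square_summable y"
  shows "square_summable (\<lambda>n. x n + y n)"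
proof -
  have "summable (\<lambda>n. 2 * ((norm (x n))\<^sup>2 + (norm (y n))\<^sup>2))"
    using assms unfolding square_summable_def by (intro summable_mult summable_add)
  moreover have "(norm (x n + y n))\<^sup>2 \<le> 2 * ((norm (x n))\<^sup>2 + (norm (y n))\<^sup>2)" for n
  proof -
    have "(norm (x n + y n))\<^sup>2 \<le> (norm (x n) + norm (y n))\<^sup>2"
      by (intro power_mono norm_triangle_ineq) auto
    also have "\<dots> \<le> 2 * ((norm (x n))\<^sup>2 + (norm (y n))\<^sup>2)"
      using sum_squares_bound[of "norm (x n)" "norm (y n)"] by (simp add: power2_sum)
    finally show ?thesis .
  qed
  ultimately show ?thesis
    unfolding square_summable_def by - (rule summable_comparison_test'[where N = 0], auto)
qed

lemma l2_norm_zero: "l2_norm (\<lambda>n. 0) = 0"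
  by (simp add: l2_norm_def)

lemma l2_norm_nonneg:
  assumes "square_summable x"
  shows "0 \<le> l2_norm x"
  using assms by (simp add: l2_norm_def square_summable_def suminf_nonneg)

lemma l2_norm_scale:
  assumes "square_summable x"
  shows "l2_norm (\<lambda>n. c * x n) = norm c * l2_norm x"
  using suminf_mult[OF assms[unfolded square_summable_def], of "(norm c)\<^sup>2"]
  by (simp add: l2_norm_def norm_mult power_mult_distrib real_sqrt_mult)

lemma norm_le_l2_norm:
  assumes "square_summable x"
  shows "norm (x n) \<le> l2_norm x"
proof -
  have "(\<Sum>k\<in>{n}. (norm (x k))\<^sup>2) \<le> (\<Sum>k. (norm (x k))\<^sup>2)"
    using assms by (intro sum_le_suminf) (auto simp: square_summable_def)
  then show ?thesis unfolding l2_norm_def by (simp add: real_le_rsqrt)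
qed

lemma l2_norm_mono:
  assumes "square_summable x" "\<And>n. norm (y n) \<le> norm (x n)"
  shows "l2_norm y \<le> l2_norm x"
  using square_summable_dominated[OF assms] assms unfolding l2_norm_def square_summable_def
  by (intro real_sqrt_le_mono suminf_le) (auto intro!: power_mono)

lemma L2_set_tendsto_l2_norm:
  assumes "square_summable x"
  shows "(\<lambda>n. L2_set (\<lambda>k. norm (x k)) {..<n}) \<longlonglongrightarrow> l2_norm x"
  unfolding L2_set_def l2_norm_def
  using assms by (intro tendsto_real_sqrt summable_LIMSEQ) (simp add: square_summable_def)

lemma l2_norm_triangle:
  assumes "square_summable x" "square_summable y"
  shows "l2_norm (\<lambda>n. x n + y n) \<le> l2_norm x + l2_norm y"
proof (rule LIMSEQ_le)
  show "(\<lambda>n. L2_set (\<lambda>k. norm (x k + y k)) {..<n}) \<longlonglongrightarrow> l2_norm (\<lambda>n. x n + y n)"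
    by (intro L2_set_tendsto_l2_norm square_summable_add assms)
  show "(\<lambda>n. L2_set (\<lambda>k. norm (x k)) {..<n} + L2_set (\<lambda>k. norm (y k)) {..<n})
      \<longlonglongrightarrow> l2_norm x + l2_norm y"
    by (intro tendsto_add L2_set_tendsto_l2_norm assms)
  have "L2_set (\<lambda>k. norm (x k + y k)) {..<n}
      \<le> L2_set (\<lambda>k. norm (x k)) {..<n} + L2_set (\<lambda>k. norm (y k)) {..<n}" for n
    by (rule order_trans[OF L2_set_mono L2_set_triangle_ineq]) (auto intro: norm_triangle_ineq)
  then show "\<exists>N. \<forall>n\<ge>N. L2_set (\<lambda>k. norm (x k + y k)) {..<n}
      \<le> L2_set (\<lambda>k. norm (x k)) {..<n} + L2_set (\<lambda>k. norm (y k)) {..<n}"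
    by blast
qed

lemma Omega_zero: "Omega (\<lambda>n. 0) = (\<lambda>n. 0)"
  by (simp add: Omega_def fun_eq_iff)

lemma Omega_scale:
  assumes "square_summable x"
  shows "Omega (\<lambda>n. c * x n) = (\<lambda>n. c * Omega x n)"
  using assms by (auto simp: Omega_def fun_eq_iff l2_norm_scale norm_mult)

lemma Omega_ln:
  assumes "square_summable x"
  shows "Omega x n = of_real (ln (l2_norm x) - ln (norm (x n))) * x n"
proof (cases "x n = 0")
  case False
  then have "l2_norm x > 0"
    using norm_le_l2_norm[OF assms, of n] by (meson less_le_trans zero_less_norm_iff)
  with False show ?thesis by (simp add: Omega_def ln_div)
qed (simp add: Omega_def)

lemma abs_ln_diff_bound:
  assumes "0 \<le> u" "u \<le> (w::real)"
  shows "\<bar>ln u - ln w\<bar> * u \<le> w"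
proof (cases "u = 0")
  case False
  then have u: "0 < u" "0 < w" using assms by auto
  have "\<bar>ln u - ln w\<bar> = ln (w / u)" using u assms by (simp add: ln_div abs_if)
  also have "\<dots> \<le> w / u - 1" using u by (intro ln_le_minus_one) simp
  finally have "\<bar>ln u - ln w\<bar> * u \<le> (w / u - 1) * u" using u by (intro mult_right_mono) auto
  also have "\<dots> \<le> w" using u by (simp add: field_simps)
  finally show ?thesis .
qed (use assms in simp)

lemma Omega_quasi_linear:
  fixes x y :: "nat \<Rightarrow> 'k::real_normed_field"
  assumes x: "square_summable x" and y: "square_summable y"
  defines "D \<equiv> \<lambda>n. Omega (\<lambda>n. x n + y n) n - Omega x n - Omega y n"
  shows "square_summable D" "l2_norm D \<le> 6 * (l2_norm x + l2_norm y)"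
proof -
  define z where "z = (\<lambda>n. x n + y n)"
  have z: "square_summable z" unfolding z_def by (intro square_summable_add x y)
  define w where "w = l2_norm x + l2_norm y"
  define lx where "lx = ln (l2_norm x) - ln w"
  define ly where "ly = ln (l2_norm y) - ln w"
  define lz where "lz = ln (l2_norm z) - ln w"
  define A1 where "A1 = (\<lambda>n. of_real lz * z n)"
  define A2 where "A2 = (\<lambda>n. of_real (- lx) * x n)"
  define A3 where "A3 = (\<lambda>n. of_real (- ly) * y n)"
  define A where "A = (\<lambda>n. A1 n + A2 n + A3 n)"
  have xw: "0 \<le> l2_norm x" "l2_norm x \<le> w" and yw: "0 \<le> l2_norm y" "l2_norm y \<le> w"
    and zw: "0 \<le> l2_norm z" "l2_norm z \<le> w"
    using l2_norm_nonneg[OF x] l2_norm_nonneg[OF y] l2_norm_nonneg[OF z] l2_norm_triangle[OF x y]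
    by (auto simp: w_def z_def)
  have s: "square_summable A1" "square_summable A2" "square_summable A3"
    unfolding A1_def A2_def A3_def by (intro square_summable_scale x y z)+
  have sA: "square_summable A" unfolding A_def by (intro square_summable_add s)
  have n1: "l2_norm A1 \<le> w" and n2: "l2_norm A2 \<le> w" and n3: "l2_norm A3 \<le> w"
    using abs_ln_diff_bound[OF xw] abs_ln_diff_bound[OF yw] abs_ln_diff_bound[OF zw]
    unfolding A1_def A2_def A3_def lx_def ly_def lz_def
    by (simp_all add: l2_norm_scale x y z abs_minus_commute del: of_real_diff of_real_minus)
  have "l2_norm A \<le> l2_norm (\<lambda>n. A1 n + A2 n) + l2_norm A3"
    unfolding A_def by (intro l2_norm_triangle square_summable_add s)
  also have "l2_norm (\<lambda>n. A1 n + A2 n) \<le> l2_norm A1 + l2_norm A2"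
    by (intro l2_norm_triangle s)
  finally have nA: "l2_norm A \<le> 3 * w" using n1 n2 n3 by linarith

  define B where "B = (\<lambda>n. of_real (ln (norm (z n))) * z n - of_real (ln (norm (x n))) * x n
      - of_real (ln (norm (y n))) * y n)"
  define X :: "nat \<Rightarrow> real" where "X = (\<lambda>n. 3 * (norm (x n) + norm (y n)))"
  have ax: "square_summable (\<lambda>n. norm (x n))" and ay: "square_summable (\<lambda>n. norm (y n))"
    using x y by (simp_all add: square_summable_def)
  have sX: "square_summable X"
    unfolding X_def by (intro square_summable_scale square_summable_add ax ay)
  have nX: "l2_norm X \<le> 3 * w"
  proof -
    have "l2_norm X = 3 * l2_norm (\<lambda>n. norm (x n) + norm (y n))"
      unfolding X_def by (subst l2_norm_scale) (auto intro!: square_summable_add ax ay)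
    also have "\<dots> \<le> 3 * (l2_norm (\<lambda>n. norm (x n)) + l2_norm (\<lambda>n. norm (y n)))"
      by (intro mult_left_mono l2_norm_triangle ax ay) auto
    also have "\<dots> = 3 * w" by (simp add: w_def l2_norm_def)
    finally show ?thesis .
  qed
  have B: "norm (B n) \<le> norm (X n)" for n
  proof -
    define v where "v = norm (x n) + norm (y n)"
    have "B n = of_real (ln (norm (z n)) - ln v) * z n - of_real (ln (norm (x n)) - ln v) * x n
        - of_real (ln (norm (y n)) - ln v) * y n"
      by (simp add: B_def z_def algebra_simps)
    also have "norm \<dots> \<le> norm (of_real (ln (norm (z n)) - ln v) * z n)
        + norm (of_real (ln (norm (x n)) - ln v) * x n)
        + norm (of_real (ln (norm (y n)) - ln v) * y n)"
      by (intro norm_triangle_le_diff add_mono order_refl)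
    also have "\<dots> \<le> v + v + v"
      unfolding norm_mult norm_of_real
      by (intro add_mono abs_ln_diff_bound) (auto simp: v_def z_def norm_triangle_ineq)
    also have "\<dots> = norm (X n)" by (simp add: X_def v_def)
    finally show ?thesis .
  qed
  have sB: "square_summable B" by (rule square_summable_dominated[OF sX B])
  have sB': "square_summable (\<lambda>n. - 1 * B n)" by (rule square_summable_scale[OF sB])
  have Dn: "D n = A n + - 1 * B n" for n
  proof -
    have "D n = Omega z n - Omega x n - Omega y n" by (simp add: D_def z_def)
    also have "\<dots> = (of_real (ln (l2_norm z)) - of_real (ln (norm (z n)))) * z n
        - (of_real (ln (l2_norm x)) - of_real (ln (norm (x n)))) * x n
        - (of_real (ln (l2_norm y)) - of_real (ln (norm (y n)))) * y n"
      by (simp only: Omega_ln[OF x] Omega_ln[OF y] Omega_ln[OF z] of_real_diff)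
    also have "\<dots> = (of_real lz * z n + of_real (- lx) * x n + of_real (- ly) * y n) - B n"
      by (simp add: lx_def ly_def lz_def B_def z_def left_diff_distrib distrib_left)
    finally show ?thesis by (simp add: A_def A1_def A2_def A3_def)
  qed
  then have D: "D = (\<lambda>n. A n + - 1 * B n)" by blast
  show "square_summable D" unfolding D by (rule square_summable_add[OF sA sB'])
  have "l2_norm D \<le> l2_norm A + l2_norm (\<lambda>n. - 1 * B n)"
    unfolding D by (rule l2_norm_triangle[OF sA sB'])
  also have "l2_norm (\<lambda>n. - 1 * B n) = l2_norm B" by (simp add: l2_norm_def)
  also have "l2_norm B \<le> l2_norm X" by (rule l2_norm_mono[OF sX B])
  finally show "l2_norm D \<le> 6 * (l2_norm x + l2_norm y)" using nA nX by (simp add: w_def)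
qed

section \<open>The Kalton--Peck space\<close>

typedef (overloaded) 'k kp =
  "{(x :: nat \<Rightarrow> 'k::real_normed_field, y :: nat \<Rightarrow> 'k).
      square_summable y \<and> square_summable (\<lambda>n. x n - Omega y n)}"
  by (intro exI[of _ "(\<lambda>n. 0, \<lambda>n. 0)"]) (simp add: Omega_zero square_summable_zero)

setup_lifting type_definition_kp

lift_definition kp_norm :: "'k::real_normed_field kp \<Rightarrow> real"
  is "\<lambda>(x, y). l2_norm (\<lambda>n. x n - Omega y n) + l2_norm y" .

lift_definition kp_scale :: "'k::real_normed_field \<Rightarrow> 'k kp \<Rightarrow> 'k kp"
  is "\<lambda>c (x, y). (\<lambda>n. c * x n, \<lambda>n. c * y n)"
proof (clarsimp, intro conjI)
  fix c :: 'k and x y :: "nat \<Rightarrow> 'k"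
  assume y: "square_summable y" and xy: "square_summable (\<lambda>n. x n - Omega y n)"
  show "square_summable (\<lambda>n. c * y n)" by (rule square_summable_scale[OF y])
  have "(\<lambda>n. c * x n - Omega (\<lambda>n. c * y n) n) = (\<lambda>n. c * (x n - Omega y n))"
    by (simp add: Omega_scale y algebra_simps)
  then show "square_summable (\<lambda>n. c * x n - Omega (\<lambda>n. c * y n) n)"
    using square_summable_scale[OF xy, of c] by simp
qed

text \<open>The vector \<open>(e\<^sub>n, 0)\<close>.\<close>

lift_definition kp_unit :: "nat \<Rightarrow> 'k::real_normed_field kp"
  is "\<lambda>n. (\<lambda>k. if k = n then 1 else 0, \<lambda>k. 0)"
proof (clarsimp simp: Omega_zero square_summable_zero)
  show "square_summable (\<lambda>k. if k = n then 1 else 0)" for n :: nat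
    unfolding square_summable_def by (rule summable_finite[of "{n}"]) auto
qed

lemma kp_add_aux:
  assumes y: "square_summable y" "square_summable (\<lambda>n. x n - Omega y n)"
    and v: "square_summable v" "square_summable (\<lambda>n. u n - Omega v n)"
  shows "square_summable (\<lambda>n. y n + v n)"
    and "square_summable (\<lambda>n. x n + u n - Omega (\<lambda>n. y n + v n) n)"
    and "l2_norm (\<lambda>n. x n + u n - Omega (\<lambda>n. y n + v n) n) + l2_norm (\<lambda>n. y n + v n)
      \<le> 7 * ((l2_norm (\<lambda>n. x n - Omega y n) + l2_norm y)
            + (l2_norm (\<lambda>n. u n - Omega v n) + l2_norm v))"
proof -
  define D where "D = (\<lambda>n. Omega (\<lambda>n. y n + v n) n - Omega y n - Omega v n)"
  have D: "square_summable D" "l2_norm D \<le> 6 * (l2_norm y + l2_norm v)"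
    using Omega_quasi_linear[OF y(1) v(1)] by (simp_all add: D_def)
  have D': "square_summable (\<lambda>n. - 1 * D n)" by (rule square_summable_scale[OF D(1)])
  have nD': "l2_norm (\<lambda>n. - 1 * D n) = l2_norm D" by (simp add: l2_norm_def)
  have eq: "(\<lambda>n. x n + u n - Omega (\<lambda>n. y n + v n) n)
      = (\<lambda>n. (x n - Omega y n) + (u n - Omega v n) + - 1 * D n)"
    by (simp add: D_def fun_eq_iff)
  show "square_summable (\<lambda>n. y n + v n)" by (rule square_summable_add[OF y(1) v(1)])
  show "square_summable (\<lambda>n. x n + u n - Omega (\<lambda>n. y n + v n) n)"
    unfolding eq by (rule square_summable_add[OF square_summable_add[OF y(2) v(2)] D'])
  have "l2_norm (\<lambda>n. x n + u n - Omega (\<lambda>n. y n + v n) n)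
      \<le> l2_norm (\<lambda>n. (x n - Omega y n) + (u n - Omega v n)) + l2_norm D"
    unfolding eq nD'[symmetric] by (rule l2_norm_triangle[OF square_summable_add[OF y(2) v(2)] D'])
  moreover have "l2_norm (\<lambda>n. (x n - Omega y n) + (u n - Omega v n))
      \<le> l2_norm (\<lambda>n. x n - Omega y n) + l2_norm (\<lambda>n. u n - Omega v n)"
    by (rule l2_norm_triangle[OF y(2) v(2)])
  moreover have "a + e \<le> 7 * ((p + s) + (q + t))"
    if "a \<le> b + d" "b \<le> p + q" "d \<le> 6 * (s + t)" "e \<le> s + t" "0 \<le> p" "0 \<le> q"
    for a b d e p q s t :: real
    using that by (simp add: algebra_simps)
  ultimately show "l2_norm (\<lambda>n. x n + u n - Omega (\<lambda>n. y n + v n) n) + l2_norm (\<lambda>n. y n + v n)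
      \<le> 7 * ((l2_norm (\<lambda>n. x n - Omega y n) + l2_norm y)
            + (l2_norm (\<lambda>n. u n - Omega v n) + l2_norm v))"
    using D(2) l2_norm_triangle[OF y(1) v(1)] l2_norm_nonneg[OF y(2)] l2_norm_nonneg[OF v(2)]
    by blast
qed

lemma kp_scale_aux:
  assumes y: "square_summable y" "square_summable (\<lambda>n. x n - Omega y n)"
  shows "l2_norm (\<lambda>n. c * x n - Omega (\<lambda>n. c * y n) n) + l2_norm (\<lambda>n. c * y n)
      = norm c * (l2_norm (\<lambda>n. x n - Omega y n) + l2_norm y)"
proof -
  have "(\<lambda>n. c * x n - Omega (\<lambda>n. c * y n) n) = (\<lambda>n. c * (x n - Omega y n))"
    by (simp add: Omega_scale y algebra_simps)
  then show ?thesis by (simp add: l2_norm_scale[OF y(1)] l2_norm_scale[OF y(2)] distrib_left)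
qed

instantiation kp :: (real_normed_field) ab_group_add
begin

lift_definition zero_kp :: "'a kp" is "(\<lambda>n. 0, \<lambda>n. 0)"
  by (simp add: Omega_zero square_summable_zero)

lift_definition plus_kp :: "'a kp \<Rightarrow> 'a kp \<Rightarrow> 'a kp"
  is "\<lambda>(x, y) (u, v). (\<lambda>n. x n + u n, \<lambda>n. y n + v n)"
  using kp_add_aux(1,2) by fast

definition uminus_kp :: "'a kp \<Rightarrow> 'a kp" where "uminus_kp z = kp_scale (- 1) z"

definition minus_kp :: "'a kp \<Rightarrow> 'a kp \<Rightarrow> 'a kp" where "minus_kp z w = z + - w"

instance
proof
  fix a b c :: "'a kp"
  show "a + b + c = a + (b + c)" by transfer (auto simp: add.assoc)
  show "a + b = b + a" by transfer (auto simp: add.commute)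
  show "0 + a = a" by transfer auto
  show "- a + a = 0" unfolding uminus_kp_def by transfer auto
  show "a - b = a + - b" by (simp add: minus_kp_def)
qed

end

interpretation kp: vector_space kp_scale
  by standard (transfer; auto simp: algebra_simps)+

lemma kp_norm_nonneg: "0 \<le> kp_norm z"
  by transfer (auto intro!: add_nonneg_nonneg l2_norm_nonneg)

lemma kp_norm_add: "kp_norm (z + w) \<le> 7 * (kp_norm z + kp_norm w)"
  by transfer (use kp_add_aux(3) in fast)

lemma kp_norm_scale: "kp_norm (kp_scale c z) = norm c * kp_norm z"
  by transfer (use kp_scale_aux in fast)

lemma kp_norm_zero: "kp_norm (0::'k::real_normed_field kp) = 0"
  by transfer (simp add: Omega_zero l2_norm_zero)

definition kp_closed :: "'k::real_normed_field kp set \<Rightarrow> bool"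
  where "kp_closed Z \<longleftrightarrow> (\<forall>f z. (\<forall>n. f n \<in> Z) \<and> (\<lambda>n. kp_norm (f n - z)) \<longlonglongrightarrow> 0 \<longrightarrow> z \<in> Z)"

definition inf_dim_closed_subspace :: "'k::real_normed_field kp set \<Rightarrow> bool"
  where "inf_dim_closed_subspace Z \<longleftrightarrow>
    kp.subspace Z \<and> kp_closed Z \<and> \<not> (\<exists>B. finite B \<and> kp.span B = Z)"

section \<open>The algebra \<open>L(Z\<^sub>2)\<close> and its quotient by the strictly singular operators\<close>

typedef (overloaded) 'k kp_op =
  "{T :: 'k::real_normed_field kp \<Rightarrow> 'k kp.
      Vector_Spaces.linear kp_scale kp_scale T \<and> (\<exists>C. \<forall>z. kp_norm (T z) \<le> C * kp_norm z)}"
  morphisms kp_apply Abs_kp_op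
  by (intro exI[of _ "\<lambda>z. z"]) (auto intro!: kp.linear_ident exI[of _ 1])

setup_lifting type_definition_kp_op

lemma kp_linear_iff:
  "Vector_Spaces.linear kp_scale kp_scale T \<longleftrightarrow>
    (\<forall>z w. T (z + w) = T z + T w) \<and> (\<forall>c z. T (kp_scale c z) = kp_scale c (T z))"
  using kp.vector_space_axioms
  by (auto simp: linear_iff_module_hom module_hom_iff module_iff_vector_space)

lemma kp_bound_nonneg:
  assumes "\<exists>C. \<forall>z. kp_norm (T z) \<le> C * kp_norm z"
  obtains C where "0 \<le> C" "\<And>z. kp_norm (T z) \<le> C * kp_norm z"
proof -
  from assms obtain C where "\<And>z. kp_norm (T z) \<le> C * kp_norm z" by blast
  then have "kp_norm (T z) \<le> \<bar>C\<bar> * kp_norm z" for z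
    by (meson abs_ge_self kp_norm_nonneg mult_right_mono order_trans)
  then show ?thesis using that[of "\<bar>C\<bar>"] by simp
qed

lift_definition kp_op_scale :: "'k::real_normed_field \<Rightarrow> 'k kp_op \<Rightarrow> 'k kp_op"
  is "\<lambda>c T z. kp_scale c (T z)"
proof (intro conjI)
  fix c :: 'k and T :: "'k kp \<Rightarrow> 'k kp"
  assume T: "Vector_Spaces.linear kp_scale kp_scale T \<and> (\<exists>C. \<forall>z. kp_norm (T z) \<le> C * kp_norm z)"
  then show "Vector_Spaces.linear kp_scale kp_scale (\<lambda>z. kp_scale c (T z))"
    by (simp add: kp_linear_iff kp.scale_right_distrib mult.commute)
  from T obtain C where "0 \<le> C" "\<And>z. kp_norm (T z) \<le> C * kp_norm z"
    using kp_bound_nonneg[of T] by blast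
  then show "\<exists>C. \<forall>z. kp_norm (kp_scale c (T z)) \<le> C * kp_norm z"
    by (intro exI[of _ "norm c * C"]) (simp add: kp_norm_scale mult.assoc mult_left_mono)
qed

text \<open>Multiplication is composition of operators.\<close>

instantiation kp_op :: (real_normed_field) ring_1
begin

lift_definition zero_kp_op :: "'a kp_op" is "\<lambda>z. 0"
  by (auto simp: kp_linear_iff kp_norm_zero intro!: exI[of _ 0])

lift_definition one_kp_op :: "'a kp_op" is "\<lambda>z. z"
  by (auto simp: kp_linear_iff intro!: exI[of _ 1])

lift_definition plus_kp_op :: "'a kp_op \<Rightarrow> 'a kp_op \<Rightarrow> 'a kp_op" is "\<lambda>S T z. S z + T z"
proof (intro conjI)
  fix S T :: "'a kp \<Rightarrow> 'a kp"
  assume S: "Vector_Spaces.linear kp_scale kp_scale S \<and> (\<exists>C. \<forall>z. kp_norm (S z) \<le> C * kp_norm z)"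
    and T: "Vector_Spaces.linear kp_scale kp_scale T \<and> (\<exists>C. \<forall>z. kp_norm (T z) \<le> C * kp_norm z)"
  then show "Vector_Spaces.linear kp_scale kp_scale (\<lambda>z. S z + T z)"
    by (simp add: kp_linear_iff kp.scale_right_distrib add_ac)
  from S T obtain C D where "\<And>z. kp_norm (S z) \<le> C * kp_norm z" "\<And>z. kp_norm (T z) \<le> D * kp_norm z"
    by blast
  then have "kp_norm (S z + T z) \<le> 7 * (C * kp_norm z + D * kp_norm z)" for z
    by (intro order_trans[OF kp_norm_add]) (auto intro!: add_mono)
  then show "\<exists>C. \<forall>z. kp_norm (S z + T z) \<le> C * kp_norm z"
    by (intro exI[of _ "7 * (C + D)"]) (simp add: algebra_simps)
qed

lift_definition times_kp_op :: "'a kp_op \<Rightarrow> 'a kp_op \<Rightarrow> 'a kp_op" is "\<lambda>S T z. S (T z)"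
proof (intro conjI)
  fix S T :: "'a kp \<Rightarrow> 'a kp"
  assume S: "Vector_Spaces.linear kp_scale kp_scale S \<and> (\<exists>C. \<forall>z. kp_norm (S z) \<le> C * kp_norm z)"
    and T: "Vector_Spaces.linear kp_scale kp_scale T \<and> (\<exists>C. \<forall>z. kp_norm (T z) \<le> C * kp_norm z)"
  then show "Vector_Spaces.linear kp_scale kp_scale (\<lambda>z. S (T z))"
    by (simp add: kp_linear_iff)
  from S obtain C where C: "0 \<le> C" "\<And>z. kp_norm (S z) \<le> C * kp_norm z"
    using kp_bound_nonneg[of S] by blast
  from T obtain D where D: "\<And>z. kp_norm (T z) \<le> D * kp_norm z" by blast
  have "kp_norm (S (T z)) \<le> C * D * kp_norm z" for z
    using order_trans[OF C(2) mult_left_mono[OF D C(1)]] by (simp add: mult.assoc)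
  then show "\<exists>C. \<forall>z. kp_norm (S (T z)) \<le> C * kp_norm z" by blast
qed

definition uminus_kp_op :: "'a kp_op \<Rightarrow> 'a kp_op" where "uminus_kp_op T = kp_op_scale (- 1) T"

definition minus_kp_op :: "'a kp_op \<Rightarrow> 'a kp_op \<Rightarrow> 'a kp_op" where "minus_kp_op S T = S + - T"

instance
proof
  fix R S T :: "'a kp_op"
  show "R + S + T = R + (S + T)" by transfer (simp add: add.assoc)
  show "R + S = S + R" by transfer (simp add: add.commute)
  show "0 + R = R" by transfer simp
  show "- R + R = 0" unfolding uminus_kp_op_def by transfer (simp add: kp.scale_minus_left)
  show "R - S = R + - S" by (simp add: minus_kp_op_def)
  show "R * S * T = R * (S * T)" by transfer simp
  show "1 * R = R" "R * 1 = R" by (transfer; simp)+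
  show "(R + S) * T = R * T + S * T" by transfer simp
  show "R * (S + T) = R * S + R * T" by transfer (simp add: kp_linear_iff)
  have "kp_unit 0 \<noteq> (0::'a kp)" by transfer (auto simp: fun_eq_iff)
  then show "(0::'a kp_op) \<noteq> 1"
    using zero_kp_op.rep_eq one_kp_op.rep_eq by (metis (mono_tags))
qed

end

definition op_norm_on :: "'k::real_normed_field kp_op \<Rightarrow> 'k kp set \<Rightarrow> real"
  where "op_norm_on T Z = (SUP z\<in>{z \<in> Z. kp_norm z \<le> 1}. kp_norm (kp_apply T z))"

definition iso_onto_range_on :: "'k::real_normed_field kp_op \<Rightarrow> 'k kp set \<Rightarrow> bool"
  where "iso_onto_range_on T Z \<longleftrightarrow> inj_on (kp_apply T) Z \<and>
    (\<exists>C. \<forall>w \<in> kp_apply T ` Z. kp_norm (the_inv_into Z (kp_apply T) w) \<le> C * kp_norm w)"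

definition strictly_singular :: "'k::real_normed_field kp_op \<Rightarrow> bool"
  where "strictly_singular T \<longleftrightarrow> (\<forall>Z. inf_dim_closed_subspace Z \<longrightarrow> \<not> iso_onto_range_on T Z)"

definition S_norm :: "'k::real_normed_field kp_op \<Rightarrow> real"
  where "S_norm T = Inf {\<epsilon>. \<epsilon> > 0 \<and> (\<forall>Y. inf_dim_closed_subspace Y \<longrightarrow>
    (\<exists>Z. inf_dim_closed_subspace Z \<and> Z \<subseteq> Y \<and> op_norm_on T Z \<le> \<epsilon>))}"

definition ss_rel :: "('k::real_normed_field kp_op \<times> 'k kp_op) set"
  where "ss_rel = {(S, T). strictly_singular (S - T)}"

definition ss_quotient :: "'k::real_normed_field kp_op set set"
  where "ss_quotient = UNIV // ss_rel"

definition ss_quotient_diff :: "'k::real_normed_field kp_op set \<Rightarrow> 'k kp_op set \<Rightarrow> 'k kp_op set"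
  where "ss_quotient_diff X Y = (\<Union>S\<in>X. \<Union>T\<in>Y. ss_rel `` {S - T})"

text \<open>\<^const>\<open>S_norm\<close> takes one and the same value on all representatives of a class.\<close>

definition ss_quotient_norm :: "'k::real_normed_field kp_op set \<Rightarrow> real"
  where "ss_quotient_norm X = the_elem (S_norm ` X)"

text \<open>
  The locale \<^locale>\<open>Metric_space\<close> requires a distance to be nonnegative and symmetric even outside the
  carrier; hence the default value 0 here and in the distance on \<open>L(H)\<close> below.
\<close>

definition ss_quotient_dist :: "'k::real_normed_field kp_op set \<Rightarrow> 'k kp_op set \<Rightarrow> real"
  where "ss_quotient_dist X Y =
    (if X \<in> ss_quotient \<and> Y \<in> ss_quotient then ss_quotient_norm (ss_quotient_diff X Y) else 0)"

section \<open>The Hilbert space \<open>H\<close> and the Kalton--Swanson map\<close>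

definition nontrivial_ultrafilter :: "'a filter \<Rightarrow> bool"
  where "nontrivial_ultrafilter U \<longleftrightarrow> U \<noteq> bot \<and>
    (\<forall>P. eventually P U \<or> eventually (\<lambda>x. \<not> P x) U) \<and> (\<forall>a. \<not> eventually (\<lambda>x. x = a) U)"

definition hermitian_form :: "('k::rc_field kp_op \<Rightarrow> 'k kp_op \<Rightarrow> 'k) \<Rightarrow> bool"
  where "hermitian_form B \<longleftrightarrow>
    (\<forall>R S T. B (R + S) T = B R T + B S T) \<and>
    (\<forall>c S T. B (kp_op_scale c S) T = c * B S T) \<and>
    (\<forall>S T. B T S = sconj (B S T))"

text \<open>
  A Hermitian form is determined by its diagonal (polarization); the diagonal prescribed here is
  nonnegative, so that the form is positive.
\<close>

definition ks_form :: "nat filter \<Rightarrow> 'k::rc_field kp_op \<Rightarrow> 'k kp_op \<Rightarrow> 'k"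
  where "ks_form U = (THE B. hermitian_form B \<and>
    (\<forall>T. B T T = of_real (Lim U (\<lambda>n. (kp_norm (kp_apply T (kp_unit n)))\<^sup>2))))"

definition ks_seminorm :: "nat filter \<Rightarrow> 'k::rc_field kp_op \<Rightarrow> real"
  where "ks_seminorm U T = sqrt (norm (ks_form U T T))"

text \<open>
  \<open>H\<close> is realised as the Cauchy sequences in \<open>L(Z\<^sub>2)\<close> modulo the null sequences, with respect to
  \<open>ks_seminorm\<close>. This performs the passage to the quotient by \<open>{T. (T, T) = 0}\<close> and the
  completion in a single step.
\<close>

definition ks_cauchy :: "nat filter \<Rightarrow> (nat \<Rightarrow> 'k::rc_field kp_op) set"
  where "ks_cauchy U = {x. \<forall>e>0. \<exists>N. \<forall>m\<ge>N. \<forall>n\<ge>N. ks_seminorm U (x m - x n) < e}"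

definition ks_rel :: "nat filter \<Rightarrow> ((nat \<Rightarrow> 'k::rc_field kp_op) \<times> (nat \<Rightarrow> 'k kp_op)) set"
  where "ks_rel U = {(x, y). x \<in> ks_cauchy U \<and> y \<in> ks_cauchy U \<and>
    (\<lambda>n. ks_seminorm U (x n - y n)) \<longlonglongrightarrow> 0}"

type_synonym 'k hvec = "(nat \<Rightarrow> 'k kp_op) set"

definition H_space :: "nat filter \<Rightarrow> 'k::rc_field hvec set"
  where "H_space U = ks_cauchy U // ks_rel U"

definition H_add :: "nat filter \<Rightarrow> 'k::rc_field hvec \<Rightarrow> 'k hvec \<Rightarrow> 'k hvec"
  where "H_add U X Y = (\<Union>x\<in>X. \<Union>y\<in>Y. ks_rel U `` {\<lambda>n. x n + y n})"

definition H_scale :: "nat filter \<Rightarrow> 'k::rc_field \<Rightarrow> 'k hvec \<Rightarrow> 'k hvec"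
  where "H_scale U c X = (\<Union>x\<in>X. ks_rel U `` {\<lambda>n. kp_op_scale c (x n)})"

definition H_inner :: "nat filter \<Rightarrow> 'k::rc_field hvec \<Rightarrow> 'k hvec \<Rightarrow> 'k"
  where "H_inner U X Y = the_elem {lim (\<lambda>n. ks_form U (x n) (y n)) | x y. x \<in> X \<and> y \<in> Y}"

definition H_norm :: "nat filter \<Rightarrow> 'k::rc_field hvec \<Rightarrow> real"
  where "H_norm U X = sqrt (norm (H_inner U X X))"

definition H_class :: "nat filter \<Rightarrow> 'k::rc_field kp_op \<Rightarrow> 'k hvec"
  where "H_class U T = ks_rel U `` {\<lambda>n. T}"

text \<open>
  \<open>L(H)\<close>: since \<open>H\<close> is a proper subset of its type, operators are taken to be \<open>undefined\<close>
  outside of it.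
\<close>

definition H_ops :: "nat filter \<Rightarrow> ('k::rc_field hvec \<Rightarrow> 'k hvec) set"
  where "H_ops U = {F \<in> H_space U \<rightarrow>\<^sub>E H_space U.
    (\<forall>X\<in>H_space U. \<forall>Y\<in>H_space U. F (H_add U X Y) = H_add U (F X) (F Y)) \<and>
    (\<forall>c. \<forall>X\<in>H_space U. F (H_scale U c X) = H_scale U c (F X)) \<and>
    (\<exists>C. \<forall>X\<in>H_space U. H_norm U (F X) \<le> C * H_norm U X)}"

definition H_ops_dist :: "nat filter \<Rightarrow>
    ('k::rc_field hvec \<Rightarrow> 'k hvec) \<Rightarrow> ('k hvec \<Rightarrow> 'k hvec) \<Rightarrow> real"
  where "H_ops_dist U F G =
    (if F \<in> H_ops U \<and> G \<in> H_ops U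
     then SUP X\<in>{X \<in> H_space U. H_norm U X \<le> 1}. H_norm U (H_add U (F X) (H_scale U (- 1) (G X)))
     else 0)"

definition Lambda :: "nat filter \<Rightarrow> 'k::rc_field kp_op \<Rightarrow> 'k hvec \<Rightarrow> 'k hvec"
  where "Lambda U A = (THE F. F \<in> H_ops U \<and> (\<forall>T. F (H_class U T) = H_class U (A * T)))"

end

theory Submission
  imports Defs
begin

text \<open>
  Write \<open>j x = (x, 0)\<close> and \<open>q (x, y) = y\<close>. The map \<open>q\<close> is strictly singular and \<open>q (T (j e\<^sub>n))\<close> tends to 0 for
  every bounded \<open>T\<close>, so that \<^const>\<open>S_norm\<close> and the norm of \<open>\<Lambda>(T)\<close> only see what \<open>T\<close> does to \<open>j(\<ell>\<^sub>2)\<close>, where the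
  quasi-norm is the Hilbert norm. The normalised Walsh--Hadamard matrix \<open>U\<close> of size \<open>N\<close>, repeated along infinitely
  many blocks, is isometric there. It exchanges unit vectors with flat vectors, whose logarithmic weights in
  \<^const>\<open>Omega\<close> differ by \<open>ln N / 2\<close>, and therefore every bounded operator on \<open>Z\<^sub>2\<close> that acts on \<open>j(\<ell>\<^sub>2)\<close> like \<open>U\<close>, up to
  something negligible, has norm at least of the order of \<open>ln N\<close>. For sizes \<open>2 ^ (k + 1)\<^sup>2\<close> the series of
  \<open>U\<^sub>k / (k + 1)\<close> is thus Cauchy for both norms, but a bounded operator on \<open>Z\<^sub>2\<close> with that sum would have
  infinite norm.
\<close>

section \<open>Square summable sequences\<close>

text \<open>The quasi-norm satisfies the triangle inequality only with the constant 7, which shapes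
  the estimates. Perturbations of size \<theta> / 14^(i+1) are summed against the weights 7^(i+1)
  that iteration produces. Where the constant 1 is indispensable, for the subadditivity of
  \<open>S_norm\<close> and of the seminorm of H, the excess is at most 6 times the norms of the
  second components, and these become negligible on a subspace or along the unit vectors. Closeness
  of a supposed limit B to the partial sums is known on the vectors (e_n, 0) only, and for large n
  only. Repeating each matrix along infinitely many blocks leaves a block beyond every such n, and
  flat vectors carry the smallness over to the second components of the images of (0, e_n). These
  images are where a contradiction can arise, since on j(l2) the sum of the series is a bounded
  operator. The sizes are chosen so that ln (2^((k+1)^2)) / (k+1) = (k+1) ln 2 is unbounded although
  1 / (k+1) tends to 0.\<close>

lemma l2_norm_power2:
  assumes "square_summable x"
  shows "(l2_norm x)\<^sup>2 = (\<Sum>n. (norm (x n))\<^sup>2)"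
  using assms unfolding l2_norm_def square_summable_def by (simp add: suminf_nonneg)

lemma l2_boundI:
  assumes "0 \<le> C" "\<And>n. (\<Sum>k<n. (norm (x k))\<^sup>2) \<le> C\<^sup>2"
  shows "square_summable x" "l2_norm x \<le> C"
proof -
  show s: "square_summable x"
    unfolding square_summable_def by (rule summableI_nonneg_bounded[of _ "C\<^sup>2"]) (use assms in auto)
  have "(l2_norm x)\<^sup>2 \<le> C\<^sup>2"
    unfolding l2_norm_power2[OF s] using s unfolding square_summable_def
    by (intro suminf_le_const assms)
  then show "l2_norm x \<le> C" using assms(1) by (rule power2_le_imp_le)
qed

lemma l2_partial_le:
  assumes "square_summable x" "finite F"
  shows "(\<Sum>k\<in>F. (norm (x k))\<^sup>2) \<le> (l2_norm x)\<^sup>2"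
  unfolding l2_norm_power2[OF assms(1)]
  using assms unfolding square_summable_def by (intro sum_le_suminf) auto

text \<open>Fatou's lemma for the counting measure, on partial sums. In \<open>kp_complete\<close>
  it carries bounds over to coordinatewise limits.\<close>

lemma l2_fatou:
  assumes s: "\<And>n. square_summable (f n)" and C: "eventually (\<lambda>n. l2_norm (f n) \<le> C) sequentially"
    and lim: "\<And>k. (\<lambda>n. f n k) \<longlonglongrightarrow> x k"
  shows "square_summable x" "l2_norm x \<le> C"
proof -
  obtain n0 where "l2_norm (f n0) \<le> C" using C unfolding eventually_sequentially by blast
  then have C0: "0 \<le> C" using l2_norm_nonneg[OF s[of n0]] by linarith
  have "(\<Sum>k<n. (norm (x k))\<^sup>2) \<le> C\<^sup>2" for n
  proof (rule tendsto_upperbound)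
    show "(\<lambda>m. \<Sum>k<n. (norm (f m k))\<^sup>2) \<longlonglongrightarrow> (\<Sum>k<n. (norm (x k))\<^sup>2)"
      by (intro tendsto_intros lim)
    show "eventually (\<lambda>m. (\<Sum>k<n. (norm (f m k))\<^sup>2) \<le> C\<^sup>2) sequentially"
      using C
    proof eventually_elim
      case (elim m)
      then have "(l2_norm (f m))\<^sup>2 \<le> C\<^sup>2" using l2_norm_nonneg[OF s] by (intro power_mono)
      then show ?case using l2_partial_le[OF s, of "{..<n}" m] by simp
    qed
  qed simp
  from l2_boundI[OF C0 this] show "square_summable x" "l2_norm x \<le> C" .
qed

lemma square_summable_uminus: "square_summable x \<Longrightarrow> square_summable (\<lambda>n. - x n)"
  by (simp add: square_summable_def)

lemma l2_norm_uminus: "l2_norm (\<lambda>n. - x n) = l2_norm x"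
  by (simp add: l2_norm_def)

lemma square_summable_diff:
  assumes "square_summable x" "square_summable y"
  shows "square_summable (\<lambda>n. x n - y n)"
  using square_summable_add[OF assms(1) square_summable_uminus[OF assms(2)]] by simp

lemma l2_norm_triangle_diff:
  assumes "square_summable x" "square_summable y"
  shows "l2_norm (\<lambda>n. x n - y n) \<le> l2_norm x + l2_norm y"
  using l2_norm_triangle[OF assms(1) square_summable_uminus[OF assms(2)]] by (simp add: l2_norm_uminus)

lemma l2_norm_diff_ge:
  assumes "square_summable x" "square_summable y"
  shows "l2_norm x - l2_norm y \<le> l2_norm (\<lambda>n. x n - y n)"
  using l2_norm_triangle[OF square_summable_diff[OF assms] assms(2)] by simp

lemma l2_norm_sum:
  assumes "\<And>i. i \<in> I \<Longrightarrow> square_summable (f i)"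
  shows "square_summable (\<lambda>n. \<Sum>i\<in>I. f i n) \<and> l2_norm (\<lambda>n. \<Sum>i\<in>I. f i n) \<le> (\<Sum>i\<in>I. l2_norm (f i))"
  using assms
proof (induction I rule: infinite_finite_induct)
  case (insert i I)
  then have "l2_norm (\<lambda>n. f i n + (\<Sum>i\<in>I. f i n)) \<le> l2_norm (f i) + l2_norm (\<lambda>n. \<Sum>i\<in>I. f i n)"
    by (intro l2_norm_triangle) auto
  with insert show ?case by (auto intro!: square_summable_add)
qed (auto simp: square_summable_zero l2_norm_zero)

lemma l2_norm_eq_0D:
  assumes "square_summable x" "l2_norm x = 0"
  shows "x n = 0"
  using norm_le_l2_norm[OF assms(1), of n] assms(2) by simp

lemma square_summable_finite:
  assumes "finite F" "\<And>n. n \<notin> F \<Longrightarrow> x n = 0"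
  shows "square_summable x"
  unfolding square_summable_def using assms by (intro summable_finite) auto

lemma l2_norm_finite:
  assumes "finite F" "\<And>n. n \<notin> F \<Longrightarrow> x n = 0"
  shows "(l2_norm x)\<^sup>2 = (\<Sum>n\<in>F. (norm (x n))\<^sup>2)"
  by (subst l2_norm_power2[OF square_summable_finite[of F]]) (use assms in \<open>auto intro!: suminf_finite\<close>)

lemma l2_norm_unit: "l2_norm (\<lambda>k. if k = n then 1 else 0 :: 'k::real_normed_field) = 1"
proof -
  have "(l2_norm (\<lambda>k. if k = n then 1 else 0 :: 'k))\<^sup>2 = 1"
    by (subst l2_norm_finite[of "{n}"]) auto
  then show ?thesis
    using l2_norm_nonneg[OF square_summable_finite[of "{n}" "(\<lambda>k. if k = n then 1 else 0 :: 'k)"]]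
    by (auto simp: power2_eq_1_iff)
qed

section \<open>Restrictions and disjoint supports\<close>

definition seq_restrict :: "(nat \<Rightarrow> 'k::real_normed_field) \<Rightarrow> nat set \<Rightarrow> nat \<Rightarrow> 'k"
  where "seq_restrict x P = (\<lambda>n. if n \<in> P then x n else 0)"

lemma seq_restrict_square_summable:
  "square_summable x \<Longrightarrow> square_summable (seq_restrict x P)"
  by (rule square_summable_dominated) (auto simp: seq_restrict_def)

lemma seq_restrict_norm_le:
  "square_summable x \<Longrightarrow> l2_norm (seq_restrict x P) \<le> l2_norm x"
  by (rule l2_norm_mono) (auto simp: seq_restrict_def)

lemma l2_pythagoras:
  assumes "square_summable x" "square_summable y" "\<And>n. x n = 0 \<or> y n = 0"
  shows "(l2_norm (\<lambda>n. x n + y n))\<^sup>2 = (l2_norm x)\<^sup>2 + (l2_norm y)\<^sup>2"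
proof -
  have "(norm (x n + y n))\<^sup>2 = (norm (x n))\<^sup>2 + (norm (y n))\<^sup>2" for n
    using assms(3)[of n] by auto
  then show ?thesis
    using assms(1,2) unfolding l2_norm_power2[OF assms(1)] l2_norm_power2[OF assms(2)]
      l2_norm_power2[OF square_summable_add[OF assms(1,2)]]
    by (simp add: suminf_add square_summable_def)
qed

text \<open>Disjointness of supports is expressed by a labelling \<open>\<beta>\<close> of the
  coordinates: the vector with index \<open>i\<close> may be nonzero only where the label is
  \<open>i\<close>. Families of blocks are given in this form throughout.\<close>

lemma l2_pythagoras_sum:
  assumes "finite I" "\<And>i. i \<in> I \<Longrightarrow> square_summable (f i)"
    and "\<And>i n. i \<in> I \<Longrightarrow> f i n \<noteq> 0 \<Longrightarrow> \<beta> n = i"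
  shows "(l2_norm (\<lambda>n. \<Sum>i\<in>I. f i n))\<^sup>2 = (\<Sum>i\<in>I. (l2_norm (f i))\<^sup>2)"
  using assms
proof (induction I rule: finite_induct)
  case (insert i I)
  have "f i n = 0 \<or> (\<Sum>j\<in>I. f j n) = 0" for n
  proof (rule disjCI)
    assume *: "(\<Sum>j\<in>I. f j n) \<noteq> 0"
    then obtain j where "j \<in> I" "f j n \<noteq> 0" by (meson sum.neutral)
    then show "f i n = 0" using insert.prems(2)[of j n] insert.prems(2)[of i n] insert.hyps by auto
  qed
  moreover have "(l2_norm (\<lambda>n. \<Sum>i\<in>I. f i n))\<^sup>2 = (\<Sum>i\<in>I. (l2_norm (f i))\<^sup>2)"
    by (rule insert.IH) (use insert.prems in auto)
  ultimately show ?case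
    using insert.hyps insert.prems l2_norm_sum[of I f]
    by (simp add: l2_pythagoras)
qed (simp add: l2_norm_zero)

lemma l2_tail:
  assumes "square_summable x"
  shows "(\<lambda>n. l2_norm (seq_restrict x {n..})) \<longlonglongrightarrow> 0"
proof -
  have s: "summable (\<lambda>k. (norm (x k))\<^sup>2)" using assms by (simp add: square_summable_def)
  have "(l2_norm (seq_restrict x {n..}))\<^sup>2 = (\<Sum>k. (norm (x k))\<^sup>2) - (\<Sum>k<n. (norm (x k))\<^sup>2)" for n
  proof -
    have "(l2_norm (\<lambda>k. seq_restrict x {n..} k + seq_restrict x {..<n} k))\<^sup>2
        = (l2_norm (seq_restrict x {n..}))\<^sup>2 + (l2_norm (seq_restrict x {..<n}))\<^sup>2"
      by (intro l2_pythagoras seq_restrict_square_summable assms) (auto simp: seq_restrict_def)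
    moreover have "(\<lambda>k. seq_restrict x {n..} k + seq_restrict x {..<n} k) = x"
      by (auto simp: seq_restrict_def)
    moreover have "(l2_norm (seq_restrict x {..<n}))\<^sup>2 = (\<Sum>k<n. (norm (x k))\<^sup>2)"
      by (subst l2_norm_finite[of "{..<n}"]) (auto simp: seq_restrict_def)
    ultimately show ?thesis by (simp add: l2_norm_power2[OF assms])
  qed
  moreover have "(\<lambda>n. (\<Sum>k. (norm (x k))\<^sup>2) - (\<Sum>k<n. (norm (x k))\<^sup>2)) \<longlonglongrightarrow> (\<Sum>k. (norm (x k))\<^sup>2) - (\<Sum>k. (norm (x k))\<^sup>2)"
    by (intro tendsto_diff tendsto_const summable_LIMSEQ s)
  ultimately have "(\<lambda>n. (l2_norm (seq_restrict x {n..}))\<^sup>2) \<longlonglongrightarrow> 0" by simp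
  from tendsto_real_sqrt[OF this] show ?thesis
    using l2_norm_nonneg[OF seq_restrict_square_summable[OF assms]] by simp
qed

text \<open>Tonelli's theorem for the counting measure. In \<open>ennreal\<close> the regrouping is
  unconditional, and summability can be read off afterwards.\<close>

lemma suminf_fibres_ennreal:
  fixes f :: "nat \<Rightarrow> ennreal" and \<beta> :: "nat \<Rightarrow> nat"
  shows "(\<Sum>n. f n) = (\<Sum>i. \<Sum>n. if \<beta> n = i then f n else 0)"
proof -
  have "(\<Sum>n. f n) = (\<integral>\<^sup>+ n. (\<Sum>i. if \<beta> n = i then f n else 0) \<partial>count_space UNIV)"
  proof (subst nn_integral_count_space_nat, rule suminf_cong)
    fix n
    show "f n = (\<Sum>i. if \<beta> n = i then f n else 0)"
      by (subst suminf_finite[of "{\<beta> n}"]) auto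
  qed
  also have "\<dots> = (\<Sum>i. \<integral>\<^sup>+ n. (if \<beta> n = i then f n else 0) \<partial>count_space UNIV)"
    by (rule nn_integral_suminf) auto
  finally show ?thesis by (simp add: nn_integral_count_space_nat)
qed

lemma square_summable_iff_ennreal:
  "square_summable x \<longleftrightarrow> (\<Sum>n. ennreal ((norm (x n))\<^sup>2)) < \<infinity>"
proof
  assume "square_summable x"
  then have "(\<Sum>n. ennreal ((norm (x n))\<^sup>2)) \<noteq> top"
    unfolding square_summable_def by (rule ennreal_suminf_neq_top) simp
  then show "(\<Sum>n. ennreal ((norm (x n))\<^sup>2)) < \<infinity>" by (simp add: top.not_eq_extremum)
next
  assume "(\<Sum>n. ennreal ((norm (x n))\<^sup>2)) < \<infinity>"
  then have "(\<Sum>n. ennreal ((norm (x n))\<^sup>2)) \<noteq> top" by auto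
  then show "square_summable x"
    unfolding square_summable_def by (intro summable_suminf_not_top) auto
qed

lemma l2_norm_ennreal:
  "square_summable x \<Longrightarrow> (\<Sum>n. ennreal ((norm (x n))\<^sup>2)) = ennreal ((l2_norm x)\<^sup>2)"
  by (simp add: l2_norm_power2 suminf_ennreal2 square_summable_def)

text \<open>The fibres of \<open>\<beta>\<close> carry disjoint blocks of lengths
  \<open>g i\<close>, so spreading \<open>a\<close> over the blocks is a weighted isometry. Lengths
  other than 1 occur when the blocks approximate images of unit vectors under an operator.\<close>

lemma l2_fibres:
  fixes a v :: "nat \<Rightarrow> 'k::real_normed_field" and \<beta> :: "nat \<Rightarrow> nat"
  assumes v: "\<And>i. square_summable (seq_restrict v {n. \<beta> n = i})"
    and g: "\<And>i. l2_norm (seq_restrict v {n. \<beta> n = i}) = g i"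
    and a: "square_summable (\<lambda>i. of_real (g i) * a i)"
  shows "square_summable (\<lambda>n. a (\<beta> n) * v n)"
    and "l2_norm (\<lambda>n. a (\<beta> n) * v n) = l2_norm (\<lambda>i. of_real (g i) * a i)"
proof -
  have "(\<Sum>n. if \<beta> n = i then ennreal ((norm (a (\<beta> n) * v n))\<^sup>2) else 0) = ennreal ((norm (of_real (g i) * a i))\<^sup>2)" for i
  proof -
    have "(\<Sum>n. if \<beta> n = i then ennreal ((norm (a (\<beta> n) * v n))\<^sup>2) else 0)
       = (\<Sum>n. ennreal ((norm (a i * seq_restrict v {n. \<beta> n = i} n))\<^sup>2))"
      by (intro suminf_cong) (auto simp: seq_restrict_def)
    also have "\<dots> = ennreal ((l2_norm (\<lambda>n. a i * seq_restrict v {n. \<beta> n = i} n))\<^sup>2)"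
      by (intro l2_norm_ennreal square_summable_scale v)
    finally show ?thesis using g[of i]
      by (simp add: l2_norm_scale v norm_mult power_mult_distrib mult.commute)
  qed
  then have *: "(\<Sum>n. ennreal ((norm (a (\<beta> n) * v n))\<^sup>2)) = (\<Sum>i. ennreal ((norm (of_real (g i) * a i))\<^sup>2))"
    by (subst suminf_fibres_ennreal[of _ \<beta>]) simp
  then show s: "square_summable (\<lambda>n. a (\<beta> n) * v n)"
    using a by (simp add: square_summable_iff_ennreal)
  have "(l2_norm (\<lambda>n. a (\<beta> n) * v n))\<^sup>2 = (l2_norm (\<lambda>i. of_real (g i) * a i))\<^sup>2"
    using * l2_norm_ennreal[OF s] l2_norm_ennreal[OF a] by simp
  then show "l2_norm (\<lambda>n. a (\<beta> n) * v n) = l2_norm (\<lambda>i. of_real (g i) * a i)"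
    using l2_norm_nonneg[OF s] l2_norm_nonneg[OF a] by simp
qed

section \<open>Basic estimates in the Kalton--Peck space\<close>

definition kp_fst :: "'k::real_normed_field kp \<Rightarrow> nat \<Rightarrow> 'k"
  where "kp_fst z = fst (Rep_kp z)"

definition kp_snd :: "'k::real_normed_field kp \<Rightarrow> nat \<Rightarrow> 'k"
  where "kp_snd z = snd (Rep_kp z)"

text \<open>The deviation of the pair from the graph of Omega. It is homogeneous in \<open>z\<close>
  but not additive, and this is the only source of the constant 7.\<close>

definition kp_res :: "'k::real_normed_field kp \<Rightarrow> nat \<Rightarrow> 'k"
  where "kp_res z = (\<lambda>n. kp_fst z n - Omega (kp_snd z) n)"

text \<open>\<open>Abs_kp\<close> is unspecified on pairs outside Z_2. Membership is checked through
  \<open>kp_mk_sel\<close>.\<close>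

definition kp_mk :: "(nat \<Rightarrow> 'k::real_normed_field) \<Rightarrow> (nat \<Rightarrow> 'k) \<Rightarrow> 'k kp"
  where "kp_mk x y = Abs_kp (x, y)"

definition kp_inj :: "(nat \<Rightarrow> 'k::real_normed_field) \<Rightarrow> 'k kp"
  where "kp_inj x = kp_mk x (\<lambda>n. 0)"

lemma kp_snd_square_summable: "square_summable (kp_snd z)"
  and kp_res_square_summable: "square_summable (kp_res z)"
  using Rep_kp[of z] by (auto simp: kp_fst_def kp_snd_def kp_res_def)

lemma kp_fst_eq: "kp_fst z n = kp_res z n + Omega (kp_snd z) n"
  by (simp add: kp_res_def)

lemma kp_norm_eq: "kp_norm z = l2_norm (kp_res z) + l2_norm (kp_snd z)"
  by (simp add: kp_norm.rep_eq kp_res_def kp_fst_def kp_snd_def case_prod_beta)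

lemma kp_eqI: "kp_fst z = kp_fst w \<Longrightarrow> kp_snd z = kp_snd w \<Longrightarrow> z = w"
  unfolding kp_fst_def kp_snd_def by (metis Rep_kp_inject prod_eq_iff)

lemma kp_mk_sel:
  assumes "square_summable y" "square_summable (\<lambda>n. x n - Omega y n)"
  shows "kp_fst (kp_mk x y) = x" "kp_snd (kp_mk x y) = y"
  using assms by (simp_all add: kp_mk_def kp_fst_def kp_snd_def Abs_kp_inverse)

lemma kp_fst_add: "kp_fst (z + w) = (\<lambda>n. kp_fst z n + kp_fst w n)"
  and kp_snd_add: "kp_snd (z + w) = (\<lambda>n. kp_snd z n + kp_snd w n)"
  by (simp_all add: kp_fst_def kp_snd_def plus_kp.rep_eq case_prod_beta)

lemma kp_fst_scale: "kp_fst (kp_scale c z) = (\<lambda>n. c * kp_fst z n)"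
  and kp_snd_scale: "kp_snd (kp_scale c z) = (\<lambda>n. c * kp_snd z n)"
  by (simp_all add: kp_fst_def kp_snd_def kp_scale.rep_eq case_prod_beta)

lemma kp_fst_zero: "kp_fst 0 = (\<lambda>n. 0)" and kp_snd_zero: "kp_snd 0 = (\<lambda>n. 0)"
  by (simp_all add: kp_fst_def kp_snd_def zero_kp.rep_eq)

lemma kp_fst_uminus: "kp_fst (- z) = (\<lambda>n. - kp_fst z n)"
  and kp_snd_uminus: "kp_snd (- z) = (\<lambda>n. - kp_snd z n)"
  unfolding uminus_kp_def kp_fst_scale kp_snd_scale by simp_all

lemma kp_fst_diff: "kp_fst (z - w) = (\<lambda>n. kp_fst z n - kp_fst w n)"
  and kp_snd_diff: "kp_snd (z - w) = (\<lambda>n. kp_snd z n - kp_snd w n)"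
  unfolding minus_kp_def kp_fst_add kp_snd_add kp_fst_uminus kp_snd_uminus by simp_all

lemma kp_fst_sum: "kp_fst (\<Sum>i\<in>I. f i) = (\<lambda>n. \<Sum>i\<in>I. kp_fst (f i) n)"
  by (induction I rule: infinite_finite_induct) (simp_all add: kp_fst_zero kp_fst_add)

lemma kp_snd_sum: "kp_snd (\<Sum>i\<in>I. f i) = (\<lambda>n. \<Sum>i\<in>I. kp_snd (f i) n)"
  by (induction I rule: infinite_finite_induct) (simp_all add: kp_snd_zero kp_snd_add)

lemmas kp_sel = kp_fst_add kp_snd_add kp_fst_scale kp_snd_scale kp_fst_zero kp_snd_zero
  kp_fst_uminus kp_snd_uminus kp_fst_diff kp_snd_diff kp_fst_sum kp_snd_sum

lemma kp_inj_sel: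
  assumes "square_summable x"
  shows "kp_fst (kp_inj x) = x" "kp_snd (kp_inj x) = (\<lambda>n. 0)" "kp_res (kp_inj x) = x"
  using kp_mk_sel[of "\<lambda>n. 0" x] assms
  by (simp_all add: kp_inj_def kp_res_def Omega_zero square_summable_zero)

lemma kp_norm_inj: "square_summable x \<Longrightarrow> kp_norm (kp_inj x) = l2_norm x"
  by (simp add: kp_norm_eq kp_inj_sel l2_norm_zero)

lemma square_summable_unit: "square_summable (\<lambda>k. if k = n then 1 else 0 :: 'k::real_normed_field)"
  by (rule square_summable_finite[of "{n}"]) auto

lemma kp_unit_eq: "kp_unit n = kp_inj (\<lambda>k. if k = n then 1 else 0)"
  by (rule kp_eqI) (simp_all add: kp_inj_sel square_summable_unit kp_fst_def[of "kp_unit n"] kp_snd_def[of "kp_unit n"] kp_unit.rep_eq)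

lemma kp_inj_add:
  "square_summable x \<Longrightarrow> square_summable y \<Longrightarrow> kp_inj (\<lambda>n. x n + y n) = kp_inj x + kp_inj y"
  by (rule kp_eqI) (simp_all add: kp_inj_sel kp_sel square_summable_add)

lemma kp_inj_diff:
  "square_summable x \<Longrightarrow> square_summable y \<Longrightarrow> kp_inj (\<lambda>n. x n - y n) = kp_inj x - kp_inj y"
  by (rule kp_eqI) (simp_all add: kp_inj_sel kp_sel square_summable_diff)

lemma kp_inj_scale: "square_summable x \<Longrightarrow> kp_inj (\<lambda>n. c * x n) = kp_scale c (kp_inj x)"
  by (rule kp_eqI) (simp_all add: kp_inj_sel kp_sel square_summable_scale)

lemma kp_norm_unit: "kp_norm (kp_unit n) = 1"
  by (simp add: kp_unit_eq kp_norm_inj square_summable_unit l2_norm_unit)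

lemma l2_res_le: "l2_norm (kp_res z) \<le> kp_norm z"
  and l2_snd_le: "l2_norm (kp_snd z) \<le> kp_norm z"
  unfolding kp_norm_eq
  using l2_norm_nonneg[OF kp_res_square_summable, of z] l2_norm_nonneg[OF kp_snd_square_summable, of z]
  by linarith+

lemma kp_res_add:
  "l2_norm (\<lambda>n. kp_res (z + w) n - (kp_res z n + kp_res w n))
     \<le> 6 * (l2_norm (kp_snd z) + l2_norm (kp_snd w))"
proof -
  have "(\<lambda>n. kp_res (z + w) n - (kp_res z n + kp_res w n))
     = (\<lambda>n. - (Omega (\<lambda>n. kp_snd z n + kp_snd w n) n - Omega (kp_snd z) n - Omega (kp_snd w) n))"
    by (auto simp: kp_res_def kp_sel)
  then show ?thesis
    by (simp only: l2_norm_uminus Omega_quasi_linear(2)[OF kp_snd_square_summable kp_snd_square_summable])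
qed

text \<open>Only Omega violates additivity, and it sees nothing but the second components. Where
  these are small the quasi-norm is almost subadditive, which makes \<open>S_norm\<close> and
  \<open>ultra_norm\<close> subadditive.\<close>

lemma kp_norm_add_sharp:
  "kp_norm (z + w) \<le> kp_norm z + kp_norm w + 6 * (l2_norm (kp_snd z) + l2_norm (kp_snd w))"
proof -
  have s: "square_summable (\<lambda>n. kp_res z n + kp_res w n)"
    by (intro square_summable_add kp_res_square_summable)
  have "l2_norm (kp_res (z + w)) - l2_norm (\<lambda>n. kp_res z n + kp_res w n)
     \<le> 6 * (l2_norm (kp_snd z) + l2_norm (kp_snd w))"
    using l2_norm_diff_ge[OF kp_res_square_summable s] kp_res_add[of z w] by (meson order_trans)
  moreover have "l2_norm (\<lambda>n. kp_res z n + kp_res w n) \<le> l2_norm (kp_res z) + l2_norm (kp_res w)"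
    by (intro l2_norm_triangle kp_res_square_summable)
  moreover have "l2_norm (kp_snd (z + w)) \<le> l2_norm (kp_snd z) + l2_norm (kp_snd w)"
    unfolding kp_sel by (intro l2_norm_triangle kp_snd_square_summable)
  ultimately show ?thesis unfolding kp_norm_eq by linarith
qed

text \<open>Adding (x, 0) leaves the argument of Omega unchanged, so the constant is 1 here.\<close>

lemma kp_norm_inj_add:
  assumes "square_summable x"
  shows "kp_norm (kp_inj x + w) \<le> l2_norm x + kp_norm w"
proof -
  have "kp_res (kp_inj x + w) = (\<lambda>n. x n + kp_res w n)"
    by (simp add: kp_res_def kp_sel kp_inj_sel assms algebra_simps)
  then have "l2_norm (kp_res (kp_inj x + w)) \<le> l2_norm x + l2_norm (kp_res w)"
    using l2_norm_triangle[OF assms kp_res_square_summable] by simp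
  moreover have "kp_snd (kp_inj x + w) = kp_snd w" by (simp add: kp_sel kp_inj_sel assms)
  ultimately show ?thesis unfolding kp_norm_eq by simp
qed

lemma kp_norm_uminus: "kp_norm (- z) = kp_norm z"
  unfolding uminus_kp_def kp_norm_scale by simp

lemma kp_norm_minus_commute: "kp_norm (z - w) = kp_norm (w - z)"
  by (metis kp_norm_uminus minus_diff_eq)

lemma kp_norm_diff: "kp_norm (z - w) \<le> 7 * (kp_norm z + kp_norm w)"
  using kp_norm_add[of z "- w"] by (simp add: kp_norm_uminus)

lemma kp_norm_inj_diff_ge:
  assumes "square_summable x"
  shows "l2_norm x - kp_norm (w - kp_inj x) \<le> kp_norm w"
    and "kp_norm w \<le> l2_norm x + kp_norm (w - kp_inj x)"
proof -
  show "kp_norm w \<le> l2_norm x + kp_norm (w - kp_inj x)"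
    using kp_norm_inj_add[OF assms, of "w - kp_inj x"] by simp
  have r: "kp_res (w - kp_inj x) = (\<lambda>n. kp_res w n - x n)"
    by (simp add: kp_res_def kp_sel kp_inj_sel assms algebra_simps)
  have "l2_norm x - l2_norm (kp_res w) \<le> l2_norm (\<lambda>n. x n - kp_res w n)"
    by (intro l2_norm_diff_ge assms kp_res_square_summable)
  also have "(\<lambda>n. x n - kp_res w n) = (\<lambda>n. - kp_res (w - kp_inj x) n)" by (simp add: r)
  also have "l2_norm (\<lambda>n. - kp_res (w - kp_inj x) n) = l2_norm (kp_res (w - kp_inj x))" by (rule l2_norm_uminus)
  finally have "l2_norm x \<le> l2_norm (kp_res w) + l2_norm (kp_res (w - kp_inj x))" by simp
  then show "l2_norm x - kp_norm (w - kp_inj x) \<le> kp_norm w"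
    using l2_norm_nonneg[OF kp_snd_square_summable[of w]]
      l2_norm_nonneg[OF kp_snd_square_summable[of "w - kp_inj x"]] unfolding kp_norm_eq by simp
qed

text \<open>A consequence of u |ln u - ln w| \<le> w for 0 \<le> u \<le> w. It makes the coordinates
  of the first component bounded functionals, although Omega does not map l2 into l2.\<close>

lemma norm_Omega_le:
  assumes "square_summable y"
  shows "norm (Omega y n) \<le> l2_norm y"
  unfolding Omega_ln[OF assms] norm_mult norm_of_real
  using abs_ln_diff_bound[OF norm_ge_zero norm_le_l2_norm[OF assms]] by (simp add: abs_minus_commute)

lemma norm_kp_fst_le: "norm (kp_fst z n) \<le> kp_norm z"
proof -
  have "norm (kp_fst z n) \<le> norm (kp_res z n) + norm (Omega (kp_snd z) n)"
    unfolding kp_fst_eq by (rule norm_triangle_ineq)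
  also have "\<dots> \<le> kp_norm z" unfolding kp_norm_eq
    by (intro add_mono norm_le_l2_norm norm_Omega_le kp_res_square_summable kp_snd_square_summable)
  finally show ?thesis .
qed

lemma norm_kp_snd_le: "norm (kp_snd z n) \<le> kp_norm z"
  using norm_le_l2_norm[OF kp_snd_square_summable] l2_snd_le by (meson order_trans)

lemma kp_norm_eq_0: "kp_norm z = 0 \<longleftrightarrow> z = 0"
proof
  assume "kp_norm z = 0"
  then show "z = 0"
    using norm_kp_fst_le[of z] norm_kp_snd_le[of z] by (intro kp_eqI) (auto simp: kp_sel)
qed (simp add: kp_norm_zero)

text \<open>The first summand is split off each time, so summand \<open>i\<close> passes through at
  most \<open>i + 1\<close> applications of the inequality with constant 7.\<close>

lemma kp_norm_sum:
  fixes f :: "nat \<Rightarrow> 'k::real_normed_field kp"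
  shows "kp_norm (\<Sum>i<n. f i) \<le> (\<Sum>i<n. 7 ^ Suc i * kp_norm (f i))"
proof (induction n arbitrary: f)
  case (Suc n)
  have "kp_norm (\<Sum>i<Suc n. f i) \<le> 7 * (kp_norm (f 0) + kp_norm (\<Sum>i<n. f (Suc i)))"
    unfolding sum.lessThan_Suc_shift by (rule kp_norm_add)
  also have "\<dots> \<le> 7 * (kp_norm (f 0) + (\<Sum>i<n. 7 ^ Suc i * kp_norm (f (Suc i))))"
    using Suc[of "\<lambda>i. f (Suc i)"] by simp
  also have "\<dots> = (\<Sum>i<Suc n. 7 ^ Suc i * kp_norm (f i))"
    unfolding sum.lessThan_Suc_shift by (simp add: sum_distrib_left algebra_simps)
  finally show ?case .
qed (simp add: kp_norm_zero)

lemma sum_geometric_le: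
  fixes \<theta> :: real
  assumes "0 \<le> \<theta>" "0 \<le> c" "\<And>i. \<bar>b i\<bar> \<le> c" "\<And>i. g i \<le> \<theta> / 14 ^ Suc i" "\<And>i. 0 \<le> g i"
  shows "(\<Sum>i<n. 7 ^ Suc i * (\<bar>b i\<bar> * g i)) \<le> \<theta> * c"
proof -
  have "(\<Sum>i<n. 7 ^ Suc i * (\<bar>b i\<bar> * g i)) \<le> (\<Sum>i<n. 7 ^ Suc i * (c * (\<theta> / 14 ^ Suc i)))"
    using assms by (intro sum_mono mult_left_mono mult_mono) auto
  also have "\<dots> = \<theta> * c * (\<Sum>i<n. (1/2) ^ Suc i)"
  proof -
    have "7 ^ Suc i * (c * (\<theta> / 14 ^ Suc i)) = \<theta> * c * (1/2) ^ Suc i" for i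
    proof -
      have "(14::real) ^ Suc i = 7 ^ Suc i * 2 ^ Suc i" by (simp flip: power_mult_distrib)
      then show ?thesis by (simp add: power_divide)
    qed
    then show ?thesis by (simp only: sum_distrib_left)
  qed
  also have "(\<Sum>i<n. (1/2::real) ^ Suc i) = 1 - (1/2) ^ n"
    by (induction n) (auto simp: field_simps)
  also have "\<theta> * c * (1 - (1/2) ^ n) \<le> \<theta> * c * 1"
    using assms by (intro mult_left_mono) auto
  finally show ?thesis by simp
qed

text \<open>The decay 14^(-i-1) beats the weight 7^(i+1) with 2^(-i-1) to spare, and the leftover
  sums to at most 1. This is the substitute for adding up small perturbations in a normed
  space.\<close>

lemma kp_norm_small_sum:
  fixes a :: "nat \<Rightarrow> 'k::real_normed_field"
  assumes "0 \<le> \<theta>" "0 \<le> c" "\<And>i. norm (a i) \<le> c" "\<And>i. kp_norm (g i) \<le> \<theta> / 14 ^ Suc i"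
  shows "kp_norm (\<Sum>i<n. kp_scale (a i) (g i)) \<le> \<theta> * c"
proof -
  have "kp_norm (\<Sum>i<n. kp_scale (a i) (g i)) \<le> (\<Sum>i<n. 7 ^ Suc i * (\<bar>norm (a i)\<bar> * kp_norm (g i)))"
    using kp_norm_sum[of "\<lambda>i. kp_scale (a i) (g i)" n] by (simp add: kp_norm_scale)
  also have "\<dots> \<le> \<theta> * c"
    by (rule sum_geometric_le) (use assms kp_norm_nonneg in auto)
  finally show ?thesis .
qed

section \<open>Limits in the quasi-norm\<close>

lemma kp_limit_unique:
  assumes "(\<lambda>n. kp_norm (f n - z)) \<longlonglongrightarrow> 0" "(\<lambda>n. kp_norm (f n - w)) \<longlonglongrightarrow> 0"
  shows "z = w"
proof -
  have "(\<lambda>n. 7 * (kp_norm (f n - w) + kp_norm (f n - z))) \<longlonglongrightarrow> 7 * (0 + 0)"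
    by (intro tendsto_intros assms)
  moreover have "kp_norm (z - w) \<le> 7 * (kp_norm (f n - w) + kp_norm (f n - z))" for n
    using kp_norm_diff[of "f n - w" "f n - z"] by simp
  ultimately have "kp_norm (z - w) \<le> 0" using LIMSEQ_le_const by fastforce
  then show ?thesis using kp_norm_nonneg[of "z - w"] kp_norm_eq_0[of "z - w"] by simp
qed

text \<open>The factor 7 arises from splitting \<open>z\<close> into \<open>f n\<close> and the
  error \<open>f n - z\<close>.\<close>

lemma kp_limit_bound:
  assumes "(\<lambda>n. kp_norm (f n - z)) \<longlonglongrightarrow> 0" "\<And>n. kp_norm (f n) \<le> C"
  shows "kp_norm z \<le> 7 * C"
proof -
  have "(\<lambda>n. 7 * (C + kp_norm (f n - z))) \<longlonglongrightarrow> 7 * (C + 0)"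
    by (intro tendsto_intros assms)
  moreover have "kp_norm z \<le> 7 * (C + kp_norm (f n - z))" for n
    using kp_norm_diff[of "f n" "f n - z"] assms(2)[of n] by simp
  ultimately show ?thesis using LIMSEQ_le_const by fastforce
qed

lemma kp_limit_add:
  assumes "(\<lambda>n. kp_norm (f n - z)) \<longlonglongrightarrow> 0" "(\<lambda>n. kp_norm (g n - w)) \<longlonglongrightarrow> 0"
  shows "(\<lambda>n. kp_norm (f n + g n - (z + w))) \<longlonglongrightarrow> 0"
proof (rule Lim_null_comparison)
  show "(\<lambda>n. 7 * (kp_norm (f n - z) + kp_norm (g n - w))) \<longlonglongrightarrow> 0"
    using tendsto_mult_left[OF tendsto_add[OF assms], of 7] by simp
  have "norm (kp_norm (f n + g n - (z + w))) \<le> 7 * (kp_norm (f n - z) + kp_norm (g n - w))" for n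
    using kp_norm_add[of "f n - z" "g n - w"] kp_norm_nonneg[of "f n + g n - (z + w)"]
    by (simp add: algebra_simps)
  then show "eventually (\<lambda>n. norm (kp_norm (f n + g n - (z + w))) \<le> 7 * (kp_norm (f n - z) + kp_norm (g n - w))) sequentially"
    by simp
qed

lemma kp_limit_scale:
  assumes "(\<lambda>n. kp_norm (f n - z)) \<longlonglongrightarrow> 0"
  shows "(\<lambda>n. kp_norm (kp_scale c (f n) - kp_scale c z)) \<longlonglongrightarrow> 0"
  using tendsto_mult_left[OF assms, of "norm c"]
  by (simp add: kp_norm_scale flip: kp.scale_right_diff_distrib)

section \<open>Completeness\<close>

text \<open>The field is R or C, so a ball lies in the continuous image of a square of real pairs.
  Both the completeness of the scalars and their limits along an ultrafilter rest on this.\<close>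

lemma rc_field_cball_compact:
  "\<exists>S::'k::rc_field set. compact S \<and> cball 0 M \<subseteq> S"
proof -
  obtain i :: 'k where i: "\<And>z. \<exists>a b. z = of_real a + of_real b * i \<and> \<bar>a\<bar> \<le> norm z \<and> \<bar>b\<bar> \<le> norm z"
  proof (cases "\<forall>z::'k. z \<in> \<real>")
    case True
    \<comment> \<open>With \<open>i = 0\<close> the real field is covered by the parametrization a +
      b i of the complex case.\<close>
    have "\<exists>a b. z = of_real a + of_real b * 0 \<and> \<bar>a\<bar> \<le> norm z \<and> \<bar>b\<bar> \<le> norm z" for z :: 'k
    proof -
      obtain r where "z = of_real r" using True by (meson Reals_cases)
      then show ?thesis by (intro exI[of _ r] exI[of _ 0]) auto
    qed
    then show ?thesis by (rule that)
  next
    case False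
    with rc_field_real_or_complex[where 'k = 'k] obtain j :: 'k where
      j: "j * j = -1" "sconj j = - j" "\<And>z. \<exists>a b. z = of_real a + of_real b * j" by blast
    have nj: "norm j = 1"
    proof -
      have "(norm j)\<^sup>2 = 1"
        using arg_cong[OF j(1), of norm] by (simp only: norm_mult norm_minus_cancel norm_one power2_eq_square)
      then show ?thesis using norm_ge_zero[of j] by (auto simp: power2_eq_1_iff)
    qed
    have "\<exists>a b. z = of_real a + of_real b * j \<and> \<bar>a\<bar> \<le> norm z \<and> \<bar>b\<bar> \<le> norm z" for z
    proof -
      obtain a b where z: "z = of_real a + of_real b * j" using j(3) by blast
      have s: "sconj z = of_real a - of_real b * j" by (simp add: z sconj_add sconj_mult sconj_of_real j)
      have "norm (z + sconj z) \<le> 2 * norm z" "norm (z - sconj z) \<le> 2 * norm z"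
        using norm_triangle_ineq[of z "sconj z"] norm_triangle_ineq4[of z "sconj z"] by (auto simp: norm_sconj)
      moreover have "z + sconj z = of_real (2 * a)" unfolding s unfolding z by simp
      moreover have "z - sconj z = of_real (2 * b) * j" unfolding s unfolding z by simp
      ultimately have "\<bar>a\<bar> \<le> norm z" "\<bar>b\<bar> \<le> norm z"
        by (simp_all only: norm_of_real norm_mult nj abs_mult)
      with z show ?thesis by blast
    qed
    then show ?thesis by (rule that)
  qed
  define S where "S = (\<lambda>(a, b). of_real a + of_real b * i) ` ({-M..M} \<times> {-M..M})"
  have "compact S" unfolding S_def
    by (intro compact_continuous_image compact_Times compact_Icc)
       (auto simp: case_prod_beta intro!: continuous_intros)
  moreover have "cball 0 M \<subseteq> S"
  proof
    fix z :: 'k assume "z \<in> cball 0 M"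
    moreover obtain a b where "z = of_real a + of_real b * i" "\<bar>a\<bar> \<le> norm z" "\<bar>b\<bar> \<le> norm z" using i by blast
    ultimately show "z \<in> S" unfolding S_def by (intro image_eqI[of _ _ "(a, b)"]) auto
  qed
  ultimately show ?thesis by blast
qed

lemma rc_field_Cauchy_convergent:
  fixes X :: "nat \<Rightarrow> 'k::rc_field"
  assumes "Cauchy X"
  shows "convergent X"
proof -
  obtain M where M: "\<And>n. norm (X n) \<le> M"
    using Cauchy_Bseq[OF assms] by (auto simp: Bseq_def)
  obtain S :: "'k set" where S: "compact S" "cball 0 M \<subseteq> S" using rc_field_cball_compact by blast
  have "X n \<in> S" for n using S(2) M by auto
  then show ?thesis
    using compact_imp_complete[OF S(1)] assms unfolding complete_def convergent_def by blast
qed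

text \<open>\<open>abs_ln_diff_bound\<close> applied to the square roots. Unlike that bound, this
  one tends to 0 with u for fixed w, which gives the continuity of t ln t at 0 and the vanishing of
  tails.\<close>

lemma abs_ln_diff_sqrt:
  assumes "0 \<le> u" "u \<le> (w::real)"
  shows "\<bar>ln u - ln w\<bar> * u \<le> 2 * sqrt (u * w)"
proof (cases "u = 0")
  case False
  then have u: "0 < u" "0 < w" using assms by auto
  have "\<bar>ln u - ln w\<bar> * u = 2 * (\<bar>ln (sqrt u) - ln (sqrt w)\<bar> * sqrt u) * sqrt u"
    using u by (simp add: ln_sqrt flip: diff_divide_distrib)
  also have "\<dots> \<le> 2 * sqrt w * sqrt u"
    using u assms by (intro mult_right_mono mult_left_mono abs_ln_diff_bound) auto
  finally show ?thesis by (simp add: real_sqrt_mult mult_ac)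
qed (use assms in simp)

lemma tendsto_ln_mult:
  fixes u :: "nat \<Rightarrow> 'k::real_normed_field"
  assumes "u \<longlonglongrightarrow> c"
  shows "(\<lambda>m. of_real (ln (norm (u m))) * u m) \<longlonglongrightarrow> of_real (ln (norm c)) * c"
proof (cases "c = 0")
  case False
  then show ?thesis by (intro tendsto_intros assms) auto
next
  case True
  have n0: "(\<lambda>m. norm (u m)) \<longlonglongrightarrow> 0" using tendsto_norm[OF assms] True by simp
  have "(\<lambda>m. of_real (ln (norm (u m))) * u m) \<longlonglongrightarrow> 0"
  proof (rule Lim_null_comparison)
    have "eventually (\<lambda>m. norm (u m) < 1) sequentially" using n0 by (rule order_tendstoD) simp
    then show "eventually (\<lambda>m. norm (of_real (ln (norm (u m))) * u m) \<le> 2 * sqrt (norm (u m))) sequentially"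
    proof eventually_elim
      case (elim m)
      then show ?case using abs_ln_diff_sqrt[of "norm (u m)" 1] by (simp add: norm_mult)
    qed
    show "(\<lambda>m. 2 * sqrt (norm (u m))) \<longlonglongrightarrow> 0"
      using tendsto_mult_left[OF tendsto_real_sqrt[OF n0], of 2] by simp
  qed
  with True show ?thesis by simp
qed

lemma l2_norm_tendsto:
  assumes u: "\<And>m. square_summable (u m)" and v: "square_summable v"
    and lim: "(\<lambda>m. l2_norm (\<lambda>k. u m k - v k)) \<longlonglongrightarrow> 0"
  shows "(\<lambda>m. l2_norm (u m)) \<longlonglongrightarrow> l2_norm v" "(\<lambda>m. u m k) \<longlonglongrightarrow> v k"
proof -
  have s: "square_summable (\<lambda>k. u m k - v k)" for m by (intro square_summable_diff u v)
  have "norm (l2_norm (u m) - l2_norm v) \<le> l2_norm (\<lambda>k. u m k - v k)" for m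
  proof -
    have "l2_norm (\<lambda>k. v k - u m k) = l2_norm (\<lambda>k. u m k - v k)"
      using l2_norm_uminus[of "\<lambda>k. u m k - v k"] by simp
    then show ?thesis using l2_norm_diff_ge[OF u v, of m] l2_norm_diff_ge[OF v u, of m] by simp
  qed
  then have "(\<lambda>m. l2_norm (u m) - l2_norm v) \<longlonglongrightarrow> 0"
    by (intro Lim_null_comparison[OF _ lim]) auto
  then show "(\<lambda>m. l2_norm (u m)) \<longlonglongrightarrow> l2_norm v" by (simp add: LIM_zero_iff)
  have "(\<lambda>m. u m k - v k) \<longlonglongrightarrow> 0"
    using norm_le_l2_norm[OF s] by (intro Lim_null_comparison[OF _ lim]) auto
  then show "(\<lambda>m. u m k) \<longlonglongrightarrow> v k" by (simp add: LIM_zero_iff)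
qed

lemma Omega_tendsto:
  fixes u :: "nat \<Rightarrow> nat \<Rightarrow> 'k::real_normed_field"
  assumes u: "\<And>m. square_summable (u m)" and v: "square_summable v"
    and lim: "(\<lambda>m. l2_norm (\<lambda>k. u m k - v k)) \<longlonglongrightarrow> 0"
  shows "(\<lambda>m. Omega (u m) k) \<longlonglongrightarrow> Omega v k"
proof (cases "l2_norm v = 0")
  case True
  then have "v k = 0" by (rule l2_norm_eq_0D[OF v])
  then have "Omega v k = 0" by (simp add: Omega_def)
  \<comment> \<open>The logarithm of the norm is discontinuous at 0, but here the values are
    squeezed by the norms themselves.\<close>
  moreover have "(\<lambda>m. Omega (u m) k) \<longlonglongrightarrow> 0"
  proof (rule Lim_null_comparison)
    show "(\<lambda>m. l2_norm (u m)) \<longlonglongrightarrow> 0" using l2_norm_tendsto(1)[OF u v lim] unfolding True .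
    show "eventually (\<lambda>m. norm (Omega (u m) k) \<le> l2_norm (u m)) sequentially"
      by (intro always_eventually allI norm_Omega_le u)
  qed
  ultimately show ?thesis by simp
next
  case False
  have "(\<lambda>m. of_real (ln (l2_norm (u m))) * u m k - of_real (ln (norm (u m k))) * u m k)
     \<longlonglongrightarrow> of_real (ln (l2_norm v)) * v k - of_real (ln (norm (v k))) * v k"
    by (intro tendsto_diff tendsto_ln_mult tendsto_mult tendsto_of_real tendsto_ln l2_norm_tendsto[OF u v lim] False)
  then show ?thesis by (simp add: Omega_ln u v left_diff_distrib)
qed

text \<open>The coordinates converge to some (x, y). Fatou's lemma on the second components of
  \<open>f n - f m\<close>, and then on their residuals, bounds the distance of \<open>f n\<close>
  from (x, y). The residuals come second because their coordinates converge only once the second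
  components are known to converge in l2.\<close>

lemma kp_complete:
  fixes f :: "nat \<Rightarrow> 'k::rc_field kp"
  assumes C: "\<And>e. e > 0 \<Longrightarrow> \<exists>N. \<forall>m\<ge>N. \<forall>n\<ge>N. kp_norm (f m - f n) < e"
  obtains z where "(\<lambda>n. kp_norm (f n - z)) \<longlonglongrightarrow> 0"
proof -
  have cf: "Cauchy (\<lambda>n. kp_fst (f n) k)" for k
  proof (rule CauchyI)
    fix e :: real assume "e > 0"
    then obtain N where "\<forall>m\<ge>N. \<forall>n\<ge>N. kp_norm (f m - f n) < e" using C by blast
    then show "\<exists>M. \<forall>m\<ge>M. \<forall>n\<ge>M. norm (kp_fst (f m) k - kp_fst (f n) k) < e"
      by (intro exI[of _ N]) (metis kp_fst_diff le_less_trans norm_kp_fst_le)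
  qed
  have cs: "Cauchy (\<lambda>n. kp_snd (f n) k)" for k
  proof (rule CauchyI)
    fix e :: real assume "e > 0"
    then obtain N where "\<forall>m\<ge>N. \<forall>n\<ge>N. kp_norm (f m - f n) < e" using C by blast
    then show "\<exists>M. \<forall>m\<ge>M. \<forall>n\<ge>M. norm (kp_snd (f m) k - kp_snd (f n) k) < e"
      by (intro exI[of _ N]) (metis kp_snd_diff le_less_trans norm_kp_snd_le)
  qed
  define x where "x k = lim (\<lambda>n. kp_fst (f n) k)" for k
  define y where "y k = lim (\<lambda>n. kp_snd (f n) k)" for k
  have x: "(\<lambda>n. kp_fst (f n) k) \<longlonglongrightarrow> x k" for k
    unfolding x_def using rc_field_Cauchy_convergent[OF cf] by (simp add: convergent_LIMSEQ_iff)
  have y: "(\<lambda>n. kp_snd (f n) k) \<longlonglongrightarrow> y k" for k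
    unfolding y_def using rc_field_Cauchy_convergent[OF cs] by (simp add: convergent_LIMSEQ_iff)
  have *: "square_summable (\<lambda>k. kp_snd (f n) k - y k) \<and> l2_norm (\<lambda>k. kp_snd (f n) k - y k) \<le> e"
    if N: "\<forall>m\<ge>N. \<forall>n\<ge>N. kp_norm (f m - f n) < e" and n: "n \<ge> N" for e N n
  proof -
    have "eventually (\<lambda>m. l2_norm (kp_snd (f n - f m)) \<le> e) sequentially"
      using eventually_ge_at_top[of N]
    proof eventually_elim
      case (elim m) then show ?case using N n l2_snd_le[of "f n - f m"] by (metis le_less_trans less_imp_le)
    qed
    moreover have "(\<lambda>m. kp_snd (f n - f m) k) \<longlonglongrightarrow> kp_snd (f n) k - y k" for k
      unfolding kp_sel by (intro tendsto_intros y)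
    ultimately show ?thesis
      using l2_fatou[of "\<lambda>m. kp_snd (f n - f m)" e "\<lambda>k. kp_snd (f n) k - y k"] kp_snd_square_summable by blast
  qed
  obtain N0 where "\<forall>m\<ge>N0. \<forall>n\<ge>N0. kp_norm (f m - f n) < 1" using C[of 1] by auto
  then have "square_summable (\<lambda>k. kp_snd (f N0) k - y k)" using * by blast
  from square_summable_diff[OF kp_snd_square_summable[of "f N0"] this] have ssy: "square_summable y" by simp
  have ly: "(\<lambda>n. l2_norm (\<lambda>k. kp_snd (f n) k - y k)) \<longlonglongrightarrow> 0"
  proof (rule LIMSEQ_I)
    fix r :: real assume r: "r > 0"
    then obtain N where "\<forall>m\<ge>N. \<forall>n\<ge>N. kp_norm (f m - f n) < r / 2" using C[of "r / 2"] by auto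
    then have "l2_norm (\<lambda>k. kp_snd (f n) k - y k) \<le> r / 2" if "n \<ge> N" for n using * that by blast
    then show "\<exists>no. \<forall>n\<ge>no. norm (l2_norm (\<lambda>k. kp_snd (f n) k - y k) - 0) < r"
      using r l2_norm_nonneg[OF square_summable_diff[OF kp_snd_square_summable ssy]]
      by (intro exI[of _ N]) force
  qed
  have **: "square_summable (\<lambda>k. kp_fst (f n) k - x k - Omega (\<lambda>k. kp_snd (f n) k - y k) k)
     \<and> l2_norm (\<lambda>k. kp_fst (f n) k - x k - Omega (\<lambda>k. kp_snd (f n) k - y k) k) \<le> e"
    if N: "\<forall>m\<ge>N. \<forall>n\<ge>N. kp_norm (f m - f n) < e" and n: "n \<ge> N" for e N n
  proof -
    have "eventually (\<lambda>m. l2_norm (kp_res (f n - f m)) \<le> e) sequentially"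
      using eventually_ge_at_top[of N]
    proof eventually_elim
      case (elim m) then show ?case using N n l2_res_le[of "f n - f m"] by (metis le_less_trans less_imp_le)
    qed
    moreover have "(\<lambda>m. kp_res (f n - f m) k) \<longlonglongrightarrow> kp_fst (f n) k - x k - Omega (\<lambda>k. kp_snd (f n) k - y k) k" for k
      unfolding kp_res_def kp_sel
    proof (intro tendsto_intros x Omega_tendsto)
      show "square_summable (\<lambda>k. kp_snd (f n) k - kp_snd (f m) k)" for m
        by (intro square_summable_diff kp_snd_square_summable)
      show "square_summable (\<lambda>k. kp_snd (f n) k - y k)"
        by (intro square_summable_diff kp_snd_square_summable ssy)
      have "l2_norm (\<lambda>k. kp_snd (f n) k - kp_snd (f m) k - (kp_snd (f n) k - y k)) = l2_norm (\<lambda>k. kp_snd (f m) k - y k)" for m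
        using l2_norm_uminus[of "\<lambda>k. kp_snd (f m) k - y k"] by simp
      then show "(\<lambda>m. l2_norm (\<lambda>k. kp_snd (f n) k - kp_snd (f m) k - (kp_snd (f n) k - y k))) \<longlonglongrightarrow> 0"
        using ly by simp
    qed
    ultimately show ?thesis
      using l2_fatou[of "\<lambda>m. kp_res (f n - f m)" e "\<lambda>k. kp_fst (f n) k - x k - Omega (\<lambda>k. kp_snd (f n) k - y k) k"]
        kp_res_square_summable by blast
  qed
  define r where "r n = kp_mk (\<lambda>k. kp_fst (f n) k - x k) (\<lambda>k. kp_snd (f n) k - y k)" for n
  define z where "z = f N0 - r N0"
  have r: "kp_fst (r n) = (\<lambda>k. kp_fst (f n) k - x k) \<and> kp_snd (r n) = (\<lambda>k. kp_snd (f n) k - y k)"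
    if "\<forall>m\<ge>N. \<forall>n\<ge>N. kp_norm (f m - f n) < e" "n \<ge> N" for e N n
    unfolding r_def using *[OF that] **[OF that] by (auto simp: kp_mk_sel)
  have zz: "kp_fst z = x" "kp_snd z = y"
    using r[OF \<open>\<forall>m\<ge>N0. \<forall>n\<ge>N0. kp_norm (f m - f n) < 1\<close> order_refl]
    by (auto simp: z_def kp_sel)
  have "kp_norm (f n - z) \<le> 2 * e"
    if "\<forall>m\<ge>N. \<forall>n\<ge>N. kp_norm (f m - f n) < e" "n \<ge> N" for e N n
    unfolding kp_norm_eq kp_res_def kp_sel zz using *[OF that] **[OF that] by simp
  then have "(\<lambda>n. kp_norm (f n - z)) \<longlonglongrightarrow> 0"
  proof (intro LIMSEQ_I)
    fix r :: real assume r: "r > 0"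
    assume b: "\<And>N e n. \<forall>m\<ge>N. \<forall>n\<ge>N. kp_norm (f m - f n) < e \<Longrightarrow> N \<le> n \<Longrightarrow> kp_norm (f n - z) \<le> 2 * e"
    obtain N where "\<forall>m\<ge>N. \<forall>n\<ge>N. kp_norm (f m - f n) < r / 4" using C[of "r / 4"] r by auto
    then have le: "kp_norm (f n - z) \<le> r / 2" if "n \<ge> N" for n using b that by fastforce
    have "norm (kp_norm (f n - z) - 0) < r" if "n \<ge> N" for n
      using le[OF that] kp_norm_nonneg[of "f n - z"] r by simp
    then show "\<exists>no. \<forall>n\<ge>no. norm (kp_norm (f n - z) - 0) < r" by blast
  qed
  then show ?thesis by (rule that)
qed

section \<open>Truncations\<close>

definition kp_restrict :: "'k::real_normed_field kp \<Rightarrow> nat set \<Rightarrow> 'k kp"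
  where "kp_restrict z P = kp_mk (seq_restrict (kp_fst z) P) (seq_restrict (kp_snd z) P)"

text \<open>Restriction changes only the norm inside the logarithm. The residual becomes the
  restricted residual plus a scalar multiple of the restricted second component, which keeps
  truncations inside Z_2.\<close>

lemma kp_restrict_aux:
  fixes z :: "'k::real_normed_field kp" and P :: "nat set"
  defines "u \<equiv> l2_norm (seq_restrict (kp_snd z) P)" and "w \<equiv> l2_norm (kp_snd z)"
  shows "(\<lambda>n. seq_restrict (kp_fst z) P n - Omega (seq_restrict (kp_snd z) P) n)
    = (\<lambda>n. seq_restrict (kp_res z) P n + of_real (ln w - ln u) * seq_restrict (kp_snd z) P n)"
proof
  fix n
  have A: "seq_restrict (kp_fst z) P n = seq_restrict (kp_res z) P n + of_real (ln w - ln (norm (kp_snd z n))) * seq_restrict (kp_snd z) P n"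
    by (simp add: seq_restrict_def kp_fst_eq Omega_ln kp_snd_square_summable w_def)
  have B: "Omega (seq_restrict (kp_snd z) P) n = of_real (ln u - ln (norm (kp_snd z n))) * seq_restrict (kp_snd z) P n"
    by (simp add: Omega_ln seq_restrict_square_summable kp_snd_square_summable u_def) (simp add: seq_restrict_def)
  show "seq_restrict (kp_fst z) P n - Omega (seq_restrict (kp_snd z) P) n
    = seq_restrict (kp_res z) P n + of_real (ln w - ln u) * seq_restrict (kp_snd z) P n"
    unfolding A B of_real_diff left_diff_distrib by simp
qed

lemma kp_restrict_sel:
  "kp_fst (kp_restrict z P) = seq_restrict (kp_fst z) P"
  "kp_snd (kp_restrict z P) = seq_restrict (kp_snd z) P"
  unfolding kp_restrict_def
  by (intro kp_mk_sel seq_restrict_square_summable kp_snd_square_summable,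
      unfold kp_restrict_aux,
      intro square_summable_add square_summable_scale seq_restrict_square_summable kp_snd_square_summable kp_res_square_summable)+

lemma kp_norm_restrict:
  fixes z :: "'k::real_normed_field kp" and P :: "nat set"
  defines "u \<equiv> l2_norm (seq_restrict (kp_snd z) P)" and "w \<equiv> l2_norm (kp_snd z)"
  shows "kp_norm (kp_restrict z P) \<le> l2_norm (seq_restrict (kp_res z) P) + \<bar>ln u - ln w\<bar> * u + u"
proof -
  have "l2_norm (kp_res (kp_restrict z P))
     \<le> l2_norm (seq_restrict (kp_res z) P) + l2_norm (\<lambda>n. of_real (ln w - ln u) * seq_restrict (kp_snd z) P n)"
    unfolding kp_res_def kp_restrict_sel kp_restrict_aux u_def w_def
    by (intro l2_norm_triangle square_summable_scale seq_restrict_square_summable kp_snd_square_summable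
        kp_res_square_summable[unfolded kp_res_def])
  also have "l2_norm (\<lambda>n. of_real (ln w - ln u) * seq_restrict (kp_snd z) P n) = \<bar>ln u - ln w\<bar> * u"
    by (subst l2_norm_scale) (auto simp: seq_restrict_square_summable kp_snd_square_summable u_def abs_minus_commute simp del: of_real_diff)
  finally show ?thesis by (simp add: kp_norm_eq kp_restrict_sel u_def)
qed

lemma abs_kp_norm: "\<bar>kp_norm z\<bar> = kp_norm z"
  by (simp add: kp_norm_nonneg)

text \<open>The factor ln (w / u) blows up as the tail norm u of the second component shrinks, but u
  ln (w / u) \<le> 2 sqrt (u w) still tends to 0.\<close>

lemma kp_tail:
  "(\<lambda>n. kp_norm (kp_restrict z {n..})) \<longlonglongrightarrow> 0"
proof (rule Lim_null_comparison)
  let ?u = "\<lambda>n. l2_norm (seq_restrict (kp_snd z) {n..})" and ?w = "l2_norm (kp_snd z)"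
  have "kp_norm (kp_restrict z {n..}) \<le> l2_norm (seq_restrict (kp_res z) {n..}) + 2 * sqrt (?u n * ?w) + ?u n" for n
    using kp_norm_restrict[of z "{n..}"]
      abs_ln_diff_sqrt[OF l2_norm_nonneg[OF seq_restrict_square_summable[OF kp_snd_square_summable]]
       seq_restrict_norm_le[OF kp_snd_square_summable[of z], of "{n..}"]] by simp
  then show "eventually (\<lambda>n. norm (kp_norm (kp_restrict z {n..})) \<le> l2_norm (seq_restrict (kp_res z) {n..}) + 2 * sqrt (?u n * ?w) + ?u n) sequentially"
    by (simp add: abs_kp_norm)
  have "(\<lambda>n. l2_norm (seq_restrict (kp_res z) {n..}) + 2 * sqrt (?u n * ?w) + ?u n) \<longlonglongrightarrow> 0 + 2 * sqrt (0 * ?w) + 0"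
    by (intro tendsto_intros l2_tail kp_snd_square_summable kp_res_square_summable)
  then show "(\<lambda>n. l2_norm (seq_restrict (kp_res z) {n..}) + 2 * sqrt (?u n * ?w) + ?u n) \<longlonglongrightarrow> 0" by simp
qed

lemma kp_restrict_disjoint_Un:
  assumes "P \<inter> Q = {}"
  shows "kp_restrict z (P \<union> Q) = kp_restrict z P + kp_restrict z Q"
  by (rule kp_eqI) (use assms in \<open>auto simp: kp_restrict_sel kp_sel seq_restrict_def fun_eq_iff\<close>)

lemma kp_restrict_UNIV: "kp_restrict z UNIV = z"
  by (rule kp_eqI) (auto simp: kp_restrict_sel seq_restrict_def fun_eq_iff)

definition kp_unit2 :: "nat \<Rightarrow> 'k::real_normed_field kp"
  where "kp_unit2 n = kp_mk (\<lambda>k. 0) (\<lambda>k. if k = n then 1 else 0)"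

lemma Omega_unit: "Omega (\<lambda>k. if k = n then 1 else 0 :: 'k::real_normed_field) = (\<lambda>k. 0)"
  by (auto simp: Omega_def l2_norm_unit)

lemma kp_unit2_sel:
  "kp_fst (kp_unit2 n) = (\<lambda>k. 0)" "kp_snd (kp_unit2 n) = (\<lambda>k. if k = n then 1 else 0)"
  unfolding kp_unit2_def by (intro kp_mk_sel; simp add: square_summable_unit Omega_unit square_summable_zero)+

lemma kp_unit_sel:
  "kp_fst (kp_unit n) = (\<lambda>k. if k = n then 1 else 0)" "kp_snd (kp_unit n) = (\<lambda>k. 0)"
  by (simp_all add: kp_unit_eq kp_inj_sel square_summable_unit)

lemma kp_norm_unit2: "kp_norm (kp_unit2 n) = 1"
  by (simp add: kp_norm_eq kp_res_def kp_unit2_sel Omega_unit l2_norm_zero l2_norm_unit)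

lemma kp_head_expand:
  "kp_restrict z {..<N} = (\<Sum>k<N. kp_scale (kp_fst z k) (kp_unit k) + kp_scale (kp_snd z k) (kp_unit2 k))"
proof -
  have one: "(\<Sum>k<N. c k * (if n = k then 1 else 0)) = (if n < N then c n else 0)" for c :: "nat \<Rightarrow> 'a" and n
    by (simp add: if_distrib[of "\<lambda>x. _ * x"] cong: if_cong)
  show ?thesis
    by (rule kp_eqI) (simp_all add: kp_restrict_sel kp_sel seq_restrict_def kp_unit_sel kp_unit2_sel fun_eq_iff one)
qed

lemma kp_head_tendsto:
  assumes "\<And>k. (\<lambda>m. kp_fst (z m) k) \<longlonglongrightarrow> 0" "\<And>k. (\<lambda>m. kp_snd (z m) k) \<longlonglongrightarrow> 0"
  shows "(\<lambda>m. kp_norm (kp_restrict (z m) {..<N})) \<longlonglongrightarrow> 0"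
proof (rule Lim_null_comparison)
  let ?b = "\<lambda>m. \<Sum>k<N. 7 ^ Suc k * (7 * (norm (kp_fst (z m) k) + norm (kp_snd (z m) k)))"
  have "kp_norm (kp_restrict (z m) {..<N}) \<le> ?b m" for m
    unfolding kp_head_expand
  proof (rule order_trans[OF kp_norm_sum], intro sum_mono mult_left_mono)
    fix k
    show "kp_norm (kp_scale (kp_fst (z m) k) (kp_unit k) + kp_scale (kp_snd (z m) k) (kp_unit2 k)) \<le> 7 * (norm (kp_fst (z m) k) + norm (kp_snd (z m) k))"
      using kp_norm_add[of "kp_scale (kp_fst (z m) k) (kp_unit k)" "kp_scale (kp_snd (z m) k) (kp_unit2 k)"]
      by (simp add: kp_norm_scale kp_norm_unit kp_norm_unit2)
  qed simp
  then show "eventually (\<lambda>m. norm (kp_norm (kp_restrict (z m) {..<N})) \<le> ?b m) sequentially"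
    by (simp add: abs_kp_norm)
  have "?b \<longlonglongrightarrow> (\<Sum>k<N. 7 ^ Suc k * (7 * (norm (0::'a) + norm (0::'a))))"
    by (intro tendsto_intros assms)
  then show "?b \<longlonglongrightarrow> 0" by simp
qed

text \<open>Coordinatewise convergence makes the heads of late vectors small, and
  \<open>kp_tail\<close> makes the tails of each single vector small. Choosing vectors and cuts
  alternately leaves one interval of coordinates per chosen vector.\<close>

lemma gliding_hump:
  fixes z :: "nat \<Rightarrow> 'k::real_normed_field kp"
  assumes z: "\<And>k. (\<lambda>m. kp_fst (z m) k) \<longlonglongrightarrow> 0" "\<And>k. (\<lambda>m. kp_snd (z m) k) \<longlonglongrightarrow> 0"
    and \<eta>: "\<And>i. \<eta> i > 0"
  shows "\<exists>(r :: nat \<Rightarrow> nat) (\<beta> :: nat \<Rightarrow> nat). strict_mono r \<and>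
    (\<forall>i. kp_norm (z (r i) - kp_restrict (z (r i)) {n. \<beta> n = i}) \<le> \<eta> i)"
proof -
  \<comment> \<open>A state is a pair: index of the last chosen vector and end of its block. The
    bound \<open>\<eta> i / 14\<close> leaves room for adding head and tail with the constant
    7.\<close>
  define S where "S i p q \<longleftrightarrow> fst p < fst q \<and> snd p < snd q \<and> kp_norm (kp_restrict (z (fst q)) {..<snd p}) < \<eta> i / 14
      \<and> kp_norm (kp_restrict (z (fst q)) {snd q..}) < \<eta> i / 14" for i and p q :: "nat \<times> nat"
  have ex: "\<exists>q. S i p q" for i p
  proof -
    have \<eta>': "\<eta> i / 14 > 0" using \<eta>[of i] by simp
    have "eventually (\<lambda>m. kp_norm (kp_restrict (z m) {..<snd p}) < \<eta> i / 14) sequentially"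
      by (rule order_tendstoD(2)[OF kp_head_tendsto[OF z] \<eta>'])
    then have "eventually (\<lambda>m. kp_norm (kp_restrict (z m) {..<snd p}) < \<eta> i / 14 \<and> fst p < m) sequentially"
      using eventually_gt_at_top by (rule eventually_conj)
    then obtain m where m: "kp_norm (kp_restrict (z m) {..<snd p}) < \<eta> i / 14" "fst p < m"
      using eventually_happens'[OF sequentially_bot] by blast
    have "eventually (\<lambda>N. kp_norm (kp_restrict (z m) {N..}) < \<eta> i / 14) sequentially"
      by (rule order_tendstoD(2)[OF kp_tail \<eta>'])
    then have "eventually (\<lambda>N. kp_norm (kp_restrict (z m) {N..}) < \<eta> i / 14 \<and> snd p < N) sequentially"
      using eventually_gt_at_top by (rule eventually_conj)
    then obtain N where "kp_norm (kp_restrict (z m) {N..}) < \<eta> i / 14" "snd p < N"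
      using eventually_happens'[OF sequentially_bot] by blast
    with m show ?thesis unfolding S_def by (intro exI[of _ "(m, N)"]) auto
  qed
  obtain p where p0: "p 0 = (0, 0)" and p: "\<And>i. S i (p i) (p (Suc i))"
  proof -
    define p where "p = rec_nat (0, 0) (\<lambda>i x. SOME q. S i x q)"
    have "S i (p i) (p (Suc i))" for i unfolding p_def by (simp, rule someI_ex, rule ex)
    moreover have "p 0 = (0, 0)" by (simp add: p_def)
    ultimately show ?thesis using that by blast
  qed
  define r where "r i = fst (p (Suc i))" for i
  define N where "N i = snd (p i)" for i
  have "strict_mono r" unfolding strict_mono_Suc_iff r_def using p by (auto simp: S_def)
  have mN: "strict_mono N" unfolding strict_mono_Suc_iff N_def using p by (auto simp: S_def)
  have N0: "N 0 = 0" by (simp add: N_def p0)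
  \<comment> \<open>Labels the intervals between successive cuts. As \<open>N 0 = 0\<close>, they
    cover every coordinate.\<close>
  define \<beta> where "\<beta> n = (LEAST i. n < N (Suc i))" for n
  have \<beta>: "{n. \<beta> n = i} = {N i..<N (Suc i)}" for i
  proof (intro set_eqI iffI)
    fix n assume "n \<in> {n. \<beta> n = i}"
    then have bi: "\<beta> n = i" by simp
    have "n < N (Suc n)" using seq_suble[OF mN, of "Suc n"] by simp
    then have "n < N (Suc i)" unfolding bi[symmetric] \<beta>_def by (rule LeastI)
    moreover have "N i \<le> n"
    proof (cases i)
      case (Suc j)
      then have "j < \<beta> n" using bi by simp
      then have "\<not> n < N (Suc j)" unfolding \<beta>_def by (rule not_less_Least)
      then show ?thesis using Suc by simp
    qed (simp add: N0)
    ultimately show "n \<in> {N i..<N (Suc i)}" by simp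
  next
    fix n assume n: "n \<in> {N i..<N (Suc i)}"
    have "\<beta> n = i" unfolding \<beta>_def
    proof (rule Least_equality)
      fix j assume "n < N (Suc j)"
      then have "N i < N (Suc j)" using n by simp
      then show "i \<le> j" using strict_mono_less[OF mN] by simp
    qed (use n in simp)
    then show "n \<in> {n. \<beta> n = i}" by simp
  qed
  have "kp_norm (z (r i) - kp_restrict (z (r i)) {n. \<beta> n = i}) \<le> \<eta> i" for i
  proof -
    have u: "UNIV = ({..<N i} \<union> {N (Suc i)..}) \<union> {N i..<N (Suc i)}" by auto
    have "N i < N (Suc i)" using mN by (simp add: strict_mono_Suc_iff)
    then have d: "({..<N i} \<union> {N (Suc i)..}) \<inter> {N i..<N (Suc i)} = {}" "{..<N i} \<inter> {N (Suc i)..} = {}" by auto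
    have "z (r i) = kp_restrict (z (r i)) {..<N i} + kp_restrict (z (r i)) {N (Suc i)..} + kp_restrict (z (r i)) {N i..<N (Suc i)}"
      using kp_restrict_UNIV[of "z (r i)"] unfolding u kp_restrict_disjoint_Un[OF d(1)] kp_restrict_disjoint_Un[OF d(2)] by simp
    then have "z (r i) - kp_restrict (z (r i)) {n. \<beta> n = i} = kp_restrict (z (r i)) {..<N i} + kp_restrict (z (r i)) {N (Suc i)..}"
      unfolding \<beta> by (metis add_diff_cancel_right')
    then show ?thesis
      using kp_norm_add[of "kp_restrict (z (r i)) {..<N i}" "kp_restrict (z (r i)) {N (Suc i)..}"] p[of i]
      unfolding S_def r_def N_def by auto
  qed
  with \<open>strict_mono r\<close> show ?thesis by blast
qed

section \<open>Sums of disjoint blocks\<close>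

text \<open>The logarithm in \<^const>\<open>Omega\<close> makes the sum of \<open>k\<close> disjoint blocks much longer than \<open>sqrt k\<close> unless
  their second components are small.\<close>

lemma kp_block_sum_ge:
  fixes w :: "nat \<Rightarrow> 'k::real_normed_field kp"
  assumes I: "finite I" "I \<noteq> {}"
    and supp: "\<And>i n. i \<in> I \<Longrightarrow> kp_fst (w i) n \<noteq> 0 \<or> kp_snd (w i) n \<noteq> 0 \<Longrightarrow> \<beta> n = i"
    and M: "\<And>i. i \<in> I \<Longrightarrow> kp_norm (w i) \<le> M" and \<delta>: "\<delta> > 0" "\<And>i. i \<in> I \<Longrightarrow> \<delta> \<le> l2_norm (kp_snd (w i))"
  shows "sqrt (card I) * (\<delta> * (ln (sqrt (card I)) + ln \<delta> - ln M) - M) \<le> kp_norm (\<Sum>i\<in>I. w i)"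
proof -
  define k where "k = real (card I)"
  have k: "k > 0" using I by (simp add: k_def card_gt_0_iff)
  obtain i0 where i0: "i0 \<in> I" using I by blast
  have "0 < M" using M[OF i0] \<delta>(2)[OF i0] \<delta>(1) l2_snd_le[of "w i0"] by linarith
  define L where "L = ln (sqrt k) + ln \<delta> - ln M"
  define Y where "Y n = (\<Sum>i\<in>I. kp_snd (w i) n)" for n
  define G where "G n = (\<Sum>i\<in>I. kp_res (w i) n)" for n
  have sY: "square_summable Y" unfolding Y_def using l2_norm_sum[of I "\<lambda>i. kp_snd (w i)"] kp_snd_square_summable by blast
  have sG: "square_summable G" unfolding G_def using l2_norm_sum[of I "\<lambda>i. kp_res (w i)"] kp_res_square_summable by blast
  have supp': "\<beta> n = i" if "i \<in> I" "kp_res (w i) n \<noteq> 0" for i n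
    using that supp[of i n] unfolding kp_res_def by (cases "kp_snd (w i) n = 0") (auto simp: Omega_def)
  have Y2: "(l2_norm Y)\<^sup>2 = (\<Sum>i\<in>I. (l2_norm (kp_snd (w i)))\<^sup>2)"
    unfolding Y_def using supp by (intro l2_pythagoras_sum[where \<beta> = \<beta>] I kp_snd_square_summable) auto
  have G2: "(l2_norm G)\<^sup>2 = (\<Sum>i\<in>I. (l2_norm (kp_res (w i)))\<^sup>2)"
    unfolding G_def using supp' by (intro l2_pythagoras_sum[where \<beta> = \<beta>] I kp_res_square_summable) auto
  have "(\<Sum>i\<in>I. \<delta>\<^sup>2) \<le> (\<Sum>i\<in>I. (l2_norm (kp_snd (w i)))\<^sup>2)"
    using \<delta> by (intro sum_mono power_mono) auto
  then have "(sqrt k * \<delta>)\<^sup>2 \<le> (l2_norm Y)\<^sup>2" using k by (simp add: Y2 k_def power_mult_distrib)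
  then have Yge: "sqrt k * \<delta> \<le> l2_norm Y"
    by (rule power2_le_imp_le) (rule l2_norm_nonneg[OF sY])
  have "(\<Sum>i\<in>I. (l2_norm (kp_res (w i)))\<^sup>2) \<le> (\<Sum>i\<in>I. M\<^sup>2)"
    by (intro sum_mono power_mono l2_norm_nonneg kp_res_square_summable order_trans[OF l2_res_le M])
  then have "(l2_norm G)\<^sup>2 \<le> (sqrt k * M)\<^sup>2" using k by (simp add: G2 k_def power_mult_distrib)
  then have Gle: "l2_norm G \<le> sqrt k * M"
    by (rule power2_le_imp_le) (use k \<open>0 < M\<close> in auto)
  let ?W = "\<Sum>i\<in>I. w i"
  have snd: "kp_snd ?W = Y" by (simp add: kp_sel Y_def fun_eq_iff)
  show ?thesis
  proof (cases "L \<le> 0")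
    case True
    then have "\<delta> * L - M \<le> 0" using \<delta>(1) \<open>0 < M\<close> mult_nonneg_nonpos[of \<delta> L] by linarith
    then have "sqrt k * (\<delta> * L - M) \<le> 0" using k by (simp add: mult_nonneg_nonpos)
    then show ?thesis using kp_norm_nonneg[of ?W] unfolding L_def k_def by linarith
  next
    case False
    \<comment> \<open>On block \<open>i\<close> the residual of the sum differs from
      \<open>G\<close> by (ln ||Y|| - ln ||y_i||) Y, with y_i the second component of
      \<open>w i\<close>. This logarithmic factor is at least \<open>L\<close> because ||Y|| \<ge>
      sqrt k \<delta> and ||y_i|| \<le> M.\<close>
    have pt: "norm (of_real L * Y n) \<le> norm (norm (G n) + norm (kp_res ?W n))" for n
    proof (cases "Y n = 0")
      case False
      then obtain i where i: "i \<in> I" "kp_snd (w i) n \<noteq> 0" unfolding Y_def by (meson sum.neutral)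
      then have b: "\<beta> n = i" using supp by blast
      have one: "(\<Sum>j\<in>I. f j) = f i" if "\<And>j. j \<in> I \<Longrightarrow> f j \<noteq> 0 \<Longrightarrow> \<beta> n = j" for f :: "nat \<Rightarrow> 'k"
      proof -
        have "(\<Sum>j\<in>I. f j) = (\<Sum>j\<in>{i}. f j)"
          by (rule sum.mono_neutral_right) (use I i b that in auto)
        then show ?thesis by simp
      qed
      have Yn: "Y n = kp_snd (w i) n" unfolding Y_def by (rule one) (use supp in blast)
      have Gn: "G n = kp_res (w i) n" unfolding G_def by (rule one) (use supp' in blast)
      have Wn: "kp_fst ?W n = kp_fst (w i) n" unfolding kp_sel by (rule one) (use supp in blast)
      have "kp_res ?W n = kp_fst (w i) n - of_real (ln (l2_norm Y) - ln (norm (Y n))) * Y n"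
        by (simp only: kp_res_def Wn snd Omega_ln[OF sY])
      also have "\<dots> = G n - of_real (ln (l2_norm Y) - ln (l2_norm (kp_snd (w i)))) * Y n"
        by (simp add: Gn kp_res_def Yn Omega_ln[OF kp_snd_square_summable] algebra_simps)
      finally have "of_real (ln (l2_norm Y) - ln (l2_norm (kp_snd (w i)))) * Y n = G n - kp_res ?W n" by simp
      then have "norm (of_real (ln (l2_norm Y) - ln (l2_norm (kp_snd (w i)))) * Y n) \<le> norm (G n) + norm (kp_res ?W n)"
        by (metis norm_triangle_ineq4)
      moreover have "L \<le> ln (l2_norm Y) - ln (l2_norm (kp_snd (w i)))"
      proof -
        have "ln (sqrt k * \<delta>) \<le> ln (l2_norm Y)" using Yge k \<delta> by (intro ln_mono) (auto intro: less_le_trans)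
        moreover have "ln (l2_norm (kp_snd (w i))) \<le> ln M"
          using \<delta>(1) \<delta>(2)[OF i(1)] M[OF i(1)] l2_snd_le[of "w i"] by (intro ln_mono) linarith+
        ultimately show ?thesis using k \<delta> by (simp add: L_def ln_mult)
      qed
      then have "L * norm (Y n) \<le> \<bar>ln (l2_norm Y) - ln (l2_norm (kp_snd (w i)))\<bar> * norm (Y n)"
        by (intro mult_right_mono) auto
      ultimately show ?thesis using \<open>\<not> L \<le> 0\<close> by (simp add: norm_mult del: of_real_diff)
    qed simp
    have s1: "square_summable (\<lambda>n. norm (G n))" "square_summable (\<lambda>n. norm (kp_res ?W n))"
      using sG kp_res_square_summable[of ?W] by (simp_all add: square_summable_def)
    have "L * l2_norm Y = l2_norm (\<lambda>n. of_real L * Y n)"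
      using False by (subst l2_norm_scale[OF sY]) simp
    also have "\<dots> \<le> l2_norm (\<lambda>n. norm (G n) + norm (kp_res ?W n))"
      by (rule l2_norm_mono[OF square_summable_add[OF s1] pt])
    also have "\<dots> \<le> l2_norm (\<lambda>n. norm (G n)) + l2_norm (\<lambda>n. norm (kp_res ?W n))"
      by (rule l2_norm_triangle[OF s1])
    also have "\<dots> = l2_norm G + l2_norm (kp_res ?W)" by (simp add: l2_norm_def)
    also have "\<dots> \<le> sqrt k * M + kp_norm ?W" using Gle l2_res_le[of ?W] by linarith
    finally have "L * l2_norm Y \<le> sqrt k * M + kp_norm ?W" .
    moreover have "L * (sqrt k * \<delta>) \<le> L * l2_norm Y" using Yge False by (intro mult_left_mono) auto
    ultimately show ?thesis unfolding L_def k_def by (simp add: algebra_simps)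
  qed
qed

section \<open>Operators and block embeddings\<close>

lemma kp_apply_add: "kp_apply T (z + w) = kp_apply T z + kp_apply T w"
  and kp_apply_scale: "kp_apply T (kp_scale c z) = kp_scale c (kp_apply T z)"
  using kp_apply[of T] by (simp_all add: kp_linear_iff)

lemma kp_apply_zero: "kp_apply T 0 = 0"
  using kp_apply_add[of T 0 0] by simp

lemma kp_apply_diff: "kp_apply T (z - w) = kp_apply T z - kp_apply T w"
  using kp_apply_add[of T "z - w" w] by simp

lemma kp_apply_sum: "kp_apply T (\<Sum>i\<in>I. f i) = (\<Sum>i\<in>I. kp_apply T (f i))"
  by (induction I rule: infinite_finite_induct) (simp_all add: kp_apply_zero kp_apply_add)

lemma kp_apply_bound:
  obtains M where "M > 0" "\<And>z. kp_norm (kp_apply T z) \<le> M * kp_norm z"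
proof -
  obtain C where C: "0 \<le> C" "\<And>z. kp_norm (kp_apply T z) \<le> C * kp_norm z"
    using kp_apply[of T] kp_bound_nonneg[of "kp_apply T"] by blast
  have "kp_norm (kp_apply T z) \<le> (C + 1) * kp_norm z" for z
    using C(2)[of z] kp_norm_nonneg[of z] by (simp add: algebra_simps)
  with C(1) show ?thesis by (intro that[of "C + 1"]) auto
qed

lemma kp_apply_limit:
  assumes "(\<lambda>n. kp_norm (f n - z)) \<longlonglongrightarrow> 0"
  shows "(\<lambda>n. kp_norm (kp_apply T (f n) - kp_apply T z)) \<longlonglongrightarrow> 0"
proof -
  obtain M where "M > 0" and M: "\<And>z. kp_norm (kp_apply T z) \<le> M * kp_norm z" using kp_apply_bound[of T] by metis
  have "(\<lambda>n. M * kp_norm (f n - z)) \<longlonglongrightarrow> 0" using tendsto_mult_left[OF assms, of M] by simp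
  then show ?thesis
    by (rule Lim_null_comparison[rotated]) (simp add: abs_kp_norm M flip: kp_apply_diff)
qed

lemma kp_op_exists:
  assumes "\<And>z w. f (z + w) = f z + f w" "\<And>c z. f (kp_scale c z) = kp_scale c (f z)"
    and "\<And>z. kp_norm (f z) \<le> C * kp_norm z"
  shows "\<exists>T. kp_apply T = f"
  by (rule exI[of _ "Abs_kp_op f"], rule Abs_kp_op_inverse) (use assms in \<open>auto simp: kp_linear_iff\<close>)

text \<open>Respecting j(l2) matters as much as the isometry: the images of the (e_n, 0) then span a
  copy of l2 on which the quasi-norm is a Hilbert norm.\<close>

definition kp_embedding :: "'k::real_normed_field kp_op \<Rightarrow> bool"
  where "kp_embedding T \<longleftrightarrow> (\<forall>z. kp_norm (kp_apply T z) = kp_norm z) \<and>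
    (\<forall>x. square_summable x \<longrightarrow> (\<exists>x'. square_summable x' \<and> kp_apply T (kp_inj x) = kp_inj x'))"

lemma kp_embedding_times: "kp_embedding S \<Longrightarrow> kp_embedding T \<Longrightarrow> kp_embedding (S * T)"
  unfolding kp_embedding_def times_kp_op.rep_eq by metis

lemma kp_embedding_inj:
  assumes "kp_embedding T" "square_summable x"
  obtains x' where "square_summable x'" "kp_apply T (kp_inj x) = kp_inj x'" "l2_norm x' = l2_norm x"
  using assms unfolding kp_embedding_def by (metis kp_norm_inj)

text \<open>Let u_i be the restriction of \<open>v\<close> to fibre \<open>i\<close>. The operator
  sends (e_i, 0) to (u_i, 0) and (0, e_i) to (Omega u_i, u_i), where Omega u_i = - u_i ln |u_i| as
  u_i has norm 1. With this correction the residual of the image is the residual of \<open>z\<close>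
  spread over the blocks, whence the isometry.\<close>

lemma block_embedding:
  fixes v :: "nat \<Rightarrow> 'k::real_normed_field" and \<beta> :: "nat \<Rightarrow> nat"
  assumes v: "\<And>i. square_summable (seq_restrict v {n. \<beta> n = i})"
    and v1: "\<And>i. l2_norm (seq_restrict v {n. \<beta> n = i}) = 1"
  obtains T where "kp_embedding T"
    and "\<And>z. kp_fst (kp_apply T z) = (\<lambda>k. v k * kp_fst z (\<beta> k) - of_real (ln (norm (v k))) * v k * kp_snd z (\<beta> k))"
    and "\<And>z. kp_snd (kp_apply T z) = (\<lambda>k. v k * kp_snd z (\<beta> k))"
proof -
  define f where "f z = (\<lambda>k. v k * kp_fst z (\<beta> k) - of_real (ln (norm (v k))) * v k * kp_snd z (\<beta> k))" for z
  define g where "g z = (\<lambda>k. v k * kp_snd z (\<beta> k))" for z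
  have fib: "square_summable (\<lambda>k. v k * a (\<beta> k))" "l2_norm (\<lambda>k. v k * a (\<beta> k)) = l2_norm a"
    if "square_summable a" for a
    using l2_fibres[OF v v1, of a] that by (simp_all add: mult.commute)
  have sg: "square_summable (g z)" and ng: "l2_norm (g z) = l2_norm (kp_snd z)" for z
    unfolding g_def by (intro fib kp_snd_square_summable)+
  have Om: "f z k - Omega (g z) k = v k * kp_res z (\<beta> k)" for z k
  proof (cases "v k = 0 \<or> kp_snd z (\<beta> k) = 0")
    case True
    then show ?thesis by (auto simp: f_def g_def Omega_def kp_res_def)
  next
    case False
    then have "ln (norm (g z k)) = ln (norm (v k)) + ln (norm (kp_snd z (\<beta> k)))"
      by (simp add: g_def norm_mult ln_mult)
    then have "Omega (g z) k = of_real (ln (l2_norm (kp_snd z)) - (ln (norm (v k)) + ln (norm (kp_snd z (\<beta> k))))) * (v k * kp_snd z (\<beta> k))"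
      by (simp add: Omega_ln[OF sg] ng) (simp add: g_def)
    also have "\<dots> = v k * Omega (kp_snd z) (\<beta> k) - of_real (ln (norm (v k))) * v k * kp_snd z (\<beta> k)"
      by (simp add: Omega_ln[OF kp_snd_square_summable] algebra_simps)
    finally show ?thesis by (simp add: f_def kp_res_def algebra_simps)
  qed
  have sf: "square_summable (\<lambda>k. f z k - Omega (g z) k)" for z
    unfolding Om by (intro fib kp_res_square_summable)
  define h where "h z = kp_mk (f z) (g z)" for z
  have hs: "kp_fst (h z) = f z" "kp_snd (h z) = g z" for z
    unfolding h_def by (intro kp_mk_sel sg sf)+
  have hn: "kp_norm (h z) = kp_norm z" for z
    unfolding kp_norm_eq kp_res_def[of "h z"] hs Om ng by (simp add: fib kp_res_square_summable)
  have "\<exists>T. kp_apply T = h"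
  proof (rule kp_op_exists[where C = 1])
    show "h (z + w) = h z + h w" for z w
      by (rule kp_eqI) (simp_all add: hs kp_sel f_def g_def algebra_simps)
    show "h (kp_scale c z) = kp_scale c (h z)" for c z
      by (rule kp_eqI) (simp_all add: hs kp_sel f_def g_def algebra_simps)
  qed (simp add: hn)
  then obtain T where T: "kp_apply T = h" by blast
  have "kp_embedding T"
    unfolding kp_embedding_def T hn
  proof (intro conjI allI impI refl)
    fix x :: "nat \<Rightarrow> 'k" assume x: "square_summable x"
    have "h (kp_inj x) = kp_inj (\<lambda>k. v k * x (\<beta> k))"
      by (rule kp_eqI) (simp_all add: hs f_def g_def kp_inj_sel x fib)
    then show "\<exists>x'. square_summable x' \<and> h (kp_inj x) = kp_inj x'" using fib(1)[OF x] by blast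
  qed
  then show ?thesis using that[of T] by (simp add: T hs f_def g_def)
qed

lemma subsequence_embedding:
  assumes "strict_mono (r :: nat \<Rightarrow> nat)"
  obtains J :: "'k::real_normed_field kp_op" where "kp_embedding J"
    "\<And>n. kp_apply J (kp_unit n) = kp_unit (r n)" "\<And>n. kp_apply J (kp_unit2 n) = kp_unit2 (r n)"
proof -
  have inj: "inj r" using assms by (rule strict_mono_imp_inj_on)
  define v where "v k = (if k \<in> range r then 1 else 0 :: 'k)" for k
  \<comment> \<open>Off the range of \<open>r\<close> the value of \<open>inv r\<close> is
    arbitrary, but \<open>v\<close> vanishes there.\<close>
  define \<beta> where "\<beta> k = inv r k" for k
  have \<beta>: "\<beta> (r i) = i" for i by (simp add: \<beta>_def inj)
  have rv: "seq_restrict v {n. \<beta> n = i} = (\<lambda>k. if k = r i then 1 else 0)" for i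
    by (auto simp: seq_restrict_def v_def \<beta> fun_eq_iff)
  obtain J where J: "kp_embedding J"
    and J1: "\<And>z. kp_fst (kp_apply J z) = (\<lambda>k. v k * kp_fst z (\<beta> k) - of_real (ln (norm (v k))) * v k * kp_snd z (\<beta> k))"
    and J2: "\<And>z. kp_snd (kp_apply J z) = (\<lambda>k. v k * kp_snd z (\<beta> k))"
    by (rule block_embedding[of v \<beta>]) (auto simp: rv square_summable_unit l2_norm_unit)
  have v_unit: "v k * (if \<beta> k = n then 1 else 0) = (if k = r n then 1 else 0)" for k n
    by (auto simp: v_def \<beta>)
  have v_log: "of_real (ln (norm (v k))) * v k = 0" for k by (simp add: v_def)
  have "kp_apply J (kp_unit n) = kp_unit (r n)" for n
    by (rule kp_eqI) (simp_all add: J1 J2 kp_unit_sel v_unit)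
  moreover have "kp_apply J (kp_unit2 n) = kp_unit2 (r n)" for n
    by (rule kp_eqI) (simp_all only: J1 J2 kp_unit2_sel v_unit v_log, simp_all)
  ultimately show ?thesis using that J by blast
qed

section \<open>Coordinate functionals on the unit vectors\<close>

text \<open>For unimodular \<open>\<theta>\<close> this is (Omega y, y) with y equal to
  \<open>\<theta>\<close> on \<open>G\<close> and 0 elsewhere. Its residual is 0, so its norm is
  only sqrt (card G) despite the logarithm in the first component.\<close>

definition flat_vector :: "nat set \<Rightarrow> (nat \<Rightarrow> 'k::real_normed_field) \<Rightarrow> 'k kp"
  where "flat_vector G \<theta> = (\<Sum>n\<in>G. kp_scale (\<theta> n)
    (kp_scale (of_real (ln (sqrt (card G)))) (kp_unit n) + kp_unit2 n))"

lemma sum_units_eq: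
  assumes "finite G"
  shows "(\<Sum>n\<in>G. kp_scale (\<theta> n) (kp_unit n)) = kp_inj (\<lambda>k. if k \<in> G then \<theta> k else 0)"
proof -
  have s: "square_summable (\<lambda>k. if k \<in> G then \<theta> k else 0)"
    by (rule square_summable_finite[OF assms]) auto
  show ?thesis
    by (rule kp_eqI) (simp_all add: kp_sel kp_inj_sel[OF s] kp_unit_sel fun_eq_iff assms if_distrib[of "\<lambda>x. _ * x"] cong: if_cong)
qed

lemma l2_norm_flat:
  assumes "finite G" "\<And>n. n \<in> G \<Longrightarrow> norm (\<theta> n) = 1"
  shows "square_summable (\<lambda>k. if k \<in> G then \<theta> k else 0)"
    "l2_norm (\<lambda>k. if k \<in> G then \<theta> k else 0) = sqrt (card G)"
proof -
  show s: "square_summable (\<lambda>k. if k \<in> G then \<theta> k else 0)"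
    by (rule square_summable_finite[OF assms(1)]) auto
  have "(l2_norm (\<lambda>k. if k \<in> G then \<theta> k else 0))\<^sup>2 = (\<Sum>n\<in>G. (norm (if n \<in> G then \<theta> n else 0))\<^sup>2)"
    by (rule l2_norm_finite[OF assms(1)]) auto
  also have "\<dots> = card G" using assms(2) by simp
  finally show "l2_norm (\<lambda>k. if k \<in> G then \<theta> k else 0) = sqrt (card G)"
    using real_sqrt_unique l2_norm_nonneg[OF s] by metis
qed

lemma kp_norm_sum_units:
  assumes "finite G" "\<And>n. n \<in> G \<Longrightarrow> norm (\<theta> n) = 1"
  shows "kp_norm (\<Sum>n\<in>G. kp_scale (\<theta> n) (kp_unit n)) = sqrt (card G)"
  by (simp add: sum_units_eq assms kp_norm_inj l2_norm_flat)

lemma flat_vector_sel: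
  assumes "finite G"
  shows "kp_fst (flat_vector G \<theta>) = (\<lambda>k. of_real (ln (sqrt (card G))) * (if k \<in> G then \<theta> k else 0))"
    "kp_snd (flat_vector G \<theta>) = (\<lambda>k. if k \<in> G then \<theta> k else 0)"
  unfolding flat_vector_def kp_sel kp_unit_sel kp_unit2_sel
  using assms by (auto simp: fun_eq_iff if_distrib[of "\<lambda>x. _ * x"] cong: if_cong)

lemma kp_norm_flat_vector:
  assumes "finite G" "\<And>n. n \<in> G \<Longrightarrow> norm (\<theta> n) = 1"
  shows "kp_norm (flat_vector G \<theta>) = sqrt (card G)"
proof -
  define y where "y = (\<lambda>k. if k \<in> G then \<theta> k else 0)"
  have fst: "kp_fst (flat_vector G \<theta>) = (\<lambda>k. of_real (ln (sqrt (card G))) * y k)"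
   and snd: "kp_snd (flat_vector G \<theta>) = y"
    unfolding flat_vector_sel[OF assms(1)] y_def by simp_all
  have "kp_res (flat_vector G \<theta>) = (\<lambda>k. 0)"
  proof
    fix k
    show "kp_res (flat_vector G \<theta>) k = 0"
      using l2_norm_flat[OF assms] by (cases "k \<in> G")
        (simp_all add: kp_res_def fst snd Omega_ln y_def assms(2))
  qed
  then show ?thesis using l2_norm_flat[OF assms] by (simp add: kp_norm_eq snd y_def l2_norm_zero)
qed

lemma not_tendsto_zero_infinite:
  fixes X :: "nat \<Rightarrow> 'k::real_normed_vector"
  assumes "\<not> X \<longlonglongrightarrow> 0"
  obtains e where "e > 0" "infinite {n. e \<le> norm (X n)}"
proof -
  from assms obtain e where e: "e > 0" "\<And>N. \<exists>n\<ge>N. e \<le> norm (X n)"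
    unfolding LIMSEQ_iff by (force simp: not_less)
  then have "infinite {n. e \<le> norm (X n)}" unfolding infinite_nat_iff_unbounded_le by auto
  with e(1) show ?thesis by (rule that)
qed

lemma ln_sqrt_unbounded:
  assumes "a > 0" "\<And>k::nat. (1::nat) \<le> k \<Longrightarrow> a * ln (sqrt k) \<le> b"
  shows False
proof -
  have "filterlim (\<lambda>k::nat. ln (sqrt k)) at_top sequentially"
    by (intro filterlim_compose[OF ln_at_top] filterlim_compose[OF sqrt_at_top] filterlim_real_sequentially)
  then have "eventually (\<lambda>k::nat. b / a < ln (sqrt k)) sequentially"
    by (simp add: filterlim_at_top_dense)
  then have "eventually (\<lambda>k::nat. b / a < ln (sqrt k) \<and> (1::nat) \<le> k) sequentially"
    using eventually_ge_at_top by (rule eventually_conj)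
  then obtain k :: nat where "b / a < ln (sqrt k)" "(1::nat) \<le> k"
    using eventually_happens'[OF sequentially_bot] by blast
  then show False using assms(1) assms(2)[of k] by (simp add: field_simps)
qed

lemma sqrt_cancel:
  assumes "real k * e \<le> sqrt k * b" "(1::nat) \<le> k"
  shows "sqrt k * e \<le> b"
proof -
  have "sqrt k * (sqrt k * e) \<le> sqrt k * b" using assms(1) by (simp flip: mult.assoc)
  then show ?thesis using assms(2) by simp
qed

text \<open>If the values stayed away from 0, then k unit vectors with suitable phases would give a
  value of order k on a vector of norm sqrt k. For the vectors (0, e_n) the flat vector plays this
  role; subtracting its first component costs a factor ln (sqrt k), still far below sqrt k.\<close>

lemma functional_null:
  fixes \<phi> :: "'k::real_normed_field kp \<Rightarrow> 'k"
  assumes add: "\<And>z w. \<phi> (z + w) = \<phi> z + \<phi> w" and scale: "\<And>c z. \<phi> (kp_scale c z) = c * \<phi> z"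
    and bound: "\<And>z. norm (\<phi> z) \<le> M * kp_norm z"
  shows "(\<lambda>n. \<phi> (kp_unit n)) \<longlonglongrightarrow> 0" "(\<lambda>n. \<phi> (kp_unit2 n)) \<longlonglongrightarrow> 0"
proof -
  have sum: "\<phi> (\<Sum>i\<in>I. f i) = (\<Sum>i\<in>I. \<phi> (f i))" for f and I :: "nat set"
  proof (induction I rule: infinite_finite_induct)
    case (insert i I) then show ?case by (simp add: add)
  qed (use add[of 0 0] in auto)
  \<comment> \<open>Phases turning each value into its modulus, so that the sums below have no
    cancellation.\<close>
  define \<theta> where "\<theta> c = (if c = 0 then 1 else of_real (norm c) / c)" for c :: 'k
  have \<theta>: "norm (\<theta> c) = 1" "\<theta> c * c = of_real (norm c)" for c by (auto simp: \<theta>_def norm_divide)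
  have M0: "0 \<le> M" using bound[of "kp_unit 0"] norm_ge_zero[of "\<phi> (kp_unit 0)"] by (simp add: kp_norm_unit del: norm_ge_zero)
  have large: "real k * e \<le> norm (\<Sum>n\<in>G. \<theta> (b n) * b n)"
    if "\<And>n. n \<in> G \<Longrightarrow> e \<le> norm (b n)" "card G = k" for k e G and b :: "nat \<Rightarrow> 'k"
  proof -
    have "(\<Sum>n\<in>G. \<theta> (b n) * b n) = of_real (\<Sum>n\<in>G. norm (b n))" by (simp add: \<theta>)
    then have "norm (\<Sum>n\<in>G. \<theta> (b n) * b n) = (\<Sum>n\<in>G. norm (b n))"
      by (simp only: norm_of_real) (simp add: sum_nonneg)
    moreover have "(\<Sum>n\<in>G. e) \<le> (\<Sum>n\<in>G. norm (b n))" using that by (intro sum_mono) auto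
    ultimately show ?thesis using that by simp
  qed
  show "(\<lambda>n. \<phi> (kp_unit n)) \<longlonglongrightarrow> 0"
  proof (rule ccontr)
    assume "\<not> (\<lambda>n. \<phi> (kp_unit n)) \<longlonglongrightarrow> 0"
    then obtain e where e: "e > 0" "infinite {n. e \<le> norm (\<phi> (kp_unit n))}" by (rule not_tendsto_zero_infinite)
    have "e * ln (sqrt k) \<le> M" if k: "(1::nat) \<le> k" for k :: nat
    proof -
      obtain G where G: "finite G" "card G = k" "G \<subseteq> {n. e \<le> norm (\<phi> (kp_unit n))}"
        using infinite_arbitrarily_large[OF e(2)] by blast
      let ?x = "\<Sum>n\<in>G. kp_scale (\<theta> (\<phi> (kp_unit n))) (kp_unit n)"
      have "real k * e \<le> norm (\<phi> ?x)" unfolding sum scale using G by (intro large) auto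
      also have "\<dots> \<le> M * sqrt k" using bound[of ?x] by (simp add: kp_norm_sum_units G \<theta>)
      finally have "real k * e \<le> sqrt k * M" by (simp add: mult.commute)
      from sqrt_cancel[OF this k] have "e * sqrt k \<le> M" by (simp add: mult.commute)
      \<comment> \<open>The estimate is weakened to a logarithmic one in order to end with
        \<open>ln_sqrt_unbounded\<close>.\<close>
      moreover have "ln (sqrt k) \<le> sqrt k" using k ln_le_minus_one[of "sqrt k"] by simp
      then have "e * ln (sqrt k) \<le> e * sqrt k" using e by simp
      ultimately show ?thesis by linarith
    qed
    then show False using ln_sqrt_unbounded e(1) by blast
  qed
  show "(\<lambda>n. \<phi> (kp_unit2 n)) \<longlonglongrightarrow> 0"
  proof (rule ccontr)
    assume "\<not> (\<lambda>n. \<phi> (kp_unit2 n)) \<longlonglongrightarrow> 0"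
    then obtain e where e: "e > 0" "infinite {n. e \<le> norm (\<phi> (kp_unit2 n))}" by (rule not_tendsto_zero_infinite)
    have key: "e * sqrt k \<le> M * (ln (sqrt k) + 1)" if k: "(1::nat) \<le> k" for k :: nat
    proof -
      obtain G where G: "finite G" "card G = k" "G \<subseteq> {n. e \<le> norm (\<phi> (kp_unit2 n))}"
        using infinite_arbitrarily_large[OF e(2)] by blast
      let ?\<theta> = "\<lambda>n. \<theta> (\<phi> (kp_unit2 n))"
      let ?x = "\<Sum>n\<in>G. kp_scale (?\<theta> n) (kp_unit n)"
      have eq: "\<phi> (flat_vector G ?\<theta>) = of_real (ln (sqrt k)) * \<phi> ?x + (\<Sum>n\<in>G. ?\<theta> n * \<phi> (kp_unit2 n))"
        unfolding flat_vector_def G(2) sum scale add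
        by (simp add: sum.distrib sum_distrib_left algebra_simps)
      have "real k * e \<le> norm (\<Sum>n\<in>G. ?\<theta> n * \<phi> (kp_unit2 n))" using G by (intro large) auto
      also have "(\<Sum>n\<in>G. ?\<theta> n * \<phi> (kp_unit2 n)) = \<phi> (flat_vector G ?\<theta>) - of_real (ln (sqrt k)) * \<phi> ?x"
        by (simp add: eq)
      also have "norm \<dots> \<le> norm (\<phi> (flat_vector G ?\<theta>)) + ln (sqrt k) * norm (\<phi> ?x)"
        by (rule order_trans[OF norm_triangle_ineq4]) (use k in \<open>simp add: norm_mult\<close>)
      also have "\<dots> \<le> M * sqrt k + ln (sqrt k) * (M * sqrt k)"
        using bound[of "flat_vector G ?\<theta>"] bound[of ?x] k
        by (intro add_mono mult_left_mono) (simp_all add: kp_norm_flat_vector kp_norm_sum_units G \<theta>)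
      also have "\<dots> = sqrt k * (M * (ln (sqrt k) + 1))" by (simp only: distrib_left mult_ac mult_1_right)
      finally show ?thesis using sqrt_cancel[OF _ k] by (metis mult.commute)
    qed
    have "eventually (\<lambda>k::nat. M * (ln (sqrt k) + 1) < e * sqrt k) sequentially"
    proof -
      have "((\<lambda>x::real. ln x / x) \<longlongrightarrow> 0) at_top" by (rule ln_x_over_x_tendsto_0)
      then have "((\<lambda>x::real. M * (ln x / x + inverse x)) \<longlongrightarrow> M * (0 + 0)) at_top"
        by (intro tendsto_intros tendsto_inverse_0_at_top filterlim_ident)
      then have "eventually (\<lambda>x::real. M * (ln x / x + inverse x) < e) at_top"
        by (rule order_tendstoD(2)) (use e in simp)
      then have "eventually (\<lambda>x::real. M * (ln x + 1) < e * x) at_top"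
        using eventually_gt_at_top[of 0]
      proof eventually_elim
        case (elim x)
        then have "M * (ln x / x + inverse x) * x < e * x" by simp
        moreover have "M * (ln x / x + inverse x) * x = M * (ln x + 1)" using elim by (simp add: field_simps)
        ultimately show ?case by simp
      qed
      moreover have "filterlim (\<lambda>k::nat. sqrt k) at_top sequentially"
        by (intro filterlim_compose[OF sqrt_at_top] filterlim_real_sequentially)
      ultimately show ?thesis by (rule eventually_compose_filterlim)
    qed
    then have "eventually (\<lambda>k::nat. M * (ln (sqrt k) + 1) < e * sqrt k \<and> (1::nat) \<le> k) sequentially"
      using eventually_ge_at_top by (rule eventually_conj)
    then obtain k :: nat where "M * (ln (sqrt k) + 1) < e * sqrt k" "(1::nat) \<le> k"
      using eventually_happens'[OF sequentially_bot] by blast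
    with key show False by fastforce
  qed
qed

text \<open>Every coordinate of an image is a bounded functional. This supplies the coordinatewise
  convergence that \<open>gliding_hump\<close> asks for.\<close>

lemma kp_apply_units_null:
  "(\<lambda>n. kp_fst (kp_apply T (kp_unit n)) k) \<longlonglongrightarrow> 0" "(\<lambda>n. kp_fst (kp_apply T (kp_unit2 n)) k) \<longlonglongrightarrow> 0"
  "(\<lambda>n. kp_snd (kp_apply T (kp_unit n)) k) \<longlonglongrightarrow> 0" "(\<lambda>n. kp_snd (kp_apply T (kp_unit2 n)) k) \<longlonglongrightarrow> 0"
proof -
  obtain M where "M > 0" and M: "\<And>z. kp_norm (kp_apply T z) \<le> M * kp_norm z" using kp_apply_bound[of T] by metis
  show "(\<lambda>n. kp_fst (kp_apply T (kp_unit n)) k) \<longlonglongrightarrow> 0" "(\<lambda>n. kp_fst (kp_apply T (kp_unit2 n)) k) \<longlonglongrightarrow> 0"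
    by (rule functional_null[of "\<lambda>z. kp_fst (kp_apply T z) k" M];
      auto simp: kp_apply_add kp_apply_scale kp_sel intro: order_trans[OF norm_kp_fst_le M])+
  show "(\<lambda>n. kp_snd (kp_apply T (kp_unit n)) k) \<longlonglongrightarrow> 0" "(\<lambda>n. kp_snd (kp_apply T (kp_unit2 n)) k) \<longlonglongrightarrow> 0"
    by (rule functional_null[of "\<lambda>z. kp_snd (kp_apply T z) k" M];
      auto simp: kp_apply_add kp_apply_scale kp_sel intro: order_trans[OF norm_kp_snd_le M])+
qed

section \<open>Growth of sums of coordinatewise null sequences\<close>

text \<open>After a gliding hump the vectors are almost disjoint blocks. Their sums grow at least
  like sqrt k ln (sqrt k) by \<open>kp_block_sum_ge\<close>, whereas the second components, being
  almost orthogonal, grow only like sqrt k. Later contradictions exploit this gap.\<close>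

lemma null_sequence_sums:
  fixes z :: "nat \<Rightarrow> 'k::real_normed_field kp"
  assumes null: "\<And>k. (\<lambda>m. kp_fst (z m) k) \<longlonglongrightarrow> 0" "\<And>k. (\<lambda>m. kp_snd (z m) k) \<longlonglongrightarrow> 0"
    and M: "\<And>n. kp_norm (z n) \<le> M" and e: "e > 0" "\<And>n. e \<le> l2_norm (kp_snd (z n))"
  shows "\<exists>(r :: nat \<Rightarrow> nat) c. strict_mono r \<and>
    (\<forall>k::nat. 1 \<le> k \<longrightarrow> sqrt k * (e / 14 * ln (sqrt k) - c) \<le> kp_norm (\<Sum>i<k. z (r i))) \<and>
    (\<forall>k::nat. 1 \<le> k \<longrightarrow> l2_norm (kp_snd (\<Sum>i<k. z (r i))) \<le> sqrt k * c)"
proof -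
  define \<eta> where "\<eta> i = e / 2 / 14 ^ Suc i" for i :: nat
  have \<eta>: "\<eta> i > 0" "\<eta> i \<le> e / 2" for i
    using e(1) one_le_power[of "14::real" "Suc i"] by (auto simp: \<eta>_def divide_le_eq intro: order_trans[of _ "e * 1"])
  from gliding_hump[of z \<eta>, OF null \<eta>(1)]
  obtain r \<beta> where r: "strict_mono r"
    and rb: "\<And>i. kp_norm (z (r i) - kp_restrict (z (r i)) {n. \<beta> n = i}) \<le> \<eta> i"
    by blast
  define w where "w i = kp_restrict (z (r i)) {n. \<beta> n = i}" for i
  define M' where "M' = 7 * (M + e / 2)"
  define \<delta> where "\<delta> = e / 2"
  have wb: "kp_norm (z (r i) - w i) \<le> e / 2 / 14 ^ Suc i" for i using rb[of i] by (simp add: w_def \<eta>_def)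
  have wM: "kp_norm (w i) \<le> M'" for i
  proof -
    have "kp_norm (w i) \<le> 7 * (kp_norm (z (r i)) + kp_norm (z (r i) - w i))"
      using kp_norm_diff[of "z (r i)" "z (r i) - w i"] by simp
    moreover have "kp_norm (z (r i)) + kp_norm (z (r i) - w i) \<le> M + e / 2"
      using M[of "r i"] rb[of i] \<eta>(2)[of i] unfolding w_def by (intro add_mono) auto
    ultimately show ?thesis unfolding M'_def by (simp add: algebra_simps)
  qed
  have wd: "\<delta> \<le> l2_norm (kp_snd (w i))" for i
  proof -
    have "l2_norm (kp_snd (z (r i))) - l2_norm (kp_snd (z (r i) - w i)) \<le> l2_norm (\<lambda>n. kp_snd (z (r i)) n - kp_snd (z (r i) - w i) n)"
      by (intro l2_norm_diff_ge kp_snd_square_summable)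
    also have "(\<lambda>n. kp_snd (z (r i)) n - kp_snd (z (r i) - w i) n) = kp_snd (w i)" by (simp add: kp_sel)
    finally show ?thesis
      using e(2)[of "r i"] l2_snd_le[of "z (r i) - w i"] rb[of i] \<eta>(2)[of i] unfolding \<delta>_def w_def by linarith
  qed
  define A where "A = \<delta> * (ln \<delta> - ln M')"
  \<comment> \<open>Chosen with 7 c = |A| + 8 M' + 7 (e / 2): the 7 pays for passing from the blocks
    back to the vectors. Also c \<ge> M' + e / 2, as the second estimate requires.\<close>
  define c where "c = (\<bar>A\<bar> + M') / 7 + M' + e / 2"
  have supp: "\<beta> n = i" if "kp_fst (w i) n \<noteq> 0 \<or> kp_snd (w i) n \<noteq> 0" for i n
    using that by (auto simp: w_def kp_restrict_sel seq_restrict_def split: if_splits)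
  have M'0: "M' > 0" using wM[of 0] kp_norm_nonneg[of "w 0"] e(1) M[of 0] kp_norm_nonneg[of "z 0"] by (simp add: M'_def)
  have err: "kp_norm (\<Sum>i<k. z (r i) - w i) \<le> e / 2" for k
    using kp_norm_small_sum[of "e / 2" 1 "\<lambda>_. 1" "\<lambda>i. z (r i) - w i" k] wb e(1) by simp
  have split: "(\<Sum>i<k. z (r i)) = (\<Sum>i<k. w i) + (\<Sum>i<k. z (r i) - w i)" for k
    by (simp flip: sum.distrib)
  have "sqrt k * (e / 14 * ln (sqrt k) - c) \<le> kp_norm (\<Sum>i<k. z (r i))" if k: "(1::nat) \<le> k" for k
  proof -
    have "sqrt (card {..<k}) * (\<delta> * (ln (sqrt (card {..<k})) + ln \<delta> - ln M') - M') \<le> kp_norm (\<Sum>i<k. w i)"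
      by (rule kp_block_sum_ge[where \<beta> = \<beta>]) (use k supp wM wd e(1) in \<open>auto simp: \<delta>_def lessThan_empty_iff\<close>)
    then have 1: "sqrt k * (\<delta> * (ln (sqrt k) + ln \<delta> - ln M') - M') \<le> kp_norm (\<Sum>i<k. w i)" by simp
    have "kp_norm (\<Sum>i<k. w i) = kp_norm ((\<Sum>i<k. z (r i)) - (\<Sum>i<k. z (r i) - w i))" by (simp add: split)
    then have 2: "kp_norm (\<Sum>i<k. w i) \<le> 7 * (kp_norm (\<Sum>i<k. z (r i)) + \<delta>)"
      using kp_norm_diff[of "\<Sum>i<k. z (r i)" "\<Sum>i<k. z (r i) - w i"] err[of k, folded \<delta>_def] unfolding distrib_left by linarith
    define s where "s = sqrt k"
    have s1: "s \<ge> 1" using k by (simp add: s_def)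
    have "s * (7 * (e / 14 * ln s - c)) \<le> s * (\<delta> * (ln s + ln \<delta> - ln M') - M' - 7 * (e / 2))"
    proof (rule mult_left_mono)
      have e1: "7 * (e / 14 * ln s - c) = \<delta> * ln s - 7 * c" by (simp add: \<delta>_def algebra_simps)
      have e2: "7 * c = \<bar>A\<bar> + 8 * M' + 7 * (e / 2)" by (simp add: c_def)
      have e3: "\<delta> * (ln s + ln \<delta> - ln M') = \<delta> * ln s + A" by (simp add: A_def algebra_simps)
      show "7 * (e / 14 * ln s - c) \<le> \<delta> * (ln s + ln \<delta> - ln M') - M' - 7 * (e / 2)"
        unfolding e1 e2 e3 using M'0 by linarith
    qed (use s1 in simp)
    also have "\<dots> = s * (\<delta> * (ln s + ln \<delta> - ln M') - M') - s * (7 * (e / 2))" by (simp add: algebra_simps)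
    also have "\<dots> \<le> s * (\<delta> * (ln s + ln \<delta> - ln M') - M') - 7 * (e / 2)"
      using mult_right_mono[OF s1, of "7 * (e / 2)"] e(1) by simp
    also have "\<dots> \<le> 7 * kp_norm (\<Sum>i<k. z (r i))" using 1 2 unfolding s_def[symmetric] \<delta>_def by (simp add: algebra_simps)
    finally have "7 * (s * (e / 14 * ln s - c)) \<le> 7 * kp_norm (\<Sum>i<k. z (r i))"
      by (simp only: mult.left_commute[of s])
    then have "s * (e / 14 * ln s - c) \<le> kp_norm (\<Sum>i<k. z (r i))" by (rule mult_left_le_imp_le) simp
    then show ?thesis unfolding s_def .
  qed
  moreover have "l2_norm (kp_snd (\<Sum>i<k. z (r i))) \<le> sqrt k * c" if k: "(1::nat) \<le> k" for k
  proof -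
    have "(l2_norm (kp_snd (\<Sum>i<k. w i)))\<^sup>2 = (\<Sum>i<k. (l2_norm (kp_snd (w i)))\<^sup>2)"
      unfolding kp_sel using supp by (intro l2_pythagoras_sum[where \<beta> = \<beta>] kp_snd_square_summable) auto
    also have "\<dots> \<le> (\<Sum>i<k. M'\<^sup>2)"
      by (intro sum_mono power_mono l2_norm_nonneg kp_snd_square_summable order_trans[OF l2_snd_le wM])
    also have "\<dots> = (sqrt k * M')\<^sup>2" by (simp add: power_mult_distrib)
    finally have 1: "l2_norm (kp_snd (\<Sum>i<k. w i)) \<le> sqrt k * M'"
      by (rule power2_le_imp_le) (use M'0 in simp)
    have "l2_norm (kp_snd (\<Sum>i<k. z (r i))) \<le> l2_norm (kp_snd (\<Sum>i<k. w i)) + l2_norm (kp_snd (\<Sum>i<k. z (r i) - w i))"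
      by (subst split, subst kp_snd_add, intro l2_norm_triangle kp_snd_square_summable)
    also have "\<dots> \<le> sqrt k * M' + e / 2"
      using 1 err[of k] l2_snd_le[of "\<Sum>i<k. z (r i) - w i"] by linarith
    also have "\<dots> \<le> sqrt k * M' + sqrt k * (e / 2)"
      using k e(1) by simp
    also have "\<dots> \<le> sqrt k * c" unfolding distrib_left[symmetric]
      using M'0 by (intro mult_left_mono) (auto simp: c_def)
    finally show ?thesis .
  qed
  ultimately show ?thesis using r by blast
qed

lemma infinite_subsequence:
  assumes "infinite (S :: nat set)"
  obtains r :: "nat \<Rightarrow> nat" where "strict_mono r" "\<And>i. r i \<in> S"
  using that[of "enumerate S"] enumerate_in_set[OF assms] strict_mono_enumerate[OF assms] by blast

text \<open>A sum of k vectors (e_n, 0) has norm sqrt k. If the second components of the images did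
  not tend to 0, suitable sums of this kind would have images of norm of order sqrt k ln (sqrt
  k).\<close>

lemma kp_snd_units_null:
  "(\<lambda>n. l2_norm (kp_snd (kp_apply T (kp_unit n)))) \<longlonglongrightarrow> 0"
proof (rule ccontr)
  assume "\<not> ?thesis"
  then obtain e where e: "e > 0" "infinite {n. e \<le> norm (l2_norm (kp_snd (kp_apply T (kp_unit n))))}"
    by (rule not_tendsto_zero_infinite)
  obtain r0 :: "nat \<Rightarrow> nat" where r0: "strict_mono r0" "\<And>i. r0 i \<in> {n. e \<le> norm (l2_norm (kp_snd (kp_apply T (kp_unit n))))}"
    using infinite_subsequence[OF e(2)] by blast
  have r0': "e \<le> l2_norm (kp_snd (kp_apply T (kp_unit (r0 i))))" for i
    using r0(2)[of i] l2_norm_nonneg[OF kp_snd_square_summable, of "kp_apply T (kp_unit (r0 i))"] by simp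
  obtain M where M: "M > 0" "\<And>z. kp_norm (kp_apply T z) \<le> M * kp_norm z" using kp_apply_bound[of T] by metis
  have "\<exists>(r :: nat \<Rightarrow> nat) c. strict_mono r \<and>
    (\<forall>k::nat. 1 \<le> k \<longrightarrow> sqrt k * (e / 14 * ln (sqrt k) - c) \<le> kp_norm (\<Sum>i<k. kp_apply T (kp_unit (r0 (r i))))) \<and>
    (\<forall>k::nat. 1 \<le> k \<longrightarrow> l2_norm (kp_snd (\<Sum>i<k. kp_apply T (kp_unit (r0 (r i))))) \<le> sqrt k * c)"
  proof (rule null_sequence_sums[of "\<lambda>n. kp_apply T (kp_unit (r0 n))" M e])
    show "kp_norm (kp_apply T (kp_unit (r0 n))) \<le> M" for n using M(2)[of "kp_unit (r0 n)"] by (simp add: kp_norm_unit)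
    show "(\<lambda>m. kp_fst (kp_apply T (kp_unit (r0 m))) k) \<longlonglongrightarrow> 0" for k
      using LIMSEQ_subseq_LIMSEQ[OF kp_apply_units_null(1) r0(1)] by (simp add: o_def)
    show "(\<lambda>m. kp_snd (kp_apply T (kp_unit (r0 m))) k) \<longlonglongrightarrow> 0" for k
      using LIMSEQ_subseq_LIMSEQ[OF kp_apply_units_null(3) r0(1)] by (simp add: o_def)
  qed (use e(1) r0' in auto)
  then obtain r c where r: "strict_mono r"
    "\<And>k. (1::nat) \<le> k \<Longrightarrow> sqrt k * (e / 14 * ln (sqrt k) - c) \<le> kp_norm (\<Sum>i<k. kp_apply T (kp_unit (r0 (r i))))"
    by blast
  have "e / 14 > 0" using e(1) by simp
  moreover have "e / 14 * ln (sqrt k) \<le> M + c" if k: "(1::nat) \<le> k" for k :: nat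
  proof -
    have inj: "inj_on (\<lambda>i. r0 (r i)) {..<k}"
      using strict_mono_imp_inj_on[OF strict_mono_o[OF r0(1) r(1)], of "{..<k}"] by (simp add: o_def)
    have "(\<Sum>i<k. kp_apply T (kp_unit (r0 (r i)))) = kp_apply T (\<Sum>n\<in>(\<lambda>i. r0 (r i)) ` {..<k}. kp_scale 1 (kp_unit n))"
      by (simp add: kp_apply_sum sum.reindex[OF inj])
    then have "kp_norm (\<Sum>i<k. kp_apply T (kp_unit (r0 (r i)))) \<le> M * sqrt k"
      using M(2)[of "\<Sum>n\<in>(\<lambda>i. r0 (r i)) ` {..<k}. kp_scale 1 (kp_unit n)"]
      by (simp add: kp_norm_sum_units[of _ "\<lambda>_. 1", simplified] card_image[OF inj])
    then have "sqrt k * (e / 14 * ln (sqrt k) - c) \<le> sqrt k * M" using r(2)[OF k] by (simp add: mult.commute)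
    then show ?thesis using k by simp
  qed
  ultimately show False by (rule ln_sqrt_unbounded)
qed

section \<open>Block subspaces\<close>

lemma l2_tail_inj:
  assumes "square_summable a"
  shows "(\<lambda>n. kp_norm (kp_inj (seq_restrict a {..<n}) - kp_inj a)) \<longlonglongrightarrow> 0"
proof -
  have "kp_norm (kp_inj (seq_restrict a {..<n}) - kp_inj a) = l2_norm (seq_restrict a {n..})" for n
  proof -
    have "kp_inj (seq_restrict a {..<n}) - kp_inj a = kp_inj (\<lambda>k. seq_restrict a {..<n} k - a k)"
      by (simp add: kp_inj_diff seq_restrict_square_summable assms)
    also have "(\<lambda>k. seq_restrict a {..<n} k - a k) = (\<lambda>k. - seq_restrict a {n..} k)"
      by (auto simp: seq_restrict_def)
    finally show ?thesis
      by (simp add: kp_norm_inj square_summable_uminus seq_restrict_square_summable assms l2_norm_uminus)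
  qed
  then show ?thesis using l2_tail[OF assms] by simp
qed

lemma kp_inj_restrict_sum: "kp_inj (seq_restrict a {..<n}) = (\<Sum>i<n. kp_scale (a i) (kp_unit i))"
  by (simp add: sum_units_eq seq_restrict_def)

lemma kp_closedD:
  "kp_closed Z \<Longrightarrow> (\<And>n. f n \<in> Z) \<Longrightarrow> (\<lambda>n. kp_norm (f n - z)) \<longlonglongrightarrow> 0 \<Longrightarrow> z \<in> Z"
  unfolding kp_closed_def by blast

text \<open>Perturbing the images of the (e_i, 0) by geometrically small errors still gives a copy
  of l2. Since 7 \<theta> \<le> 1 / 2, the map \<open>\<Phi>\<close> changes norms by a factor of at
  most 2, which yields closedness and infinite dimension of its range.\<close>

lemma block_space:
  fixes z :: "nat \<Rightarrow> 'k::rc_field kp"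
  assumes T: "kp_embedding T" and \<theta>: "0 \<le> \<theta>" "\<theta> \<le> 1 / 14"
    and z: "\<And>i. kp_norm (z i - kp_apply T (kp_unit i)) \<le> \<theta> / 14 ^ Suc i"
  shows "\<exists>\<Phi>. (\<forall>a. square_summable a \<longrightarrow>
      kp_norm (\<Phi> a - kp_apply T (kp_inj a)) \<le> 7 * \<theta> * l2_norm a \<and> l2_norm a \<le> 2 * kp_norm (\<Phi> a) \<and>
      (\<lambda>n. kp_norm ((\<Sum>i<n. kp_scale (a i) (z i)) - \<Phi> a)) \<longlonglongrightarrow> 0) \<and>
    inf_dim_closed_subspace (\<Phi> ` {a. square_summable a})"
proof -
  define g where "g i = z i - kp_apply T (kp_unit i)" for i
  have isoT: "kp_norm (kp_apply T w) = kp_norm w" for w using T by (simp add: kp_embedding_def)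
  have "\<exists>w. (\<lambda>n. kp_norm ((\<Sum>i<n. kp_scale (a i) (g i)) - w)) \<longlonglongrightarrow> 0"
    if a: "square_summable a" for a
  proof -
    define s where "s n = (\<Sum>i<n. kp_scale (a i) (g i))" for n
    have tail: "kp_norm (s m - s n) \<le> \<theta> / 14 ^ n * l2_norm a" if "n \<le> m" for m n
    proof -
      have "s m - s n = (\<Sum>j<m - n. kp_scale (a (n + j)) (g (n + j)))"
      proof -
        have "s m = s n + (\<Sum>i\<in>{n..<m}. kp_scale (a i) (g i))"
          unfolding s_def using that by (metis sum.atLeastLessThan_concat le0 atLeast0LessThan)
        also have "(\<Sum>i\<in>{n..<m}. kp_scale (a i) (g i)) = (\<Sum>j<m - n. kp_scale (a (n + j)) (g (n + j)))"
          by (rule sum.reindex_bij_witness[of _ "\<lambda>j. n + j" "\<lambda>i. i - n"]) (use that in auto)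
        finally show ?thesis by simp
      qed
      also have "kp_norm \<dots> \<le> \<theta> / 14 ^ n * l2_norm a"
      proof (rule kp_norm_small_sum)
        show "kp_norm (g (n + i)) \<le> \<theta> / 14 ^ n / 14 ^ Suc i" for i
          using z[of "n + i"] by (simp add: g_def power_add mult_ac)
      qed (use \<theta> a in \<open>auto intro: l2_norm_nonneg norm_le_l2_norm\<close>)
      finally show ?thesis .
    qed
    have lim: "(\<lambda>n. \<theta> / 14 ^ n * l2_norm a) \<longlonglongrightarrow> 0"
    proof -
      have "(\<lambda>n. (1 / 14 :: real) ^ n) \<longlonglongrightarrow> 0" by (rule LIMSEQ_realpow_zero) auto
      from tendsto_mult_left[OF this, of "\<theta> * l2_norm a"] show ?thesis by (simp add: power_one_over field_simps)
    qed
    have "\<exists>N. \<forall>m\<ge>N. \<forall>n\<ge>N. kp_norm (s m - s n) < e" if "e > 0" for e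
    proof -
      have "eventually (\<lambda>n. \<theta> / 14 ^ n * l2_norm a < e) sequentially"
        by (rule order_tendstoD(2)[OF lim that])
      then obtain N where N: "\<And>n. n \<ge> N \<Longrightarrow> \<theta> / 14 ^ n * l2_norm a < e"
        unfolding eventually_sequentially by blast
      have "kp_norm (s m - s n) < e" if "m \<ge> N" "n \<ge> N" for m n
      proof (cases "n \<le> m")
        case True then show ?thesis using tail[of n m] N[of n] that by simp
      next
        case False then show ?thesis using tail[of m n] N[of m] that kp_norm_minus_commute[of "s m" "s n"] by simp
      qed
      then show ?thesis by blast
    qed
    then obtain w where "(\<lambda>n. kp_norm (s n - w)) \<longlonglongrightarrow> 0" by (rule kp_complete)
    then show ?thesis unfolding s_def by blast
  qed
  then obtain \<Psi> where \<Psi>: "\<And>a. square_summable a \<Longrightarrow> (\<lambda>n. kp_norm ((\<Sum>i<n. kp_scale (a i) (g i)) - \<Psi> a)) \<longlonglongrightarrow> 0"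
    by metis
  have n\<Psi>: "kp_norm (\<Psi> a) \<le> 7 * \<theta> * l2_norm a" if a: "square_summable a" for a
  proof -
    have "kp_norm (\<Sum>i<n. kp_scale (a i) (g i)) \<le> \<theta> * l2_norm a" for n
      by (rule kp_norm_small_sum) (use \<theta> a z in \<open>auto intro: l2_norm_nonneg norm_le_l2_norm simp: g_def\<close>)
    from kp_limit_bound[OF \<Psi>[OF a] this] show ?thesis by simp
  qed
  define \<Phi> where "\<Phi> a = kp_apply T (kp_inj a) + \<Psi> a" for a
  have lim: "(\<lambda>n. kp_norm ((\<Sum>i<n. kp_scale (a i) (z i)) - \<Phi> a)) \<longlonglongrightarrow> 0" if a: "square_summable a" for a
  proof -
    have "(\<lambda>n. kp_norm (kp_apply T (kp_inj (seq_restrict a {..<n})) - kp_apply T (kp_inj a))) \<longlonglongrightarrow> 0"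
      by (intro kp_apply_limit l2_tail_inj a)
    from kp_limit_add[OF this \<Psi>[OF a]]
    have "(\<lambda>n. kp_norm (kp_apply T (kp_inj (seq_restrict a {..<n})) + (\<Sum>i<n. kp_scale (a i) (g i)) - \<Phi> a)) \<longlonglongrightarrow> 0"
      unfolding \<Phi>_def .
    moreover have "kp_apply T (kp_inj (seq_restrict a {..<n})) + (\<Sum>i<n. kp_scale (a i) (g i)) = (\<Sum>i<n. kp_scale (a i) (z i))" for n
      unfolding kp_inj_restrict_sum kp_apply_sum kp_apply_scale
      by (simp add: g_def flip: sum.distrib kp.scale_right_distrib)
    ultimately show ?thesis by simp
  qed
  have n\<Phi>: "kp_norm (\<Phi> a - kp_apply T (kp_inj a)) \<le> 7 * \<theta> * l2_norm a" if "square_summable a" for a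
    using n\<Psi>[OF that] by (simp add: \<Phi>_def)
  have low: "l2_norm a \<le> 2 * kp_norm (\<Phi> a)" and up: "kp_norm (\<Phi> a) \<le> 2 * l2_norm a" if a: "square_summable a" for a
  proof -
    obtain x' where x': "square_summable x'" "kp_apply T (kp_inj a) = kp_inj x'" "l2_norm x' = l2_norm a"
      by (rule kp_embedding_inj[OF T a])
    have "7 * \<theta> * l2_norm a \<le> 1 / 2 * l2_norm a"
      using \<theta>(2) by (intro mult_right_mono l2_norm_nonneg a) auto
    then show "l2_norm a \<le> 2 * kp_norm (\<Phi> a)" "kp_norm (\<Phi> a) \<le> 2 * l2_norm a"
      using kp_norm_inj_diff_ge[OF x'(1), of "\<Phi> a"] n\<Phi>[OF a] l2_norm_nonneg[OF a] unfolding x'(2,3) by linarith+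
  qed
  have add: "\<Phi> (\<lambda>k. a k + b k) = \<Phi> a + \<Phi> b" if "square_summable a" "square_summable b" for a b
  proof (rule kp_limit_unique[OF lim[OF square_summable_add[OF that]]])
    show "(\<lambda>n. kp_norm ((\<Sum>i<n. kp_scale (a i + b i) (z i)) - (\<Phi> a + \<Phi> b))) \<longlonglongrightarrow> 0"
      using kp_limit_add[OF lim lim, OF that] by (simp add: kp.scale_left_distrib sum.distrib)
  qed
  have scale: "\<Phi> (\<lambda>k. c * a k) = kp_scale c (\<Phi> a)" if "square_summable a" for a c
  proof (rule kp_limit_unique[OF lim[OF square_summable_scale[OF that]]])
    show "(\<lambda>n. kp_norm ((\<Sum>i<n. kp_scale (c * a i) (z i)) - kp_scale c (\<Phi> a))) \<longlonglongrightarrow> 0"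
      using kp_limit_scale[OF lim[OF that], of c] by (simp add: kp.scale_sum_right)
  qed
  have diff: "\<Phi> (\<lambda>k. a k - b k) = \<Phi> a - \<Phi> b" if "square_summable a" "square_summable b" for a b
    using add[OF square_summable_diff[OF that] that(2)] by simp
  let ?Z = "\<Phi> ` {a. square_summable a}"
  have sub: "kp.subspace ?Z"
  proof (rule kp.subspaceI)
    show "0 \<in> ?Z"
      using low[OF square_summable_zero] up[OF square_summable_zero] kp_norm_eq_0[of "\<Phi> (\<lambda>k. 0)"] kp_norm_nonneg[of "\<Phi> (\<lambda>k. 0)"]
        square_summable_zero by (auto simp: l2_norm_zero intro!: image_eqI[of _ _ "\<lambda>k. 0"])
    show "x + y \<in> ?Z" if xy: "x \<in> ?Z" "y \<in> ?Z" for x y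
    proof -
      obtain a b where "x = \<Phi> a" "square_summable a" "y = \<Phi> b" "square_summable b" using xy by blast
      then show ?thesis by (intro image_eqI[of _ _ "\<lambda>k. a k + b k"]) (auto simp: add square_summable_add)
    qed
    show "kp_scale c x \<in> ?Z" if "x \<in> ?Z" for x c
    proof -
      obtain a where "x = \<Phi> a" "square_summable a" using \<open>x \<in> ?Z\<close> by blast
      then show ?thesis by (intro image_eqI[of _ _ "\<lambda>k. c * a k"]) (auto simp: scale square_summable_scale)
    qed
  qed
  have closed: "kp_closed ?Z"
    unfolding kp_closed_def
  proof (intro allI impI, elim conjE)
    fix f w assume f: "\<forall>n. f n \<in> ?Z" and fl: "(\<lambda>n. kp_norm (f n - w)) \<longlonglongrightarrow> 0"
    have "\<forall>n. \<exists>b. square_summable b \<and> f n = \<Phi> b" using f by blast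
    then obtain a where a: "\<And>n. square_summable (a n)" "\<And>n. f n = \<Phi> (a n)" by metis
    have "\<exists>N. \<forall>m\<ge>N. \<forall>n\<ge>N. kp_norm (kp_inj (a m) - kp_inj (a n)) < e" if e: "e > 0" for e
    proof -
      have "eventually (\<lambda>n. kp_norm (f n - w) < e / 28) sequentially"
        by (rule order_tendstoD(2)[OF fl]) (use e in simp)
      then obtain N where N: "\<And>n. n \<ge> N \<Longrightarrow> kp_norm (f n - w) < e / 28"
        unfolding eventually_sequentially by blast
      have "kp_norm (kp_inj (a m) - kp_inj (a n)) < e" if "m \<ge> N" "n \<ge> N" for m n
      proof -
        have "kp_norm (kp_inj (a m) - kp_inj (a n)) = l2_norm (\<lambda>k. a m k - a n k)"
          by (simp add: kp_norm_inj square_summable_diff a(1) flip: kp_inj_diff)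
        also have "\<dots> \<le> 2 * kp_norm (f m - f n)"
          using low[OF square_summable_diff[OF a(1) a(1)], of m n] by (simp add: diff a)
        also have "kp_norm (f m - f n) \<le> 7 * (kp_norm (f m - w) + kp_norm (f n - w))"
          using kp_norm_diff[of "f m - w" "f n - w"] by simp
        finally show ?thesis using N[OF that(1)] N[OF that(2)] by simp
      qed
      then show ?thesis by blast
    qed
    \<comment> \<open>Completeness of l2 is borrowed from Z_2: a limit of elements of j(l2) has
      second component 0 and lies in j(l2) again.\<close>
    then obtain y where y: "(\<lambda>n. kp_norm (kp_inj (a n) - y)) \<longlonglongrightarrow> 0" by (rule kp_complete)
    have "kp_snd y = (\<lambda>k. 0)"
    proof
      fix k
      have "norm (kp_snd y k) \<le> kp_norm (kp_inj (a n) - y)" for n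
        using norm_kp_snd_le[of "kp_inj (a n) - y" k] by (simp add: kp_sel kp_inj_sel a)
      then have "norm (kp_snd y k) \<le> 0" using y LIMSEQ_le_const by blast
      then show "kp_snd y k = 0" by simp
    qed
    then have sf: "square_summable (kp_fst y)" and "y = kp_inj (kp_fst y)"
      using kp_res_square_summable[of y] by (auto simp: kp_res_def Omega_zero kp_inj_sel intro!: kp_eqI)
    then have y': "(\<lambda>n. kp_norm (kp_inj (a n) - kp_inj (kp_fst y))) \<longlonglongrightarrow> 0" using y by simp
    have "kp_norm (f n - \<Phi> (kp_fst y)) \<le> 2 * kp_norm (kp_inj (a n) - kp_inj (kp_fst y))" for n
      using up[OF square_summable_diff[OF a(1)[of n] sf]]
      by (simp add: diff[OF a(1) sf] a(2) kp_norm_inj square_summable_diff[OF a(1) sf] flip: kp_inj_diff[OF a(1) sf])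
    then have "eventually (\<lambda>n. norm (kp_norm (f n - \<Phi> (kp_fst y))) \<le> 2 * kp_norm (kp_inj (a n) - kp_inj (kp_fst y))) sequentially"
      by (simp add: abs_kp_norm)
    moreover have "(\<lambda>n. 2 * kp_norm (kp_inj (a n) - kp_inj (kp_fst y))) \<longlonglongrightarrow> 0"
      using tendsto_mult_left[OF y', of 2] by simp
    ultimately have "(\<lambda>n. kp_norm (f n - \<Phi> (kp_fst y))) \<longlonglongrightarrow> 0" by (rule Lim_null_comparison)
    then have "w = \<Phi> (kp_fst y)" by (rule kp_limit_unique[OF fl])
    then show "w \<in> ?Z" using sf by blast
  qed
  define e where "e i = (\<lambda>k. if k = i then 1 else 0 :: 'k)" for i :: nat
  have se: "square_summable (e i)" for i unfolding e_def by (rule square_summable_unit)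
  have fin: "\<Phi> (\<lambda>k. if k \<in> J then u k else 0) = (\<Sum>j\<in>J. kp_scale (u j) (\<Phi> (e j)))"
    if "finite J" for J and u :: "nat \<Rightarrow> 'k"
    using that
  proof (induction J rule: finite_induct)
    case empty
    show ?case using scale[OF se, of 0 0] by simp
  next
    case (insert j J)
    have "(\<lambda>k. if k \<in> insert j J then u k else 0) = (\<lambda>k. u j * e j k + (if k \<in> J then u k else 0))"
      using insert.hyps by (auto simp: e_def)
    then show ?case
      using insert by (simp add: add scale se square_summable_scale square_summable_finite[of J])
  qed
  have injE: "inj (\<lambda>i. \<Phi> (e i))"
  proof (rule injI, rule ccontr)
    fix i j assume eq: "\<Phi> (e i) = \<Phi> (e j)" "i \<noteq> j"
    have "l2_norm (\<lambda>k. e i k - e j k) \<le> 2 * kp_norm (\<Phi> (e i) - \<Phi> (e j))"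
      using low[OF square_summable_diff[OF se se]] by (simp add: diff se)
    then have "l2_norm (\<lambda>k. e i k - e j k) = 0"
      using l2_norm_nonneg[OF square_summable_diff[OF se se]] eq(1) by (simp add: kp_norm_zero antisym)
    then have "e i i - e j i = 0" by (rule l2_norm_eq_0D[OF square_summable_diff[OF se se]])
    then show False using eq(2) by (simp add: e_def)
  qed
  have indep: "kp.independent (range (\<lambda>i. \<Phi> (e i)))"
  proof
    assume "kp.dependent (range (\<lambda>i. \<Phi> (e i)))"
    then obtain t u where t: "finite t" "t \<subseteq> range (\<lambda>i. \<Phi> (e i))" "(\<Sum>v\<in>t. kp_scale (u v) v) = 0" "\<exists>v\<in>t. u v \<noteq> 0"
      unfolding kp.dependent_explicit by blast
    then obtain J where J: "t = (\<lambda>i. \<Phi> (e i)) ` J" by (meson subset_imageE)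
    have finJ: "finite J" using t(1) unfolding J by (rule finite_imageD) (rule inj_on_subset[OF injE], simp)
    have "(\<Sum>j\<in>J. kp_scale (u (\<Phi> (e j))) (\<Phi> (e j))) = 0"
      using t(3) unfolding J by (subst (asm) sum.reindex[OF inj_on_subset[OF injE]]) auto
    then have 0: "\<Phi> (\<lambda>k. if k \<in> J then u (\<Phi> (e k)) else 0) = 0" by (simp add: fin[OF finJ])
    have s: "square_summable (\<lambda>k. if k \<in> J then u (\<Phi> (e k)) else 0)"
      by (rule square_summable_finite[OF finJ]) auto
    have "l2_norm (\<lambda>k. if k \<in> J then u (\<Phi> (e k)) else 0) = 0"
      using low[OF s] l2_norm_nonneg[OF s] by (simp add: 0 kp_norm_zero)
    from l2_norm_eq_0D[OF s this] have "u (\<Phi> (e k)) = 0" if "k \<in> J" for k using that by (metis (mono_tags))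
    then show False using t(4) J by blast
  qed
  have "\<not> (\<exists>B. finite B \<and> kp.span B = ?Z)"
  proof
    assume "\<exists>B. finite B \<and> kp.span B = ?Z"
    then obtain B where B: "finite B" "kp.span B = ?Z" by blast
    have "range (\<lambda>i. \<Phi> (e i)) \<subseteq> kp.span B" unfolding B(2) using se by blast
    then have "finite (range (\<lambda>i. \<Phi> (e i)))" using kp.independent_span_bound[OF B(1) indep] by blast
    then show False using injE finite_imageD infinite_UNIV_nat by blast
  qed
  with sub closed have "inf_dim_closed_subspace ?Z" by (simp add: inf_dim_closed_subspace_def)
  then show ?thesis using n\<Phi> low lim by (intro exI[of _ \<Phi>]) blast
qed

section \<open>Block sequences in subspaces\<close>

text \<open>A finite set spanning the kernel would span \<open>V\<close> after adjoining one vector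
  outside the kernel: one functional lowers the dimension by at most one.\<close>

lemma inf_dim_kernel:
  fixes V :: "'k::real_normed_field kp set"
  assumes V: "kp.subspace V" "\<not> (\<exists>B. finite B \<and> kp.span B = V)"
    and add: "\<And>z w. \<phi> (z + w) = \<phi> z + \<phi> w" and scale: "\<And>c z. \<phi> (kp_scale c z) = c * \<phi> z"
  shows "kp.subspace {z \<in> V. \<phi> z = 0}" "\<not> (\<exists>B. finite B \<and> kp.span B = {z \<in> V. \<phi> z = 0})"
proof -
  have z0: "\<phi> 0 = 0" using add[of 0 0] by simp
  show sub: "kp.subspace {z \<in> V. \<phi> z = 0}"
    using V(1) z0 unfolding kp.subspace_def by (auto simp: add scale)
  show "\<not> (\<exists>B. finite B \<and> kp.span B = {z \<in> V. \<phi> z = 0})"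
  proof
    assume "\<exists>B. finite B \<and> kp.span B = {z \<in> V. \<phi> z = 0}"
    then obtain B where B: "finite B" "kp.span B = {z \<in> V. \<phi> z = 0}" by blast
    show False
    proof (cases "\<forall>z\<in>V. \<phi> z = 0")
      case True
      then have "kp.span B = V" using B(2) by blast
      then show False using V(2) B(1) by blast
    next
      case False
      then obtain v where v: "v \<in> V" "\<phi> v \<noteq> 0" by blast
      have "B \<subseteq> kp.span B" by (rule kp.span_superset)
      then have "kp.span (insert v B) \<subseteq> V" using v B(2) by (intro kp.span_minimal V(1)) auto
      moreover have "V \<subseteq> kp.span (insert v B)"
      proof
        fix z assume z: "z \<in> V"
        define c where "c = \<phi> z / \<phi> v"
        have "\<phi> (z - kp_scale c v) + \<phi> (kp_scale c v) = \<phi> z" by (simp flip: add)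
        then have "\<phi> (z - kp_scale c v) = 0" using v by (simp add: scale c_def)
        then have "z - kp_scale c v \<in> kp.span B"
          unfolding B(2) using z v kp.subspace_diff[OF V(1)] kp.subspace_scale[OF V(1)] by blast
        then show "z \<in> kp.span (insert v B)" by (auto simp: kp.span_insert)
      qed
      ultimately have "kp.span (insert v B) = V" by blast
      then show False using V(2) B(1) by blast
    qed
  qed
qed

lemma inf_dim_tail_vector:
  fixes Y :: "'k::real_normed_field kp set"
  assumes Y: "kp.subspace Y" "\<not> (\<exists>B. finite B \<and> kp.span B = Y)"
  shows "\<exists>z\<in>Y. z \<noteq> 0 \<and> (\<forall>k<N. kp_fst z k = 0 \<and> kp_snd z k = 0)"
proof -
  define V where "V N = {z \<in> Y. \<forall>k<N. kp_fst z k = 0 \<and> kp_snd z k = 0}" for N :: nat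
  have V: "kp.subspace (V N) \<and> \<not> (\<exists>B. finite B \<and> kp.span B = V N)" for N
  proof (induction N)
    case 0
    show ?case using Y by (simp add: V_def)
  next
    case (Suc N)
    define W where "W = {z \<in> V N. kp_fst z N = 0}"
    have W: "kp.subspace W" "\<not> (\<exists>B. finite B \<and> kp.span B = W)"
      unfolding W_def using inf_dim_kernel[of "V N" "\<lambda>z. kp_fst z N"] Suc by (auto simp: kp_sel)
    have "V (Suc N) = {z \<in> W. kp_snd z N = 0}"
      by (auto simp: V_def W_def less_Suc_eq)
    then show ?case using inf_dim_kernel[OF W, of "\<lambda>z. kp_snd z N"] by (auto simp: kp_sel)
  qed
  have "V N \<noteq> {0}" using V[of N] kp.span_empty by (metis finite.emptyI)
  moreover have "0 \<in> V N" using V[of N] kp.subspace_0 by blast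
  ultimately obtain z where "z \<in> V N" "z \<noteq> 0" by blast
  then show ?thesis by (auto simp: V_def)
qed

text \<open>Strict singularity of q, with the vector moved beyond any given coordinate. If q were
  bounded below on the tail of \<open>Y\<close>, sums of k normalised vectors escaping to infinity
  would have norm of order sqrt k ln (sqrt k), but second components of norm of order sqrt
  k.\<close>

lemma small_second_component:
  fixes Y :: "'k::real_normed_field kp set"
  assumes Y: "kp.subspace Y" "\<not> (\<exists>B. finite B \<and> kp.span B = Y)" and \<epsilon>: "\<epsilon> > 0"
  shows "\<exists>z\<in>Y. kp_norm z = 1 \<and> l2_norm (kp_snd z) \<le> \<epsilon> \<and> (\<forall>k<N. kp_fst z k = 0 \<and> kp_snd z k = 0)"
proof (rule ccontr)
  assume neg: "\<not> ?thesis"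
  define tl where "tl N = {z \<in> Y. \<forall>k<N. kp_fst z k = 0 \<and> kp_snd z k = 0}" for N :: nat
  have normalize: "kp_scale (of_real (1 / kp_norm z)) z \<in> tl n \<and> kp_norm (kp_scale (of_real (1 / kp_norm z)) z) = 1"
    if "z \<in> tl n" "z \<noteq> 0" for z n
    using that kp.subspace_scale[OF Y(1)] kp_norm_nonneg[of z] kp_norm_eq_0[of z]
    by (auto simp: tl_def kp_sel kp_norm_scale norm_divide)
  have big: "\<epsilon> * kp_norm z \<le> l2_norm (kp_snd z)" if z: "z \<in> tl N" "z \<noteq> 0" for z
  proof -
    have p: "kp_norm z > 0" using z kp_norm_nonneg[of z] kp_norm_eq_0[of z] by linarith
    have "\<epsilon> < l2_norm (kp_snd (kp_scale (of_real (1 / kp_norm z)) z))"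
      using neg normalize[OF z] unfolding tl_def by (auto simp: not_le)
    also have "\<dots> = l2_norm (kp_snd z) / kp_norm z"
      using p unfolding kp_sel by (subst l2_norm_scale) (auto simp: kp_snd_square_summable norm_divide)
    finally show ?thesis using p by (simp add: field_simps)
  qed
  have "\<exists>z. z \<in> tl (max n N) \<and> kp_norm z = 1" for n
    using inf_dim_tail_vector[OF Y, of "max n N"] normalize unfolding tl_def by blast
  then obtain z where z: "\<And>n. z n \<in> tl (max n N)" "\<And>n. kp_norm (z n) = 1" by metis
  have ev0: "(\<lambda>m. kp_fst (z m) k) \<longlonglongrightarrow> 0" "(\<lambda>m. kp_snd (z m) k) \<longlonglongrightarrow> 0" for k
  proof -
    have "eventually (\<lambda>m. kp_fst (z m) k = 0 \<and> kp_snd (z m) k = 0) sequentially"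
      using eventually_gt_at_top[of k] by eventually_elim (use z(1) in \<open>auto simp: tl_def\<close>)
    then show "(\<lambda>m. kp_fst (z m) k) \<longlonglongrightarrow> 0" "(\<lambda>m. kp_snd (z m) k) \<longlonglongrightarrow> 0"
      by (auto intro!: tendsto_eventually elim: eventually_mono)
  qed
  have tlN: "z n \<in> tl N" for n using z(1)[of n] by (auto simp: tl_def)
  have "\<epsilon> \<le> l2_norm (kp_snd (z n))" for n
  proof -
    have "z n \<noteq> 0" using z(2)[of n] by (auto simp: kp_norm_zero)
    then show ?thesis using big[OF tlN, of n] z(2)[of n] by simp
  qed
  from null_sequence_sums[of z 1 \<epsilon>, OF ev0 _ \<epsilon> this] z(2)
  obtain r :: "nat \<Rightarrow> nat" and c where r: "strict_mono r"
    and lo: "\<And>k. (1::nat) \<le> k \<Longrightarrow> sqrt k * (\<epsilon> / 14 * ln (sqrt k) - c) \<le> kp_norm (\<Sum>i<k. z (r i))"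
    and hi: "\<And>k. (1::nat) \<le> k \<Longrightarrow> l2_norm (kp_snd (\<Sum>i<k. z (r i))) \<le> sqrt k * c"
    by auto
  have "\<epsilon> * \<epsilon> / 14 > 0" using \<epsilon> by simp
  moreover have "\<epsilon> * \<epsilon> / 14 * ln (sqrt k) \<le> c + \<epsilon> * c" if k: "(1::nat) \<le> k" for k
  proof -
    let ?s = "\<Sum>i<k. z (r i)"
    have "?s \<in> tl N"
      using tlN kp.subspace_sum[OF Y(1), of "{..<k}" "\<lambda>i. z (r i)"] by (auto simp: tl_def kp_sel)
    then have "\<epsilon> * kp_norm ?s \<le> l2_norm (kp_snd ?s)"
      by (cases "?s = 0") (auto simp: big kp_norm_zero l2_norm_nonneg kp_snd_square_summable)
    also have "\<dots> \<le> sqrt k * c" by (rule hi[OF k])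
    finally have "\<epsilon> * (sqrt k * (\<epsilon> / 14 * ln (sqrt k) - c)) \<le> sqrt k * c"
      using mult_left_mono[OF lo[OF k], of \<epsilon>] \<epsilon> by linarith
    then have "sqrt k * (\<epsilon> * (\<epsilon> / 14 * ln (sqrt k) - c)) \<le> sqrt k * c" by (simp only: mult.left_commute)
    then have "\<epsilon> * (\<epsilon> / 14 * ln (sqrt k) - c) \<le> c" by (rule mult_left_le_imp_le) (use k in simp)
    then show ?thesis by (simp add: algebra_simps)
  qed
  ultimately show False by (rule ln_sqrt_unbounded)
qed

text \<open>With w the truncation and y its second component, subtracting (res w, 0) leaves (Omega
  y, y), whose norm is only that of y. The constant is 14 = 7 (1 + 1).\<close>

lemma kp_near_inj:
  assumes "kp_norm (z - kp_restrict z P) \<le> \<eta>" "l2_norm (kp_snd z) \<le> \<eta>"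
  shows "kp_norm (z - kp_inj (kp_res (kp_restrict z P))) \<le> 14 * \<eta>"
proof -
  define w where "w = kp_restrict z P"
  have sw: "square_summable (kp_res w)" by (rule kp_res_square_summable)
  have "kp_res (w - kp_inj (kp_res w)) = (\<lambda>n. 0)"
    by (simp add: kp_res_def[of "w - kp_inj (kp_res w)"] kp_sel kp_inj_sel sw) (simp add: kp_res_def)
  then have "kp_norm (w - kp_inj (kp_res w)) = l2_norm (kp_snd w)"
    by (simp add: kp_norm_eq l2_norm_zero kp_sel kp_inj_sel sw)
  also have "\<dots> \<le> l2_norm (kp_snd z)"
    unfolding w_def kp_restrict_sel by (intro seq_restrict_norm_le kp_snd_square_summable)
  finally show ?thesis
    using kp_norm_add[of "z - w" "w - kp_inj (kp_res w)"] assms unfolding w_def[symmetric] by simp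
qed

text \<open>Vectors of \<open>Y\<close> with tiny second components are, after a gliding hump, close
  to disjoint blocks in j(l2); normalised blocks are images of unit vectors under a block embedding.
  Thus every infinite dimensional subspace almost contains such a copy of l2.\<close>

lemma subspace_block_sequence:
  fixes Y :: "'k::real_normed_field kp set"
  assumes Y: "kp.subspace Y" "\<not> (\<exists>B. finite B \<and> kp.span B = Y)" and \<theta>: "\<theta> > 0"
  shows "\<exists>T z. kp_embedding T \<and> (\<forall>i. z i \<in> Y \<and> kp_norm (z i - kp_apply T (kp_unit i)) \<le> \<theta> / 14 ^ Suc i)"
proof -
  \<comment> \<open>28 = 14 * 2: the 14 comes from \<open>kp_near_inj\<close>, the 2 from rescaling
    by \<open>c i\<close>. The minimum with 1 keeps the blocks at length at least 1 / 2, so that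
    \<open>c i \<le> 2\<close>.\<close>
  define \<eta> where "\<eta> i = min 1 \<theta> / 28 / 14 ^ Suc i" for i :: nat
  have \<eta>: "\<eta> i > 0" "28 * \<eta> i \<le> \<theta> / 14 ^ Suc i" "28 * \<eta> i \<le> 1" for i
  proof -
    show "\<eta> i > 0" using \<theta> by (simp add: \<eta>_def)
    show "28 * \<eta> i \<le> \<theta> / 14 ^ Suc i" unfolding \<eta>_def by (simp add: divide_right_mono)
    have "28 * \<eta> i \<le> 1 / 14 ^ Suc i" unfolding \<eta>_def by (simp add: divide_right_mono)
    also have "\<dots> \<le> 1" using one_le_power[of "14::real" "Suc i"] by simp
    finally show "28 * \<eta> i \<le> 1" .
  qed
  have anti: "\<eta> j \<le> \<eta> i" if "i \<le> j" for i j
    unfolding \<eta>_def using that \<theta> by (intro divide_left_mono power_increasing) auto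
  have "\<exists>z\<in>Y. kp_norm z = 1 \<and> l2_norm (kp_snd z) \<le> \<eta> n \<and> (\<forall>k<n. kp_fst z k = 0 \<and> kp_snd z k = 0)" for n
    by (rule small_second_component[OF Y \<eta>(1)])
  then obtain z0 where z0: "\<And>n. z0 n \<in> Y" "\<And>n. kp_norm (z0 n) = 1" "\<And>n. l2_norm (kp_snd (z0 n)) \<le> \<eta> n"
    "\<And>n k. k < n \<Longrightarrow> kp_fst (z0 n) k = 0 \<and> kp_snd (z0 n) k = 0" by metis
  have ev0: "(\<lambda>m. kp_fst (z0 m) k) \<longlonglongrightarrow> 0" "(\<lambda>m. kp_snd (z0 m) k) \<longlonglongrightarrow> 0" for k
  proof -
    have "eventually (\<lambda>m. kp_fst (z0 m) k = 0 \<and> kp_snd (z0 m) k = 0) sequentially"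
      using eventually_gt_at_top[of k] by eventually_elim (use z0(4) in auto)
    then show "(\<lambda>m. kp_fst (z0 m) k) \<longlonglongrightarrow> 0" "(\<lambda>m. kp_snd (z0 m) k) \<longlonglongrightarrow> 0"
      by (auto intro!: tendsto_eventually elim: eventually_mono)
  qed
  from gliding_hump[of z0 \<eta>, OF ev0 \<eta>(1)]
  obtain r \<beta> where r: "strict_mono r"
    and rb: "\<And>i. kp_norm (z0 (r i) - kp_restrict (z0 (r i)) {n. \<beta> n = i}) \<le> \<eta> i" by blast
  define w where "w i = kp_restrict (z0 (r i)) {n. \<beta> n = i}" for i
  define v where "v i = kp_res (w i)" for i
  have sv: "square_summable (v i)" for i unfolding v_def by (rule kp_res_square_summable)
  have supp: "\<beta> k = i" if "v i k \<noteq> 0" for i k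
    using that by (auto simp: v_def w_def kp_res_def kp_restrict_sel seq_restrict_def Omega_def split: if_splits)
  have near: "kp_norm (z0 (r i) - kp_inj (v i)) \<le> 14 * \<eta> i" for i
    unfolding v_def w_def
    using rb[of i] order_trans[OF z0(3) anti[OF seq_suble[OF r]], of i] by (rule kp_near_inj)
  define c where "c i = 1 / l2_norm (v i)" for i
  have vge: "1 / 2 \<le> l2_norm (v i)" for i
    using kp_norm_inj_diff_ge(2)[OF sv, of "z0 (r i)" i] near[of i] \<eta>(3)[of i] z0(2)[of "r i"] by linarith
  have c: "0 < c i" "c i \<le> 2" "c i * l2_norm (v i) = 1" for i
  proof -
    have "l2_norm (v i) > 0" using vge[of i] by linarith
    then show "0 < c i" "c i \<le> 2" "c i * l2_norm (v i) = 1"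
      using vge[of i] by (simp_all add: c_def divide_le_eq)
  qed
  define V where "V k = of_real (c (\<beta> k)) * v (\<beta> k) k" for k
  have rV: "seq_restrict V {n. \<beta> n = i} = (\<lambda>k. of_real (c i) * v i k)" for i
    using supp by (auto simp: seq_restrict_def V_def fun_eq_iff)
  obtain T where T: "kp_embedding T"
    and T1: "\<And>z. kp_fst (kp_apply T z) = (\<lambda>k. V k * kp_fst z (\<beta> k) - of_real (ln (norm (V k))) * V k * kp_snd z (\<beta> k))"
    and T2: "\<And>z. kp_snd (kp_apply T z) = (\<lambda>k. V k * kp_snd z (\<beta> k))"
  proof (rule block_embedding[of V \<beta>])
    show "square_summable (seq_restrict V {n. \<beta> n = i})" for i
      unfolding rV by (intro square_summable_scale sv)
    show "l2_norm (seq_restrict V {n. \<beta> n = i}) = 1" for i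
      unfolding rV using c[of i] by (subst l2_norm_scale[OF sv]) simp
  qed blast
  have Tu: "kp_apply T (kp_unit i) = kp_scale (of_real (c i)) (kp_inj (v i))" for i
  proof (rule kp_eqI)
    have "V k * (if \<beta> k = i then 1 else 0) = of_real (c i) * v i k" for k
      using fun_cong[OF rV[of i], of k] by (auto simp: seq_restrict_def split: if_splits)
    then show "kp_fst (kp_apply T (kp_unit i)) = kp_fst (kp_scale (of_real (c i)) (kp_inj (v i)))"
      by (simp add: T1 kp_unit_sel kp_sel kp_inj_sel sv)
    show "kp_snd (kp_apply T (kp_unit i)) = kp_snd (kp_scale (of_real (c i)) (kp_inj (v i)))"
      by (simp add: T2 kp_unit_sel kp_sel kp_inj_sel sv)
  qed
  define z where "z i = kp_scale (of_real (c i)) (z0 (r i))" for i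
  have "z i \<in> Y" for i unfolding z_def by (intro kp.subspace_scale Y z0)
  moreover have "kp_norm (z i - kp_apply T (kp_unit i)) \<le> \<theta> / 14 ^ Suc i" for i
  proof -
    have "kp_norm (z i - kp_apply T (kp_unit i)) = c i * kp_norm (z0 (r i) - kp_inj (v i))"
      unfolding Tu z_def kp.scale_right_diff_distrib[symmetric] kp_norm_scale using c(1)[of i] by simp
    also have "\<dots> \<le> 2 * (14 * \<eta> i)"
      using c[of i] near[of i] kp_norm_nonneg \<eta>(1)[of i] by (intro mult_mono) auto
    finally show ?thesis using \<eta>(2)[of i] by simp
  qed
  ultimately show ?thesis using T by blast
qed

lemma strict_subsequence:
  assumes "\<And>i. eventually (P i) sequentially"
  shows "\<exists>r :: nat \<Rightarrow> nat. strict_mono r \<and> (\<forall>i. P i (r i))"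
proof -
  obtain N where N: "\<And>i n. n \<ge> N i \<Longrightarrow> P i n"
    using assms unfolding eventually_sequentially by metis
  define r where "r = rec_nat (N 0) (\<lambda>i x. max (Suc x) (N (Suc i)))"
  have r: "r 0 = N 0" "r (Suc i) = max (Suc (r i)) (N (Suc i))" for i by (simp_all add: r_def)
  have "strict_mono r" unfolding strict_mono_Suc_iff by (simp add: r less_max_iff_disj)
  moreover have "P i (r i)" for i by (rule N, cases i) (simp_all add: r)
  ultimately show ?thesis by blast
qed

text \<open>Testing on embedded unit vectors suffices: \<open>Y\<close> almost contains a copy of
  l2, and a subsequence of its basis on which \<open>R\<close> decays geometrically spans a subspace
  where \<open>R\<close> is small.\<close>

lemma small_on_subspace:
  fixes R :: "'k::rc_field kp_op"
  assumes null: "\<And>T. kp_embedding T \<Longrightarrow> (\<lambda>n. kp_norm (kp_apply R (kp_apply T (kp_unit n)))) \<longlonglongrightarrow> 0"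
    and Y: "inf_dim_closed_subspace Y" and \<epsilon>: "\<epsilon> > 0"
  shows "\<exists>Z. inf_dim_closed_subspace Z \<and> Z \<subseteq> Y \<and> (\<forall>z\<in>Z. kp_norm (kp_apply R z) \<le> \<epsilon> * kp_norm z)"
proof -
  obtain M where M: "M > 0" "\<And>z. kp_norm (kp_apply R z) \<le> M * kp_norm z" using kp_apply_bound[of R] by metis
  \<comment> \<open>98 = 7 * 7 * 2: one 7 for splitting the image of \<open>z (r i)\<close>, one for
    the limit, and 2 for the lower estimate of \<open>\<Phi>\<close>. The bound 1 / 14 serves
    \<open>block_space\<close>.\<close>
  define \<theta> where "\<theta> = min (1 / 14) (\<epsilon> / (98 * (M + 1)))"
  have \<theta>: "0 < \<theta>" "\<theta> \<le> 1 / 14" using \<epsilon> M(1) by (simp_all only: \<theta>_def min.cobounded1) simp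
  have "\<theta> \<le> \<epsilon> / (98 * (M + 1))" by (simp add: \<theta>_def)
  then have \<theta>\<epsilon>: "98 * (M + 1) * \<theta> \<le> \<epsilon>" using M(1) by (simp add: field_simps)
  obtain T z where T: "kp_embedding T" and zY: "\<And>i. z i \<in> Y"
    and z: "\<And>i. kp_norm (z i - kp_apply T (kp_unit i)) \<le> \<theta> / 14 ^ Suc i"
    using subspace_block_sequence[of Y \<theta>] Y \<theta>(1) unfolding inf_dim_closed_subspace_def by blast
  have "eventually (\<lambda>n. kp_norm (kp_apply R (kp_apply T (kp_unit n))) < \<theta> / 14 ^ Suc i) sequentially" for i
    by (rule order_tendstoD(2)[OF null[OF T]]) (use \<theta> in simp)
  from strict_subsequence[of "\<lambda>i n. kp_norm (kp_apply R (kp_apply T (kp_unit n))) < \<theta> / 14 ^ Suc i", OF this]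
  obtain r where r: "strict_mono r" "\<And>i. kp_norm (kp_apply R (kp_apply T (kp_unit (r i)))) < \<theta> / 14 ^ Suc i" by blast
  obtain J :: "'k kp_op" where J: "kp_embedding J" "\<And>n. kp_apply J (kp_unit n) = kp_unit (r n)"
    using subsequence_embedding[OF r(1)] by metis
  have TJ: "kp_embedding (T * J)" by (rule kp_embedding_times[OF T J(1)])
  have z': "kp_norm (z (r i) - kp_apply (T * J) (kp_unit i)) \<le> \<theta> / 14 ^ Suc i" for i
  proof -
    have "\<theta> / 14 ^ Suc (r i) \<le> \<theta> / 14 ^ Suc i"
      using \<theta> seq_suble[OF r(1), of i] by (intro divide_left_mono power_increasing) auto
    then show ?thesis using z[of "r i"] by (simp add: times_kp_op.rep_eq J(2))
  qed
  from block_space[OF TJ less_imp_le[OF \<theta>(1)] \<theta>(2) z']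
  obtain \<Phi> where low: "\<And>a. square_summable a \<Longrightarrow> l2_norm a \<le> 2 * kp_norm (\<Phi> a)"
    and lim: "\<And>a. square_summable a \<Longrightarrow> (\<lambda>n. kp_norm ((\<Sum>i<n. kp_scale (a i) (z (r i))) - \<Phi> a)) \<longlonglongrightarrow> 0"
    and idcs: "inf_dim_closed_subspace (\<Phi> ` {a. square_summable a})" by blast
  have "\<Phi> a \<in> Y" if a: "square_summable a" for a
  proof -
    have sums: "(\<Sum>i<n. kp_scale (a i) (z (r i))) \<in> Y" for n
      using Y zY by (auto simp: inf_dim_closed_subspace_def intro!: kp.subspace_sum kp.subspace_scale)
    have "kp_closed Y" using Y by (simp add: inf_dim_closed_subspace_def)
    from kp_closedD[OF this sums lim[OF a]] show ?thesis .
  qed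
  moreover have "kp_norm (kp_apply R (\<Phi> a)) \<le> \<epsilon> * kp_norm (\<Phi> a)" if a: "square_summable a" for a
  proof -
    have R: "kp_norm (kp_apply R (z (r i))) \<le> 7 * (M + 1) * \<theta> / 14 ^ Suc i" for i
    proof -
      have "kp_norm (kp_apply R (z (r i)))
         \<le> 7 * (kp_norm (kp_apply R (z (r i) - kp_apply (T * J) (kp_unit i))) + kp_norm (kp_apply R (kp_apply (T * J) (kp_unit i))))"
        using kp_norm_add[of "kp_apply R (z (r i) - kp_apply (T * J) (kp_unit i))" "kp_apply R (kp_apply (T * J) (kp_unit i))"]
        by (simp flip: kp_apply_add)
      also have "\<dots> \<le> 7 * (M * (\<theta> / 14 ^ Suc i) + \<theta> / 14 ^ Suc i)"
      proof (intro mult_left_mono add_mono)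
        show "kp_norm (kp_apply R (z (r i) - kp_apply (T * J) (kp_unit i))) \<le> M * (\<theta> / 14 ^ Suc i)"
          using M(1) by (intro order_trans[OF M(2)] mult_left_mono z') simp
        show "kp_norm (kp_apply R (kp_apply (T * J) (kp_unit i))) \<le> \<theta> / 14 ^ Suc i"
          using r(2)[of i] by (simp add: times_kp_op.rep_eq J(2))
      qed simp
      also have "\<dots> = 7 * (M + 1) * \<theta> / 14 ^ Suc i" by (simp add: add_divide_distrib algebra_simps)
      finally show ?thesis .
    qed
    have "kp_norm (\<Sum>i<n. kp_scale (a i) (kp_apply R (z (r i)))) \<le> 7 * (M + 1) * \<theta> * l2_norm a" for n
      by (rule kp_norm_small_sum[OF _ _ _ R]) (use M(1) \<theta>(1) a in \<open>auto intro: l2_norm_nonneg norm_le_l2_norm\<close>)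
    then have "kp_norm (kp_apply R (\<Sum>i<n. kp_scale (a i) (z (r i)))) \<le> 7 * (M + 1) * \<theta> * l2_norm a" for n
      by (simp add: kp_apply_sum kp_apply_scale)
    from kp_limit_bound[OF kp_apply_limit[OF lim[OF a]] this]
    have "kp_norm (kp_apply R (\<Phi> a)) \<le> 7 * (7 * (M + 1) * \<theta> * l2_norm a)" .
    also have "\<dots> \<le> 7 * (7 * (M + 1) * \<theta> * (2 * kp_norm (\<Phi> a)))"
      using low[OF a] M(1) \<theta>(1) by (intro mult_left_mono) auto
    also have "\<dots> = 98 * (M + 1) * \<theta> * kp_norm (\<Phi> a)" by simp
    also have "\<dots> \<le> \<epsilon> * kp_norm (\<Phi> a)" by (intro mult_right_mono \<theta>\<epsilon> kp_norm_nonneg)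
    finally show ?thesis .
  qed
  ultimately show ?thesis using idcs by (intro exI[of _ "\<Phi> ` {a. square_summable a}"]) auto
qed

section \<open>Strictly singular operators and the seminorm\<close>

text \<open>The unperturbed case \<theta> = 0 of \<open>block_space\<close>.\<close>

lemma embedding_range:
  fixes T :: "'k::rc_field kp_op"
  assumes T: "kp_embedding T"
  shows "inf_dim_closed_subspace ((\<lambda>a. kp_apply T (kp_inj a)) ` {a. square_summable a})"
proof -
  have "kp_norm (kp_apply T (kp_unit i) - kp_apply T (kp_unit i)) \<le> 0 / 14 ^ Suc i" for i
    by (simp add: kp_norm_zero)
  from block_space[OF T _ _ this] obtain \<Phi> where
    \<Phi>: "\<And>a. square_summable a \<Longrightarrow> kp_norm (\<Phi> a - kp_apply T (kp_inj a)) \<le> 0"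
    and Z: "inf_dim_closed_subspace (\<Phi> ` {a. square_summable a})" by auto
  have "\<Phi> a = kp_apply T (kp_inj a)" if "square_summable a" for a
  proof -
    have "kp_norm (\<Phi> a - kp_apply T (kp_inj a)) = 0"
      using \<Phi>[OF that] kp_norm_nonneg[of "\<Phi> a - kp_apply T (kp_inj a)"] by simp
    then show ?thesis by (simp add: kp_norm_eq_0)
  qed
  then have "\<Phi> ` {a. square_summable a} = (\<lambda>a. kp_apply T (kp_inj a)) ` {a. square_summable a}"
    by (intro image_cong) auto
  with Z show ?thesis by simp
qed

text \<open>By \<open>kp_snd_units_null\<close> the images of the (e_n, 0) have second components
  tending to 0. Along a subsequence they are therefore close to disjoint blocks \<open>g i\<close>
  of j(l2), with lengths almost between \<open>c\<close> and \<open>d\<close>, and on the span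
  \<open>R\<close> is close to the diagonal map into these blocks.\<close>

lemma almost_isometric_subsequence:
  fixes R :: "'k::rc_field kp_op"
  assumes S: "infinite S" and cd: "\<And>n. n \<in> S \<Longrightarrow> c \<le> kp_norm (kp_apply R (kp_unit n))"
      "\<And>n. n \<in> S \<Longrightarrow> kp_norm (kp_apply R (kp_unit n)) \<le> d" and \<eta>: "\<eta> > 0"
  shows "\<exists>r J. strict_mono r \<and> (\<forall>i. r i \<in> S) \<and> kp_embedding J \<and>
    (\<forall>n. kp_apply J (kp_unit n) = kp_unit (r n)) \<and> (\<forall>n. kp_apply J (kp_unit2 n) = kp_unit2 (r n)) \<and>
    (\<forall>a. square_summable a \<longrightarrow> (c - \<eta>) * l2_norm a \<le> kp_norm (kp_apply R (kp_apply J (kp_inj a))) \<and>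
      kp_norm (kp_apply R (kp_apply J (kp_inj a))) \<le> (d + \<eta>) * l2_norm a)"
proof -
  \<comment> \<open>In the end \<open>\<kappa>\<close> is charged once for the lengths of the blocks
    and seven times for the perturbation.\<close>
  define \<kappa> where "\<kappa> = \<eta> / 100"
  have \<kappa>: "\<kappa> > 0" using \<eta> by (simp add: \<kappa>_def)
  define \<mu> where "\<mu> i = \<kappa> / 14 / 14 ^ Suc i" for i :: nat
  have \<mu>: "\<mu> i > 0" "14 * \<mu> i \<le> \<kappa>" for i
  proof -
    show "\<mu> i > 0" using \<kappa> by (simp add: \<mu>_def)
    have "14 * \<mu> i = \<kappa> / 14 ^ Suc i" by (simp add: \<mu>_def)
    also have "\<dots> \<le> \<kappa>" using \<kappa> one_le_power[of "14::real" "Suc i"] by (simp add: divide_le_eq mult_le_cancel_left1 del: power_Suc)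
    finally show "14 * \<mu> i \<le> \<kappa>" .
  qed
  have anti: "\<mu> j \<le> \<mu> i" if "i \<le> j" for i j
    unfolding \<mu>_def using that \<kappa> by (intro divide_left_mono power_increasing) auto
  obtain r0 :: "nat \<Rightarrow> nat" where r0: "strict_mono r0" "\<And>i. r0 i \<in> S" using infinite_subsequence[OF S] by metis
  have "(\<lambda>n. l2_norm (kp_snd (kp_apply R (kp_unit (r0 n))))) \<longlonglongrightarrow> 0"
    using LIMSEQ_subseq_LIMSEQ[OF kp_snd_units_null r0(1)] by (simp add: o_def)
  then have "eventually (\<lambda>n. l2_norm (kp_snd (kp_apply R (kp_unit (r0 n)))) < \<mu> i) sequentially" for i
    by (rule order_tendstoD(2)) (rule \<mu>)
  from strict_subsequence[of "\<lambda>i n. l2_norm (kp_snd (kp_apply R (kp_unit (r0 n)))) < \<mu> i", OF this]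
  obtain r1 where r1: "strict_mono r1" "\<And>i. l2_norm (kp_snd (kp_apply R (kp_unit (r0 (r1 i))))) < \<mu> i" by blast
  define z where "z n = kp_apply R (kp_unit (r0 (r1 n)))" for n
  have r01: "strict_mono (\<lambda>n. r0 (r1 n))" using strict_mono_o[OF r0(1) r1(1)] by (simp add: o_def)
  have null: "(\<lambda>m. kp_fst (z m) k) \<longlonglongrightarrow> 0" "(\<lambda>m. kp_snd (z m) k) \<longlonglongrightarrow> 0" for k
    using LIMSEQ_subseq_LIMSEQ[OF kp_apply_units_null(1) r01] LIMSEQ_subseq_LIMSEQ[OF kp_apply_units_null(3) r01]
    by (simp_all add: o_def z_def)
  from gliding_hump[of z \<mu>, OF null \<mu>(1)]
  obtain r2 \<beta> where r2: "strict_mono r2"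
    and rb: "\<And>i. kp_norm (z (r2 i) - kp_restrict (z (r2 i)) {n. \<beta> n = i}) \<le> \<mu> i" by blast
  define r where "r i = r0 (r1 (r2 i))" for i
  have r: "strict_mono r" using strict_mono_o[OF r01 r2] unfolding r_def o_def .
  have rS: "r i \<in> S" for i using r0(2) by (simp add: r_def)
  have zr: "z (r2 i) = kp_apply R (kp_unit (r i))" for i by (simp add: z_def r_def)
  define g where "g i = kp_res (kp_restrict (z (r2 i)) {n. \<beta> n = i})" for i
  have sg: "square_summable (g i)" for i unfolding g_def by (rule kp_res_square_summable)
  have near: "kp_norm (z (r2 i) - kp_inj (g i)) \<le> 14 * \<mu> i" for i
    unfolding g_def
  proof (rule kp_near_inj[OF rb])
    have "l2_norm (kp_snd (z (r2 i))) \<le> \<mu> (r2 i)" using r1(2)[of "r2 i"] by (simp add: z_def)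
    also have "\<dots> \<le> \<mu> i" by (rule anti[OF seq_suble[OF r2]])
    finally show "l2_norm (kp_snd (z (r2 i))) \<le> \<mu> i" .
  qed
  have glo: "c - \<kappa> \<le> l2_norm (g i)" and gup: "l2_norm (g i) \<le> d + \<kappa>" for i
    using kp_norm_inj_diff_ge[OF sg[of i], of "z (r2 i)"] near[of i] \<mu>(2)[of i] cd[OF rS, of i] unfolding zr by linarith+
  define v where "v k = g (\<beta> k) k" for k
  have supp: "\<beta> k = i" if "g i k \<noteq> 0" for i k
    using that by (auto simp: g_def kp_res_def kp_restrict_sel seq_restrict_def Omega_def split: if_splits)
  have rv: "seq_restrict v {n. \<beta> n = i} = g i" for i
    using supp by (auto simp: seq_restrict_def v_def fun_eq_iff)
  have g0: "0 \<le> l2_norm (g i)" for i by (rule l2_norm_nonneg[OF sg])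
  have dk: "0 \<le> d + \<kappa>" using gup[of 0] g0[of 0] by linarith
  have dom: "norm (of_real (l2_norm (g i)) * a i) \<le> norm (of_real (d + \<kappa>) * a i)" for a :: "nat \<Rightarrow> 'k" and i
    using gup[of i] g0[of i] dk by (simp add: norm_mult mult_right_mono del: of_real_add)
  have sga: "square_summable (\<lambda>i. of_real (l2_norm (g i)) * a i)"
   and nga: "l2_norm (\<lambda>i. of_real (l2_norm (g i)) * a i) \<le> (d + \<kappa>) * l2_norm a"
    if a: "square_summable a" for a :: "nat \<Rightarrow> 'k"
  proof -
    show "square_summable (\<lambda>i. of_real (l2_norm (g i)) * a i)"
      by (rule square_summable_dominated[of "\<lambda>i. of_real (d + \<kappa>) * a i"]) (rule square_summable_scale[OF a], rule dom)
    have "l2_norm (\<lambda>i. of_real (l2_norm (g i)) * a i) \<le> l2_norm (\<lambda>i. of_real (d + \<kappa>) * a i)"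
      by (rule l2_norm_mono[of "\<lambda>i. of_real (d + \<kappa>) * a i"]) (rule square_summable_scale[OF a], rule dom)
    then show "l2_norm (\<lambda>i. of_real (l2_norm (g i)) * a i) \<le> (d + \<kappa>) * l2_norm a"
      using dk by (simp add: l2_norm_scale[OF a] del: of_real_add)
  qed
  have "square_summable (seq_restrict v {n. \<beta> n = i})" "l2_norm (seq_restrict v {n. \<beta> n = i}) = l2_norm (g i)" for i
    by (simp_all add: rv sg)
  note fib = l2_fibres[OF this]
  have sav: "square_summable (\<lambda>k. a (\<beta> k) * v k)"
    and nav: "l2_norm (\<lambda>k. a (\<beta> k) * v k) = l2_norm (\<lambda>i. of_real (l2_norm (g i)) * a i)"
    if "square_summable a" for a using fib[OF sga[OF that]] by blast+
  obtain J :: "'k kp_op" where J: "kp_embedding J" "\<And>n. kp_apply J (kp_unit n) = kp_unit (r n)"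
    "\<And>n. kp_apply J (kp_unit2 n) = kp_unit2 (r n)" using subsequence_embedding[OF r] by metis
  have close: "kp_norm (kp_apply R (kp_apply J (kp_inj a)) - kp_inj (\<lambda>k. a (\<beta> k) * v k)) \<le> 7 * (\<kappa> * l2_norm a)"
    if a: "square_summable a" for a
  proof (rule kp_limit_bound)
    let ?t = "\<lambda>n. \<Sum>i<n. kp_scale (a i) (z (r2 i) - kp_inj (g i))"
    show "kp_norm (?t n) \<le> \<kappa> * l2_norm a" for n
    proof (rule kp_norm_small_sum)
      show "kp_norm (z (r2 i) - kp_inj (g i)) \<le> \<kappa> / 14 ^ Suc i" for i
        using near[of i] by (simp add: \<mu>_def)
    qed (use \<kappa> a in \<open>auto intro: l2_norm_nonneg norm_le_l2_norm\<close>)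
    have 1: "(\<lambda>n. kp_norm (kp_apply R (kp_apply J (kp_inj (seq_restrict a {..<n}))) - kp_apply R (kp_apply J (kp_inj a)))) \<longlonglongrightarrow> 0"
      by (intro kp_apply_limit l2_tail_inj a)
    have 2: "(\<lambda>n. kp_norm (kp_inj (\<lambda>k. - seq_restrict a {..<n} (\<beta> k) * v k) - kp_inj (\<lambda>k. - a (\<beta> k) * v k))) \<longlonglongrightarrow> 0"
    proof (rule Lim_null_comparison)
      have "kp_norm (kp_inj (\<lambda>k. - seq_restrict a {..<n} (\<beta> k) * v k) - kp_inj (\<lambda>k. - a (\<beta> k) * v k))
         \<le> (d + \<kappa>) * l2_norm (seq_restrict a {n..})" for n
      proof -
        have s1: "square_summable (\<lambda>k. - seq_restrict a {..<n} (\<beta> k) * v k)" "square_summable (\<lambda>k. - a (\<beta> k) * v k)"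
          using square_summable_uminus[OF sav[OF seq_restrict_square_summable[OF a]]] square_summable_uminus[OF sav[OF a]] by simp_all
        have "kp_inj (\<lambda>k. - seq_restrict a {..<n} (\<beta> k) * v k) - kp_inj (\<lambda>k. - a (\<beta> k) * v k)
            = kp_inj (\<lambda>k. - seq_restrict a {..<n} (\<beta> k) * v k - - a (\<beta> k) * v k)"
          by (rule kp_inj_diff[OF s1, symmetric])
        also have "(\<lambda>k. - seq_restrict a {..<n} (\<beta> k) * v k - - a (\<beta> k) * v k) = (\<lambda>k. seq_restrict a {n..} (\<beta> k) * v k)"
          by (auto simp: seq_restrict_def fun_eq_iff)
        finally show ?thesis
          using nga[OF seq_restrict_square_summable[OF a]]
          by (simp add: kp_norm_inj nav sav seq_restrict_square_summable a)
      qed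
      then show "eventually (\<lambda>n. norm (kp_norm (kp_inj (\<lambda>k. - seq_restrict a {..<n} (\<beta> k) * v k) - kp_inj (\<lambda>k. - a (\<beta> k) * v k)))
         \<le> (d + \<kappa>) * l2_norm (seq_restrict a {n..})) sequentially" by (simp only: real_norm_def abs_kp_norm eventually_True)
      show "(\<lambda>n. (d + \<kappa>) * l2_norm (seq_restrict a {n..})) \<longlonglongrightarrow> 0"
        using tendsto_mult_left[OF l2_tail[OF a], of "d + \<kappa>"] by simp
    qed
    have neg: "kp_inj (\<lambda>k. - b (\<beta> k) * v k) = - kp_inj (\<lambda>k. b (\<beta> k) * v k)" if b: "square_summable b" for b
      by (rule kp_eqI) (simp_all add: kp_sel kp_inj_sel sav[OF b] square_summable_uminus[OF sav[OF b]])
    have gsum: "(\<Sum>i<n. kp_scale (a i) (kp_inj (g i))) = kp_inj (\<lambda>k. seq_restrict a {..<n} (\<beta> k) * v k)" for n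
    proof (rule kp_eqI)
      have "(\<Sum>i<n. a i * g i k) = seq_restrict a {..<n} (\<beta> k) * v k" for k
      proof -
        have "(\<Sum>i<n. a i * g i k) = (\<Sum>i<n. if i = \<beta> k then a (\<beta> k) * v k else 0)"
          using supp by (intro sum.cong) (auto simp: v_def)
        then show ?thesis by (simp add: seq_restrict_def)
      qed
      then show "kp_fst (\<Sum>i<n. kp_scale (a i) (kp_inj (g i))) = kp_fst (kp_inj (\<lambda>k. seq_restrict a {..<n} (\<beta> k) * v k))"
        by (simp add: kp_sel kp_inj_sel sg sav seq_restrict_square_summable a)
      show "kp_snd (\<Sum>i<n. kp_scale (a i) (kp_inj (g i))) = kp_snd (kp_inj (\<lambda>k. seq_restrict a {..<n} (\<beta> k) * v k))"
        by (simp add: kp_sel kp_inj_sel sg sav seq_restrict_square_summable a)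
    qed
    have "?t n = kp_apply R (kp_apply J (kp_inj (seq_restrict a {..<n}))) + kp_inj (\<lambda>k. - seq_restrict a {..<n} (\<beta> k) * v k)" for n
    proof -
      have "?t n = (\<Sum>i<n. kp_scale (a i) (z (r2 i))) - (\<Sum>i<n. kp_scale (a i) (kp_inj (g i)))"
        by (simp add: kp.scale_right_diff_distrib sum_subtractf)
      also have "(\<Sum>i<n. kp_scale (a i) (z (r2 i))) = kp_apply R (kp_apply J (kp_inj (seq_restrict a {..<n})))"
        by (simp add: kp_inj_restrict_sum kp_apply_sum kp_apply_scale J(2) zr)
      finally show ?thesis by (simp only: gsum neg[OF seq_restrict_square_summable[OF a]] diff_conv_add_uminus)
    qed
    then show "(\<lambda>n. kp_norm (?t n - (kp_apply R (kp_apply J (kp_inj a)) - kp_inj (\<lambda>k. a (\<beta> k) * v k)))) \<longlonglongrightarrow> 0"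
      using kp_limit_add[OF 1 2] by (simp only: neg[OF a] diff_conv_add_uminus)
  qed
  have "(c - \<eta>) * l2_norm a \<le> kp_norm (kp_apply R (kp_apply J (kp_inj a)))"
    "kp_norm (kp_apply R (kp_apply J (kp_inj a))) \<le> (d + \<eta>) * l2_norm a" if a: "square_summable a" for a
  proof -
    have a0: "0 \<le> l2_norm a" by (rule l2_norm_nonneg[OF a])
    have \<eta>\<kappa>: "\<eta> = \<kappa> * 100" by (simp add: \<kappa>_def)
    have ka: "0 \<le> \<kappa> * l2_norm a" using \<kappa> a0 by simp
    have lo: "(c - \<kappa>) * l2_norm a \<le> l2_norm (\<lambda>k. a (\<beta> k) * v k)"
    proof (cases "c - \<kappa> \<le> 0")
      case True
      then show ?thesis using l2_norm_nonneg[OF sav[OF a]] a0 mult_nonpos_nonneg[of "c - \<kappa>" "l2_norm a"] by linarith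
    next
      case False
      have "(c - \<kappa>) * l2_norm a = l2_norm (\<lambda>i. of_real (c - \<kappa>) * a i)"
        using False by (subst l2_norm_scale[OF a]) (simp del: of_real_diff)
      also have "\<dots> \<le> l2_norm (\<lambda>i. of_real (l2_norm (g i)) * a i)"
        using glo g0 False by (intro l2_norm_mono[OF sga[OF a]]) (simp add: norm_mult mult_right_mono del: of_real_diff)
      finally show ?thesis by (simp add: nav[OF a])
    qed
    have up: "l2_norm (\<lambda>k. a (\<beta> k) * v k) \<le> (d + \<kappa>) * l2_norm a" using nga[OF a] by (simp add: nav[OF a])
    show "(c - \<eta>) * l2_norm a \<le> kp_norm (kp_apply R (kp_apply J (kp_inj a)))"
      using kp_norm_inj_diff_ge(1)[OF sav[OF a], of "kp_apply R (kp_apply J (kp_inj a))"] close[OF a] lo ka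
      unfolding \<eta>\<kappa> by (simp add: algebra_simps)
    show "kp_norm (kp_apply R (kp_apply J (kp_inj a))) \<le> (d + \<eta>) * l2_norm a"
      using kp_norm_inj_diff_ge(2)[OF sav[OF a], of "kp_apply R (kp_apply J (kp_inj a))"] close[OF a] up ka
      unfolding \<eta>\<kappa> by (simp add: algebra_simps)
  qed
  then show ?thesis using r rS J by blast
qed

lemma iso_onto_range_onI:
  assumes Z: "kp.subspace Z" and c: "c > 0" "\<And>z. z \<in> Z \<Longrightarrow> c * kp_norm z \<le> kp_norm (kp_apply K z)"
  shows "iso_onto_range_on K Z"
proof -
  have inj: "inj_on (kp_apply K) Z"
  proof (rule inj_onI)
    fix z w assume zw: "z \<in> Z" "w \<in> Z" "kp_apply K z = kp_apply K w"
    have "c * kp_norm (z - w) \<le> kp_norm (kp_apply K (z - w))" by (intro c kp.subspace_diff[OF Z] zw)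
    also have "\<dots> = 0" by (simp add: kp_apply_diff zw(3) kp_norm_zero)
    finally have "kp_norm (z - w) = 0" using c(1) kp_norm_nonneg[of "z - w"] by (simp add: mult_le_0_iff)
    then show "z = w" by (simp add: kp_norm_eq_0)
  qed
  have "kp_norm (the_inv_into Z (kp_apply K) w) \<le> 1 / c * kp_norm w" if w: "w \<in> kp_apply K ` Z" for w
  proof -
    obtain z where z: "z \<in> Z" "w = kp_apply K z" using w by blast
    then show ?thesis using c(1) c(2)[OF z(1)] by (simp add: the_inv_into_f_f[OF inj] field_simps)
  qed
  with inj show ?thesis unfolding iso_onto_range_on_def by blast
qed

text \<open>Otherwise \<open>K * T\<close> would stay away from 0 on infinitely many unit vectors,
  hence be bounded below on a copy of l2, and \<open>K\<close> would be an isomorphism on the image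
  of that copy under the isometry \<open>T\<close>.\<close>

lemma strictly_singular_null:
  fixes K :: "'k::rc_field kp_op"
  assumes K: "strictly_singular K" and T: "kp_embedding T"
  shows "(\<lambda>n. kp_norm (kp_apply K (kp_apply T (kp_unit n)))) \<longlonglongrightarrow> 0"
proof (rule ccontr)
  assume "\<not> ?thesis"
  then obtain e where e: "e > 0" "infinite {n. e \<le> norm (kp_norm (kp_apply K (kp_apply T (kp_unit n))))}"
    by (rule not_tendsto_zero_infinite)
  define S where "S = {n. e \<le> norm (kp_norm (kp_apply K (kp_apply T (kp_unit n))))}"
  obtain M where M: "M > 0" "\<And>z. kp_norm (kp_apply (K * T) z) \<le> M * kp_norm z" using kp_apply_bound[of "K * T"] by metis
  have "\<exists>r J. strict_mono r \<and> (\<forall>i. r i \<in> S) \<and> kp_embedding J \<and>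
    (\<forall>n. kp_apply J (kp_unit n) = kp_unit (r n)) \<and> (\<forall>n. kp_apply J (kp_unit2 n) = kp_unit2 (r n)) \<and>
    (\<forall>a. square_summable a \<longrightarrow> (e - e / 2) * l2_norm a \<le> kp_norm (kp_apply (K * T) (kp_apply J (kp_inj a))) \<and>
      kp_norm (kp_apply (K * T) (kp_apply J (kp_inj a))) \<le> (M + e / 2) * l2_norm a)"
  proof (rule almost_isometric_subsequence)
    show "infinite S" using e(2) by (simp add: S_def)
    show "e \<le> kp_norm (kp_apply (K * T) (kp_unit n))" if "n \<in> S" for n
      using that by (simp add: S_def times_kp_op.rep_eq abs_kp_norm)
    show "kp_norm (kp_apply (K * T) (kp_unit n)) \<le> M" for n
      using M(2)[of "kp_unit n"] by (simp add: kp_norm_unit)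
  qed (use e(1) in simp)
  then obtain J where J: "kp_embedding J"
    "\<And>a. square_summable a \<Longrightarrow> (e - e / 2) * l2_norm a \<le> kp_norm (kp_apply (K * T) (kp_apply J (kp_inj a)))" by blast
  have TJ: "kp_embedding (T * J)" by (rule kp_embedding_times[OF T J(1)])
  let ?Z = "(\<lambda>a. kp_apply (T * J) (kp_inj a)) ` {a. square_summable a}"
  have Z: "inf_dim_closed_subspace ?Z" by (rule embedding_range[OF TJ])
  have "iso_onto_range_on K ?Z"
  proof (rule iso_onto_range_onI)
    show "kp.subspace ?Z" using Z by (simp add: inf_dim_closed_subspace_def)
    show "0 < e / 2" using e(1) by simp
    fix z assume "z \<in> ?Z"
    then obtain a where a: "square_summable a" "z = kp_apply (T * J) (kp_inj a)" by blast
    have "kp_norm z = l2_norm a" using TJ a by (simp add: kp_embedding_def kp_norm_inj)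
    then show "e / 2 * kp_norm z \<le> kp_norm (kp_apply K z)"
      using J(2)[OF a(1)] by (simp add: a(2) times_kp_op.rep_eq)
  qed
  with K Z show False unfolding strictly_singular_def by blast
qed

text \<open>The operator taking (x, y) to (y, 0) is bounded, and after \<open>S\<close> it tends to
  0 on embedded unit vectors by \<open>kp_snd_units_null\<close>.\<close>

lemma kp_snd_small_on_subspace:
  fixes S :: "'k::rc_field kp_op"
  assumes Y: "inf_dim_closed_subspace Y" and \<epsilon>: "\<epsilon> > 0"
  shows "\<exists>Z. inf_dim_closed_subspace Z \<and> Z \<subseteq> Y \<and> (\<forall>z\<in>Z. l2_norm (kp_snd (kp_apply S z)) \<le> \<epsilon> * kp_norm z)"
proof -
  have "\<exists>Q. kp_apply Q = (\<lambda>z::'k kp. kp_inj (kp_snd z))"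
    by (rule kp_op_exists[where C = 1])
      (simp_all add: kp_sel kp_inj_add kp_inj_scale kp_snd_square_summable kp_norm_inj l2_snd_le)
  then obtain Q :: "'k kp_op" where Q: "\<And>z. kp_apply Q z = kp_inj (kp_snd z)" by metis
  have "\<exists>Z. inf_dim_closed_subspace Z \<and> Z \<subseteq> Y \<and> (\<forall>z\<in>Z. kp_norm (kp_apply (Q * S) z) \<le> \<epsilon> * kp_norm z)"
  proof (rule small_on_subspace[OF _ Y \<epsilon>])
    fix T :: "'k kp_op"
    show "(\<lambda>n. kp_norm (kp_apply (Q * S) (kp_apply T (kp_unit n)))) \<longlonglongrightarrow> 0"
      using kp_snd_units_null[of "S * T"] by (simp add: times_kp_op.rep_eq Q kp_norm_inj kp_snd_square_summable)
  qed
  then show ?thesis by (simp add: times_kp_op.rep_eq Q kp_norm_inj kp_snd_square_summable)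
qed

section \<open>The seminorm in pointwise form\<close>

definition S_bound :: "'k::real_normed_field kp_op \<Rightarrow> real \<Rightarrow> bool"
  where "S_bound T \<epsilon> \<longleftrightarrow> (\<forall>Y. inf_dim_closed_subspace Y \<longrightarrow>
    (\<exists>Z. inf_dim_closed_subspace Z \<and> Z \<subseteq> Y \<and> (\<forall>z\<in>Z. kp_norm (kp_apply T z) \<le> \<epsilon> * kp_norm z)))"

lemma op_norm_on_le_iff:
  assumes Z: "kp.subspace Z" and \<epsilon>: "\<epsilon> \<ge> 0"
  shows "op_norm_on T Z \<le> \<epsilon> \<longleftrightarrow> (\<forall>z\<in>Z. kp_norm (kp_apply T z) \<le> \<epsilon> * kp_norm z)"
proof -
  obtain M where M: "M > 0" "\<And>z. kp_norm (kp_apply T z) \<le> M * kp_norm z" using kp_apply_bound[of T] by metis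
  have ne: "{z \<in> Z. kp_norm z \<le> 1} \<noteq> {}" using kp.subspace_0[OF Z] kp_norm_zero[where 'k = 'a] by force
  have "kp_norm (kp_apply T z) \<le> M" if "kp_norm z \<le> 1" for z
    using M(2)[of z] mult_left_mono[OF that, of M] M(1) by linarith
  then have bdd: "bdd_above ((\<lambda>z. kp_norm (kp_apply T z)) ` {z \<in> Z. kp_norm z \<le> 1})"
    by (intro bdd_aboveI[of _ M]) auto
  have iff: "op_norm_on T Z \<le> \<epsilon> \<longleftrightarrow> (\<forall>z\<in>{z \<in> Z. kp_norm z \<le> 1}. kp_norm (kp_apply T z) \<le> \<epsilon>)"
    unfolding op_norm_on_def by (rule cSUP_le_iff[OF ne bdd])
  show ?thesis
  proof
    assume *: "op_norm_on T Z \<le> \<epsilon>"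
    show "\<forall>z\<in>Z. kp_norm (kp_apply T z) \<le> \<epsilon> * kp_norm z"
    proof
      fix z assume z: "z \<in> Z"
      show "kp_norm (kp_apply T z) \<le> \<epsilon> * kp_norm z"
      proof (cases "kp_norm z = 0")
        case True
        then show ?thesis using M(2)[of z] by simp
      next
        case False
        then have p: "kp_norm z > 0" using kp_norm_nonneg[of z] by simp
        define w where "w = kp_scale (of_real (1 / kp_norm z)) z"
        have "kp_norm w = 1" using p by (simp add: w_def kp_norm_scale norm_divide)
        moreover have "w \<in> Z" unfolding w_def by (rule kp.subspace_scale[OF Z z])
        ultimately have "kp_norm (kp_apply T w) \<le> \<epsilon>" using * iff by simp
        moreover have "kp_norm (kp_apply T w) = kp_norm (kp_apply T z) / kp_norm z"
          using p by (simp add: w_def kp_apply_scale kp_norm_scale norm_divide)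
        ultimately show ?thesis using p by (simp add: field_simps)
      qed
    qed
  next
    assume *: "\<forall>z\<in>Z. kp_norm (kp_apply T z) \<le> \<epsilon> * kp_norm z"
    show "op_norm_on T Z \<le> \<epsilon>"
      unfolding iff
    proof
      fix z assume z: "z \<in> {z \<in> Z. kp_norm z \<le> 1}"
      then have "kp_norm (kp_apply T z) \<le> \<epsilon> * kp_norm z" using * by blast
      also have "\<dots> \<le> \<epsilon>" using mult_left_mono[of "kp_norm z" 1 \<epsilon>] z \<epsilon> by simp
      finally show "kp_norm (kp_apply T z) \<le> \<epsilon>" .
    qed
  qed
qed

lemma S_norm_eq: "S_norm T = Inf {\<epsilon>. \<epsilon> > 0 \<and> S_bound T \<epsilon>}"
proof -
  have "op_norm_on T Z \<le> \<epsilon> \<longleftrightarrow> (\<forall>z\<in>Z. kp_norm (kp_apply T z) \<le> \<epsilon> * kp_norm z)"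
    if "inf_dim_closed_subspace Z" "\<epsilon> > 0" for Z \<epsilon>
    using op_norm_on_le_iff[of Z \<epsilon> T] that by (simp add: inf_dim_closed_subspace_def)
  then have "{\<epsilon>. \<epsilon> > 0 \<and> (\<forall>Y. inf_dim_closed_subspace Y \<longrightarrow>
      (\<exists>Z. inf_dim_closed_subspace Z \<and> Z \<subseteq> Y \<and> op_norm_on T Z \<le> \<epsilon>))} = {\<epsilon>. \<epsilon> > 0 \<and> S_bound T \<epsilon>}"
    unfolding S_bound_def by blast
  then show ?thesis by (simp add: S_norm_def)
qed

lemma S_bound_exists: "\<exists>\<epsilon>>0. S_bound T \<epsilon>"
proof -
  obtain M where M: "M > 0" "\<And>z. kp_norm (kp_apply T z) \<le> M * kp_norm z" using kp_apply_bound[of T] by metis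
  then show ?thesis unfolding S_bound_def by blast
qed

lemma S_norm_nonneg: "0 \<le> S_norm T"
  unfolding S_norm_eq using S_bound_exists[of T] by (intro cInf_greatest) auto

lemma S_norm_le:
  assumes "\<epsilon> > 0" "S_bound T \<epsilon>"
  shows "S_norm T \<le> \<epsilon>"
  unfolding S_norm_eq using assms by (intro cInf_lower bdd_belowI[of _ 0]) auto

lemma S_bound_mono:
  assumes "S_bound T \<epsilon>" "\<epsilon> \<le> \<epsilon>'"
  shows "S_bound T \<epsilon>'"
proof -
  have "\<epsilon> * kp_norm z \<le> \<epsilon>' * kp_norm z" for z :: "'a kp"
    using assms(2) by (rule mult_right_mono) (rule kp_norm_nonneg)
  then show ?thesis using assms(1) unfolding S_bound_def by (meson order_trans)
qed

lemma S_bound_if_less: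
  assumes "S_norm T < \<epsilon>"
  shows "S_bound T \<epsilon>"
proof -
  have "{\<epsilon>. \<epsilon> > 0 \<and> S_bound T \<epsilon>} \<noteq> {}" using S_bound_exists[of T] by blast
  from cInf_lessD[OF this assms[unfolded S_norm_eq]] obtain \<epsilon>' where "S_bound T \<epsilon>'" "\<epsilon>' < \<epsilon>" by blast
  from S_bound_mono[OF this(1) less_imp_le[OF this(2)]] show ?thesis .
qed

text \<open>Two nested subspaces realise the two bounds, two further ones make the second components
  negligible, and \<open>kp_norm_add_sharp\<close> then gives the constant 1.\<close>

lemma S_norm_triangle:
  fixes S T :: "'k::rc_field kp_op"
  shows "S_norm (S + T) \<le> S_norm S + S_norm T"
proof (rule field_le_epsilon)
  fix e :: real assume e: "e > 0"
  \<comment> \<open>14 = 2 + 6 * 2: the slack in both bounds plus the error term of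
    \<open>kp_norm_add_sharp\<close>.\<close>
  define \<eta> where "\<eta> = e / 14"
  have \<eta>: "\<eta> > 0" "e = 14 * \<eta>" using e by (simp_all add: \<eta>_def)
  have S: "S_bound S (S_norm S + \<eta>)" and T: "S_bound T (S_norm T + \<eta>)"
    using \<eta> by (auto intro: S_bound_if_less)
  have "S_bound (S + T) (S_norm S + S_norm T + e)"
    unfolding S_bound_def
  proof (intro allI impI)
    fix Y :: "'k kp set" assume "inf_dim_closed_subspace Y"
    then obtain Z1 where Z1: "inf_dim_closed_subspace Z1" "Z1 \<subseteq> Y"
      "\<And>z. z \<in> Z1 \<Longrightarrow> kp_norm (kp_apply S z) \<le> (S_norm S + \<eta>) * kp_norm z" using S unfolding S_bound_def by blast
    obtain Z2 where Z2: "inf_dim_closed_subspace Z2" "Z2 \<subseteq> Z1"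
      "\<And>z. z \<in> Z2 \<Longrightarrow> kp_norm (kp_apply T z) \<le> (S_norm T + \<eta>) * kp_norm z" using T Z1(1) unfolding S_bound_def by blast
    obtain Z3 where Z3: "inf_dim_closed_subspace Z3" "Z3 \<subseteq> Z2"
      "\<And>z. z \<in> Z3 \<Longrightarrow> l2_norm (kp_snd (kp_apply S z)) \<le> \<eta> * kp_norm z"
      using kp_snd_small_on_subspace[OF Z2(1) \<eta>(1), of S] by blast
    obtain Z4 where Z4: "inf_dim_closed_subspace Z4" "Z4 \<subseteq> Z3"
      "\<And>z. z \<in> Z4 \<Longrightarrow> l2_norm (kp_snd (kp_apply T z)) \<le> \<eta> * kp_norm z"
      using kp_snd_small_on_subspace[OF Z3(1) \<eta>(1), of T] by blast
    have "kp_norm (kp_apply (S + T) z) \<le> (S_norm S + S_norm T + e) * kp_norm z" if z: "z \<in> Z4" for z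
    proof -
      have z3: "z \<in> Z3" using z Z4(2) by blast
      have z2: "z \<in> Z2" using z3 Z3(2) by blast
      have z1: "z \<in> Z1" using z2 Z2(2) by blast
      have "kp_norm (kp_apply (S + T) z) \<le> kp_norm (kp_apply S z) + kp_norm (kp_apply T z)
        + 6 * (l2_norm (kp_snd (kp_apply S z)) + l2_norm (kp_snd (kp_apply T z)))"
        unfolding plus_kp_op.rep_eq by (rule kp_norm_add_sharp)
      then show ?thesis
        using Z1(3)[OF z1] Z2(3)[OF z2] Z3(3)[OF z3] Z4(3)[OF z] unfolding \<eta>(2) by (simp add: algebra_simps)
    qed
    then show "\<exists>Z. inf_dim_closed_subspace Z \<and> Z \<subseteq> Y \<and> (\<forall>z\<in>Z. kp_norm (kp_apply (S + T) z) \<le> (S_norm S + S_norm T + e) * kp_norm z)"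
      using Z4(1,2) Z3(2) Z2(2) Z1(2) by (intro exI[of _ Z4]) auto
  qed
  then show "S_norm (S + T) \<le> S_norm S + S_norm T + e"
    using S_norm_nonneg[of S] S_norm_nonneg[of T] e by (intro S_norm_le) auto
qed

lemma kp_apply_uminus: "kp_apply (- T) z = - kp_apply T z"
  unfolding uminus_kp_op_def uminus_kp_def kp_op_scale.rep_eq ..

lemma kp_apply_minus: "kp_apply (S - T) z = kp_apply S z - kp_apply T z"
  unfolding minus_kp_op_def plus_kp_op.rep_eq kp_apply_uminus minus_kp_def ..

lemma S_norm_uminus: "S_norm (- T) = S_norm T"
  unfolding S_norm_eq S_bound_def kp_apply_uminus kp_norm_uminus ..

lemma S_norm_minus_commute: "S_norm (S - T) = S_norm (T - S)"
  by (metis S_norm_uminus minus_diff_eq)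

lemma inf_dim_closed_subspace_nonzero:
  assumes "inf_dim_closed_subspace Z"
  obtains z where "z \<in> Z" "kp_norm z > 0"
proof -
  have "Z \<noteq> {0}" using assms kp.span_empty unfolding inf_dim_closed_subspace_def by (metis finite.emptyI)
  moreover have "0 \<in> Z" using assms kp.subspace_0 unfolding inf_dim_closed_subspace_def by blast
  ultimately obtain z where "z \<in> Z" "z \<noteq> 0" by blast
  then show ?thesis using that kp_norm_nonneg[of z] kp_norm_eq_0[of z] by fastforce
qed

text \<open>Strictly singular operators tend to 0 on all embedded unit vectors, so
  \<open>small_on_subspace\<close> applies. Conversely, an inverse bounded by C contradicts a bound
  \<epsilon> with |C| \<epsilon> < 1 on a smaller subspace.\<close>

lemma S_norm_eq_0_iff:
  fixes K :: "'k::rc_field kp_op"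
  shows "S_norm K = 0 \<longleftrightarrow> strictly_singular K"
proof
  assume K: "strictly_singular K"
  have "S_bound K \<epsilon>" if "\<epsilon> > 0" for \<epsilon>
    unfolding S_bound_def using small_on_subspace[OF strictly_singular_null[OF K] _ that] by blast
  then have "S_norm K \<le> \<epsilon>" if "\<epsilon> > 0" for \<epsilon> using S_norm_le that by blast
  then have "S_norm K \<le> 0" using field_le_epsilon[of "S_norm K" 0] by simp
  then show "S_norm K = 0" using S_norm_nonneg[of K] by simp
next
  assume 0: "S_norm K = 0"
  show "strictly_singular K"
    unfolding strictly_singular_def
  proof (intro allI impI notI)
    fix Z assume Z: "inf_dim_closed_subspace Z" and iso: "iso_onto_range_on K Z"
    from iso obtain C where inj: "inj_on (kp_apply K) Z"
      and C: "\<And>w. w \<in> kp_apply K ` Z \<Longrightarrow> kp_norm (the_inv_into Z (kp_apply K) w) \<le> C * kp_norm w"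
      unfolding iso_onto_range_on_def by blast
    have C': "kp_norm z \<le> C * kp_norm (kp_apply K z)" if "z \<in> Z" for z
      using C[of "kp_apply K z"] that by (simp add: the_inv_into_f_f[OF inj])
    define \<epsilon> where "\<epsilon> = 1 / (2 * (\<bar>C\<bar> + 1))"
    have \<epsilon>: "\<epsilon> > 0" "\<bar>C\<bar> * \<epsilon> < 1" by (auto simp: \<epsilon>_def field_simps)
    have "S_bound K \<epsilon>" using 0 \<epsilon>(1) by (intro S_bound_if_less) simp
    then obtain Z' where Z': "inf_dim_closed_subspace Z'" "Z' \<subseteq> Z"
      "\<And>z. z \<in> Z' \<Longrightarrow> kp_norm (kp_apply K z) \<le> \<epsilon> * kp_norm z" using Z unfolding S_bound_def by blast
    obtain z where z: "z \<in> Z'" "kp_norm z > 0" using inf_dim_closed_subspace_nonzero[OF Z'(1)] by blast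
    have "kp_norm z \<le> C * kp_norm (kp_apply K z)" using C' z Z'(2) by blast
    also have "\<dots> \<le> \<bar>C\<bar> * kp_norm (kp_apply K z)" by (intro mult_right_mono kp_norm_nonneg) simp
    also have "\<dots> \<le> \<bar>C\<bar> * (\<epsilon> * kp_norm z)" using Z'(3)[OF z(1)] by (intro mult_left_mono) auto
    also have "\<dots> < 1 * kp_norm z" using \<epsilon>(2) z(2) by (simp flip: mult.assoc)
    finally show False by simp
  qed
qed

text \<open>Turns the seminorm into estimates on the (e_n, 0). If 2 \<epsilon> were exceeded
  infinitely often, \<open>R\<close> would be bounded below by 3 \<epsilon> / 2 on a copy of l2, and
  no subspace of it could realise the bound \<epsilon>.\<close>

lemma S_norm_units:
  fixes R :: "'k::rc_field kp_op"
  assumes "S_norm R < \<epsilon>"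
  shows "eventually (\<lambda>n. kp_norm (kp_apply R (kp_unit n)) \<le> 2 * \<epsilon>) sequentially"
proof (rule ccontr)
  assume neg: "\<not> ?thesis"
  define S where "S = {n. 2 * \<epsilon> \<le> kp_norm (kp_apply R (kp_unit n))}"
  have \<epsilon>: "\<epsilon> > 0" using assms S_norm_nonneg[of R] by linarith
  have "infinite S"
    unfolding infinite_nat_iff_unbounded_le
  proof
    fix m
    from neg obtain n where "n \<ge> m" "\<not> kp_norm (kp_apply R (kp_unit n)) \<le> 2 * \<epsilon>"
      unfolding eventually_sequentially by blast
    then show "\<exists>n\<ge>m. n \<in> S" unfolding S_def by (intro exI[of _ n]) simp
  qed
  obtain M where M: "M > 0" "\<And>z. kp_norm (kp_apply R z) \<le> M * kp_norm z" using kp_apply_bound[of R] by metis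
  have M': "kp_norm (kp_apply R (kp_unit n)) \<le> M" for n using M(2)[of "kp_unit n"] by (simp add: kp_norm_unit)
  from almost_isometric_subsequence[OF \<open>infinite S\<close>, of "2 * \<epsilon>" R M "\<epsilon> / 2"] M' \<epsilon>
  obtain J where J: "kp_embedding J"
    "\<And>a. square_summable a \<Longrightarrow> (2 * \<epsilon> - \<epsilon> / 2) * l2_norm a \<le> kp_norm (kp_apply R (kp_apply J (kp_inj a)))"
    unfolding S_def by auto
  from S_bound_if_less[OF assms] embedding_range[OF J(1)]
  obtain Z where Z: "inf_dim_closed_subspace Z" "Z \<subseteq> (\<lambda>a. kp_apply J (kp_inj a)) ` {a. square_summable a}"
      "\<And>z. z \<in> Z \<Longrightarrow> kp_norm (kp_apply R z) \<le> \<epsilon> * kp_norm z" unfolding S_bound_def by blast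
  obtain z where z: "z \<in> Z" "kp_norm z > 0" using inf_dim_closed_subspace_nonzero[OF Z(1)] by blast
  obtain a where a: "square_summable a" "z = kp_apply J (kp_inj a)" using z Z(2) by blast
  have "kp_norm z = l2_norm a" using J(1) a by (simp add: kp_embedding_def kp_norm_inj)
  then have "(2 * \<epsilon> - \<epsilon> / 2) * kp_norm z \<le> \<epsilon> * kp_norm z" using J(2)[OF a(1)] Z(3)[OF z(1)] a(2) by simp
  then show False using z(2) \<epsilon> by simp
qed

section \<open>The quotient metric\<close>

lemma S_norm_triangle_diff:
  fixes S T R :: "'k::rc_field kp_op"
  shows "S_norm (S - R) \<le> S_norm (S - T) + S_norm (T - R)"
  using S_norm_triangle[of "S - T" "T - R"] by simp

lemma ss_rel_iff: "(S, T) \<in> ss_rel \<longleftrightarrow> S_norm (S - T :: 'k::rc_field kp_op) = 0"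
  by (simp add: ss_rel_def S_norm_eq_0_iff)

text \<open>Closure of the strictly singular operators under sums is read off from the subadditivity
  of \<open>S_norm\<close>.\<close>

lemma ss_rel_equiv: "equiv UNIV (ss_rel :: ('k::rc_field kp_op \<times> _) set)"
proof (rule equivI)
  have z: "S_norm (0 :: 'k kp_op) = 0"
  proof -
    have "S_norm (0 :: 'k kp_op) \<le> e" if "e > 0" for e
      by (rule S_norm_le[OF that]) (use that in \<open>auto simp: S_bound_def zero_kp_op.rep_eq kp_norm_zero kp_norm_nonneg\<close>)
    then show ?thesis using field_le_epsilon[of "S_norm (0 :: 'k kp_op)" 0] S_norm_nonneg[of "0 :: 'k kp_op"] by simp
  qed
  then show "refl (ss_rel :: ('k kp_op \<times> _) set)" by (auto simp: refl_on_def ss_rel_iff)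
  show "sym (ss_rel :: ('k kp_op \<times> _) set)" by (auto simp: sym_def ss_rel_iff S_norm_minus_commute)
  show "trans (ss_rel :: ('k kp_op \<times> _) set)"
  proof (rule transI)
    fix S T R :: "'k kp_op" assume "(S, T) \<in> ss_rel" "(T, R) \<in> ss_rel"
    then show "(S, R) \<in> ss_rel"
      using S_norm_triangle_diff[of S R T] S_norm_nonneg[of "S - R"] by (simp add: ss_rel_iff)
  qed
qed simp

lemma S_norm_class:
  fixes S T :: "'k::rc_field kp_op"
  assumes "(S, T) \<in> ss_rel"
  shows "S_norm S = S_norm T"
proof -
  have "S_norm (S - T) = 0" "S_norm (T - S) = 0"
    using assms S_norm_minus_commute[of S T] by (simp_all add: ss_rel_iff)
  then show ?thesis using S_norm_triangle[of "S - T" T] S_norm_triangle[of "T - S" S] by simp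
qed

lemma ss_quotient_dist_class:
  fixes S T :: "'k::rc_field kp_op"
  shows "ss_quotient_dist (ss_rel `` {S}) (ss_rel `` {T}) = S_norm (S - T)"
proof -
  have in_quot: "ss_rel `` {R} \<in> ss_quotient" for R :: "'k kp_op" by (simp add: ss_quotient_def quotientI)
  have diff: "ss_rel `` {S' - T'} = ss_rel `` {S - T}" if "(S, S') \<in> ss_rel" "(T, T') \<in> ss_rel" for S' T'
  proof (rule equiv_class_eq[OF ss_rel_equiv])
    have "S_norm ((S' - T') - (S - T)) \<le> S_norm (S' - S) + S_norm (T - T')"
      using S_norm_triangle[of "S' - S" "T - T'"] by (simp add: algebra_simps)
    then show "(S' - T', S - T) \<in> ss_rel"
      using that S_norm_nonneg[of "(S' - T') - (S - T)"] S_norm_minus_commute[of S' S] by (simp add: ss_rel_iff)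
  qed
  have self: "R \<in> ss_rel `` {R}" for R :: "'k kp_op" by (rule equiv_class_self[OF ss_rel_equiv]) simp
  have "ss_quotient_diff (ss_rel `` {S}) (ss_rel `` {T}) = ss_rel `` {S - T}"
    unfolding ss_quotient_diff_def
  proof (intro equalityI subsetI)
    fix R assume "R \<in> (\<Union>S'\<in>ss_rel `` {S}. \<Union>T'\<in>ss_rel `` {T}. ss_rel `` {S' - T'})"
    then obtain S' T' where "(S, S') \<in> ss_rel" "(T, T') \<in> ss_rel" "R \<in> ss_rel `` {S' - T'}" by blast
    then show "R \<in> ss_rel `` {S - T}" using diff by blast
  next
    fix R assume "R \<in> ss_rel `` {S - T}"
    then show "R \<in> (\<Union>S'\<in>ss_rel `` {S}. \<Union>T'\<in>ss_rel `` {T}. ss_rel `` {S' - T'})" using self by blast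
  qed
  moreover have "S_norm ` (ss_rel `` {R}) = {S_norm R}" for R :: "'k kp_op"
  proof (intro equalityI subsetI)
    fix x assume "x \<in> S_norm ` (ss_rel `` {R})"
    then obtain T where "x = S_norm T" "(R, T) \<in> ss_rel" by blast
    then show "x \<in> {S_norm R}" using S_norm_class[of R T] by simp
  qed (use self in blast)
  ultimately show ?thesis by (simp add: ss_quotient_dist_def in_quot ss_quotient_norm_def)
qed

lemma ss_quotient_cases:
  assumes "X \<in> ss_quotient"
  obtains S where "X = ss_rel `` {S}"
  using assms unfolding ss_quotient_def by (rule quotientE)

lemma ss_quotient_Metric_space: "Metric_space (ss_quotient :: 'k::rc_field kp_op set set) ss_quotient_dist"
proof
  have nn: "0 \<le> ss_quotient_dist X Y" if "X \<in> ss_quotient" "Y \<in> ss_quotient" for X Y :: "'k kp_op set"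
    using that by (elim ss_quotient_cases) (simp add: ss_quotient_dist_class S_norm_nonneg)
  show "0 \<le> ss_quotient_dist X Y" for X Y :: "'k kp_op set"
  proof (cases "X \<in> ss_quotient \<and> Y \<in> ss_quotient")
    case False then show ?thesis unfolding ss_quotient_dist_def by auto
  qed (use nn in blast)
  have cm: "ss_quotient_dist X Y = ss_quotient_dist Y X" if "X \<in> ss_quotient" "Y \<in> ss_quotient" for X Y :: "'k kp_op set"
    using that by (elim ss_quotient_cases) (simp add: ss_quotient_dist_class S_norm_minus_commute)
  show "ss_quotient_dist X Y = ss_quotient_dist Y X" for X Y :: "'k kp_op set"
  proof (cases "X \<in> ss_quotient \<and> Y \<in> ss_quotient")
    case False then show ?thesis unfolding ss_quotient_dist_def by auto
  qed (use cm in blast)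
  show "ss_quotient_dist X Y = 0 \<longleftrightarrow> X = Y" if XY: "X \<in> ss_quotient" "Y \<in> ss_quotient" for X Y :: "'k kp_op set"
  proof -
    obtain S T where ST: "X = ss_rel `` {S}" "Y = ss_rel `` {T}" using XY by (elim ss_quotient_cases)
    have "X = Y \<longleftrightarrow> (S, T) \<in> ss_rel" unfolding ST by (rule eq_equiv_class_iff[OF ss_rel_equiv]) auto
    then show ?thesis by (simp add: ST ss_quotient_dist_class ss_rel_iff)
  qed
  show "ss_quotient_dist X Z \<le> ss_quotient_dist X Y + ss_quotient_dist Y Z"
    if XYZ: "X \<in> ss_quotient" "Y \<in> ss_quotient" "Z \<in> ss_quotient" for X Y Z :: "'k kp_op set"
  proof -
    obtain S T R where "X = ss_rel `` {S}" "Y = ss_rel `` {T}" "Z = ss_rel `` {R}" using XYZ by (elim ss_quotient_cases)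
    then show ?thesis by (simp add: ss_quotient_dist_class S_norm_triangle_diff)
  qed
qed

lemma ss_quotient_mcompleteD:
  fixes A :: "nat \<Rightarrow> 'k::rc_field kp_op"
  assumes c: "Metric_space.mcomplete (ss_quotient :: 'k kp_op set set) ss_quotient_dist"
    and A: "\<And>e. e > 0 \<Longrightarrow> \<exists>N. \<forall>m\<ge>N. \<forall>n\<ge>N. S_norm (A m - A n) < e"
  obtains B where "(\<lambda>n. S_norm (A n - B)) \<longlonglongrightarrow> 0"
proof -
  interpret Metric_space "ss_quotient :: 'k kp_op set set" ss_quotient_dist by (rule ss_quotient_Metric_space)
  have q: "ss_rel `` {R} \<in> ss_quotient" for R :: "'k kp_op" by (simp add: ss_quotient_def quotientI)
  have "MCauchy (\<lambda>n. ss_rel `` {A n})"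
    unfolding MCauchy_def using A q by (auto simp: ss_quotient_dist_class)
  then obtain X where X: "limitin mtopology (\<lambda>n. ss_rel `` {A n}) X sequentially"
    using c unfolding mcomplete_def by blast
  then have Xq: "X \<in> ss_quotient" and lim: "(\<lambda>n. ss_quotient_dist (ss_rel `` {A n}) X) \<longlonglongrightarrow> 0"
    unfolding limitin_metric_dist_null by auto
  obtain B where "X = ss_rel `` {B}" using Xq by (rule ss_quotient_cases)
  then show ?thesis using that lim by (simp add: ss_quotient_dist_class)
qed

section \<open>Block diagonal Walsh--Hadamard operators\<close>

text \<open>The entry of Sylvester's Hadamard matrix of order 2^m: the sign is the parity of the
  number of ones shared by the last m binary digits of \<open>t\<close> and
  \<open>s\<close>.\<close>

fun walsh :: "nat \<Rightarrow> nat \<Rightarrow> nat \<Rightarrow> real"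
  where "walsh 0 t s = 1"
  | "walsh (Suc m) t s = walsh m (t div 2) (s div 2) * (if odd t \<and> odd s then - 1 else 1)"

lemma walsh_commute: "walsh m t s = walsh m s t"
  by (induction m arbitrary: t s) auto

lemma abs_walsh: "\<bar>walsh m t s\<bar> = 1"
  by (induction m arbitrary: t s) (auto simp: abs_mult)

lemma walsh_square: "walsh m t s * walsh m t s = 1"
  using abs_walsh[of m t s] by (metis abs_mult_self_eq mult_1)

lemma sum_lessThan_double: "(\<Sum>s<2 * n. f s) = (\<Sum>s<n. f (2 * s) + f (2 * s + 1))" for n :: nat and f :: "nat \<Rightarrow> 'a::comm_monoid_add"
  by (induction n) (simp_all add: add.assoc)

text \<open>Pairing the columns 2 s and 2 s + 1 splits off a factor 1 + \<sigma> t \<sigma> t',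
  which vanishes exactly when the last digits differ. The remaining digits are covered by
  induction.\<close>

lemma walsh_orthogonal:
  assumes "t < 2 ^ m" "t' < 2 ^ m"
  shows "(\<Sum>s<2 ^ m. walsh m t s * walsh m t' s) = (if t = t' then 2 ^ m else 0)"
  using assms
proof (induction m arbitrary: t t')
  case (Suc m)
  define \<sigma> where "\<sigma> t = (if odd t then - 1 else 1 :: real)" for t :: nat
  have even: "walsh (Suc m) t (2 * s) = walsh m (t div 2) s" for t s by simp
  have odd: "walsh (Suc m) t (2 * s + 1) = walsh m (t div 2) s * \<sigma> t" for t s by (simp add: \<sigma>_def)
  have "(\<Sum>s<2 ^ Suc m. walsh (Suc m) t s * walsh (Suc m) t' s)
    = (\<Sum>s<2 ^ m. (1 + \<sigma> t * \<sigma> t') * (walsh m (t div 2) s * walsh m (t' div 2) s))"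
    unfolding power_Suc sum_lessThan_double even odd by (intro sum.cong) (simp_all add: algebra_simps)
  also have "\<dots> = (1 + \<sigma> t * \<sigma> t') * (if t div 2 = t' div 2 then 2 ^ m else 0)"
    unfolding sum_distrib_left[symmetric] using Suc.prems by (subst Suc.IH) auto
  also have "\<dots> = (if t = t' then 2 ^ Suc m else 0)"
  proof (cases "t div 2 = t' div 2 \<and> t \<noteq> t'")
    case True
    then have "odd t \<longleftrightarrow> even t'" by presburger
    with True show ?thesis by (auto simp: \<sigma>_def)
  qed (auto simp: \<sigma>_def)
  finally show ?case .
qed simp

section \<open>Arrangement of the coordinates in blocks\<close>

definition block_size :: "nat \<Rightarrow> nat"
  where "block_size k = 2 ^ (Suc k)\<^sup>2"

text \<open>\<open>prod_encode\<close> arranges the coordinates in rows, and row \<open>k\<close> is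
  cut into infinitely many consecutive blocks of one size; \<open>b\<close> counts the blocks of the
  row and \<open>t\<close> is the position in the block.\<close>

definition block_index :: "nat \<Rightarrow> nat \<Rightarrow> nat \<Rightarrow> nat"
  where "block_index k b t = prod_encode (k, b * block_size k + t)"

definition block_kind :: "nat \<Rightarrow> nat"
  where "block_kind n = fst (prod_decode n)"

definition block_number :: "nat \<Rightarrow> nat"
  where "block_number n = snd (prod_decode n) div block_size (block_kind n)"

definition block_pos :: "nat \<Rightarrow> nat"
  where "block_pos n = snd (prod_decode n) mod block_size (block_kind n)"

definition block_id :: "nat \<Rightarrow> nat"
  where "block_id n = prod_encode (block_kind n, block_number n)"

lemma block_size_pos: "0 < block_size k"
  by (simp add: block_size_def)

lemma block_index_inverse: "block_index (block_kind n) (block_number n) (block_pos n) = n"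
  by (simp add: block_index_def block_kind_def block_number_def block_pos_def)

lemma block_index_sel:
  assumes "t < block_size k"
  shows "block_kind (block_index k b t) = k" "block_number (block_index k b t) = b"
    "block_pos (block_index k b t) = t"
  using assms by (simp_all add: block_index_def block_kind_def block_number_def block_pos_def)

lemma block_pos_less: "block_pos n < block_size (block_kind n)"
  by (simp add: block_pos_def block_size_pos)

lemma block_index_inj: "inj_on (block_index k b) {..<block_size k}"
  by (rule inj_onI) (metis block_index_sel(3) lessThan_iff)

lemma block_index_eq_iff:
  "t < block_size k \<Longrightarrow> t' < block_size k \<Longrightarrow> block_index k b t = block_index k b t' \<longleftrightarrow> t = t'"
  using block_index_sel(3) by metis

lemma block_id_fibre: "{n. block_id n = prod_encode (k, b)} = block_index k b ` {..<block_size k}"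
proof (intro equalityI subsetI)
  fix n assume "n \<in> {n. block_id n = prod_encode (k, b)}"
  then have "block_kind n = k" "block_number n = b" by (simp_all add: block_id_def)
  then show "n \<in> block_index k b ` {..<block_size k}"
    using block_index_inverse[of n] block_pos_less[of n] by (intro image_eqI[of _ _ "block_pos n"]) auto
next
  fix n assume "n \<in> block_index k b ` {..<block_size k}"
  then show "n \<in> {n. block_id n = prod_encode (k, b)}" by (auto simp: block_id_def block_index_sel)
qed

lemma sum_block: "(\<Sum>n | block_id n = prod_encode (k, b). f n) = (\<Sum>t<block_size k. f (block_index k b t))"
  unfolding block_id_fibre by (subst sum.reindex[OF block_index_inj]) simp

text \<open>An initial segment of coordinates need not be made of whole blocks. It is enlarged to
  the finite union of all blocks it meets before the blockwise inequality is summed.\<close>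

lemma blockwise_l2_bound:
  fixes x :: "nat \<Rightarrow> 'a::real_normed_field" and y :: "nat \<Rightarrow> 'b::real_normed_field"
  assumes x: "square_summable x" and C: "0 \<le> C"
    and le: "\<And>k b. (\<Sum>t<block_size k. (norm (y (block_index k b t)))\<^sup>2) \<le> C\<^sup>2 * (\<Sum>t<block_size k. (norm (x (block_index k b t)))\<^sup>2)"
  shows "square_summable y" "l2_norm y \<le> C * l2_norm x"
proof -
  have fin: "finite {n. block_id n = i}" for i
    using block_id_fibre[of "fst (prod_decode i)" "snd (prod_decode i)"] by simp
  have le': "(\<Sum>n | block_id n = i. (norm (y n))\<^sup>2) \<le> C\<^sup>2 * (\<Sum>n | block_id n = i. (norm (x n))\<^sup>2)" for i
  proof -
    obtain k b where i: "i = prod_encode (k, b)" by (metis prod_decode_inverse surj_pair)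
    show ?thesis unfolding i sum_block by (rule le)
  qed
  have "(\<Sum>k<n. (norm (y k))\<^sup>2) \<le> (C * l2_norm x)\<^sup>2" for n
  proof -
    define T where "T = block_id ` {..<n}"
    define F where "F = {m. block_id m \<in> T}"
    have "F = (\<Union>i\<in>T. {m. block_id m = i})" by (auto simp: F_def)
    then have finF: "finite F" using fin by (simp add: T_def)
    have grp: "(\<Sum>i\<in>T. \<Sum>m | block_id m = i. h m) = sum h F" for h :: "nat \<Rightarrow> real"
    proof -
      have "(\<Sum>i\<in>T. sum h {m \<in> F. block_id m = i}) = sum h F"
        by (rule sum.group[OF finF]) (auto simp: T_def F_def)
      moreover have "{m \<in> F. block_id m = i} = {m. block_id m = i}" if "i \<in> T" for i using that by (auto simp: F_def)
      ultimately show ?thesis by simp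
    qed
    have "(\<Sum>k<n. (norm (y k))\<^sup>2) \<le> (\<Sum>m\<in>F. (norm (y m))\<^sup>2)"
      by (intro sum_mono2 finF) (auto simp: F_def T_def)
    also have "\<dots> \<le> (\<Sum>i\<in>T. C\<^sup>2 * (\<Sum>m | block_id m = i. (norm (x m))\<^sup>2))"
      unfolding grp[symmetric] by (intro sum_mono le')
    also have "\<dots> = C\<^sup>2 * (\<Sum>m\<in>F. (norm (x m))\<^sup>2)" by (simp add: grp flip: sum_distrib_left)
    also have "\<dots> \<le> C\<^sup>2 * (l2_norm x)\<^sup>2" by (intro mult_left_mono l2_partial_le x finF) simp
    finally show ?thesis by (simp add: power_mult_distrib)
  qed
  from l2_boundI[OF _ this] show "square_summable y" "l2_norm y \<le> C * l2_norm x"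
    using C l2_norm_nonneg[OF x] by simp_all
qed

section \<open>Block diagonal operators built from the normalised matrices\<close>

definition unit_walsh :: "nat \<Rightarrow> nat \<Rightarrow> nat \<Rightarrow> real"
  where "unit_walsh k t s = walsh ((Suc k)\<^sup>2) t s / sqrt (block_size k)"

lemma unit_walsh_orthogonal:
  assumes "t < block_size k" "t' < block_size k"
  shows "(\<Sum>s<block_size k. unit_walsh k t s * unit_walsh k t' s) = (if t = t' then 1 else 0)"
proof -
  have "(\<Sum>s<block_size k. unit_walsh k t s * unit_walsh k t' s)
    = (\<Sum>s<block_size k. walsh ((Suc k)\<^sup>2) t s * walsh ((Suc k)\<^sup>2) t' s) / block_size k"
    unfolding sum_divide_distrib by (intro sum.cong) (simp_all add: unit_walsh_def)
  also have "\<dots> = (if t = t' then 1 else 0)"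
    using walsh_orthogonal[of t "(Suc k)\<^sup>2" t'] assms unfolding block_size_def by simp
  finally show ?thesis .
qed

lemma unit_walsh_commute: "unit_walsh k t s = unit_walsh k s t"
  by (simp add: unit_walsh_def walsh_commute)

lemma abs_unit_walsh: "\<bar>unit_walsh k t s\<bar> = 1 / sqrt (block_size k)"
  by (simp add: unit_walsh_def abs_walsh)

lemma abs_unit_walsh_le: "\<bar>unit_walsh k t s\<bar> \<le> 1"
  using block_size_pos[of k] by (simp add: abs_unit_walsh)

lemma sconj_sum: "sconj (\<Sum>i\<in>I. f i) = (\<Sum>i\<in>I. sconj (f i :: 'k::rc_field))"
  by (induction I rule: infinite_finite_induct) (simp_all add: sconj_zero sconj_add)

text \<open>Parseval's identity. The symmetry of the matrix turns orthonormal rows into orthonormal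
  columns.\<close>

lemma unit_walsh_isometry:
  fixes x :: "nat \<Rightarrow> 'k::rc_field"
  shows "(\<Sum>t<block_size k. (norm (\<Sum>s<block_size k. of_real (unit_walsh k t s) * x s))\<^sup>2) = (\<Sum>s<block_size k. (norm (x s))\<^sup>2)"
proof -
  let ?N = "block_size k" and ?u = "\<lambda>t s. of_real (unit_walsh k t s) :: 'k"
  have "of_real (\<Sum>t<?N. (norm (\<Sum>s<?N. ?u t s * x s))\<^sup>2)
     = (\<Sum>t<?N. (\<Sum>s<?N. ?u t s * x s) * (\<Sum>s<?N. ?u t s * sconj (x s)))"
    unfolding of_real_sum mult_sconj[symmetric] by (simp only: sconj_sum sconj_mult sconj_of_real)
  also have "\<dots> = (\<Sum>t<?N. \<Sum>s<?N. \<Sum>s'<?N. (?u t s * ?u t s') * (x s * sconj (x s')))"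
    unfolding sum_product by (simp only: mult_ac)
  also have "\<dots> = (\<Sum>s<?N. \<Sum>s'<?N. \<Sum>t<?N. (?u t s * ?u t s') * (x s * sconj (x s')))"
    by (subst sum.swap) (intro sum.cong refl sum.swap)
  also have "\<dots> = (\<Sum>s<?N. \<Sum>s'<?N. (if s = s' then 1 else 0) * (x s * sconj (x s')))"
  proof (intro sum.cong refl)
    fix s s' assume "s \<in> {..<?N}" "s' \<in> {..<?N}"
    then have "(\<Sum>t<?N. unit_walsh k t s * unit_walsh k t s') = (if s = s' then 1 else 0)"
      using unit_walsh_orthogonal[of s k s'] by (simp add: unit_walsh_commute[of k _ s] unit_walsh_commute[of k _ s'])
    then have "(\<Sum>t<?N. ?u t s * ?u t s') = (if s = s' then 1 else 0)"
      by (simp flip: of_real_mult of_real_sum)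
    then show "(\<Sum>t<?N. (?u t s * ?u t s') * (x s * sconj (x s'))) = (if s = s' then 1 else 0) * (x s * sconj (x s'))"
      by (simp flip: sum_distrib_right)
  qed
  also have "\<dots> = (\<Sum>s<?N. x s * sconj (x s))"
    by (intro sum.cong refl) (simp add: if_distrib[of "\<lambda>c. c * _"] cong: if_cong)
  also have "\<dots> = of_real (\<Sum>s<?N. (norm (x s))\<^sup>2)" by (simp add: mult_sconj)
  finally show ?thesis unfolding of_real_eq_iff .
qed

text \<open>The direct sum over all blocks of c_k U_k, with U_k the normalised matrix for blocks of
  kind k.\<close>

definition walsh_map :: "(nat \<Rightarrow> real) \<Rightarrow> (nat \<Rightarrow> 'k::real_normed_field) \<Rightarrow> nat \<Rightarrow> 'k"
  where "walsh_map c x n = of_real (c (block_kind n)) *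
    (\<Sum>s<block_size (block_kind n). of_real (unit_walsh (block_kind n) (block_pos n) s) *
       x (block_index (block_kind n) (block_number n) s))"

lemma walsh_map_block:
  "t < block_size k \<Longrightarrow> walsh_map c x (block_index k b t)
    = of_real (c k) * (\<Sum>s<block_size k. of_real (unit_walsh k t s) * x (block_index k b s))"
  by (simp add: walsh_map_def block_index_sel)

lemma walsh_map_add: "walsh_map c (\<lambda>n. x n + y n) = (\<lambda>n. walsh_map c x n + walsh_map c y n)"
  by (simp add: walsh_map_def fun_eq_iff distrib_left sum.distrib)

lemma walsh_map_scale: "walsh_map c (\<lambda>n. r * x n) = (\<lambda>n. r * walsh_map c x n)"
  by (simp add: walsh_map_def fun_eq_iff sum_distrib_left mult_ac)

lemma walsh_map_l2:
  fixes x :: "nat \<Rightarrow> 'k::rc_field"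
  assumes x: "square_summable x" and c: "\<And>k. \<bar>c k\<bar> \<le> a"
  shows "square_summable (walsh_map c x)" "l2_norm (walsh_map c x) \<le> a * l2_norm x"
proof -
  have a: "0 \<le> a" using c[of 0] by linarith
  have le: "(\<Sum>t<block_size k. (norm (walsh_map c x (block_index k b t)))\<^sup>2) \<le> a\<^sup>2 * (\<Sum>t<block_size k. (norm (x (block_index k b t)))\<^sup>2)" for k b
  proof -
    have "(\<Sum>t<block_size k. (norm (walsh_map c x (block_index k b t)))\<^sup>2)
       = (c k)\<^sup>2 * (\<Sum>t<block_size k. (norm (\<Sum>s<block_size k. of_real (unit_walsh k t s) * x (block_index k b s)))\<^sup>2)"
      unfolding sum_distrib_left by (intro sum.cong refl) (simp add: walsh_map_block norm_mult power_mult_distrib)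
    also have "\<dots> = (c k)\<^sup>2 * (\<Sum>t<block_size k. (norm (x (block_index k b t)))\<^sup>2)"
      by (simp only: unit_walsh_isometry)
    also have "\<dots> \<le> a\<^sup>2 * (\<Sum>t<block_size k. (norm (x (block_index k b t)))\<^sup>2)"
      using c[of k] a by (intro mult_right_mono sum_nonneg) (auto simp flip: abs_le_square_iff)
    finally show ?thesis .
  qed
  show "square_summable (walsh_map c x)" "l2_norm (walsh_map c x) \<le> a * l2_norm x"
    by (rule blockwise_l2_bound[OF x a le])+
qed

text \<open>Only finitely many block sizes occur, so crude estimates suffice for the commutator with \<^const>\<open>Omega\<close>.\<close>

lemma walsh_map_Omega:
  fixes y :: "nat \<Rightarrow> 'k::rc_field"
  assumes y: "square_summable y" and c: "\<And>k. \<bar>c k\<bar> \<le> 1" "\<And>k. K < k \<Longrightarrow> c k = 0"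
    and N: "\<And>k. k \<le> K \<Longrightarrow> block_size k \<le> N"
  defines "E \<equiv> \<lambda>n. Omega (walsh_map c y) n - walsh_map c (Omega y) n"
  shows "square_summable E" "l2_norm E \<le> (1 + (1 + real N) * real N) * l2_norm y"
proof -
  define D where "D = walsh_map c y"
  have D: "square_summable D" and Dy: "l2_norm D \<le> l2_norm y"
    using walsh_map_l2[OF y c(1)] by (simp_all add: D_def)
  \<comment> \<open>The l1 norm of \<open>y\<close> over the block of \<open>n\<close>. It dominates
    every entry of \<open>y\<close> and of its image there and so serves as common scale for the
    logarithms.\<close>
  define \<sigma> where "\<sigma> n = (if block_kind n \<le> K then \<Sum>s<block_size (block_kind n). norm (y (block_index (block_kind n) (block_number n) s)) else 0)" for n
  have \<sigma>: "square_summable \<sigma>" "l2_norm \<sigma> \<le> real N * l2_norm y"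
  proof -
    have le: "(\<Sum>t<block_size k. (norm (\<sigma> (block_index k b t)))\<^sup>2) \<le> (real N)\<^sup>2 * (\<Sum>t<block_size k. (norm (y (block_index k b t)))\<^sup>2)" for k b
    proof (cases "k \<le> K")
      case True
      let ?s = "\<Sum>s<block_size k. norm (y (block_index k b s))"
      let ?q = "\<Sum>t<block_size k. (norm (y (block_index k b t)))\<^sup>2"
      have "(\<Sum>t<block_size k. (norm (\<sigma> (block_index k b t)))\<^sup>2) = real (block_size k) * ?s\<^sup>2"
        using True by (simp add: \<sigma>_def block_index_sel)
      also have "\<dots> \<le> real (block_size k) * (real (block_size k) * ?q)"
        using sum_squared_le_sum_of_squares[of "\<lambda>s. norm (y (block_index k b s))" "{..<block_size k}"]
        by (intro mult_left_mono) (simp_all add: mult.commute)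
      also have "\<dots> \<le> real N * (real N * ?q)"
        using N[OF True] by (intro mult_mono mult_right_mono sum_nonneg mult_nonneg_nonneg) auto
      finally show ?thesis by (simp add: power2_eq_square mult.assoc)
    next
      case False
      then show ?thesis by (simp add: \<sigma>_def block_index_sel sum_nonneg)
    qed
    show "square_summable \<sigma>" "l2_norm \<sigma> \<le> real N * l2_norm y"
      by (rule blockwise_l2_bound[OF y _ le]; simp)+
  qed
  \<comment> \<open>The share of the commutator caused by the two global norms. The remainder
    involves only the entries of a single block.\<close>
  define E1 where "E1 n = of_real (ln (l2_norm D) - ln (l2_norm y)) * D n" for n
  have E1: "square_summable E1" "l2_norm E1 \<le> l2_norm y"
    unfolding E1_def using abs_ln_diff_bound[OF l2_norm_nonneg[OF D] Dy]
    by (simp_all add: square_summable_scale[OF D] l2_norm_scale[OF D] del: of_real_diff)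
  have E2: "norm (E n - E1 n) \<le> norm ((1 + real N) * \<sigma> n)" for n
  proof (cases "block_kind n \<le> K")
    case False
    then have "c (block_kind n) = 0" using c(2) by simp
    then have "D n = 0" "walsh_map c (Omega y) n = 0" by (simp_all add: D_def walsh_map_def)
    then have "E n - E1 n = 0" by (simp add: E_def E1_def Omega_def flip: D_def)
    then show ?thesis by simp
  next
    case True
    define k b t where "k = block_kind n" and "b = block_number n" and "t = block_pos n"
    define i where "i = block_index k b"
    define u where "u s = c k * unit_walsh k t s" for s
    have u: "\<bar>u s\<bar> \<le> 1" for s
      unfolding u_def abs_mult using c(1)[of k] abs_unit_walsh_le[of k t s] by (intro mult_le_one) auto
    have map: "walsh_map c x n = (\<Sum>s<block_size k. of_real (u s) * x (i s))" for x :: "nat \<Rightarrow> 'k"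
      by (simp add: walsh_map_def k_def b_def t_def i_def u_def sum_distrib_left mult.assoc)
    have \<sigma>n: "\<sigma> n = (\<Sum>s<block_size k. norm (y (i s)))" using True by (simp add: \<sigma>_def k_def b_def i_def)
    have ys: "norm (y (i s)) \<le> \<sigma> n" if "s < block_size k" for s
      unfolding \<sigma>n using that by (intro member_le_sum) auto
    have Dn: "norm (D n) \<le> \<sigma> n"
      unfolding D_def map \<sigma>n
    proof (rule order_trans[OF norm_sum], rule sum_mono)
      fix s
      show "norm (of_real (u s) * y (i s)) \<le> norm (y (i s))"
        using mult_right_mono[OF u[of s] norm_ge_zero[of "y (i s)"]] by (simp add: norm_mult)
    qed
    \<comment> \<open>\<open>D\<close> is the image of \<open>y\<close>, so shifting all logarithms
      by \<open>\<tau>\<close> leaves the difference unchanged. Afterwards each entry of modulus u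
      contributes u |ln u - \<tau>| \<le> \<sigma> n.\<close>
    define \<tau> where "\<tau> = ln (\<sigma> n)"
    have "walsh_map c (Omega y) n = of_real (ln (l2_norm y)) * D n - (\<Sum>s<block_size k. of_real (u s) * (of_real (ln (norm (y (i s)))) * y (i s)))"
      unfolding D_def map Omega_ln[OF y] sum_distrib_left sum_subtractf[symmetric]
      by (intro sum.cong refl) (simp add: algebra_simps)
    moreover have "Omega D n = of_real (ln (l2_norm D)) * D n - of_real (ln (norm (D n))) * D n"
      by (simp add: Omega_ln[OF D] left_diff_distrib)
    moreover have "of_real \<tau> * D n = (\<Sum>s<block_size k. of_real (u s) * (of_real \<tau> * y (i s)))"
      unfolding D_def map sum_distrib_left by (intro sum.cong refl) (simp add: mult_ac)
    ultimately have "E n - E1 n = - (of_real (ln (norm (D n)) - \<tau>) * D n)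
        + (\<Sum>s<block_size k. of_real (u s) * (of_real (ln (norm (y (i s))) - \<tau>) * y (i s)))"
      by (simp add: E_def E1_def left_diff_distrib right_diff_distrib sum_subtractf flip: D_def)
    also have "norm \<dots> \<le> norm (of_real (ln (norm (D n)) - \<tau>) * D n) + (\<Sum>s<block_size k. \<sigma> n)"
    proof (rule order_trans[OF norm_triangle_ineq], rule add_mono, simp, rule order_trans[OF norm_sum], rule sum_mono)
      fix s assume "s \<in> {..<block_size k}"
      then have "norm (of_real (ln (norm (y (i s))) - \<tau>) * y (i s)) \<le> \<sigma> n"
        unfolding norm_mult norm_of_real \<tau>_def by (intro abs_ln_diff_bound ys) auto
      then show "norm (of_real (u s) * (of_real (ln (norm (y (i s))) - \<tau>) * y (i s))) \<le> \<sigma> n"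
        using mult_mono[OF u[of s] _ _ norm_ge_zero, of "of_real (ln (norm (y (i s))) - \<tau>) * y (i s)" "\<sigma> n"]
        by (simp add: norm_mult[of "of_real (u s)"] del: of_real_diff)
    qed
    also have "norm (of_real (ln (norm (D n)) - \<tau>) * D n) \<le> \<sigma> n"
      unfolding norm_mult norm_of_real \<tau>_def by (intro abs_ln_diff_bound Dn) auto
    also have "\<sigma> n + (\<Sum>s<block_size k. \<sigma> n) \<le> (1 + real N) * \<sigma> n"
    proof -
      have "0 \<le> \<sigma> n" using Dn norm_ge_zero order_trans by blast
      moreover have "real (block_size k) \<le> real N" using N[of k] True by (simp add: k_def)
      ultimately have "real (block_size k) * \<sigma> n \<le> real N * \<sigma> n" by (intro mult_right_mono)
      then show ?thesis by (simp add: algebra_simps)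
    qed
    also have "\<dots> \<le> norm ((1 + real N) * \<sigma> n)" by simp
    finally show ?thesis by simp
  qed
  have s\<sigma>: "square_summable (\<lambda>n. (1 + real N) * \<sigma> n)" by (rule square_summable_scale[OF \<sigma>(1)])
  have sE2: "square_summable (\<lambda>n. E n - E1 n)" by (rule square_summable_dominated[OF s\<sigma> E2])
  have nE2: "l2_norm (\<lambda>n. E n - E1 n) \<le> (1 + real N) * (real N * l2_norm y)"
  proof -
    have "l2_norm (\<lambda>n. E n - E1 n) \<le> l2_norm (\<lambda>n. (1 + real N) * \<sigma> n)" by (rule l2_norm_mono[OF s\<sigma> E2])
    also have "\<dots> = (1 + real N) * l2_norm \<sigma>" by (subst l2_norm_scale[OF \<sigma>(1)]) simp
    also have "\<dots> \<le> (1 + real N) * (real N * l2_norm y)" by (intro mult_left_mono \<sigma>) simp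
    finally show ?thesis .
  qed
  have E: "E = (\<lambda>n. (E n - E1 n) + E1 n)" by simp
  show "square_summable E" by (subst E) (rule square_summable_add[OF sE2 E1(1)])
  have "l2_norm E \<le> l2_norm (\<lambda>n. E n - E1 n) + l2_norm E1" by (subst E) (rule l2_norm_triangle[OF sE2 E1(1)])
  then show "l2_norm E \<le> (1 + (1 + real N) * real N) * l2_norm y"
    using nE2 E1(2) by (simp add: algebra_simps)
qed

text \<open>The same block diagonal map acts on both components, and its commutator with Omega is
  bounded by the second component alone. Hence the coefficient of the full norm is \<open>a\<close>,
  whatever the block sizes; only \<open>C\<close> depends on them, and \<open>C\<close> is invisible
  to \<open>S_norm\<close> and \<open>ultra_norm\<close>.\<close>

lemma walsh_op_exists:
  assumes c: "\<And>k. \<bar>c k\<bar> \<le> a" "a \<le> 1" "\<And>k. K < k \<Longrightarrow> c k = 0"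
  shows "\<exists>A :: 'k::rc_field kp_op. \<exists>C\<ge>0. \<forall>z.
    kp_fst (kp_apply A z) = walsh_map c (kp_fst z) \<and> kp_snd (kp_apply A z) = walsh_map c (kp_snd z) \<and>
    kp_norm (kp_apply A z) \<le> a * kp_norm z + C * l2_norm (kp_snd z)"
proof -
  define N where "N = Max (block_size ` {..K})"
  have N: "block_size k \<le> N" if "k \<le> K" for k using that by (auto simp: N_def)
  define C where "C = 1 + (1 + real N) * real N"
  have C: "C \<ge> 0" by (simp add: C_def)
  have a: "0 \<le> a" using c(1)[of 0] by linarith
  have c1: "\<bar>c k\<bar> \<le> 1" for k using c(1)[of k] c(2) by linarith
  define f :: "'k kp \<Rightarrow> 'k kp" where "f z = kp_mk (walsh_map c (kp_fst z)) (walsh_map c (kp_snd z))" for z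
  define E where "E z n = Omega (walsh_map c (kp_snd z)) n - walsh_map c (Omega (kp_snd z)) n" for z :: "'k kp" and n
  have E: "square_summable (E z)" "l2_norm (E z) \<le> C * l2_norm (kp_snd z)" for z
    unfolding E_def C_def
    by (rule walsh_map_Omega[of "kp_snd z" c K N, OF kp_snd_square_summable c1 c(3) N]; assumption)+
  have res: "(\<lambda>n. walsh_map c (kp_fst z) n - Omega (walsh_map c (kp_snd z)) n) = (\<lambda>n. walsh_map c (kp_res z) n - E z n)" for z :: "'k kp"
  proof
    fix n
    have "kp_fst z = (\<lambda>n. kp_res z n + Omega (kp_snd z) n)" by (simp add: kp_res_def)
    then have "walsh_map c (kp_fst z) n = walsh_map c (kp_res z) n + walsh_map c (Omega (kp_snd z)) n"
      by (simp only: walsh_map_add)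
    then show "walsh_map c (kp_fst z) n - Omega (walsh_map c (kp_snd z)) n = walsh_map c (kp_res z) n - E z n"
      by (simp add: E_def)
  qed
  have sel: "kp_fst (f z) = walsh_map c (kp_fst z)" "kp_snd (f z) = walsh_map c (kp_snd z)" for z
    unfolding f_def
    by (intro kp_mk_sel walsh_map_l2[OF _ c(1)] kp_snd_square_summable, unfold res,
        intro square_summable_diff walsh_map_l2[OF _ c(1)] kp_res_square_summable E)+
  have bound: "kp_norm (f z) \<le> a * kp_norm z + C * l2_norm (kp_snd z)" for z
  proof -
    have "l2_norm (kp_res (f z)) \<le> l2_norm (walsh_map c (kp_res z)) + l2_norm (E z)"
      unfolding kp_res_def[of "f z"] sel res
      by (intro l2_norm_triangle_diff walsh_map_l2(1)[OF _ c(1)] kp_res_square_summable E)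
    also have "\<dots> \<le> a * l2_norm (kp_res z) + C * l2_norm (kp_snd z)"
      by (intro add_mono walsh_map_l2 E kp_res_square_summable c)
    finally have "l2_norm (kp_res (f z)) \<le> a * l2_norm (kp_res z) + C * l2_norm (kp_snd z)" .
    moreover have "l2_norm (kp_snd (f z)) \<le> a * l2_norm (kp_snd z)"
      unfolding sel by (intro walsh_map_l2 kp_snd_square_summable c)
    ultimately show ?thesis unfolding kp_norm_eq by (simp add: algebra_simps)
  qed
  have "\<exists>A. kp_apply A = f"
  proof (rule kp_op_exists[where C = "a + C"])
    show "f (z + w) = f z + f w" for z w by (rule kp_eqI) (simp_all add: sel kp_sel walsh_map_add)
    show "f (kp_scale r z) = kp_scale r (f z)" for r z by (rule kp_eqI) (simp_all add: sel kp_sel walsh_map_scale)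
    show "kp_norm (f z) \<le> (a + C) * kp_norm z" for z
      using bound[of z] mult_left_mono[OF l2_snd_le[of z] C] by (simp add: distrib_right)
  qed
  then obtain A where "kp_apply A = f" by blast
  then show ?thesis using C bound sel by (intro exI[of _ A] exI[of _ C]) simp
qed

section \<open>The partial sums of the series\<close>

definition walsh_coeff :: "nat \<Rightarrow> nat \<Rightarrow> real"
  where "walsh_coeff m k = (if k \<le> m then 1 / real (Suc k) else 0)"

text \<open>The two equations determine both components of every value, so the choice is
  unique.\<close>

definition walsh_op :: "nat \<Rightarrow> 'k::rc_field kp_op"
  where "walsh_op m = (SOME A. \<forall>z. kp_fst (kp_apply A z) = walsh_map (walsh_coeff m) (kp_fst z) \<and>
    kp_snd (kp_apply A z) = walsh_map (walsh_coeff m) (kp_snd z))"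

lemma walsh_op_sel:
  "kp_fst (kp_apply (walsh_op m) z) = walsh_map (walsh_coeff m) (kp_fst z)"
  "kp_snd (kp_apply (walsh_op m) z) = walsh_map (walsh_coeff m) (kp_snd (z :: 'k::rc_field kp))"
proof -
  have "\<bar>walsh_coeff m k\<bar> \<le> 1" "m < k \<Longrightarrow> walsh_coeff m k = 0" for k by (auto simp: walsh_coeff_def)
  from walsh_op_exists[of "walsh_coeff m" 1 m, OF this(1) order_refl this(2)]
  have "\<exists>A :: 'k kp_op. \<forall>z. kp_fst (kp_apply A z) = walsh_map (walsh_coeff m) (kp_fst z) \<and>
    kp_snd (kp_apply A z) = walsh_map (walsh_coeff m) (kp_snd z)" by blast
  from someI_ex[OF this]
  show "kp_fst (kp_apply (walsh_op m) z) = walsh_map (walsh_coeff m) (kp_fst z)"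
    "kp_snd (kp_apply (walsh_op m) z) = walsh_map (walsh_coeff m) (kp_snd z)"
    unfolding walsh_op_def by blast+
qed

text \<open>The coefficients of the difference vanish up to \<open>p\<close> and are at most 1 /
  (p+1) in modulus beyond it. \<open>C\<close> may grow with \<open>m\<close> and \<open>n\<close>,
  as it is attached to the second component only.\<close>

lemma walsh_op_diff_bound:
  assumes p: "p \<le> m" "p \<le> n"
  shows "\<exists>C\<ge>0. \<forall>z. kp_norm (kp_apply (walsh_op m - walsh_op n :: 'k::rc_field kp_op) z)
    \<le> 1 / real (Suc p) * kp_norm z + C * l2_norm (kp_snd z)"
proof -
  define c where "c k = walsh_coeff m k - walsh_coeff n k" for k
  have "\<bar>c k\<bar> \<le> 1 / real (Suc p)" for k
  proof (cases "k \<le> p")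
    case False
    then have "1 / real (Suc k) \<le> 1 / real (Suc p)" by (intro divide_left_mono) auto
    then show ?thesis by (auto simp: c_def walsh_coeff_def)
  qed (use p in \<open>auto simp: c_def walsh_coeff_def\<close>)
  moreover have "c k = 0" if "max m n < k" for k using that by (auto simp: c_def walsh_coeff_def)
  ultimately have "\<exists>A :: 'k kp_op. \<exists>C\<ge>0. \<forall>z.
    kp_fst (kp_apply A z) = walsh_map c (kp_fst z) \<and> kp_snd (kp_apply A z) = walsh_map c (kp_snd z) \<and>
    kp_norm (kp_apply A z) \<le> 1 / real (Suc p) * kp_norm z + C * l2_norm (kp_snd z)"
    by (intro walsh_op_exists[where K = "max m n"]) auto
  then obtain A :: "'k kp_op" and C where C: "C \<ge> 0" "\<And>z. kp_norm (kp_apply A z) \<le> 1 / real (Suc p) * kp_norm z + C * l2_norm (kp_snd z)"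
    and A: "\<And>z. kp_fst (kp_apply A z) = walsh_map c (kp_fst z)" "\<And>z. kp_snd (kp_apply A z) = walsh_map c (kp_snd z)"
    by blast
  have "walsh_map c x k = walsh_map (walsh_coeff m) x k - walsh_map (walsh_coeff n) x k" for x :: "nat \<Rightarrow> 'k" and k
    by (simp add: walsh_map_def c_def left_diff_distrib)
  then have "kp_apply (walsh_op m - walsh_op n) z = kp_apply A z" for z
    unfolding kp_apply_minus by (intro kp_eqI) (simp_all add: kp_sel A walsh_op_sel fun_eq_iff)
  then show ?thesis using C by auto
qed

text \<open>Every subspace contains one on which second components are at most e / (C + 1) times the
  norm; there the term with \<open>C\<close> is absorbed by \<open>e\<close>.\<close>

lemma walsh_op_S_norm:
  assumes p: "p \<le> m" "p \<le> n"
  shows "S_norm (walsh_op m - walsh_op n :: 'k::rc_field kp_op) \<le> 1 / real (Suc p)"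
proof (rule field_le_epsilon)
  fix e :: real assume e: "e > 0"
  obtain C where C: "C \<ge> 0" "\<And>z. kp_norm (kp_apply (walsh_op m - walsh_op n :: 'k kp_op) z)
    \<le> 1 / real (Suc p) * kp_norm z + C * l2_norm (kp_snd z)" using walsh_op_diff_bound[OF p] by metis
  have "S_bound (walsh_op m - walsh_op n :: 'k kp_op) (1 / real (Suc p) + e)"
    unfolding S_bound_def
  proof (intro allI impI)
    fix Y :: "'k kp set" assume Y: "inf_dim_closed_subspace Y"
    have "e / (C + 1) > 0" using e C(1) by simp
    from kp_snd_small_on_subspace[OF Y this, of 1] obtain Z where Z: "inf_dim_closed_subspace Z" "Z \<subseteq> Y"
      "\<And>z. z \<in> Z \<Longrightarrow> l2_norm (kp_snd z) \<le> e / (C + 1) * kp_norm z" by (auto simp: one_kp_op.rep_eq)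
    have "kp_norm (kp_apply (walsh_op m - walsh_op n :: 'k kp_op) z) \<le> (1 / real (Suc p) + e) * kp_norm z" if "z \<in> Z" for z
    proof -
      have "C * l2_norm (kp_snd z) \<le> C * (e / (C + 1) * kp_norm z)" by (intro mult_left_mono Z(3) that C)
      also have "\<dots> = C / (C + 1) * (e * kp_norm z)" by simp
      also have "\<dots> \<le> 1 * (e * kp_norm z)" using C(1) e kp_norm_nonneg[of z] by (intro mult_right_mono) auto
      finally show ?thesis using C(2)[of z] by (simp add: distrib_right)
    qed
    then show "\<exists>Z. inf_dim_closed_subspace Z \<and> Z \<subseteq> Y \<and> (\<forall>z\<in>Z. kp_norm (kp_apply (walsh_op m - walsh_op n) z) \<le> (1 / real (Suc p) + e) * kp_norm z)"
      using Z(1,2) by blast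
  qed
  then show "S_norm (walsh_op m - walsh_op n :: 'k kp_op) \<le> 1 / real (Suc p) + e"
    using e by (intro S_norm_le) (auto intro: add_nonneg_pos)
qed

section \<open>The sequence has no limit\<close>

text \<open>Up to ln (sqrt k) times a sum of k vectors (e_n, 0), a sum of k vectors (0, e_n) is a
  flat vector of norm sqrt k. Its image under \<open>R\<close> is thus of size at most sqrt k (7 M +
  14 \<delta> ln (sqrt k)) on a suitable subsequence. Second components above 200 \<delta> would
  force growth with factor 200 \<delta> / 14 before the logarithm, and 200 / 14 > 14.\<close>

lemma kp_snd_units2_small:
  fixes R :: "'k::rc_field kp_op"
  assumes \<delta>: "\<delta> > 0" and ev: "eventually (\<lambda>n. kp_norm (kp_apply R (kp_unit n)) \<le> \<delta>) sequentially"
  shows "eventually (\<lambda>n. l2_norm (kp_snd (kp_apply R (kp_unit2 n))) \<le> 200 * \<delta>) sequentially"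
proof (rule ccontr)
  assume neg: "\<not> ?thesis"
  obtain n0 where n0: "\<And>n. n \<ge> n0 \<Longrightarrow> kp_norm (kp_apply R (kp_unit n)) \<le> \<delta>" using ev unfolding eventually_sequentially by blast
  define S where "S = {n. n0 \<le> n \<and> 200 * \<delta> \<le> l2_norm (kp_snd (kp_apply R (kp_unit2 n)))}"
  have "infinite S"
    unfolding infinite_nat_iff_unbounded_le
  proof
    fix m
    from neg obtain n where "n \<ge> max m n0" "\<not> l2_norm (kp_snd (kp_apply R (kp_unit2 n))) \<le> 200 * \<delta>"
      unfolding eventually_sequentially by blast
    then show "\<exists>n\<ge>m. n \<in> S" unfolding S_def by (intro exI[of _ n]) simp
  qed
  obtain M where M: "M > 0" "\<And>z. kp_norm (kp_apply R z) \<le> M * kp_norm z" using kp_apply_bound[of R] by metis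
  have S\<delta>: "kp_norm (kp_apply R (kp_unit n)) \<le> \<delta>" if "n \<in> S" for n using n0 that by (simp add: S_def)
  from almost_isometric_subsequence[OF \<open>infinite S\<close>, of 0 R \<delta> \<delta>, OF kp_norm_nonneg S\<delta> \<delta>]
  obtain r J where r: "strict_mono r" "\<And>i. r i \<in> S" and J: "\<And>n. kp_apply J (kp_unit n) = kp_unit (r n)"
    and up: "\<And>a. square_summable a \<Longrightarrow> kp_norm (kp_apply R (kp_apply J (kp_inj a))) \<le> (\<delta> + \<delta>) * l2_norm a"
    by blast
  have M2: "kp_norm (kp_apply R (kp_unit2 (r n))) \<le> M" for n using M(2)[of "kp_unit2 (r n)"] by (simp add: kp_norm_unit2)
  have null: "(\<lambda>m. kp_fst (kp_apply R (kp_unit2 (r m))) k) \<longlonglongrightarrow> 0" "(\<lambda>m. kp_snd (kp_apply R (kp_unit2 (r m))) k) \<longlonglongrightarrow> 0" for k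
    using LIMSEQ_subseq_LIMSEQ[OF kp_apply_units_null(2) r(1)] LIMSEQ_subseq_LIMSEQ[OF kp_apply_units_null(4) r(1)]
    by (simp_all add: o_def)
  have big: "200 * \<delta> \<le> l2_norm (kp_snd (kp_apply R (kp_unit2 (r n))))" for n using r(2)[of n] by (simp add: S_def)
  from null_sequence_sums[of "\<lambda>n. kp_apply R (kp_unit2 (r n))", OF null M2 _ big] \<delta>
  obtain r2 c where r2: "strict_mono r2"
    and lo: "\<And>k. (1::nat) \<le> k \<Longrightarrow> sqrt k * (200 * \<delta> / 14 * ln (sqrt k) - c) \<le> kp_norm (\<Sum>i<k. kp_apply R (kp_unit2 (r (r2 i))))"
    by auto
  have "200 * \<delta> / 14 - 14 * \<delta> > 0" using \<delta> by simp
  moreover have "(200 * \<delta> / 14 - 14 * \<delta>) * ln (sqrt k) \<le> 7 * M + c" if k: "(1::nat) \<le> k" for k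
  proof -
    define H where "H = r2 ` {..<k}"
    define G where "G = r ` H"
    have inj2: "inj_on r2 {..<k}" and inj: "inj_on r H" using strict_mono_imp_inj_on r2 r(1) by blast+
    have H: "finite H" "card H = k" by (simp_all add: H_def card_image[OF inj2])
    have G: "finite G" "card G = k" by (simp_all add: G_def H card_image[OF inj])
    have l: "0 \<le> ln (sqrt k)" using k by simp
    let ?f = "flat_vector G (\<lambda>_. 1) :: 'k kp" and ?x = "\<Sum>n\<in>H. kp_scale 1 (kp_unit n) :: 'k kp"
    have "?f = kp_scale (of_real (ln (sqrt k))) (kp_apply J ?x) + (\<Sum>n\<in>G. kp_unit2 n)"
      unfolding flat_vector_def G(2) kp_apply_sum kp_apply_scale J
      by (simp add: sum.distrib kp.scale_sum_right G_def sum.reindex[OF inj])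
    then have "kp_apply R (\<Sum>n\<in>G. kp_unit2 n) = kp_apply R ?f - kp_scale (of_real (ln (sqrt k))) (kp_apply R (kp_apply J ?x))"
      by (simp add: kp_apply_add kp_apply_scale)
    moreover have "kp_apply R (\<Sum>n\<in>G. kp_unit2 n) = (\<Sum>i<k. kp_apply R (kp_unit2 (r (r2 i))))"
      by (simp add: kp_apply_sum G_def H_def sum.reindex[OF inj[unfolded H_def]] sum.reindex[OF inj2])
    ultimately have "kp_norm (\<Sum>i<k. kp_apply R (kp_unit2 (r (r2 i))))
      \<le> 7 * (kp_norm (kp_apply R ?f) + kp_norm (kp_scale (of_real (ln (sqrt k))) (kp_apply R (kp_apply J ?x))))"
      using kp_norm_diff by metis
    also have "kp_norm (kp_apply R ?f) \<le> M * sqrt k"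
      using M(2)[of ?f] by (simp add: kp_norm_flat_vector G)
    also have "kp_norm (kp_scale (of_real (ln (sqrt k))) (kp_apply R (kp_apply J ?x))) \<le> ln (sqrt k) * ((\<delta> + \<delta>) * sqrt k)"
    proof -
      have "kp_norm (kp_apply R (kp_apply J ?x)) \<le> (\<delta> + \<delta>) * sqrt k"
        using up[of "\<lambda>k. if k \<in> H then 1 else 0"] l2_norm_flat[OF H(1), of "\<lambda>_. 1 :: 'k"]
        unfolding sum_units_eq[OF H(1), of "\<lambda>_. 1 :: 'k"] H(2) by simp
      then show ?thesis using l by (simp add: kp_norm_scale mult_left_mono)
    qed
    finally have "sqrt k * (200 * \<delta> / 14 * ln (sqrt k) - c) \<le> 7 * (M * sqrt k + ln (sqrt k) * ((\<delta> + \<delta>) * sqrt k))"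
      using lo[OF k] by simp
    also have "\<dots> = sqrt k * (7 * M + 14 * \<delta> * ln (sqrt k))" by (simp add: algebra_simps)
    finally have "200 * \<delta> / 14 * ln (sqrt k) - c \<le> 7 * M + 14 * \<delta> * ln (sqrt k)"
      by (rule mult_left_le_imp_le) (use k in simp)
    then show ?thesis unfolding left_diff_distrib by linarith
  qed
  ultimately show False by (rule ln_sqrt_unbounded)
qed

section \<open>Comparison of matrix entries on a single block\<close>

lemma L2_set_le_l2_norm:
  assumes x: "square_summable x" and i: "inj_on i {..<N::nat}"
  shows "L2_set (\<lambda>s. norm (x (i s))) {..<N} \<le> l2_norm x"
proof -
  have "(\<Sum>s<N. (norm (x (i s)))\<^sup>2) = (\<Sum>n\<in>i ` {..<N}. (norm (x n))\<^sup>2)" by (simp add: sum.reindex[OF i])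
  also have "\<dots> \<le> (l2_norm x)\<^sup>2" by (intro l2_partial_le x) simp
  finally show ?thesis unfolding L2_set_def using l2_norm_nonneg[OF x] by (intro real_le_lsqrt sum_nonneg) auto
qed

text \<open>Reads off finitely many entries of z + w with the logarithms of z alone. Exchanging
  Omega of the sum for Omega of z costs the quasi-linearity constant 6 and Omega of the second
  component of w, which is bounded only coordinate by coordinate, whence sqrt N.\<close>

lemma kp_local_bound:
  assumes i: "inj_on i {..<N::nat}"
  shows "L2_set (\<lambda>s. norm (kp_fst z (i s) + kp_fst w (i s) - Omega (kp_snd z) (i s))) {..<N}
    \<le> kp_norm (z + w) + 6 * (l2_norm (kp_snd z) + l2_norm (kp_snd w)) + sqrt N * l2_norm (kp_snd w)"
proof -
  define q where "q n = Omega (\<lambda>n. kp_snd z n + kp_snd w n) n - Omega (kp_snd z) n - Omega (kp_snd w) n" for n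
  have q: "square_summable q" "l2_norm q \<le> 6 * (l2_norm (kp_snd z) + l2_norm (kp_snd w))"
    unfolding q_def by (rule Omega_quasi_linear; rule kp_snd_square_summable)+
  have eq: "kp_fst z n + kp_fst w n - Omega (kp_snd z) n = kp_res (z + w) n + q n + Omega (kp_snd w) n" for n
    by (simp add: kp_res_def kp_sel q_def)
  have "L2_set (\<lambda>s. norm (kp_fst z (i s) + kp_fst w (i s) - Omega (kp_snd z) (i s))) {..<N}
    \<le> L2_set (\<lambda>s. (norm (kp_res (z + w) (i s)) + norm (q (i s))) + norm (Omega (kp_snd w) (i s))) {..<N}"
    unfolding eq by (intro L2_set_mono order_trans[OF norm_triangle_ineq] add_right_mono norm_triangle_ineq) auto
  also have "\<dots> \<le> L2_set (\<lambda>s. norm (kp_res (z + w) (i s)) + norm (q (i s))) {..<N} + L2_set (\<lambda>s. norm (Omega (kp_snd w) (i s))) {..<N}"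
    by (rule L2_set_triangle_ineq)
  also have "L2_set (\<lambda>s. norm (kp_res (z + w) (i s)) + norm (q (i s))) {..<N}
    \<le> L2_set (\<lambda>s. norm (kp_res (z + w) (i s))) {..<N} + L2_set (\<lambda>s. norm (q (i s))) {..<N}"
    by (rule L2_set_triangle_ineq)
  also have "\<dots> \<le> kp_norm (z + w) + 6 * (l2_norm (kp_snd z) + l2_norm (kp_snd w))"
    using L2_set_le_l2_norm[OF kp_res_square_summable i, of "z + w"] L2_set_le_l2_norm[OF q(1) i] q(2) l2_res_le[of "z + w"] by linarith
  also have "L2_set (\<lambda>s. norm (Omega (kp_snd w) (i s))) {..<N} \<le> sqrt N * l2_norm (kp_snd w)"
  proof -
    have "L2_set (\<lambda>s. norm (Omega (kp_snd w) (i s))) {..<N} \<le> L2_set (\<lambda>s. l2_norm (kp_snd w)) {..<N}"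
      by (intro L2_set_mono norm_Omega_le kp_snd_square_summable) auto
    then show ?thesis using l2_norm_nonneg[OF kp_snd_square_summable[of w]] by (simp add: L2_set_constant)
  qed
  finally show ?thesis by simp
qed

lemma walsh_map_unit:
  assumes t: "t < block_size k"
  shows "walsh_map c (\<lambda>n. if n = block_index k b t then 1 else 0 :: 'k::rc_field) n
    = (if block_id n = prod_encode (k, b) then of_real (c k * unit_walsh k (block_pos n) t) else 0)"
proof (cases "block_id n = prod_encode (k, b)")
  case True
  then have n: "block_kind n = k" "block_number n = b" by (simp_all add: block_id_def)
  have "(\<Sum>s<block_size k. of_real (unit_walsh k (block_pos n) s) * (if block_index k b s = block_index k b t then 1 else 0 :: 'k))
    = (\<Sum>s<block_size k. if s = t then of_real (unit_walsh k (block_pos n) s) else 0)"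
    using t by (intro sum.cong) (auto simp: block_index_eq_iff)
  then show ?thesis using True t by (simp add: walsh_map_def n)
next
  case False
  have "(if block_index (block_kind n) (block_number n) s = block_index k b t then 1 else 0 :: 'k) = 0"
    if "s < block_size (block_kind n)" for s
  proof -
    have "block_index (block_kind n) (block_number n) s \<noteq> block_index k b t"
      using False block_index_sel[OF that] block_index_sel[OF t] unfolding block_id_def by metis
    then show ?thesis by simp
  qed
  then show ?thesis using False by (simp add: walsh_map_def)
qed

lemma walsh_map_row:
  assumes j: "j < block_size k"
  shows "walsh_map c (\<lambda>n. if block_id n = prod_encode (k, b) then of_real (walsh ((Suc k)\<^sup>2) j (block_pos n)) else 0 :: 'k::rc_field)
    = (\<lambda>n. if n = block_index k b j then of_real (c k * sqrt (block_size k)) else 0)" (is "walsh_map c ?h = _")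
proof
  fix n
  show "walsh_map c ?h n = (if n = block_index k b j then of_real (c k * sqrt (block_size k)) else 0)"
  proof (cases "block_id n = prod_encode (k, b)")
    case True
    then have n: "block_kind n = k" "block_number n = b" by (simp_all add: block_id_def)
    define t where "t = block_pos n"
    have t: "t < block_size k" using block_pos_less[of n] by (simp add: t_def n)
    have nt: "n = block_index k b t" using block_index_inverse[of n] by (simp add: t_def n)
    have id: "block_id (block_index k b s) = prod_encode (k, b)" "block_pos (block_index k b s) = s" if "s < block_size k" for s
      using block_index_sel[OF that] by (simp_all add: block_id_def)
    have "walsh_map c ?h n = of_real (c k) * (\<Sum>s<block_size k. of_real (unit_walsh k t s) * of_real (walsh ((Suc k)\<^sup>2) j s))"
      unfolding walsh_map_def n t_def[symmetric] by (simp add: id)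
    also have "(\<Sum>s<block_size k. of_real (unit_walsh k t s) * of_real (walsh ((Suc k)\<^sup>2) j s) :: 'k)
       = of_real (sqrt (block_size k) * (\<Sum>s<block_size k. unit_walsh k t s * unit_walsh k j s))"
      unfolding sum_distrib_left of_real_sum
      using block_size_pos[of k] by (intro sum.cong refl) (simp add: unit_walsh_def[of k j])
    also have "\<dots> = of_real (sqrt (block_size k) * (if t = j then 1 else 0))"
      by (simp only: unit_walsh_orthogonal[OF t j])
    finally show ?thesis using t j by (auto simp: nt block_index_eq_iff)
  next
    case False
    then have "n \<noteq> block_index k b j" using block_index_sel[OF j] unfolding block_id_def by metis
    moreover have "?h (block_index (block_kind n) (block_number n) s) = 0" if "s < block_size (block_kind n)" for s
      using False block_index_sel[OF that] unfolding block_id_def by auto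
    ultimately show ?thesis by (simp add: walsh_map_def)
  qed
qed

text \<open>Read an operator close to \<open>a U\<close> on a block of size \<open>N\<close> as a matrix with respect to the two components
  of \<open>Z\<^sub>2\<close>. Its upper right entry has to be near \<open>a (ln N / 2) U\<close> because of the unit vectors, which \<open>U\<close>
  flattens, and near \<open>- a (ln N / 2) U\<close> because of the rows of \<open>U\<close>, which it maps to multiples of unit vectors.
  Comparing traces bounds \<open>a ln N\<close>.\<close>

lemma walsh_coefficient_bound:
  fixes B :: "'k::rc_field kp_op"
  assumes M: "M > 0" "\<And>z. kp_norm (kp_apply B z) \<le> M * kp_norm z"
    and ev: "\<And>\<delta>. \<delta> > 0 \<Longrightarrow> \<exists>m0. \<forall>m\<ge>m0. eventually (\<lambda>n. kp_norm (kp_apply (B - walsh_op m) (kp_unit n)) \<le> \<delta>) sequentially"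
  shows "ln (block_size p) / real (Suc p) \<le> 2 * M + 13"
proof -
  define N where "N = block_size p"
  define x where "x = sqrt (real N)"
  define L where "L = ln x"
  define a where "a = 1 / real (Suc p)"
  have N1: "1 \<le> real N" using block_size_pos[of p] by (simp add: N_def)
  have x1: "1 \<le> x" using N1 by (simp add: x_def)
  have xx: "x * x = real N" using N1 by (simp add: x_def)
  have L0: "0 \<le> L" using x1 by (simp add: L_def)
  have a: "0 < a" "a \<le> 1" by (simp_all add: a_def)
  \<comment> \<open>Collects the coefficients of \<open>\<delta>\<close> in the final inequality,
    once \<open>b1\<close>, \<open>b2\<close> and \<open>W\<close> are expanded; the choice of
    \<open>\<delta>\<close> bounds their total contribution by 1.\<close>
  define K where "K = (6 + x) * real N * (L + 200) + real N * L + 1200 * x + 200 * real N"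
  have K0: "0 \<le> K" using N1 x1 L0 by (simp add: K_def)
  define \<delta> where "\<delta> = 1 / (K + 1)"
  have \<delta>: "\<delta> > 0" "\<delta> * K \<le> 1" using K0 by (simp_all add: \<delta>_def)
  obtain m0 where m0: "\<And>m. m \<ge> m0 \<Longrightarrow> eventually (\<lambda>n. kp_norm (kp_apply (B - walsh_op m) (kp_unit n)) \<le> \<delta>) sequentially"
    using ev[OF \<delta>(1)] by blast
  define m where "m = max m0 p"
  define A :: "'k kp_op" where "A = walsh_op m"
  define R where "R = B - A"
  have evR: "eventually (\<lambda>n. kp_norm (kp_apply R (kp_unit n)) \<le> \<delta>) sequentially"
    unfolding R_def A_def by (rule m0) (simp add: m_def)
  \<comment> \<open>The index threshold is used as the number of the block as well: all coordinates
    of block \<open>b\<close> in row \<open>p\<close> are at least \<open>b\<close>, so both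
    estimates hold on the whole block.\<close>
  obtain b where b: "\<And>n. n \<ge> b \<Longrightarrow> kp_norm (kp_apply R (kp_unit n)) \<le> \<delta> \<and> l2_norm (kp_snd (kp_apply R (kp_unit2 n))) \<le> 200 * \<delta>"
    using eventually_conj[OF evR kp_snd_units2_small[OF \<delta>(1) evR]] unfolding eventually_sequentially by blast
  define c where "c = walsh_coeff m"
  have cp: "c p = a" by (simp add: c_def walsh_coeff_def a_def m_def)
  have BA: "kp_apply B z = kp_apply A z + kp_apply R z" for z by (simp add: R_def kp_apply_minus)
  define i where "i = block_index p b"
  have inj: "inj_on i {..<N}" unfolding i_def N_def by (rule block_index_inj)
  have ib: "b \<le> i t" for t
  proof -
    have "b \<le> b * N" using N1 by simp
    also have "\<dots> \<le> prod_encode (p, b * N + t)" using le_prod_encode_2[of "b * N + t" p] by linarith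
    finally show ?thesis by (simp add: i_def block_index_def N_def)
  qed
  have RE: "kp_norm (kp_apply R (kp_unit (i t))) \<le> \<delta>" and RF: "l2_norm (kp_snd (kp_apply R (kp_unit2 (i t)))) \<le> 200 * \<delta>" for t
    using b[OF ib] by blast+
  define U where "U = unit_walsh p"
  define h where "h = walsh ((Suc p)\<^sup>2)"
  have Uh: "U t s = h t s / x" for t s by (simp add: U_def h_def unit_walsh_def x_def N_def)
  have hh: "h t s * h t s = 1" "\<bar>h t s\<bar> = 1" for t s by (simp_all add: h_def walsh_square abs_walsh)
  have G: "{n. block_id n = prod_encode (p, b)} = i ` {..<N}" unfolding i_def N_def by (rule block_id_fibre)
  have idi: "block_id (i t) = prod_encode (p, b)" "block_pos (i t) = t" if "t < N" for t
    using that by (simp_all add: i_def N_def block_id_def block_index_sel)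
  \<comment> \<open>The upper right matrix entries. \<open>A\<close> contributes none, since it acts
    on the two components separately, so \<open>P\<close> belongs to \<open>B\<close> as much as to
    \<open>R\<close>. \<open>Q\<close> is the deviation from the value dictated by the unit
    vectors.\<close>
  define P where "P t j = kp_fst (kp_apply R (kp_unit2 (i t))) (i j)" for t j
  define Q where "Q t j = P t j - of_real (a * U j t * L)" for t j
  define b1 where "b1 = M + 6 * (a + 200 * \<delta>) + x * (200 * \<delta>)"

  have unit_rows: "L2_set (\<lambda>j. norm (Q t j)) {..<N} \<le> b1" if t: "t < N" for t
  proof -
    let ?z = "kp_apply A (kp_unit2 (i t))" and ?w = "kp_apply R (kp_unit2 (i t))"
    have fst: "kp_fst ?z = (\<lambda>n. 0)"
      unfolding A_def walsh_op_sel kp_unit2_sel by (simp add: walsh_map_def fun_eq_iff)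
    have snd: "kp_snd ?z = (\<lambda>n. if block_id n = prod_encode (p, b) then of_real (a * U (block_pos n) t) else 0)"
      unfolding A_def walsh_op_sel kp_unit2_sel i_def c_def[symmetric]
      using t by (simp add: walsh_map_unit fun_eq_iff cp U_def N_def)
    have "(l2_norm (kp_snd ?z))\<^sup>2 = (\<Sum>n | block_id n = prod_encode (p, b). (norm (kp_snd ?z n))\<^sup>2)"
    proof (rule l2_norm_finite)
      show "finite {n. block_id n = prod_encode (p, b)}" unfolding G by simp
    qed (simp add: snd)
    also have "\<dots> = (\<Sum>s<N. (norm (kp_snd ?z (i s)))\<^sup>2)" unfolding N_def i_def by (rule sum_block)
    also have "\<dots> = (\<Sum>s<N. a\<^sup>2 * (U t s * U t s))"
      by (intro sum.cong refl) (simp add: snd idi U_def unit_walsh_commute[of p t] power2_eq_square[of "unit_walsh p _ _"] power_mult_distrib del: of_real_mult)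
    also have "\<dots> = a\<^sup>2" unfolding sum_distrib_left[symmetric] U_def N_def
      using t by (simp add: unit_walsh_orthogonal N_def)
    finally have ln: "l2_norm (kp_snd ?z) = a"
      using a l2_norm_nonneg[OF kp_snd_square_summable, of ?z] by (simp add: power2_eq_iff_nonneg)
    \<comment> \<open>The image has norm \<open>a\<close> and all its entries on the block have
      modulus a / sqrt N, so Omega multiplies it by \<open>L\<close>. The first component of
      \<open>A\<close> on this vector is 0, which leaves \<open>R\<close> to compensate.\<close>
    have Om: "Omega (kp_snd ?z) (i j) = of_real (a * U j t * L)" if j: "j < N" for j
    proof -
      have "norm (kp_snd ?z (i j)) = a / x" using a x1 j by (simp add: snd idi Uh norm_mult norm_divide hh)
      then have "ln (norm (kp_snd ?z (i j))) = ln a - L" using a x1 by (simp add: ln_div L_def)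
      then have "Omega (kp_snd ?z) (i j) = of_real (ln a - (ln a - L)) * kp_snd ?z (i j)"
        by (simp only: Omega_ln[OF kp_snd_square_summable] ln)
      then show ?thesis using j by (simp add: snd idi)
    qed
    have "L2_set (\<lambda>j. norm (Q t j)) {..<N} = L2_set (\<lambda>j. norm (kp_fst ?z (i j) + kp_fst ?w (i j) - Omega (kp_snd ?z) (i j))) {..<N}"
      by (rule L2_set_cong) (simp_all add: Om fst Q_def P_def)
    also have "\<dots> \<le> kp_norm (?z + ?w) + 6 * (l2_norm (kp_snd ?z) + l2_norm (kp_snd ?w)) + x * l2_norm (kp_snd ?w)"
      unfolding x_def by (rule kp_local_bound[OF inj])
    also have "kp_norm (?z + ?w) \<le> M" using M(2)[of "kp_unit2 (i t)"] by (simp add: BA kp_norm_unit2)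
    also have "M + 6 * (l2_norm (kp_snd ?z) + l2_norm (kp_snd ?w)) + x * l2_norm (kp_snd ?w) \<le> b1"
      unfolding b1_def ln using RF[of t] x1 by (intro add_mono mult_left_mono) auto
    finally show ?thesis by simp
  qed

  define W where "W = real N * (L * \<delta> + 200 * \<delta>)"
  define b2 where "b2 = M * x + 6 * (a * x + W) + x * W"
  \<comment> \<open>\<open>A\<close> maps the flat vector of row \<open>j\<close> to a x (L e_j,
    e_j). Omega vanishes on multiples of e_j, so the entry a x L is uncompensated and
    \<open>R\<close> has to cancel it, contrary to the sign that \<open>unit_rows\<close> gives to
    \<open>P\<close>.\<close>
  have row: "2 * a * L * x \<le> b2 + real N * (L * \<delta>) + (\<Sum>t<N. norm (Q t j))" if j: "j < N" for j
  proof -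
    define \<theta> where "\<theta> n = (of_real (h j (block_pos n)) :: 'k)" for n :: nat
    let ?G = "i ` {..<N}"
    let ?f = "flat_vector ?G \<theta> :: 'k kp"
    have card: "card ?G = N" by (simp add: card_image[OF inj])
    have n\<theta>: "norm (\<theta> n) = 1" for n by (simp add: \<theta>_def hh)
    let ?z = "kp_apply A ?f" and ?w = "kp_apply R ?f"
    have row_eq: "walsh_map c (\<lambda>n. if n \<in> ?G then \<theta> n else 0) = (\<lambda>n. if n = i j then of_real (a * x) else 0)"
      using walsh_map_row[of j p c b] j
      unfolding \<theta>_def h_def N_def[symmetric] G[symmetric] i_def[symmetric] cp x_def by simp
    have snd: "kp_snd ?z = (\<lambda>n. if n = i j then of_real (a * x) else 0)"
      unfolding A_def walsh_op_sel c_def[symmetric] flat_vector_sel[OF finite_imageI[OF finite_lessThan]] by (rule row_eq)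
    have fst: "kp_fst ?z = (\<lambda>n. of_real L * (if n = i j then of_real (a * x) else 0))"
      unfolding A_def walsh_op_sel c_def[symmetric] flat_vector_sel[OF finite_imageI[OF finite_lessThan]] walsh_map_scale row_eq card
      by (simp add: L_def x_def)
    have "kp_snd ?z = (\<lambda>n. of_real (a * x) * (if n = i j then 1 else 0))" by (auto simp: snd)
    then have ln: "l2_norm (kp_snd ?z) = a * x"
      using a x1 by (simp add: l2_norm_scale square_summable_unit l2_norm_unit norm_mult abs_mult)
    have Om: "Omega (kp_snd ?z) (i j) = 0"
      using a x1 by (simp add: Omega_def ln) (simp add: snd norm_mult abs_mult)
    have fw: "?w = (\<Sum>t<N. kp_scale (\<theta> (i t)) (kp_scale (of_real L) (kp_apply R (kp_unit (i t))) + kp_apply R (kp_unit2 (i t))))"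
      unfolding flat_vector_def card kp_apply_sum sum.reindex[OF inj] by (simp add: kp_apply_scale kp_apply_add L_def x_def)
    have sw: "l2_norm (kp_snd ?w) \<le> W"
    proof -
      have s: "square_summable (\<lambda>n. \<theta> (i t) * (of_real L * kp_snd (kp_apply R (kp_unit (i t))) n + kp_snd (kp_apply R (kp_unit2 (i t))) n))" for t
        by (intro square_summable_scale square_summable_add kp_snd_square_summable)
      have each: "l2_norm (\<lambda>n. \<theta> (i t) * (of_real L * kp_snd (kp_apply R (kp_unit (i t))) n + kp_snd (kp_apply R (kp_unit2 (i t))) n)) \<le> L * \<delta> + 200 * \<delta>" for t
      proof -
        have "l2_norm (\<lambda>n. \<theta> (i t) * (of_real L * kp_snd (kp_apply R (kp_unit (i t))) n + kp_snd (kp_apply R (kp_unit2 (i t))) n))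
          = l2_norm (\<lambda>n. of_real L * kp_snd (kp_apply R (kp_unit (i t))) n + kp_snd (kp_apply R (kp_unit2 (i t))) n)"
          by (subst l2_norm_scale) (simp_all add: n\<theta> square_summable_scale square_summable_add kp_snd_square_summable)
        also have "\<dots> \<le> l2_norm (\<lambda>n. of_real L * kp_snd (kp_apply R (kp_unit (i t))) n) + l2_norm (kp_snd (kp_apply R (kp_unit2 (i t))))"
          by (intro l2_norm_triangle square_summable_scale kp_snd_square_summable)
        also have "l2_norm (\<lambda>n. of_real L * kp_snd (kp_apply R (kp_unit (i t))) n) = L * l2_norm (kp_snd (kp_apply R (kp_unit (i t))))"
          using L0 by (simp add: l2_norm_scale kp_snd_square_summable)
        also have "\<dots> \<le> L * \<delta>" using L0 order_trans[OF l2_snd_le RE] by (intro mult_left_mono) auto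
        finally show ?thesis using RF[of t] by simp
      qed
      have "kp_snd ?w = (\<lambda>n. \<Sum>t<N. \<theta> (i t) * (of_real L * kp_snd (kp_apply R (kp_unit (i t))) n + kp_snd (kp_apply R (kp_unit2 (i t))) n))"
        unfolding fw by (simp only: kp_sel)
      then have "l2_norm (kp_snd ?w) \<le> (\<Sum>t<N. l2_norm (\<lambda>n. \<theta> (i t) * (of_real L * kp_snd (kp_apply R (kp_unit (i t))) n + kp_snd (kp_apply R (kp_unit2 (i t))) n)))"
        using l2_norm_sum[of "{..<N}" "\<lambda>t n. \<theta> (i t) * (of_real L * kp_snd (kp_apply R (kp_unit (i t))) n + kp_snd (kp_apply R (kp_unit2 (i t))) n)"] s by simp
      also have "\<dots> \<le> (\<Sum>t<N. L * \<delta> + 200 * \<delta>)" by (intro sum_mono each)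
      finally show ?thesis by (simp add: W_def)
    qed
    have "norm (kp_fst ?z (i j) + kp_fst ?w (i j) - Omega (kp_snd ?z) (i j))
      \<le> L2_set (\<lambda>s. norm (kp_fst ?z (i s) + kp_fst ?w (i s) - Omega (kp_snd ?z) (i s))) {..<N}"
      using j by (intro member_le_L2_set[of _ j]) auto
    also have "\<dots> \<le> kp_norm (?z + ?w) + 6 * (l2_norm (kp_snd ?z) + l2_norm (kp_snd ?w)) + x * l2_norm (kp_snd ?w)"
      unfolding x_def by (rule kp_local_bound[OF inj])
    also have "kp_norm (?z + ?w) \<le> M * x"
      using M(2)[of ?f] by (simp add: BA kp_norm_flat_vector n\<theta> card x_def)
    also have "M * x + 6 * (l2_norm (kp_snd ?z) + l2_norm (kp_snd ?w)) + x * l2_norm (kp_snd ?w) \<le> b2"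
      unfolding b2_def ln using sw x1 M(1) a by (intro add_mono mult_left_mono) auto
    finally have le: "norm (kp_fst ?z (i j) + kp_fst ?w (i j)) \<le> b2" by (simp add: Om)
    let ?e = "\<Sum>t<N. \<theta> (i t) * (of_real L * kp_fst (kp_apply R (kp_unit (i t))) (i j))"
    \<comment> \<open>Each summand is a L / x because h = x U has entries of modulus 1, and N / x =
      x. The sum has the same sign as the first component of the image under \<open>A\<close>, hence
      the factor 2 in \<open>row\<close>.\<close>
    have main: "(\<Sum>t<N. of_real (h j t) * of_real (a * U j t * L) :: 'k) = of_real (a * L * x)"
    proof -
      have "h j t * (a * U j t * L) = a * L / x" for t using hh(1)[of j t] by (simp add: Uh)
      then have sum: "(\<Sum>t<N. h j t * (a * U j t * L)) = real N * (a * L / x)" by simp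
      have "(\<Sum>t<N. of_real (h j t) * of_real (a * U j t * L) :: 'k) = of_real (\<Sum>t<N. h j t * (a * U j t * L))"
        by (simp only: of_real_sum of_real_mult)
      also note sum
      also have "real N * (a * L / x) = a * L * x" unfolding xx[symmetric] using x1 by simp
      finally show ?thesis .
    qed
    have "kp_fst ?w (i j) = (\<Sum>t<N. \<theta> (i t) * (of_real L * kp_fst (kp_apply R (kp_unit (i t))) (i j) + P t j))"
      unfolding fw by (simp only: kp_sel P_def)
    also have "\<dots> = ?e + (\<Sum>t<N. \<theta> (i t) * P t j)" by (simp add: distrib_left sum.distrib)
    also have "(\<Sum>t<N. \<theta> (i t) * P t j) = (\<Sum>t<N. of_real (h j t) * Q t j + of_real (h j t) * of_real (a * U j t * L))"
      by (intro sum.cong refl) (simp add: \<theta>_def idi Q_def right_diff_distrib)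
    also have "\<dots> = (\<Sum>t<N. of_real (h j t) * Q t j) + of_real (a * L * x)" by (simp only: sum.distrib main)
    finally have fstw: "kp_fst ?w (i j) = ?e + ((\<Sum>t<N. of_real (h j t) * Q t j) + of_real (a * L * x))" .
    have tri: "norm (u - v - w) \<le> norm u + norm v + norm w" for u v w :: 'k
      by (intro order_trans[OF norm_triangle_ineq4] add_right_mono norm_triangle_ineq4)
    have "of_real (2 * a * L * x) = (kp_fst ?z (i j) + kp_fst ?w (i j)) - ?e - (\<Sum>t<N. of_real (h j t) * Q t j)"
      unfolding fstw by (simp add: fst)
    then have "norm (of_real (2 * a * L * x) :: 'k) \<le> norm (kp_fst ?z (i j) + kp_fst ?w (i j)) + norm ?e + norm (\<Sum>t<N. of_real (h j t) * Q t j)"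
      by (simp only: tri)
    moreover have "norm ?e \<le> (\<Sum>t<N. L * \<delta>)"
    proof (rule order_trans[OF norm_sum], rule sum_mono)
      fix t
      have "norm (kp_fst (kp_apply R (kp_unit (i t))) (i j)) \<le> \<delta>" using order_trans[OF norm_kp_fst_le RE] .
      then show "norm (\<theta> (i t) * (of_real L * kp_fst (kp_apply R (kp_unit (i t))) (i j))) \<le> L * \<delta>"
        using L0 by (simp add: norm_mult n\<theta> mult_left_mono)
    qed
    moreover have "norm (\<Sum>t<N. of_real (h j t) * Q t j) \<le> (\<Sum>t<N. norm (Q t j))"
      by (rule order_trans[OF norm_sum]) (simp add: norm_mult hh)
    moreover have "norm (of_real (2 * a * L * x) :: 'k) = 2 * a * L * x"
      unfolding norm_of_real using a L0 x1 by simp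
    ultimately show ?thesis using le by simp
  qed

  \<comment> \<open>For fixed \<open>j\<close>, \<open>row\<close> involves all Q t j, while
    \<open>unit_rows\<close> controls them over \<open>j\<close> for fixed \<open>t\<close>. Summing
    over \<open>j\<close> and exchanging the sums joins the two.\<close>
  have "real N * (2 * a * L * x) = (\<Sum>j<N. 2 * a * L * x)" by simp
  also have "\<dots> \<le> (\<Sum>j<N. b2 + real N * (L * \<delta>) + (\<Sum>t<N. norm (Q t j)))"
    by (intro sum_mono row) simp
  also have "\<dots> = real N * (b2 + real N * (L * \<delta>)) + (\<Sum>t<N. \<Sum>j<N. norm (Q t j))"
    by (simp add: sum.distrib) (rule sum.swap)
  also have "(\<Sum>t<N. \<Sum>j<N. norm (Q t j)) \<le> (\<Sum>t<N. b1 * x)"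
  proof (rule sum_mono)
    fix t assume t: "t \<in> {..<N}"
    \<comment> \<open>Cauchy-Schwarz against the constant 1; the loss sqrt N matches the factor
      \<open>x\<close> on the left-hand side.\<close>
    have "(\<Sum>j<N. norm (Q t j)) \<le> L2_set (\<lambda>j. norm (Q t j)) {..<N} * L2_set (\<lambda>j. 1) {..<N}"
      using L2_set_mult_ineq[of "\<lambda>j. norm (Q t j)" "\<lambda>j. 1" "{..<N}"] by simp
    also have "\<dots> \<le> b1 * x" using unit_rows[of t] t x1 by (simp add: L2_set_constant x_def mult_right_mono)
    finally show "(\<Sum>j<N. norm (Q t j)) \<le> b1 * x" .
  qed
  also have "(\<Sum>t<N. b1 * x) = real N * (b1 * x)" by simp
  finally have "real N * (2 * a * L * x) \<le> real N * (b2 + real N * (L * \<delta>) + b1 * x)" by (simp add: distrib_left)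
  then have "2 * a * L * x \<le> b2 + real N * (L * \<delta>) + b1 * x"
    by (rule mult_left_le_imp_le) (use N1 in linarith)
  also have "\<dots> = x * (2 * M + 12 * a) + \<delta> * ((6 + x) * real N * (L + 200) + real N * L + 1200 * x + 200 * (x * x))"
    unfolding b1_def b2_def W_def by (simp add: algebra_simps)
  also have "\<dots> = x * (2 * M + 12 * a) + \<delta> * K" unfolding xx K_def ..
  also have "\<dots> \<le> x * (2 * M + 12 * a) + x * 1" using \<delta>(2) x1 by simp
  also have "\<dots> = x * (2 * M + 12 * a + 1)" by (simp only: distrib_left)
  finally have "x * (2 * a * L) \<le> x * (2 * M + 12 * a + 1)" by (simp only: mult_ac)
  then have "2 * a * L \<le> 2 * M + 12 * a + 1" by (rule mult_left_le_imp_le) (use x1 in linarith)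
  moreover have "2 * L = ln (real N)" using N1 by (simp add: L_def x_def ln_sqrt)
  then have "2 * a * L = ln (block_size p) / real (Suc p)" by (simp add: a_def N_def)
  ultimately show ?thesis using a(2) by linarith
qed

text \<open>Closeness is asked for on the (e_n, 0) alone, with a range of n depending on m.
  Convergence in the quotient and convergence in L(H) both reduce to this condition, so both halves
  of the result end here.\<close>

lemma walsh_op_no_limit:
  fixes B :: "'k::rc_field kp_op"
  assumes "\<And>\<delta>. \<delta> > 0 \<Longrightarrow> \<exists>m0. \<forall>m\<ge>m0. eventually (\<lambda>n. kp_norm (kp_apply (B - walsh_op m) (kp_unit n)) \<le> \<delta>) sequentially"
  shows False
proof -
  obtain M where M: "M > 0" "\<And>z. kp_norm (kp_apply B z) \<le> M * kp_norm z" using kp_apply_bound[of B] by metis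
  obtain p :: nat where p: "(2 * M + 13) / ln 2 < real p" using reals_Archimedean2 by blast
  have "ln (block_size p) = real ((Suc p)\<^sup>2) * ln 2"
    unfolding block_size_def by (simp add: ln_realpow del: of_nat_Suc)
  then have "ln (block_size p) = real (Suc p) * (real (Suc p) * ln 2)"
    by (simp only: of_nat_power of_nat_mult power2_eq_square mult.assoc)
  then have "ln (block_size p) / real (Suc p) = real (Suc p) * ln 2" by (simp del: of_nat_Suc)
  then have "real (Suc p) * ln 2 \<le> 2 * M + 13" using walsh_coefficient_bound[OF M assms, of p] by simp
  moreover have "2 * M + 13 < real p * ln 2" using p by (simp add: divide_less_eq)
  moreover have "real p * ln 2 \<le> real (Suc p) * ln 2" by (intro mult_right_mono) auto
  ultimately show False by linarith
qed

lemma ss_quotient_not_mcomplete: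
  "\<not> Metric_space.mcomplete (ss_quotient :: 'k::rc_field kp_op set set) ss_quotient_dist"
proof
  assume c: "Metric_space.mcomplete (ss_quotient :: 'k kp_op set set) ss_quotient_dist"
  have "\<exists>N. \<forall>m\<ge>N. \<forall>n\<ge>N. S_norm (walsh_op m - walsh_op n :: 'k kp_op) < e" if "e > 0" for e
  proof -
    obtain p where p: "1 / real (Suc p) < e" using nat_approx_posE[OF \<open>e > 0\<close>] by blast
    show ?thesis by (intro exI[of _ p] allI impI le_less_trans[OF walsh_op_S_norm p])
  qed
  from ss_quotient_mcompleteD[OF c this] obtain B :: "'k kp_op" where
    B: "(\<lambda>n. S_norm (walsh_op n - B)) \<longlonglongrightarrow> 0" by blast
  show False
  proof (rule walsh_op_no_limit[of B])
    fix \<delta> :: real assume "\<delta> > 0"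
    then have "eventually (\<lambda>m. S_norm (walsh_op m - B) < \<delta> / 2) sequentially" by (intro order_tendstoD[OF B]) simp
    then obtain m0 where m0: "\<And>m. m \<ge> m0 \<Longrightarrow> S_norm (walsh_op m - B) < \<delta> / 2" unfolding eventually_sequentially by blast
    have "eventually (\<lambda>n. kp_norm (kp_apply (B - walsh_op m) (kp_unit n)) \<le> \<delta>) sequentially" if "m \<ge> m0" for m
      using S_norm_units[of "B - walsh_op m" "\<delta> / 2"] m0[OF that] by (simp add: S_norm_minus_commute)
    then show "\<exists>m0. \<forall>m\<ge>m0. eventually (\<lambda>n. kp_norm (kp_apply (B - walsh_op m) (kp_unit n)) \<le> \<delta>) sequentially" by blast
  qed
qed

section \<open>Limits along an ultrafilter\<close>

text \<open>Compactness provides a cluster point, and an ultrafilter decides each of its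
  neighbourhoods.\<close>

lemma ultrafilter_tendsto:
  fixes X :: "'a \<Rightarrow> 'b::topological_space"
  assumes U: "nontrivial_ultrafilter U" and S: "compact S" "\<And>n. X n \<in> S"
  shows "\<exists>l. (X \<longlongrightarrow> l) U"
proof -
  define F where "F = filtermap X U"
  have "F \<noteq> bot" using U by (simp add: F_def nontrivial_ultrafilter_def filtermap_bot_iff)
  moreover have "eventually (\<lambda>x. x \<in> S) F" using S(2) by (simp add: F_def eventually_filtermap)
  ultimately obtain l where l: "inf (nhds l) F \<noteq> bot" using S(1) unfolding compact_filter by blast
  have "(X \<longlongrightarrow> l) U"
  proof (rule topological_tendstoI)
    fix V assume V: "open V" "l \<in> V"
    show "eventually (\<lambda>n. X n \<in> V) U"
    proof (rule ccontr)
      assume "\<not> eventually (\<lambda>n. X n \<in> V) U"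
      then have "eventually (\<lambda>n. X n \<notin> V) U" using U unfolding nontrivial_ultrafilter_def by blast
      then have "eventually (\<lambda>x. x \<notin> V) F" by (simp add: F_def eventually_filtermap)
      moreover have "eventually (\<lambda>x. x \<in> V) (nhds l)" using V by (auto simp: eventually_nhds)
      ultimately have "eventually (\<lambda>x. False) (inf (nhds l) F)"
        unfolding eventually_inf by (intro exI[of _ "\<lambda>x. x \<in> V"] exI[of _ "\<lambda>x. x \<notin> V"]) auto
      then show False using l by (simp add: trivial_limit_def)
    qed
  qed
  then show ?thesis by blast
qed

lemma ultrafilter_bounded_tendsto:
  fixes X :: "nat \<Rightarrow> 'k::rc_field"
  assumes U: "nontrivial_ultrafilter U" and b: "\<And>n. norm (X n) \<le> M"
  shows "\<exists>l. (X \<longlongrightarrow> l) U"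
proof -
  obtain S :: "'k set" where "compact S" "cball 0 M \<subseteq> S" using rc_field_cball_compact by blast
  then show ?thesis using b by (intro ultrafilter_tendsto[OF U, of S]) auto
qed

text \<open>Nontriviality removes each single index, hence every finite set of them.\<close>

lemma ultrafilter_eventually:
  assumes U: "nontrivial_ultrafilter U" and P: "eventually P sequentially"
  shows "eventually P U"
proof -
  obtain N where N: "\<And>n. n \<ge> N \<Longrightarrow> P n" using P unfolding eventually_sequentially by blast
  have "eventually (\<lambda>n. n \<noteq> a) U" for a :: nat using U unfolding nontrivial_ultrafilter_def by blast
  then have "eventually (\<lambda>n. \<forall>a\<in>{..<N}. n \<noteq> a) U" by (intro eventually_ball_finite) auto
  then show ?thesis by (rule eventually_mono) (use N in \<open>auto simp: not_less[symmetric]\<close>)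
qed

lemma ultrafilter_le_sequentially:
  "nontrivial_ultrafilter U \<Longrightarrow> U \<le> sequentially"
  by (rule filter_leI) (rule ultrafilter_eventually)

text \<open>By \<open>ks_seminorm_eq\<close> this is the seminorm of H. Its subadditivity is
  obtained directly from Z_2, before the form is known to exist.\<close>

definition ultra_norm :: "nat filter \<Rightarrow> 'k::rc_field kp_op \<Rightarrow> real"
  where "ultra_norm U T = Lim U (\<lambda>n. kp_norm (kp_apply T (kp_unit n)))"

lemma kp_units_bounded: "\<exists>M>0. \<forall>n. kp_norm (kp_apply T (kp_unit n)) \<le> M"
proof -
  obtain M where M: "M > 0" "\<And>z. kp_norm (kp_apply T z) \<le> M * kp_norm z" using kp_apply_bound[of T] by metis
  have "kp_norm (kp_apply T (kp_unit n)) \<le> M" for n using M(2)[of "kp_unit n"] by (simp add: kp_norm_unit)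
  then show ?thesis using M(1) by blast
qed

context
  fixes U :: "nat filter"
  assumes U: "nontrivial_ultrafilter U"
begin

lemma U_nonbot: "U \<noteq> bot"
  using U by (simp add: nontrivial_ultrafilter_def)

lemma ultra_norm_tendsto: "((\<lambda>n. kp_norm (kp_apply T (kp_unit n))) \<longlongrightarrow> ultra_norm U T) U"
proof -
  obtain M where "\<And>n. kp_norm (kp_apply T (kp_unit n)) \<le> M" using kp_units_bounded[of T] by blast
  then obtain l where l: "((\<lambda>n. kp_norm (kp_apply T (kp_unit n))) \<longlongrightarrow> l) U"
    using ultrafilter_bounded_tendsto[OF U, of "\<lambda>n. kp_norm (kp_apply T (kp_unit n))" M] by (auto simp: abs_kp_norm)
  then show ?thesis using tendsto_Lim[OF U_nonbot l] by (simp add: ultra_norm_def)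
qed

lemma kp_snd_units_ultra: "((\<lambda>n. l2_norm (kp_snd (kp_apply T (kp_unit n)))) \<longlongrightarrow> 0) U"
  using kp_snd_units_null ultrafilter_le_sequentially[OF U] by (rule tendsto_mono[rotated])

lemma ultra_norm_nonneg: "0 \<le> ultra_norm U T"
  by (rule tendsto_lowerbound[OF ultra_norm_tendsto _ U_nonbot]) (simp add: kp_norm_nonneg)

lemma ultra_norm_triangle: "ultra_norm U (S + T) \<le> ultra_norm U S + ultra_norm U T"
proof -
  have "((\<lambda>n. kp_norm (kp_apply S (kp_unit n)) + kp_norm (kp_apply T (kp_unit n))
      + 6 * (l2_norm (kp_snd (kp_apply S (kp_unit n))) + l2_norm (kp_snd (kp_apply T (kp_unit n)))))
    \<longlongrightarrow> ultra_norm U S + ultra_norm U T + 6 * (0 + 0)) U"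
    by (intro tendsto_intros ultra_norm_tendsto kp_snd_units_ultra)
  moreover have "eventually (\<lambda>n. kp_norm (kp_apply (S + T) (kp_unit n))
      \<le> kp_norm (kp_apply S (kp_unit n)) + kp_norm (kp_apply T (kp_unit n))
      + 6 * (l2_norm (kp_snd (kp_apply S (kp_unit n))) + l2_norm (kp_snd (kp_apply T (kp_unit n))))) U"
    unfolding plus_kp_op.rep_eq by (intro always_eventually allI kp_norm_add_sharp)
  ultimately show ?thesis using tendsto_le[OF U_nonbot _ ultra_norm_tendsto] by fastforce
qed

lemma ultra_norm_scale: "ultra_norm U (kp_op_scale c T) = norm c * ultra_norm U T"
proof (rule tendsto_unique[OF U_nonbot ultra_norm_tendsto])
  show "((\<lambda>n. kp_norm (kp_apply (kp_op_scale c T) (kp_unit n))) \<longlongrightarrow> norm c * ultra_norm U T) U"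
    unfolding kp_op_scale.rep_eq kp_norm_scale by (intro tendsto_intros ultra_norm_tendsto)
qed

text \<open>For every \<open>T\<close> the second components of the images of (e_n, 0) vanish in the
  limit, so H does not see the constant \<open>C\<close>.\<close>

lemma ultra_norm_mult_le:
  assumes A: "\<And>z. kp_norm (kp_apply A z) \<le> a * kp_norm z + C * l2_norm (kp_snd z)"
  shows "ultra_norm U (A * T) \<le> a * ultra_norm U T"
proof -
  have "((\<lambda>n. a * kp_norm (kp_apply T (kp_unit n)) + C * l2_norm (kp_snd (kp_apply T (kp_unit n))))
    \<longlongrightarrow> a * ultra_norm U T + C * 0) U"
    by (intro tendsto_intros ultra_norm_tendsto kp_snd_units_ultra)
  from tendsto_le[OF U_nonbot this ultra_norm_tendsto[of "A * T"]] show ?thesis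
    by (simp add: times_kp_op.rep_eq A)
qed

end

section \<open>The Hermitian form\<close>

text \<open>The real part of a times the conjugate of b, written by polarization so that real and
  complex scalars are treated alike.\<close>

definition real_ip :: "'k::rc_field \<Rightarrow> 'k \<Rightarrow> real"
  where "real_ip a b = ((norm (a + b))\<^sup>2 - (norm (a - b))\<^sup>2) / 4"

lemma real_ip_eq: "of_real (2 * real_ip a b) = a * sconj b + b * sconj (a :: 'k::rc_field)"
proof -
  have "of_real (4 * real_ip a b) = (a + b) * sconj (a + b) - (a - b) * sconj (a - b)"
    by (simp add: real_ip_def mult_sconj)
  also have "\<dots> = 2 * (a * sconj b + b * sconj a)"
  proof -
    have sd: "sconj (a - b) = sconj a - sconj b" using sconj_add[of a "- b"] by (simp only: sconj_minus diff_conv_add_uminus)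
    show ?thesis unfolding sd sconj_add by (simp add: algebra_simps)
  qed
  finally have "2 * (of_real (2 * real_ip a b) :: 'k) = 2 * (a * sconj b + b * sconj a)" by simp
  then show ?thesis by (simp only: mult_cancel_left) simp
qed

lemma real_ip_eqI:
  assumes "a * sconj b + b * sconj a = c * sconj d + d * sconj (c :: 'k::rc_field)"
  shows "real_ip a b = real_ip c d"
proof -
  have "(of_real (2 * real_ip a b) :: 'k) = of_real (2 * real_ip c d)" unfolding real_ip_eq by (rule assms)
  then show ?thesis unfolding of_real_eq_iff by simp
qed

lemma real_ip_add: "real_ip (a + b) c = real_ip a c + real_ip b (c :: 'k::rc_field)"
proof -
  have "(of_real (2 * real_ip (a + b) c) :: 'k) = of_real (2 * real_ip a c) + of_real (2 * real_ip b c)"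
    unfolding real_ip_eq by (simp add: sconj_add algebra_simps)
  then have "(of_real (2 * real_ip (a + b) c) :: 'k) = of_real (2 * real_ip a c + 2 * real_ip b c)" by simp
  then show ?thesis unfolding of_real_eq_iff by simp
qed

lemma real_ip_commute: "real_ip a b = real_ip b (a :: 'k::rc_field)"
  by (rule real_ip_eqI) (simp add: add.commute)

lemma real_ip_self: "real_ip a a = (norm a)\<^sup>2"
  by (simp add: real_ip_def norm_mult power_mult_distrib flip: mult_2)

lemma real_ip_scale: "real_ip (c * a) b = real_ip a (sconj c * (b :: 'k::rc_field))"
  by (rule real_ip_eqI) (simp add: sconj_mult sconj_sconj mult_ac)

lemma real_ip_of_real: "real_ip (of_real r * a) b = r * real_ip a (b :: 'k::rc_field)"
proof -
  have "(of_real (2 * real_ip (of_real r * a) b) :: 'k) = of_real r * of_real (2 * real_ip a b)"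
    unfolding real_ip_eq by (simp add: sconj_mult sconj_of_real algebra_simps)
  then have "(of_real (2 * real_ip (of_real r * a) b) :: 'k) = of_real (r * (2 * real_ip a b))" by simp
  then show ?thesis unfolding of_real_eq_iff by simp
qed

lemma abs_real_ip_le: "\<bar>real_ip a b\<bar> \<le> norm a * norm (b :: 'k::rc_field)"
proof -
  have "norm (of_real (2 * real_ip a b) :: 'k) \<le> norm (a * sconj b) + norm (b * sconj a)"
    unfolding real_ip_eq by (rule norm_triangle_ineq)
  then show ?thesis unfolding norm_of_real norm_mult norm_sconj by (simp add: abs_mult mult.commute)
qed

section \<open>Inner products of residuals and their limits\<close>

definition l2_ip :: "(nat \<Rightarrow> 'k::rc_field) \<Rightarrow> (nat \<Rightarrow> 'k) \<Rightarrow> real"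
  where "l2_ip x y = (\<Sum>k. real_ip (x k) (y k))"

lemma l2_ip_summable:
  assumes x: "square_summable x" and y: "square_summable y"
  shows "summable (\<lambda>k. real_ip (x k) (y k :: 'k::rc_field))" "\<bar>l2_ip x y\<bar> \<le> l2_norm x * l2_norm y"
proof -
  have part: "(\<Sum>k<n. \<bar>real_ip (x k) (y k)\<bar>) \<le> l2_norm x * l2_norm y" for n
  proof -
    have "(\<Sum>k<n. \<bar>real_ip (x k) (y k)\<bar>) \<le> (\<Sum>k<n. norm (x k) * norm (y k))"
      by (intro sum_mono abs_real_ip_le)
    also have "\<dots> \<le> L2_set (\<lambda>k. norm (x k)) {..<n} * L2_set (\<lambda>k. norm (y k)) {..<n}"
      using L2_set_mult_ineq[of "\<lambda>k. norm (x k)" "\<lambda>k. norm (y k)" "{..<n}"] by simp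
    also have "\<dots> \<le> l2_norm x * l2_norm y"
      using L2_set_le_l2_norm[OF x, of "\<lambda>k. k" n] L2_set_le_l2_norm[OF y, of "\<lambda>k. k" n]
      by (intro mult_mono) (auto simp: inj_on_def l2_norm_nonneg x L2_set_nonneg)
    finally show ?thesis .
  qed
  have abs: "summable (\<lambda>k. \<bar>real_ip (x k) (y k)\<bar>)"
    by (rule summableI_nonneg_bounded[OF _ part]) simp
  then show s: "summable (\<lambda>k. real_ip (x k) (y k))" by (rule summable_rabs_cancel)
  have "\<bar>l2_ip x y\<bar> \<le> (\<Sum>k. \<bar>real_ip (x k) (y k)\<bar>)" unfolding l2_ip_def by (rule summable_rabs[OF abs])
  also have "\<dots> \<le> l2_norm x * l2_norm y" by (rule suminf_le_const[OF abs part])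
  finally show "\<bar>l2_ip x y\<bar> \<le> l2_norm x * l2_norm y" .
qed

lemma l2_ip_add:
  assumes "square_summable x" "square_summable y" "square_summable z"
  shows "l2_ip (\<lambda>n. x n + y n) z = l2_ip x z + l2_ip y (z :: nat \<Rightarrow> 'k::rc_field)"
  unfolding l2_ip_def real_ip_add
  by (rule suminf_add[symmetric]) (intro l2_ip_summable assms)+

lemma l2_ip_self: "square_summable x \<Longrightarrow> l2_ip x x = (l2_norm x)\<^sup>2"
  by (simp add: l2_ip_def real_ip_self l2_norm_power2)

lemma l2_ip_commute: "l2_ip x y = l2_ip y x"
  unfolding l2_ip_def by (subst real_ip_commute) simp

lemma l2_ip_scale: "l2_ip (\<lambda>n. c * x n) y = l2_ip x (\<lambda>n. sconj c * y n)"
  by (simp add: l2_ip_def real_ip_scale)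

lemma l2_ip_of_real:
  assumes "square_summable x" "square_summable y"
  shows "l2_ip (\<lambda>n. of_real r * x n) y = r * l2_ip x (y :: nat \<Rightarrow> 'k::rc_field)"
  unfolding l2_ip_def real_ip_of_real by (rule suminf_mult) (intro l2_ip_summable assms)

lemma kp_res_scale: "kp_res (kp_scale c z) = (\<lambda>n. c * kp_res z n)"
  by (simp add: kp_res_def kp_sel Omega_scale kp_snd_square_summable right_diff_distrib)

text \<open>The residuals carry the whole limiting norm. They are not additive in the operator, but
  additivity returns in the limit.\<close>

definition unit_ip :: "'k::rc_field kp_op \<Rightarrow> 'k kp_op \<Rightarrow> nat \<Rightarrow> real"
  where "unit_ip S T n = l2_ip (kp_res (kp_apply S (kp_unit n))) (kp_res (kp_apply T (kp_unit n)))"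

definition ultra_ip :: "nat filter \<Rightarrow> 'k::rc_field kp_op \<Rightarrow> 'k kp_op \<Rightarrow> real"
  where "ultra_ip U S T = Lim U (unit_ip S T)"

lemma abs_unit_ip_le: "\<bar>unit_ip S T n\<bar> \<le> kp_norm (kp_apply S (kp_unit n)) * kp_norm (kp_apply T (kp_unit n))"
  unfolding unit_ip_def
  by (rule order_trans[OF l2_ip_summable(2)])
    (auto intro!: mult_mono l2_res_le kp_res_square_summable l2_norm_nonneg kp_norm_nonneg)

lemma hermitian_formD:
  assumes "hermitian_form F"
  shows "F (R + S) T = F R T + F S T" "F (kp_op_scale c S) T = c * F S T" "F T S = sconj (F S T)"
  using assms unfolding hermitian_form_def by blast+

text \<open>Polarization: the diagonal at S + T determines B S T plus its conjugate. If there is an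
  imaginary unit, the same at i S determines the difference as well; otherwise conjugation is
  trivial.\<close>

lemma hermitian_form_unique:
  assumes B: "hermitian_form B" and B': "hermitian_form B'" and eq: "\<And>T. B T T = B' T (T :: 'k::rc_field kp_op)"
  shows "B = B'"
proof (intro ext)
  fix S T
  have add2: "F S (T + T') = F S T + F S T'" if "hermitian_form F" for F :: "'k kp_op \<Rightarrow> 'k kp_op \<Rightarrow> 'k" and S T T'
  proof -
    note D = hermitian_formD[OF that]
    have "F S (T + T') = sconj (F (T + T') S)" by (rule D(3))
    also have "\<dots> = sconj (F T S) + sconj (F T' S)" by (simp only: D(1) sconj_add)
    also have "sconj (F T S) = F S T" by (rule D(3)[symmetric])
    also have "sconj (F T' S) = F S T'" by (rule D(3)[symmetric])
    finally show ?thesis .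
  qed
  have sym: "B S T + sconj (B S T) = B' S T + sconj (B' S T)" for S T
  proof -
    have exp: "F (S + T) (S + T) = F S S + (F S T + sconj (F S T)) + F T T" if "hermitian_form F" for F :: "'k kp_op \<Rightarrow> 'k kp_op \<Rightarrow> 'k"
    proof -
      note D = hermitian_formD[OF that]
      have "F (S + T) (S + T) = F S S + F S T + (F T S + F T T)" by (simp only: add2[OF that] D(1)) (simp add: algebra_simps)
      also have "F T S = sconj (F S T)" by (rule D(3))
      finally show ?thesis by (simp add: algebra_simps)
    qed
    show ?thesis using exp[OF B] exp[OF B'] eq[of "S + T"] eq[of S] eq[of T] by simp
  qed
  show "B S T = B' S T"
  proof (cases "\<forall>z::'k. z \<in> \<real>")
    case True
    have "sconj z = z" for z :: 'k using True by (metis Reals_cases sconj_of_real)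
    then have "2 * B S T = 2 * B' S T" using sym[of S T] by simp
    then show ?thesis by simp
  next
    case False
    with rc_field_real_or_complex[where 'k = 'k] obtain i :: 'k where i: "i * i = - 1" "sconj i = - i" by blast
    have "i * B S T + sconj (i * B S T) = i * B' S T + sconj (i * B' S T)"
      using sym[of "kp_op_scale i S" T] by (simp only: hermitian_formD(2)[OF B] hermitian_formD(2)[OF B'])
    then have "i * B S T - i * sconj (B S T) = i * B' S T - i * sconj (B' S T)" by (simp add: sconj_mult i)
    then have "i * (B S T - sconj (B S T)) = i * (B' S T - sconj (B' S T))" by (simp add: right_diff_distrib)
    then have d: "B S T - sconj (B S T) = B' S T - sconj (B' S T)" using i(1) by auto
    have "2 * B S T = (B S T + sconj (B S T)) + (B S T - sconj (B S T))" by simp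
    also have "\<dots> = (B' S T + sconj (B' S T)) + (B' S T - sconj (B' S T))" by (simp only: sym d)
    also have "\<dots> = 2 * B' S T" by simp
    finally have "2 * B S T = 2 * B' S T" .
    then show ?thesis by simp
  qed
qed

context
  fixes U :: "nat filter"
  assumes U: "nontrivial_ultrafilter U"
begin

lemma ultra_ip_tendsto: "((unit_ip S T) \<longlongrightarrow> ultra_ip U S T) U"
proof -
  obtain M where M: "M > 0" "\<And>n. kp_norm (kp_apply S (kp_unit n)) \<le> M" using kp_units_bounded[of S] by blast
  obtain M' where M': "M' > 0" "\<And>n. kp_norm (kp_apply T (kp_unit n)) \<le> M'" using kp_units_bounded[of T] by blast
  have "norm (unit_ip S T n) \<le> M * M'" for n
  proof -
    have "kp_norm (kp_apply S (kp_unit n)) * kp_norm (kp_apply T (kp_unit n)) \<le> M * M'"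
      using M M' by (intro mult_mono kp_norm_nonneg) auto
    then show ?thesis using abs_unit_ip_le[of S T n] by simp
  qed
  from ultrafilter_bounded_tendsto[OF U, of "unit_ip S T", OF this] obtain l where l: "(unit_ip S T \<longlongrightarrow> l) U" by blast
  then show ?thesis using tendsto_Lim[OF U_nonbot[OF U] l] by (simp add: ultra_ip_def)
qed

lemma ultra_ip_eqI: "(unit_ip S T \<longlongrightarrow> l) U \<Longrightarrow> ultra_ip U S T = l"
  by (rule tendsto_unique[OF U_nonbot[OF U] ultra_ip_tendsto])

text \<open>The failure of the residual to be additive is bounded by 6 times the second components
  of the images, which vanish along \<open>U\<close>.\<close>

lemma ultra_ip_add: "ultra_ip U (S + S') T = ultra_ip U S T + ultra_ip U S' T"
proof (rule ultra_ip_eqI)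
  obtain M where M: "M > 0" "\<And>n. kp_norm (kp_apply T (kp_unit n)) \<le> M" using kp_units_bounded[of T] by blast
  let ?e = "\<lambda>n. 6 * (l2_norm (kp_snd (kp_apply S (kp_unit n))) + l2_norm (kp_snd (kp_apply S' (kp_unit n)))) * M"
  have est: "\<bar>unit_ip (S + S') T n - (unit_ip S T n + unit_ip S' T n)\<bar> \<le> ?e n" for n
  proof -
    let ?a = "kp_apply S (kp_unit n)" and ?b = "kp_apply S' (kp_unit n)" and ?t = "kp_res (kp_apply T (kp_unit n))"
    let ?d = "\<lambda>k. kp_res (?a + ?b) k - (kp_res ?a k + kp_res ?b k)"
    have d: "square_summable ?d" by (intro square_summable_diff square_summable_add kp_res_square_summable)
    have "unit_ip (S + S') T n = l2_ip (\<lambda>k. ?d k + (kp_res ?a k + kp_res ?b k)) ?t"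
      by (simp add: unit_ip_def plus_kp_op.rep_eq)
    also have "\<dots> = l2_ip ?d ?t + l2_ip (\<lambda>k. kp_res ?a k + kp_res ?b k) ?t"
      by (intro l2_ip_add d square_summable_add kp_res_square_summable)
    also have "l2_ip (\<lambda>k. kp_res ?a k + kp_res ?b k) ?t = unit_ip S T n + unit_ip S' T n"
      unfolding unit_ip_def by (intro l2_ip_add kp_res_square_summable)
    finally have "\<bar>unit_ip (S + S') T n - (unit_ip S T n + unit_ip S' T n)\<bar> \<le> l2_norm ?d * l2_norm ?t"
      using l2_ip_summable(2)[OF d kp_res_square_summable] by simp
    also have "\<dots> \<le> ?e n"
      using order_trans[OF l2_res_le M(2)]
      by (intro mult_mono kp_res_add l2_norm_nonneg kp_res_square_summable mult_nonneg_nonneg add_nonneg_nonneg kp_snd_square_summable) auto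
    finally show ?thesis .
  qed
  have "(?e \<longlongrightarrow> 6 * (0 + 0) * M) U" by (intro tendsto_intros kp_snd_units_ultra U)
  then have e0: "(?e \<longlongrightarrow> 0) U" by simp
  have "((\<lambda>n. unit_ip (S + S') T n - (unit_ip S T n + unit_ip S' T n)) \<longlongrightarrow> 0) U"
  proof (rule Lim_null_comparison[OF _ e0])
    show "eventually (\<lambda>n. norm (unit_ip (S + S') T n - (unit_ip S T n + unit_ip S' T n)) \<le> ?e n) U"
      unfolding real_norm_def by (intro always_eventually allI est)
  qed
  moreover have "((\<lambda>n. unit_ip S T n + unit_ip S' T n) \<longlongrightarrow> ultra_ip U S T + ultra_ip U S' T) U"
    by (intro tendsto_intros ultra_ip_tendsto)
  ultimately show "(unit_ip (S + S') T \<longlongrightarrow> ultra_ip U S T + ultra_ip U S' T) U"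
    using tendsto_add[of "\<lambda>n. unit_ip (S + S') T n - (unit_ip S T n + unit_ip S' T n)" 0 U
      "\<lambda>n. unit_ip S T n + unit_ip S' T n" "ultra_ip U S T + ultra_ip U S' T"] by simp
qed

lemma ultra_ip_commute: "ultra_ip U S T = ultra_ip U T S"
  unfolding ultra_ip_def unit_ip_def by (subst l2_ip_commute) simp

lemma ultra_ip_scale: "ultra_ip U (kp_op_scale c S) T = ultra_ip U S (kp_op_scale (sconj c) T)"
  unfolding ultra_ip_def unit_ip_def by (simp add: kp_op_scale.rep_eq kp_res_scale l2_ip_scale)

lemma ultra_ip_of_real: "ultra_ip U (kp_op_scale (of_real r) S) T = r * ultra_ip U S T"
proof (rule ultra_ip_eqI)
  have "unit_ip (kp_op_scale (of_real r) S) T = (\<lambda>n. r * unit_ip S T n)"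
    by (simp add: unit_ip_def fun_eq_iff kp_op_scale.rep_eq kp_res_scale l2_ip_of_real kp_res_square_summable)
  then show "(unit_ip (kp_op_scale (of_real r) S) T \<longlongrightarrow> r * ultra_ip U S T) U"
    by (simp only:) (intro tendsto_intros ultra_ip_tendsto)
qed

lemma ultra_ip_self: "ultra_ip U T T = (ultra_norm U T)\<^sup>2"
proof (rule ultra_ip_eqI)
  \<comment> \<open>The difference under the square is the norm of the residual.\<close>
  have "((\<lambda>n. (kp_norm (kp_apply T (kp_unit n)) - l2_norm (kp_snd (kp_apply T (kp_unit n))))\<^sup>2) \<longlongrightarrow> (ultra_norm U T - 0)\<^sup>2) U"
    by (intro tendsto_intros ultra_norm_tendsto kp_snd_units_ultra U)
  then show "(unit_ip T T \<longlongrightarrow> (ultra_norm U T)\<^sup>2) U"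
    by (simp add: unit_ip_def[abs_def] l2_ip_self kp_res_square_summable kp_norm_eq)
qed

lemma abs_ultra_ip_le: "\<bar>ultra_ip U S T\<bar> \<le> ultra_norm U S * ultra_norm U T"
  by (rule tendsto_le[OF U_nonbot[OF U] tendsto_mult[OF ultra_norm_tendsto[OF U] ultra_norm_tendsto[OF U]] tendsto_rabs[OF ultra_ip_tendsto]])
    (simp add: abs_unit_ip_le)

text \<open>The limit of the real inner products is the form for real scalars and its real part for
  complex ones. The bound adds the estimates of real and imaginary part, whence the factor 2; it
  yields the continuity needed in \<open>H_norm_cls\<close>.\<close>

lemma hermitian_form_exists:
  "\<exists>B :: 'k::rc_field kp_op \<Rightarrow> 'k kp_op \<Rightarrow> 'k. hermitian_form B \<and> (\<forall>T. B T T = of_real ((ultra_norm U T)\<^sup>2)) \<and>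
     (\<forall>S T. norm (B S T) \<le> 2 * (ultra_norm U S * ultra_norm U T))"
proof (cases "\<forall>z::'k. z \<in> \<real>")
  case True
  define B where "B S T = (of_real (ultra_ip U S T) :: 'k)" for S T :: "'k kp_op"
  have "B (kp_op_scale c S) T = c * B S T" for c S T
  proof -
    obtain r where "c = of_real r" using True by (meson Reals_cases)
    then show ?thesis by (simp add: B_def ultra_ip_of_real)
  qed
  then have "hermitian_form B"
    by (auto simp: hermitian_form_def B_def ultra_ip_add sconj_of_real intro: ultra_ip_commute)
  moreover have "norm (B S T) \<le> 2 * (ultra_norm U S * ultra_norm U T)" for S T
    using abs_ultra_ip_le[of S T] ultra_norm_nonneg[OF U, of S] ultra_norm_nonneg[OF U, of T] mult_nonneg_nonneg[of "ultra_norm U S" "ultra_norm U T"]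
    by (simp add: B_def)
  ultimately show ?thesis by (intro exI[of _ B]) (simp add: B_def ultra_ip_self)
next
  case False
  with rc_field_real_or_complex[where 'k = 'k] obtain i :: 'k where i: "i * i = - 1" "sconj i = - i"
    "\<And>z. \<exists>a b. z = of_real a + of_real b * i" by blast
  have ni: "norm i = 1"
  proof -
    have "(norm i)\<^sup>2 = 1"
      using arg_cong[OF i(1), of norm] by (simp only: norm_mult norm_minus_cancel norm_one power2_eq_square)
    then show ?thesis using norm_ge_zero[of i] by (auto simp: power2_eq_1_iff)
  qed
  have ss: "kp_op_scale c (kp_op_scale d T) = kp_op_scale (c * d) T" for c d and T :: "'k kp_op"
    by transfer simp
  have sa: "kp_op_scale (c + d) T = kp_op_scale c T + kp_op_scale d T" for c d and T :: "'k kp_op"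
    by transfer (simp add: kp.scale_left_distrib)
  have sadd: "kp_op_scale c (S + T) = kp_op_scale c S + kp_op_scale c T" for c and S T :: "'k kp_op"
    by transfer (simp add: kp.scale_right_distrib)
  have s1: "kp_op_scale 1 T = T" for T :: "'k kp_op" by transfer simp
  let ?R = "ultra_ip U" and ?i = "kp_op_scale i"
  have neg: "?R S (kp_op_scale (- 1) T) = - ?R S T" for S T :: "'k kp_op"
  proof -
    have "?R (kp_op_scale (of_real (- 1)) T) S = - 1 * ?R T S" by (rule ultra_ip_of_real)
    then show ?thesis using ultra_ip_commute[of S] by simp
  qed
  have Ri: "?R (?i S) T = - ?R S (?i T)" for S T :: "'k kp_op"
  proof -
    have "?R (?i S) T = ?R S (kp_op_scale (- 1) (?i T))" by (simp add: ultra_ip_scale i(2) ss)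
    then show ?thesis by (simp add: neg)
  qed
  \<comment> \<open>The form is conjugate linear in the second argument, so the imaginary part at
    (S, T) is the real part at (S, i T).\<close>
  define B where "B S T = of_real (?R S T) + i * of_real (?R S (?i T))" for S T :: "'k kp_op"
  have radd: "?R S (T + T') = ?R S T + ?R S T'" for S T T' :: "'k kp_op"
    using ultra_ip_add[of T T' S] ultra_ip_commute[of S] by simp
  have Badd: "B (S + S') T = B S T + B S' T" for S S' T
    by (simp add: B_def ultra_ip_add algebra_simps)
  have Breal: "B (kp_op_scale (of_real r) S) T = of_real r * B S T" for r S T
    by (simp add: B_def ultra_ip_of_real algebra_simps)
  have Bi: "B (?i S) T = i * B S T" for S T
  proof -
    have "?R (?i S) (?i T) = ?R S T"
      unfolding Ri ss i(1) by (simp add: neg)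
    then have "B (?i S) T = of_real (- ?R S (?i T)) + i * of_real (?R S T)" by (simp add: B_def Ri[of S T])
    also have "\<dots> = i * of_real (?R S T) + (i * i) * of_real (?R S (?i T))" unfolding i(1) by simp
    also have "\<dots> = i * B S T" by (simp add: B_def algebra_simps)
    finally show ?thesis .
  qed
  have Bscale: "B (kp_op_scale c S) T = c * B S T" for c S T
  proof -
    obtain a b where c: "c = of_real a + of_real b * i" using i(3) by blast
    have "kp_op_scale c S = kp_op_scale (of_real a) S + kp_op_scale (of_real b) (?i S)" by (simp add: c sa ss)
    then show ?thesis by (simp add: Badd Breal Bi c algebra_simps)
  qed
  have "B T S = sconj (B S T)" for S T
    using Ri[of S T] ultra_ip_commute[of T S] ultra_ip_commute[of T "?i S"]
    by (simp add: B_def sconj_add sconj_mult sconj_of_real i(2))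
  with Badd Bscale have "hermitian_form B" unfolding hermitian_form_def by blast
  moreover have "B T T = of_real ((ultra_norm U T)\<^sup>2)" for T
    using Ri[of T T] ultra_ip_commute[of T "?i T"] by (simp add: B_def ultra_ip_self)
  moreover have "norm (B S T) \<le> 2 * (ultra_norm U S * ultra_norm U T)" for S T
  proof -
    have "norm (B S T) \<le> \<bar>?R S T\<bar> + \<bar>?R S (?i T)\<bar>"
      unfolding B_def by (rule order_trans[OF norm_triangle_ineq]) (simp add: norm_mult ni)
    then show ?thesis using abs_ultra_ip_le[of S T] abs_ultra_ip_le[of S "?i T"] by (simp add: ultra_norm_scale[OF U] ni)
  qed
  ultimately show ?thesis by blast
qed

lemma ks_form_properties:
  shows "hermitian_form (ks_form U :: 'k::rc_field kp_op \<Rightarrow> _)"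
    and "ks_form U T (T :: 'k kp_op) = of_real ((ultra_norm U T)\<^sup>2)"
    and "norm (ks_form U S (T :: 'k kp_op)) \<le> 2 * (ultra_norm U S * ultra_norm U T)"
proof -
  obtain B :: "'k kp_op \<Rightarrow> 'k kp_op \<Rightarrow> 'k" where B: "hermitian_form B" "\<And>T. B T T = of_real ((ultra_norm U T)\<^sup>2)"
     "\<And>S T. norm (B S T) \<le> 2 * (ultra_norm U S * ultra_norm U T)" using hermitian_form_exists by blast
  have Lim: "Lim U (\<lambda>n. (kp_norm (kp_apply T (kp_unit n)))\<^sup>2) = (ultra_norm U T)\<^sup>2" for T :: "'k kp_op"
    by (rule tendsto_Lim[OF U_nonbot[OF U]]) (intro tendsto_intros ultra_norm_tendsto U)
  have "ks_form U = B"
    unfolding ks_form_def Lim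
  proof (rule the_equality)
    show "hermitian_form B \<and> (\<forall>T. B T T = of_real ((ultra_norm U T)\<^sup>2))" using B by blast
    fix B' :: "'k kp_op \<Rightarrow> 'k kp_op \<Rightarrow> 'k" assume "hermitian_form B' \<and> (\<forall>T. B' T T = of_real ((ultra_norm U T)\<^sup>2))"
    then show "B' = B" using B by (intro hermitian_form_unique) auto
  qed
  then show "hermitian_form (ks_form U :: 'k kp_op \<Rightarrow> _)" "ks_form U T T = of_real ((ultra_norm U T)\<^sup>2)"
    "norm (ks_form U S T) \<le> 2 * (ultra_norm U S * ultra_norm U T)" using B by simp_all
qed

lemma ks_seminorm_eq: "ks_seminorm U T = ultra_norm U T"
  unfolding ks_seminorm_def ks_form_properties(2) norm_of_real using ultra_norm_nonneg[OF U, of T] by simp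

end

section \<open>The Hilbert space and its operators\<close>

context
  fixes U :: "nat filter"
  assumes U: "nontrivial_ultrafilter U"
begin

abbreviation (input) nrm :: "'k::rc_field kp_op \<Rightarrow> real" where "nrm \<equiv> ultra_norm U"

abbreviation (input) cls :: "(nat \<Rightarrow> 'k::rc_field kp_op) \<Rightarrow> 'k hvec" where "cls x \<equiv> ks_rel U `` {x}"

lemma nrm_uminus: "nrm (- T) = nrm T"
  unfolding uminus_kp_op_def ultra_norm_scale[OF U] by simp

lemma nrm_commute: "nrm (S - T) = nrm (T - S)"
  by (metis nrm_uminus minus_diff_eq)

lemma nrm_zero: "nrm 0 = 0"
proof -
  have "kp_op_scale 0 (0 :: 'a kp_op) = 0" by transfer simp
  then show ?thesis using ultra_norm_scale[OF U, of 0 "0 :: 'a kp_op"] by simp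
qed

lemma abs_nrm: "\<bar>nrm T\<bar> = nrm T"
  using ultra_norm_nonneg[OF U, of T] by simp

lemma nrm_triangle_diff: "nrm (S - R) \<le> nrm (S - T) + nrm (T - R)"
  using ultra_norm_triangle[OF U, of "S - T" "T - R"] by simp

lemma nrm_diff_le: "nrm (S - T) \<le> nrm S + nrm T"
  using nrm_triangle_diff[of S T 0] nrm_uminus[of T] by simp

lemma abs_nrm_diff: "\<bar>nrm S - nrm T\<bar> \<le> nrm (S - T)"
  using nrm_triangle_diff[of S 0 T] nrm_triangle_diff[of T 0 S] nrm_commute[of S T] by simp

lemma nrm_scale_diff: "nrm (kp_op_scale c S - kp_op_scale c T) = norm c * nrm (S - T)"
proof -
  have "kp_op_scale c S - kp_op_scale c T = kp_op_scale c (S - T)"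
    by (rule kp_apply_inject[THEN iffD1]) (simp add: fun_eq_iff kp_apply_minus kp_op_scale.rep_eq kp.scale_right_diff_distrib)
  then show ?thesis by (simp add: ultra_norm_scale[OF U])
qed

lemma nrm_mult_bounded: "\<exists>C\<ge>0. \<forall>T. nrm (A * T) \<le> C * nrm T"
proof -
  obtain M where M: "M > 0" "\<And>z. kp_norm (kp_apply A z) \<le> M * kp_norm z" using kp_apply_bound[of A] by metis
  then have "nrm (A * T) \<le> M * nrm T" for T using ultra_norm_mult_le[OF U, of A M 0 T] by simp
  then show ?thesis using M(1) by (intro exI[of _ M]) simp
qed

lemma ks_cauchy_iff: "x \<in> ks_cauchy U \<longleftrightarrow> (\<forall>e>0. \<exists>N. \<forall>m\<ge>N. \<forall>n\<ge>N. nrm (x m - x n) < e)"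
  by (simp add: ks_cauchy_def ks_seminorm_eq[OF U])

lemma ks_rel_iff: "(x, y) \<in> ks_rel U \<longleftrightarrow> x \<in> ks_cauchy U \<and> y \<in> ks_cauchy U \<and> (\<lambda>n. nrm (x n - y n)) \<longlonglongrightarrow> 0"
  by (simp add: ks_rel_def ks_seminorm_eq[OF U])

lemma ks_cauchyD:
  assumes "x \<in> ks_cauchy U" "e > 0"
  obtains N where "\<And>m n. m \<ge> N \<Longrightarrow> n \<ge> N \<Longrightarrow> nrm (x m - x n) < e"
  using assms ks_cauchy_iff[of x] by blast

lemma ks_cauchyI_le:
  assumes x: "x \<in> ks_cauchy U" and y: "y \<in> ks_cauchy U" and C: "C \<ge> 0"
    and le: "\<And>m n. nrm (z m - z n) \<le> C * (nrm (x m - x n) + nrm (y m - y n))"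
  shows "z \<in> ks_cauchy U"
  unfolding ks_cauchy_iff
proof (intro allI impI)
  fix e :: real assume e: "e > 0"
  define d where "d = e / (2 * (C + 1))"
  have d: "d > 0" "C * (2 * d) < e"
  proof -
    show "d > 0" using e C by (simp add: d_def)
    have "C * (2 * d) = C / (C + 1) * e" using C by (simp add: d_def field_simps)
    also have "\<dots> < 1 * e" using e C by (intro mult_strict_right_mono) auto
    finally show "C * (2 * d) < e" by simp
  qed
  obtain N1 where N1: "\<And>m n. m \<ge> N1 \<Longrightarrow> n \<ge> N1 \<Longrightarrow> nrm (x m - x n) < d" using ks_cauchyD[OF x d(1)] by metis
  obtain N2 where N2: "\<And>m n. m \<ge> N2 \<Longrightarrow> n \<ge> N2 \<Longrightarrow> nrm (y m - y n) < d" using ks_cauchyD[OF y d(1)] by metis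
  have "nrm (z m - z n) < e" if "m \<ge> max N1 N2" "n \<ge> max N1 N2" for m n
  proof -
    have "nrm (x m - x n) + nrm (y m - y n) \<le> 2 * d" using N1[of m n] N2[of m n] that by simp
    then have "C * (nrm (x m - x n) + nrm (y m - y n)) \<le> C * (2 * d)" using C by (rule mult_left_mono)
    then show ?thesis using le[of m n] d(2) by linarith
  qed
  then show "\<exists>N. \<forall>m\<ge>N. \<forall>n\<ge>N. nrm (z m - z n) < e" by blast
qed

lemma ks_cauchy_add:
  assumes "x \<in> ks_cauchy U" "y \<in> ks_cauchy U"
  shows "(\<lambda>n. x n + y n) \<in> ks_cauchy U"
proof (rule ks_cauchyI_le[OF assms, of 1])
  show "nrm (x m + y m - (x n + y n)) \<le> 1 * (nrm (x m - x n) + nrm (y m - y n))" for m n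
    using ultra_norm_triangle[OF U, of "x m - x n" "y m - y n"] by (simp add: algebra_simps)
qed simp

lemma ks_cauchy_scale:
  assumes "x \<in> ks_cauchy U"
  shows "(\<lambda>n. kp_op_scale c (x n)) \<in> ks_cauchy U"
proof (rule ks_cauchyI_le[OF assms assms, of "norm c"])
  show "nrm (kp_op_scale c (x m) - kp_op_scale c (x n)) \<le> norm c * (nrm (x m - x n) + nrm (x m - x n))" for m n
    using ultra_norm_nonneg[OF U, of "x m - x n"] by (simp add: nrm_scale_diff mult_left_mono)
qed simp

lemma ks_cauchy_const: "(\<lambda>n. T) \<in> ks_cauchy U"
  by (simp add: ks_cauchy_iff nrm_zero)

lemma nrm_convergent:
  assumes x: "x \<in> ks_cauchy U"
  shows "convergent (\<lambda>n. nrm (x n))"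
proof (rule Cauchy_convergent, rule CauchyI)
  fix e :: real assume "e > 0"
  then obtain N where "\<And>m n. m \<ge> N \<Longrightarrow> n \<ge> N \<Longrightarrow> nrm (x m - x n) < e" using ks_cauchyD[OF x] by metis
  then show "\<exists>M. \<forall>m\<ge>M. \<forall>n\<ge>M. norm (nrm (x m) - nrm (x n)) < e"
    using abs_nrm_diff by (metis le_less_trans real_norm_def)
qed

lemma ks_cauchy_bounded:
  assumes x: "x \<in> ks_cauchy U"
  shows "\<exists>K>0. \<forall>n. nrm (x n) \<le> K"
  using convergent_imp_Bseq[OF nrm_convergent[OF x]] by (simp add: Bseq_def abs_nrm)

lemma ks_rel_equiv: "equiv (ks_cauchy U) (ks_rel U)"
proof (rule equivI)
  show "ks_rel U \<subseteq> ks_cauchy U \<times> ks_cauchy U" by (auto simp: ks_rel_iff)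
  show "refl_on (ks_cauchy U) (ks_rel U)" by (auto simp: refl_on_def ks_rel_iff nrm_zero)
  show "sym (ks_rel U)" by (auto simp: sym_def ks_rel_iff nrm_commute)
  show "trans (ks_rel U)"
  proof (rule transI)
    fix x y z assume "(x, y) \<in> ks_rel U" "(y, z) \<in> ks_rel U"
    then have xy: "x \<in> ks_cauchy U" "z \<in> ks_cauchy U" "(\<lambda>n. nrm (x n - y n)) \<longlonglongrightarrow> 0" "(\<lambda>n. nrm (y n - z n)) \<longlonglongrightarrow> 0"
      by (simp_all add: ks_rel_iff)
    have "(\<lambda>n. nrm (x n - z n)) \<longlonglongrightarrow> 0"
    proof (rule Lim_null_comparison)
      show "(\<lambda>n. nrm (x n - y n) + nrm (y n - z n)) \<longlonglongrightarrow> 0" using tendsto_add[OF xy(3,4)] by simp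
      show "eventually (\<lambda>n. norm (nrm (x n - z n)) \<le> nrm (x n - y n) + nrm (y n - z n)) sequentially"
        unfolding real_norm_def abs_nrm by (intro always_eventually allI nrm_triangle_diff)
    qed
    with xy show "(x, z) \<in> ks_rel U" by (simp add: ks_rel_iff)
  qed
qed

lemma cls_self: "x \<in> ks_cauchy U \<Longrightarrow> x \<in> cls x"
  by (rule equiv_class_self[OF ks_rel_equiv])

lemma cls_eq: "(x, y) \<in> ks_rel U \<Longrightarrow> cls x = cls y"
  by (rule equiv_class_eq[OF ks_rel_equiv])

lemma cls_in_H: "x \<in> ks_cauchy U \<Longrightarrow> cls x \<in> H_space U"
  by (simp add: H_space_def quotientI)

lemma H_space_cases:
  assumes "X \<in> H_space U"
  obtains x where "x \<in> ks_cauchy U" "X = cls x"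
  using assms unfolding H_space_def by (rule quotientE)

lemma H_add_cls:
  assumes x: "x \<in> ks_cauchy U" and y: "y \<in> ks_cauchy U"
  shows "H_add U (cls x) (cls y) = cls (\<lambda>n. x n + y n)"
proof -
  have "cls (\<lambda>n. x' n + y' n) = cls (\<lambda>n. x n + y n)" if "x' \<in> cls x" "y' \<in> cls y" for x' y'
  proof (rule cls_eq[symmetric])
    have r: "x' \<in> ks_cauchy U" "y' \<in> ks_cauchy U" "(\<lambda>n. nrm (x n - x' n)) \<longlonglongrightarrow> 0" "(\<lambda>n. nrm (y n - y' n)) \<longlonglongrightarrow> 0"
      using that by (simp_all add: ks_rel_iff)
    have "(\<lambda>n. nrm (x n + y n - (x' n + y' n))) \<longlonglongrightarrow> 0"
    proof (rule Lim_null_comparison)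
      show "(\<lambda>n. nrm (x n - x' n) + nrm (y n - y' n)) \<longlonglongrightarrow> 0" using tendsto_add[OF r(3,4)] by simp
      have "nrm (x n + y n - (x' n + y' n)) \<le> nrm (x n - x' n) + nrm (y n - y' n)" for n
        using ultra_norm_triangle[OF U, of "x n - x' n" "y n - y' n"] by (simp add: algebra_simps)
      then show "eventually (\<lambda>n. norm (nrm (x n + y n - (x' n + y' n))) \<le> nrm (x n - x' n) + nrm (y n - y' n)) sequentially"
        by (simp add: abs_nrm)
    qed
    then show "(\<lambda>n. x n + y n, \<lambda>n. x' n + y' n) \<in> ks_rel U"
      using x y r by (simp add: ks_rel_iff ks_cauchy_add)
  qed
  then show ?thesis unfolding H_add_def using cls_self[OF x] cls_self[OF y] by blast
qed

lemma H_scale_cls: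
  assumes x: "x \<in> ks_cauchy U"
  shows "H_scale U c (cls x) = cls (\<lambda>n. kp_op_scale c (x n))"
proof -
  have "cls (\<lambda>n. kp_op_scale c (x' n)) = cls (\<lambda>n. kp_op_scale c (x n))" if "x' \<in> cls x" for x'
  proof (rule cls_eq[symmetric])
    have r: "x' \<in> ks_cauchy U" "(\<lambda>n. nrm (x n - x' n)) \<longlonglongrightarrow> 0" using that by (simp_all add: ks_rel_iff)
    have "(\<lambda>n. nrm (kp_op_scale c (x n) - kp_op_scale c (x' n))) \<longlonglongrightarrow> 0"
      unfolding nrm_scale_diff using tendsto_mult_left[OF r(2), of "norm c"] by simp
    then show "(\<lambda>n. kp_op_scale c (x n), \<lambda>n. kp_op_scale c (x' n)) \<in> ks_rel U"
      using x r by (simp add: ks_rel_iff ks_cauchy_scale)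
  qed
  then show ?thesis unfolding H_scale_def using cls_self[OF x] by blast
qed

text \<open>\<open>H_inner\<close> collects limits over all pairs of representatives. They must be
  shown to exist and to agree before \<open>the_elem\<close> has a meaning; the norm of H then
  becomes a limit of seminorms of operators.\<close>

lemma H_norm_cls:
  fixes x :: "nat \<Rightarrow> 'k::rc_field kp_op"
  assumes x: "x \<in> ks_cauchy U"
  shows "(\<lambda>n. nrm (x n)) \<longlonglongrightarrow> H_norm U (cls x)"
proof -
  obtain L where L: "(\<lambda>n. nrm (x n)) \<longlonglongrightarrow> L" using nrm_convergent[OF x] by (auto simp: convergent_def)
  have L0: "0 \<le> L" by (rule LIMSEQ_le_const[OF L]) (use ultra_norm_nonneg[OF U] in blast)
  have lim: "lim (\<lambda>n. ks_form U (x' n) (y' n)) = of_real (L\<^sup>2)" if "x' \<in> cls x" "y' \<in> cls x" for x' y'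
  proof (rule limI)
    have r: "x' \<in> ks_cauchy U" "y' \<in> ks_cauchy U" "(\<lambda>n. nrm (x n - x' n)) \<longlonglongrightarrow> 0" "(\<lambda>n. nrm (x n - y' n)) \<longlonglongrightarrow> 0"
      using that by (simp_all add: ks_rel_iff)
    have "(\<lambda>n. nrm (x' n) - nrm (x n)) \<longlonglongrightarrow> 0"
    proof (rule Lim_null_comparison[OF _ r(3)])
      have "norm (nrm (x' n) - nrm (x n)) \<le> nrm (x n - x' n)" for n
        using abs_nrm_diff[of "x' n" "x n"] nrm_commute[of "x n" "x' n"] by simp
      then show "eventually (\<lambda>n. norm (nrm (x' n) - nrm (x n)) \<le> nrm (x n - x' n)) sequentially"
        by (intro always_eventually allI)
    qed
    from tendsto_add[OF this L] have L': "(\<lambda>n. nrm (x' n)) \<longlonglongrightarrow> L" by simp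
    have d: "(\<lambda>n. nrm (x' n - y' n)) \<longlonglongrightarrow> 0"
    proof (rule Lim_null_comparison)
      show "(\<lambda>n. nrm (x n - x' n) + nrm (x n - y' n)) \<longlonglongrightarrow> 0" using tendsto_add[OF r(3,4)] by simp
      have "nrm (x' n - y' n) \<le> nrm (x n - x' n) + nrm (x n - y' n)" for n
        using nrm_triangle_diff[of "x' n" "y' n" "x n"] nrm_commute[of "x n" "x' n"] by simp
      then show "eventually (\<lambda>n. norm (nrm (x' n - y' n)) \<le> nrm (x n - x' n) + nrm (x n - y' n)) sequentially"
        by (simp add: abs_nrm)
    qed
    obtain K where K: "K > 0" "\<And>n. nrm (x' n) \<le> K" using ks_cauchy_bounded[OF r(1)] by blast
    note D = hermitian_formD[OF ks_form_properties(1)[OF U]]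
    have diff: "ks_form U (x' n) (y' n) - ks_form U (x' n) (x' n) = ks_form U (x' n) (y' n - x' n)" for n
    proof -
      have "ks_form U (x' n) (y' n) = sconj (ks_form U (y' n) (x' n))" by (rule D(3))
      also have "ks_form U (y' n) (x' n) = ks_form U ((y' n - x' n) + x' n) (x' n)" by simp
      also have "\<dots> = ks_form U (y' n - x' n) (x' n) + ks_form U (x' n) (x' n)" by (rule D(1))
      also have "sconj \<dots> = sconj (ks_form U (y' n - x' n) (x' n)) + sconj (ks_form U (x' n) (x' n))" by (rule sconj_add)
      also have "sconj (ks_form U (y' n - x' n) (x' n)) = ks_form U (x' n) (y' n - x' n)" by (rule D(3)[symmetric])
      also have "sconj (ks_form U (x' n) (x' n)) = ks_form U (x' n) (x' n)" by (rule D(3)[symmetric])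
      finally show ?thesis by simp
    qed
    have "(\<lambda>n. ks_form U (x' n) (y' n) - ks_form U (x' n) (x' n)) \<longlonglongrightarrow> 0"
    proof (rule Lim_null_comparison)
      show "(\<lambda>n. 2 * (K * nrm (x' n - y' n))) \<longlonglongrightarrow> 0"
        using tendsto_mult_left[OF d, of "2 * K"] by (simp add: mult.assoc)
      have "norm (ks_form U (x' n) (y' n) - ks_form U (x' n) (x' n)) \<le> 2 * (K * nrm (x' n - y' n))" for n
      proof -
        have "norm (ks_form U (x' n) (y' n - x' n)) \<le> 2 * (nrm (x' n) * nrm (y' n - x' n))"
          by (rule ks_form_properties(3)[OF U])
        also have "\<dots> \<le> 2 * (K * nrm (y' n - x' n))"
          using K by (intro mult_left_mono mult_right_mono ultra_norm_nonneg U) auto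
        finally show ?thesis unfolding diff by (simp add: nrm_commute[of "x' n"])
      qed
      then show "eventually (\<lambda>n. norm (ks_form U (x' n) (y' n) - ks_form U (x' n) (x' n)) \<le> 2 * (K * nrm (x' n - y' n))) sequentially"
        by (intro always_eventually allI)
    qed
    moreover have "(\<lambda>n. ks_form U (x' n) (x' n)) \<longlonglongrightarrow> of_real (L\<^sup>2)"
      unfolding ks_form_properties(2)[OF U] by (intro tendsto_intros L')
    ultimately have "(\<lambda>n. (ks_form U (x' n) (y' n) - ks_form U (x' n) (x' n)) + ks_form U (x' n) (x' n)) \<longlonglongrightarrow> 0 + of_real (L\<^sup>2)"
      by (rule tendsto_add)
    then show "(\<lambda>n. ks_form U (x' n) (y' n)) \<longlonglongrightarrow> of_real (L\<^sup>2)" by simp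
  qed
  have "{lim (\<lambda>n. ks_form U (x' n) (y' n)) | x' y'. x' \<in> cls x \<and> y' \<in> cls x} = {of_real (L\<^sup>2)}"
  proof (intro equalityI subsetI)
    fix c assume "c \<in> {lim (\<lambda>n. ks_form U (x' n) (y' n)) | x' y'. x' \<in> cls x \<and> y' \<in> cls x}"
    then show "c \<in> {of_real (L\<^sup>2)}" using lim by blast
  next
    fix c :: 'k assume "c \<in> {of_real (L\<^sup>2)}"
    then have "c = lim (\<lambda>n. ks_form U (x n) (x n))" using lim[OF cls_self[OF x] cls_self[OF x]] by simp
    then show "c \<in> {lim (\<lambda>n. ks_form U (x' n) (y' n)) | x' y'. x' \<in> cls x \<and> y' \<in> cls x}" using cls_self[OF x] by blast
  qed
  then have "H_inner U (cls x) (cls x) = of_real (L\<^sup>2)" unfolding H_inner_def by (simp only: the_elem_eq)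
  then have "H_norm U (cls x) = L" unfolding H_norm_def using L0 by (simp add: norm_power)
  with L show ?thesis by simp
qed

text \<open>The expression under the supremum in \<open>H_ops_dist\<close>: H carries only addition
  and scaling, so a difference takes this form.\<close>

definition H_dist :: "'k::rc_field hvec \<Rightarrow> 'k hvec \<Rightarrow> real"
  where "H_dist X Y = H_norm U (H_add U X (H_scale U (- 1) Y))"

lemma H_dist_cls:
  assumes x: "x \<in> ks_cauchy U" and y: "y \<in> ks_cauchy U"
  shows "(\<lambda>n. nrm (x n - y n)) \<longlonglongrightarrow> H_dist (cls x) (cls y)"
    and "(\<lambda>n. x n - y n) \<in> ks_cauchy U" "H_dist (cls x) (cls y) = H_norm U (cls (\<lambda>n. x n - y n))"
proof -
  have eq: "x n - y n = x n + kp_op_scale (- 1) (y n)" for n unfolding minus_kp_op_def uminus_kp_op_def ..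
  show c: "(\<lambda>n. x n - y n) \<in> ks_cauchy U" unfolding eq by (intro ks_cauchy_add ks_cauchy_scale x y)
  show h: "H_dist (cls x) (cls y) = H_norm U (cls (\<lambda>n. x n - y n))"
    unfolding H_dist_def H_scale_cls[OF y] H_add_cls[OF x ks_cauchy_scale[OF y]] eq ..
  show "(\<lambda>n. nrm (x n - y n)) \<longlonglongrightarrow> H_dist (cls x) (cls y)" unfolding h by (rule H_norm_cls[OF c])
qed

lemma H_norm_nonneg: "X \<in> H_space U \<Longrightarrow> 0 \<le> H_norm U X"
  by (erule H_space_cases) (auto intro!: LIMSEQ_le_const[OF H_norm_cls] ultra_norm_nonneg U)

lemma H_dist_nonneg:
  assumes "X \<in> H_space U" "Y \<in> H_space U" shows "0 \<le> H_dist X Y"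
proof -
  obtain x y where xy: "x \<in> ks_cauchy U" "X = cls x" "y \<in> ks_cauchy U" "Y = cls y" using assms by (metis H_space_cases)
  show ?thesis unfolding xy by (rule LIMSEQ_le_const[OF H_dist_cls(1)[OF xy(1,3)]]) (use ultra_norm_nonneg[OF U] in blast)
qed

lemma H_dist_commute:
  assumes "X \<in> H_space U" "Y \<in> H_space U" shows "H_dist X Y = H_dist Y X"
proof -
  obtain x y where xy: "x \<in> ks_cauchy U" "X = cls x" "y \<in> ks_cauchy U" "Y = cls y" using assms by (metis H_space_cases)
  show ?thesis unfolding xy
    by (rule LIMSEQ_unique[OF H_dist_cls(1)[OF xy(1,3)]]) (subst nrm_commute, rule H_dist_cls(1)[OF xy(3,1)])
qed

lemma H_dist_triangle:
  assumes "X \<in> H_space U" "Y \<in> H_space U" "Z \<in> H_space U" shows "H_dist X Z \<le> H_dist X Y + H_dist Y Z"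
proof -
  obtain x y z where xy: "x \<in> ks_cauchy U" "X = cls x" "y \<in> ks_cauchy U" "Y = cls y" "z \<in> ks_cauchy U" "Z = cls z"
    using assms by (metis H_space_cases)
  show ?thesis unfolding xy
    by (rule LIMSEQ_le[OF H_dist_cls(1)[OF xy(1,5)] tendsto_add[OF H_dist_cls(1)[OF xy(1,3)] H_dist_cls(1)[OF xy(3,5)]]])
      (use nrm_triangle_diff in blast)
qed

lemma H_dist_eq_0:
  assumes "X \<in> H_space U" "Y \<in> H_space U" shows "H_dist X Y = 0 \<longleftrightarrow> X = Y"
proof -
  obtain x y where xy: "x \<in> ks_cauchy U" "X = cls x" "y \<in> ks_cauchy U" "Y = cls y" using assms by (metis H_space_cases)
  have "cls x = cls y \<longleftrightarrow> (x, y) \<in> ks_rel U" by (rule eq_equiv_class_iff[OF ks_rel_equiv xy(1,3)])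
  also have "\<dots> \<longleftrightarrow> H_dist (cls x) (cls y) = 0"
    using H_dist_cls(1)[OF xy(1,3)] LIMSEQ_unique by (auto simp: ks_rel_iff xy(1,3))
  finally show ?thesis by (simp add: xy)
qed

lemma H_dist_le_norms:
  assumes "X \<in> H_space U" "Y \<in> H_space U" shows "H_dist X Y \<le> H_norm U X + H_norm U Y"
proof -
  obtain x y where xy: "x \<in> ks_cauchy U" "X = cls x" "y \<in> ks_cauchy U" "Y = cls y" using assms by (metis H_space_cases)
  show ?thesis unfolding xy
    by (rule LIMSEQ_le[OF H_dist_cls(1)[OF xy(1,3)] tendsto_add[OF H_norm_cls[OF xy(1)] H_norm_cls[OF xy(3)]]])
      (use nrm_diff_le in blast)
qed

lemma H_scale_closed: "X \<in> H_space U \<Longrightarrow> H_scale U c X \<in> H_space U"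
  by (erule H_space_cases) (simp add: H_scale_cls cls_in_H ks_cauchy_scale)

lemma H_add_closed: "X \<in> H_space U \<Longrightarrow> Y \<in> H_space U \<Longrightarrow> H_add U X Y \<in> H_space U"
  by (elim H_space_cases) (simp add: H_add_cls cls_in_H ks_cauchy_add)

lemma H_norm_scale:
  assumes "X \<in> H_space U" shows "H_norm U (H_scale U c X) = norm c * H_norm U X"
proof -
  obtain x where x: "x \<in> ks_cauchy U" "X = cls x" using assms by (rule H_space_cases)
  have "(\<lambda>n. nrm (kp_op_scale c (x n))) \<longlonglongrightarrow> norm c * H_norm U (cls x)"
    unfolding ultra_norm_scale[OF U] by (intro tendsto_intros H_norm_cls x)
  then show ?thesis unfolding x(2) H_scale_cls[OF x(1)]
    using LIMSEQ_unique[OF H_norm_cls[OF ks_cauchy_scale[OF x(1)]]] by blast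
qed

lemma H_scale_inverse:
  assumes "X \<in> H_space U" "c \<noteq> 0" shows "H_scale U c (H_scale U (1 / c) X) = X"
proof -
  obtain x where x: "x \<in> ks_cauchy U" "X = cls x" using assms(1) by (rule H_space_cases)
  have "kp_op_scale c (kp_op_scale (1 / c) T) = T" for T using assms(2) by transfer simp
  then show ?thesis unfolding x(2) by (simp add: H_scale_cls x(1) ks_cauchy_scale)
qed

lemma H_opsD:
  assumes "F \<in> H_ops U"
  shows "X \<in> H_space U \<Longrightarrow> F X \<in> H_space U"
    "X \<in> H_space U \<Longrightarrow> Y \<in> H_space U \<Longrightarrow> F (H_add U X Y) = H_add U (F X) (F Y)"
    "X \<in> H_space U \<Longrightarrow> F (H_scale U c X) = H_scale U c (F X)"
    "\<exists>C\<ge>0. \<forall>X\<in>H_space U. H_norm U (F X) \<le> C * H_norm U X"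
proof -
  show "X \<in> H_space U \<Longrightarrow> F X \<in> H_space U"
    "X \<in> H_space U \<Longrightarrow> Y \<in> H_space U \<Longrightarrow> F (H_add U X Y) = H_add U (F X) (F Y)"
    "X \<in> H_space U \<Longrightarrow> F (H_scale U c X) = H_scale U c (F X)"
    using assms unfolding H_ops_def by blast+
  obtain C where C: "\<And>X. X \<in> H_space U \<Longrightarrow> H_norm U (F X) \<le> C * H_norm U X" using assms unfolding H_ops_def by blast
  have "H_norm U (F X) \<le> \<bar>C\<bar> * H_norm U X" if "X \<in> H_space U" for X
    using C[OF that] mult_right_mono[OF abs_ge_self[of C] H_norm_nonneg[OF that]] by linarith
  then show "\<exists>C\<ge>0. \<forall>X\<in>H_space U. H_norm U (F X) \<le> C * H_norm U X" by (intro exI[of _ "\<bar>C\<bar>"]) simp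
qed

lemma H_ops_lipschitz:
  assumes F: "F \<in> H_ops U"
  shows "\<exists>C\<ge>0. \<forall>X\<in>H_space U. \<forall>Y\<in>H_space U. H_dist (F X) (F Y) \<le> C * H_dist X Y"
proof -
  obtain C where C: "C \<ge> 0" "\<And>X. X \<in> H_space U \<Longrightarrow> H_norm U (F X) \<le> C * H_norm U X" using H_opsD(4)[OF F] by blast
  have "H_dist (F X) (F Y) \<le> C * H_dist X Y" if XY: "X \<in> H_space U" "Y \<in> H_space U" for X Y
  proof -
    have "H_dist (F X) (F Y) = H_norm U (F (H_add U X (H_scale U (- 1) Y)))"
      using XY by (simp add: H_dist_def H_opsD(2,3)[OF F] H_scale_closed)
    also have "\<dots> \<le> C * H_dist X Y" unfolding H_dist_def by (intro C H_add_closed H_scale_closed XY)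
    finally show ?thesis .
  qed
  then show ?thesis using C(1) by blast
qed

text \<open>The classes of single operators are dense in H and bounded operators are Lipschitz, so
  agreement on these classes propagates. This is the uniqueness behind the definition of
  \<open>Lambda\<close>.\<close>

lemma H_ops_eqI:
  fixes F G :: "'k::rc_field hvec \<Rightarrow> 'k hvec"
  assumes F: "F \<in> H_ops U" and G: "G \<in> H_ops U" and eq: "\<And>T. F (H_class U T) = G (H_class U T)"
  shows "F = G"
proof (rule PiE_ext[of F "H_space U" "\<lambda>_. H_space U" G])
  show "F \<in> H_space U \<rightarrow>\<^sub>E H_space U" "G \<in> H_space U \<rightarrow>\<^sub>E H_space U" using F G by (simp_all add: H_ops_def)
  fix X :: "'k hvec" assume X: "X \<in> H_space U"
  then obtain x where x: "x \<in> ks_cauchy U" "X = cls x" by (rule H_space_cases)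
  obtain C where C: "C \<ge> 0" "\<And>X Y. X \<in> H_space U \<Longrightarrow> Y \<in> H_space U \<Longrightarrow> H_dist (F X) (F Y) \<le> C * H_dist X Y"
    using H_ops_lipschitz[OF F] by blast
  obtain D where D: "D \<ge> 0" "\<And>X Y. X \<in> H_space U \<Longrightarrow> Y \<in> H_space U \<Longrightarrow> H_dist (G X) (G Y) \<le> D * H_dist X Y"
    using H_ops_lipschitz[OF G] by blast
  have "H_dist (F X) (G X) \<le> (C + D) * e" if e: "e > 0" for e
  proof -
    obtain N where N: "\<And>m n. m \<ge> N \<Longrightarrow> n \<ge> N \<Longrightarrow> nrm (x m - x n) < e" using ks_cauchyD[OF x(1) e] by metis
    define Y where "Y = H_class U (x N)"
    have Yc: "Y = cls (\<lambda>n. x N)" by (simp add: Y_def H_class_def)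
    have Y: "Y \<in> H_space U" unfolding Yc by (intro cls_in_H ks_cauchy_const)
    have "H_dist X Y \<le> e" unfolding x(2) Yc
      by (rule LIMSEQ_le_const2[OF H_dist_cls(1)[OF x(1) ks_cauchy_const]]) (use N in \<open>auto intro!: exI[of _ N] less_imp_le\<close>)
    moreover have "H_dist (F X) (G X) \<le> H_dist (F X) (F Y) + H_dist (F Y) (G X)"
      by (intro H_dist_triangle H_opsD(1)[OF F] H_opsD(1)[OF G] X Y)
    moreover have "H_dist (F Y) (G X) = H_dist (G X) (G Y)"
      unfolding Y_def eq by (rule H_dist_commute) (use H_opsD(1)[OF G] X Y in \<open>simp_all add: Y_def\<close>)
    moreover have "C * H_dist X Y \<le> C * e" "D * H_dist X Y \<le> D * e"
      using C(1) D(1) \<open>H_dist X Y \<le> e\<close> by (simp_all add: mult_left_mono)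
    ultimately show ?thesis using C(2)[OF X Y] D(2)[OF X Y] unfolding distrib_right by linarith
  qed
  then have "H_dist (F X) (G X) \<le> e" if e: "e > 0" for e
  proof -
    assume *: "\<And>e. e > 0 \<Longrightarrow> H_dist (F X) (G X) \<le> (C + D) * e"
    have "H_dist (F X) (G X) \<le> (C + D) * (e / (C + D + 1))" using C(1) D(1) e by (intro *) simp
    also have "\<dots> \<le> e" using C(1) D(1) e by (simp add: field_simps)
    finally show ?thesis .
  qed
  then have "H_dist (F X) (G X) \<le> 0" using field_le_epsilon[of "H_dist (F X) (G X)" 0] by simp
  then show "F X = G X"
    using H_dist_nonneg[of "F X" "G X"] H_dist_eq_0[of "F X" "G X"] H_opsD(1)[OF F X] H_opsD(1)[OF G X] by simp
qed

lemma zero_class: "cls (\<lambda>n. 0) \<in> H_space U" "H_norm U (cls (\<lambda>n. 0)) = 0"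
proof -
  show "cls (\<lambda>n. 0) \<in> H_space U" by (intro cls_in_H ks_cauchy_const)
  show "H_norm U (cls (\<lambda>n. 0)) = 0"
    using LIMSEQ_unique[OF H_norm_cls[OF ks_cauchy_const[of 0]] tendsto_const] by (simp add: nrm_zero)
qed

lemma H_ops_dist_bdd:
  assumes F: "F \<in> H_ops U" and G: "G \<in> H_ops U"
  shows "bdd_above ((\<lambda>X. H_dist (F X) (G X)) ` {X \<in> H_space U. H_norm U X \<le> 1})"
proof -
  obtain C where C: "C \<ge> 0" "\<And>X. X \<in> H_space U \<Longrightarrow> H_norm U (F X) \<le> C * H_norm U X" using H_opsD(4)[OF F] by blast
  obtain D where D: "D \<ge> 0" "\<And>X. X \<in> H_space U \<Longrightarrow> H_norm U (G X) \<le> D * H_norm U X" using H_opsD(4)[OF G] by blast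
  have "H_dist (F X) (G X) \<le> C + D" if X: "X \<in> H_space U" "H_norm U X \<le> 1" for X
    using H_dist_le_norms[OF H_opsD(1)[OF F X(1)] H_opsD(1)[OF G X(1)]] C(2)[OF X(1)] D(2)[OF X(1)]
      mult_left_mono[OF X(2) C(1)] mult_left_mono[OF X(2) D(1)] by simp
  then show ?thesis by (intro bdd_aboveI[of _ "C + D"]) auto
qed

lemma H_ops_dist_ge:
  assumes "F \<in> H_ops U" "G \<in> H_ops U" "X \<in> H_space U" "H_norm U X \<le> 1"
  shows "H_dist (F X) (G X) \<le> H_ops_dist U F G"
  unfolding H_ops_dist_def H_dist_def[symmetric] using assms
  by (simp only: if_True simp_thms) (rule cSUP_upper[OF _ H_ops_dist_bdd], auto)

lemma H_ops_dist_le: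
  fixes F G :: "'k::rc_field hvec \<Rightarrow> 'k hvec"
  assumes "F \<in> H_ops U" "G \<in> H_ops U" "\<And>X. X \<in> H_space U \<Longrightarrow> H_norm U X \<le> 1 \<Longrightarrow> H_dist (F X) (G X) \<le> e"
  shows "H_ops_dist U F G \<le> e"
proof -
  have "cls (\<lambda>n. 0 :: 'k kp_op) \<in> {X \<in> H_space U. H_norm U X \<le> 1}" by (simp add: zero_class)
  then show ?thesis
    unfolding H_ops_dist_def H_dist_def[symmetric] using assms by (auto intro!: cSUP_least)
qed

lemma H_ops_Metric_space: "Metric_space (H_ops U :: ('k::rc_field hvec \<Rightarrow> _) set) (H_ops_dist U)"
proof
  fix F G :: "'k hvec \<Rightarrow> 'k hvec"
  show nn: "0 \<le> H_ops_dist U F G"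
  proof (cases "F \<in> H_ops U \<and> G \<in> H_ops U")
    case True
    have z: "cls (\<lambda>n. 0 :: 'k kp_op) \<in> H_space U" "H_norm U (cls (\<lambda>n. 0 :: 'k kp_op)) \<le> 1" by (simp_all add: zero_class)
    have "0 \<le> H_dist (F (cls (\<lambda>n. 0))) (G (cls (\<lambda>n. 0)))"
      using True z by (intro H_dist_nonneg H_opsD(1)[of F] H_opsD(1)[of G]) auto
    also have "\<dots> \<le> H_ops_dist U F G" using True z by (intro H_ops_dist_ge) auto
    finally show ?thesis .
  next
    case False
    then show ?thesis unfolding H_ops_dist_def by auto
  qed
  show "H_ops_dist U F G = H_ops_dist U G F"
  proof (cases "F \<in> H_ops U \<and> G \<in> H_ops U")
    case True
    then have "H_dist (F X) (G X) = H_dist (G X) (F X)" if "X \<in> {X \<in> H_space U. H_norm U X \<le> 1}" for X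
      using that by (intro H_dist_commute H_opsD(1)[of F] H_opsD(1)[of G]) auto
    then show ?thesis unfolding H_ops_dist_def H_dist_def[symmetric] using True by simp
  next
    case False
    then show ?thesis unfolding H_ops_dist_def by auto
  qed
next
  fix F G :: "'k hvec \<Rightarrow> 'k hvec" assume F: "F \<in> H_ops U" and G: "G \<in> H_ops U"
  show "H_ops_dist U F G = 0 \<longleftrightarrow> F = G"
  proof
    assume 0: "H_ops_dist U F G = 0"
    have ball: "F X = G X" if X: "X \<in> H_space U" "H_norm U X \<le> 1" for X
      using H_ops_dist_ge[OF F G X] 0 H_dist_nonneg[OF H_opsD(1)[OF F X(1)] H_opsD(1)[OF G X(1)]]
        H_dist_eq_0[OF H_opsD(1)[OF F X(1)] H_opsD(1)[OF G X(1)]] by simp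
    show "F = G"
    proof (rule PiE_ext[of F "H_space U" "\<lambda>_. H_space U" G])
      show "F \<in> H_space U \<rightarrow>\<^sub>E H_space U" "G \<in> H_space U \<rightarrow>\<^sub>E H_space U" using F G by (simp_all add: H_ops_def)
      fix X :: "'k hvec" assume X: "X \<in> H_space U"
      \<comment> \<open>Adding 1 keeps the scalar nonzero when \<open>X\<close> has norm 0; dividing
        by it moves \<open>X\<close> into the unit ball.\<close>
      define c where "c = (of_real (H_norm U X + 1) :: 'k)"
      have c: "c \<noteq> 0" "norm c = H_norm U X + 1"
      proof -
        show nc: "norm c = H_norm U X + 1" unfolding c_def norm_of_real using H_norm_nonneg[OF X] by simp
        show "c \<noteq> 0" using nc H_norm_nonneg[OF X] by auto
      qed
      define Y where "Y = H_scale U (1 / c) X"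
      have Y: "Y \<in> H_space U" unfolding Y_def by (rule H_scale_closed[OF X])
      have "H_norm U Y \<le> 1" unfolding Y_def H_norm_scale[OF X]
        using c H_norm_nonneg[OF X] by (simp add: norm_divide)
      then have "F Y = G Y" by (rule ball[OF Y])
      then have "F (H_scale U c Y) = G (H_scale U c Y)" by (simp add: H_opsD(3)[OF F Y] H_opsD(3)[OF G Y])
      then show "F X = G X" unfolding Y_def H_scale_inverse[OF X c(1)] .
    qed
  next
    assume eq: "F = G"
    have "H_ops_dist U F G \<le> 0"
    proof (rule H_ops_dist_le[OF F G])
      fix X :: "'k hvec" assume X: "X \<in> H_space U"
      show "H_dist (F X) (G X) \<le> 0" using H_dist_eq_0[OF H_opsD(1)[OF G X] H_opsD(1)[OF G X]] by (simp add: eq)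
    qed
    moreover have "0 \<le> H_dist (F (cls (\<lambda>n. 0))) (G (cls (\<lambda>n. 0)))"
      by (intro H_dist_nonneg H_opsD(1)[OF F] H_opsD(1)[OF G] zero_class)
    moreover have "H_dist (F (cls (\<lambda>n. 0))) (G (cls (\<lambda>n. 0))) \<le> H_ops_dist U F G"
      by (rule H_ops_dist_ge[OF F G]) (simp_all add: zero_class)
    ultimately show "H_ops_dist U F G = 0" by linarith
  qed
  fix H :: "'k hvec \<Rightarrow> 'k hvec" assume H: "H \<in> H_ops U"
  show "H_ops_dist U F H \<le> H_ops_dist U F G + H_ops_dist U G H"
  proof (rule H_ops_dist_le[OF F H])
    fix X :: "'k hvec" assume X: "X \<in> H_space U" "H_norm U X \<le> 1"
    have "H_dist (F X) (H X) \<le> H_dist (F X) (G X) + H_dist (G X) (H X)"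
      by (intro H_dist_triangle H_opsD(1)[OF F] H_opsD(1)[OF G] H_opsD(1)[OF H] X)
    then show "H_dist (F X) (H X) \<le> H_ops_dist U F G + H_ops_dist U G H"
      using H_ops_dist_ge[OF F G X] H_ops_dist_ge[OF G H X] by linarith
  qed
qed

section \<open>The Kalton--Swanson map and its range\<close>

text \<open>Left multiplications that are uniformly Cauchy converge to an operator on H, given on
  representatives by the diagonal sequence A n * x n. The sequence A n itself need not converge to
  an operator on Z_2. A constant sequence gives the operator of \<open>Lambda\<close>.\<close>

lemma H_ops_limit:
  fixes A :: "nat \<Rightarrow> 'k::rc_field kp_op"
  assumes C: "C \<ge> 0" "\<And>n T. nrm (A n * T) \<le> C * nrm T"
    and cauchy: "\<And>e. e > 0 \<Longrightarrow> \<exists>N. \<forall>m\<ge>N. \<forall>n\<ge>N. \<forall>T. nrm ((A m - A n) * T) \<le> e * nrm T"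
  shows "\<exists>F\<in>H_ops U. \<forall>x\<in>ks_cauchy U. (\<lambda>n. A n * x n) \<in> ks_cauchy U \<and> F (cls x) = cls (\<lambda>n. A n * x n)"
proof -
  have Ax: "(\<lambda>n. A n * x n) \<in> ks_cauchy U" if x: "x \<in> ks_cauchy U" for x
    unfolding ks_cauchy_iff
  proof (intro allI impI)
    fix e :: real assume e: "e > 0"
    obtain K where K: "K > 0" "\<And>n. nrm (x n) \<le> K" using ks_cauchy_bounded[OF x] by blast
    have "e / (2 * K) > 0" "e / (2 * (C + 1)) > 0" using e K C by simp_all
    from cauchy[OF this(1)] ks_cauchyD[OF x this(2)]
    obtain N1 N2 where N1: "\<And>m n T. m \<ge> N1 \<Longrightarrow> n \<ge> N1 \<Longrightarrow> nrm ((A m - A n) * T) \<le> e / (2 * K) * nrm T"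
      and N2: "\<And>m n. m \<ge> N2 \<Longrightarrow> n \<ge> N2 \<Longrightarrow> nrm (x m - x n) < e / (2 * (C + 1))" by metis
    have "nrm (A m * x m - A n * x n) < e" if "m \<ge> max N1 N2" "n \<ge> max N1 N2" for m n
    proof -
      have "nrm (A m * x m - A n * x n) \<le> nrm (A m * x m - A m * x n) + nrm (A m * x n - A n * x n)"
        by (rule nrm_triangle_diff)
      also have "A m * x m - A m * x n = A m * (x m - x n)" by (simp add: right_diff_distrib)
      also have "A m * x n - A n * x n = (A m - A n) * x n" by (simp add: left_diff_distrib)
      also have "nrm (A m * (x m - x n)) \<le> (C + 1) * nrm (x m - x n)"
        using C(2)[of m "x m - x n"] ultra_norm_nonneg[OF U, of "x m - x n"] by (simp add: distrib_right)
      also have "\<dots> < (C + 1) * (e / (2 * (C + 1)))" using N2[of m n] that C by (intro mult_strict_left_mono) auto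
      also have "\<dots> = e / 2"
      proof -
        have "c * (e / (2 * c)) = e / 2" if "c > 0" for c :: real using that by simp
        then show ?thesis using C(1) by (metis add_nonneg_pos zero_less_one)
      qed
      also have "nrm ((A m - A n) * x n) \<le> e / 2"
      proof -
        have "nrm ((A m - A n) * x n) \<le> e / (2 * K) * nrm (x n)" using N1[of m n] that by simp
        also have "\<dots> \<le> e / (2 * K) * K" using K e by (intro mult_left_mono) auto
        finally show ?thesis using K by simp
      qed
      finally show ?thesis by simp
    qed
    then show "\<exists>N. \<forall>m\<ge>N. \<forall>n\<ge>N. nrm (A m * x m - A n * x n) < e" by blast
  qed
  have wd: "cls (\<lambda>n. A n * x n) = cls (\<lambda>n. A n * y n)" if xy: "(x, y) \<in> ks_rel U" for x y
  proof (rule cls_eq)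
    have r: "x \<in> ks_cauchy U" "y \<in> ks_cauchy U" "(\<lambda>n. nrm (x n - y n)) \<longlonglongrightarrow> 0" using xy by (simp_all add: ks_rel_iff)
    have "(\<lambda>n. nrm (A n * x n - A n * y n)) \<longlonglongrightarrow> 0"
    proof (rule Lim_null_comparison)
      show "(\<lambda>n. C * nrm (x n - y n)) \<longlonglongrightarrow> 0" using tendsto_mult_left[OF r(3), of C] by simp
      have "nrm (A n * x n - A n * y n) \<le> C * nrm (x n - y n)" for n
        using C(2)[of n "x n - y n"] by (simp add: right_diff_distrib)
      then show "eventually (\<lambda>n. norm (nrm (A n * x n - A n * y n)) \<le> C * nrm (x n - y n)) sequentially"
        by (simp add: abs_nrm)
    qed
    then show "(\<lambda>n. A n * x n, \<lambda>n. A n * y n) \<in> ks_rel U" using r Ax by (simp add: ks_rel_iff)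
  qed
  \<comment> \<open>By \<open>wd\<close> the class does not depend on the representative chosen;
    outside H the value is that required of a member of \<open>H_ops\<close>.\<close>
  define F where "F X = (if X \<in> H_space U then cls (\<lambda>n. A n * (SOME x. x \<in> X) n) else undefined)" for X
  have F: "F (cls x) = cls (\<lambda>n. A n * x n)" if x: "x \<in> ks_cauchy U" for x
  proof -
    have "(SOME y. y \<in> cls x) \<in> cls x" by (rule someI[of "\<lambda>y. y \<in> cls x", OF cls_self[OF x]])
    then have "cls (\<lambda>n. A n * x n) = cls (\<lambda>n. A n * (SOME y. y \<in> cls x) n)" by (intro wd) simp
    then show ?thesis using cls_in_H[OF x] by (simp add: F_def)
  qed
  have "F \<in> H_ops U"
    unfolding H_ops_def
  proof (intro CollectI conjI ballI allI)
    show "F \<in> H_space U \<rightarrow>\<^sub>E H_space U"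
    proof (rule PiE_I)
      fix X :: "'k hvec" assume "X \<in> H_space U"
      then show "F X \<in> H_space U" by (elim H_space_cases) (simp add: F cls_in_H Ax)
    qed (simp add: F_def)
    fix X :: "'k hvec" assume "X \<in> H_space U"
    then obtain x where x: "x \<in> ks_cauchy U" "X = cls x" by (rule H_space_cases)
    show "F (H_scale U c X) = H_scale U c (F X)" for c
    proof -
      have "A n * kp_op_scale c T = kp_op_scale c (A n * T)" for n T
        by (rule kp_apply_inject[THEN iffD1]) (simp add: fun_eq_iff times_kp_op.rep_eq kp_op_scale.rep_eq kp_apply_scale)
      then show ?thesis unfolding x(2) by (simp add: H_scale_cls x(1) F ks_cauchy_scale Ax)
    qed
    fix Y :: "'k hvec" assume "Y \<in> H_space U"
    then obtain y where y: "y \<in> ks_cauchy U" "Y = cls y" by (rule H_space_cases)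
    show "F (H_add U X Y) = H_add U (F X) (F Y)"
      unfolding x(2) y(2) by (simp add: H_add_cls x(1) y(1) F ks_cauchy_add Ax distrib_left)
  next
    have "H_norm U (F X) \<le> C * H_norm U X" if X: "X \<in> H_space U" for X
    proof -
      obtain x where x: "x \<in> ks_cauchy U" "X = cls x" using X by (rule H_space_cases)
      show ?thesis unfolding x(2) F[OF x(1)]
        by (rule LIMSEQ_le[OF H_norm_cls[OF Ax[OF x(1)]] tendsto_mult_left[OF H_norm_cls[OF x(1)]]]) (use C(2) in blast)
    qed
    then show "\<exists>C. \<forall>X\<in>H_space U. H_norm U (F X) \<le> C * H_norm U X" by blast
  qed
  then show ?thesis using F Ax by blast
qed

text \<open>Existence comes from \<open>H_ops_limit\<close> for a constant sequence and uniqueness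
  from \<open>H_ops_eqI\<close>, which justifies the definite description.\<close>

lemma Lambda_properties:
  fixes A :: "'k::rc_field kp_op"
  shows "Lambda U A \<in> H_ops U"
    and "x \<in> ks_cauchy U \<Longrightarrow> (\<lambda>n. A * x n) \<in> ks_cauchy U \<and> Lambda U A (cls x) = cls (\<lambda>n. A * x n)"
proof -
  obtain C where C: "C \<ge> 0" "\<And>T. nrm (A * T) \<le> C * nrm T" using nrm_mult_bounded[of A] by blast
  have "\<exists>F\<in>H_ops U. \<forall>x\<in>ks_cauchy U. (\<lambda>n. A * x n) \<in> ks_cauchy U \<and> F (cls x) = cls (\<lambda>n. A * x n)"
    by (rule H_ops_limit[OF C]) (auto simp: nrm_zero ultra_norm_nonneg[OF U] intro!: mult_nonneg_nonneg)
  then obtain F where F: "F \<in> H_ops U"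
    "\<And>x. x \<in> ks_cauchy U \<Longrightarrow> (\<lambda>n. A * x n) \<in> ks_cauchy U \<and> F (cls x) = cls (\<lambda>n. A * x n)" by blast
  have FT: "F (H_class U T) = H_class U (A * T)" for T
    unfolding H_class_def using F(2)[OF ks_cauchy_const[of T]] by simp
  have "Lambda U A = F"
    unfolding Lambda_def
  proof (rule the_equality)
    show "F \<in> H_ops U \<and> (\<forall>T. F (H_class U T) = H_class U (A * T))" using F(1) FT by blast
    fix G :: "'k hvec \<Rightarrow> 'k hvec" assume "G \<in> H_ops U \<and> (\<forall>T. G (H_class U T) = H_class U (A * T))"
    then show "G = F" using F(1) FT by (intro H_ops_eqI) auto
  qed
  then show "Lambda U A \<in> H_ops U"
    "x \<in> ks_cauchy U \<Longrightarrow> (\<lambda>n. A * x n) \<in> ks_cauchy U \<and> Lambda U A (cls x) = cls (\<lambda>n. A * x n)"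
    using F by simp_all
qed

lemma walsh_op_nrm_diff:
  assumes "p \<le> m" "p \<le> n"
  shows "nrm ((walsh_op m - walsh_op n) * T) \<le> 1 / real (Suc p) * nrm (T :: 'k::rc_field kp_op)"
proof -
  obtain C where "\<And>z. kp_norm (kp_apply (walsh_op m - walsh_op n :: 'k kp_op) z)
    \<le> 1 / real (Suc p) * kp_norm z + C * l2_norm (kp_snd z)" using walsh_op_diff_bound[OF assms, where 'k = 'k] by metis
  then show ?thesis by (rule ultra_norm_mult_le[OF U])
qed

lemma Lambda_range_not_closedin:
  "\<not> closedin (Metric_space.mtopology (H_ops U) (H_ops_dist U)) (range (Lambda U :: 'k::rc_field kp_op \<Rightarrow> _))"
proof
  interpret Metric_space "H_ops U :: ('k hvec \<Rightarrow> 'k hvec) set" "H_ops_dist U" by (rule H_ops_Metric_space)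
  assume closed: "closedin mtopology (range (Lambda U :: 'k kp_op \<Rightarrow> _))"
  let ?A = "walsh_op :: nat \<Rightarrow> 'k kp_op"
  obtain C0 where C0: "C0 \<ge> 0" "\<And>T. nrm (?A 0 * T) \<le> C0 * nrm T" using nrm_mult_bounded[of "?A 0"] by blast
  have bound: "nrm (?A n * T) \<le> (C0 + 1) * nrm T" for n T
  proof -
    have "nrm (?A n * T) \<le> nrm ((?A n - ?A 0) * T) + nrm (?A 0 * T)"
      using ultra_norm_triangle[OF U, of "(?A n - ?A 0) * T" "?A 0 * T"] by (simp add: left_diff_distrib)
    then show ?thesis using walsh_op_nrm_diff[of 0 n 0 T] C0(2)[of T] unfolding distrib_right by simp
  qed
  \<comment> \<open>The limit of the images is constructed in L(H) directly, so closedness of the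
    range is used only to represent it by an operator on Z_2.\<close>
  have "\<exists>F\<in>H_ops U. \<forall>x\<in>ks_cauchy U. (\<lambda>n. ?A n * x n) \<in> ks_cauchy U \<and> F (cls x) = cls (\<lambda>n. ?A n * x n)"
  proof (rule H_ops_limit[OF _ bound])
    fix e :: real assume "e > 0"
    then obtain p where p: "1 / real (Suc p) < e" using nat_approx_posE by blast
    have "nrm ((?A m - ?A n) * T) \<le> e * nrm T" if "p \<le> m" "p \<le> n" for m n T
      using walsh_op_nrm_diff[OF that, of T] mult_right_mono[OF less_imp_le[OF p] ultra_norm_nonneg[OF U, of T]] by linarith
    then show "\<exists>N. \<forall>m\<ge>N. \<forall>n\<ge>N. \<forall>T. nrm ((?A m - ?A n) * T) \<le> e * nrm T" by blast
  qed (use C0(1) in simp)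
  then obtain F where F: "F \<in> H_ops U"
    "\<And>x. x \<in> ks_cauchy U \<Longrightarrow> (\<lambda>n. ?A n * x n) \<in> ks_cauchy U \<and> F (cls x) = cls (\<lambda>n. ?A n * x n)" by blast
  have dist: "H_ops_dist U (Lambda U (?A m)) F \<le> 1 / real (Suc m)" for m
  proof (rule H_ops_dist_le[OF Lambda_properties(1) F(1)])
    fix X :: "'k hvec" assume X: "X \<in> H_space U" "H_norm U X \<le> 1"
    then obtain x where x: "x \<in> ks_cauchy U" "X = cls x" by (elim H_space_cases)
    have "H_dist (Lambda U (?A m) X) (F X) \<le> 1 / real (Suc m) * H_norm U X"
      unfolding x(2) Lambda_properties(2)[OF x(1), THEN conjunct2] F(2)[OF x(1), THEN conjunct2]
    proof (rule LIMSEQ_le[OF H_dist_cls(1) tendsto_mult_left[OF H_norm_cls[OF x(1)]]])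
      have "nrm (?A m * x n - ?A n * x n) \<le> 1 / real (Suc m) * nrm (x n)" if "n \<ge> m" for n
        using walsh_op_nrm_diff[of m m n "x n"] that by (simp add: left_diff_distrib)
      then show "\<exists>N. \<forall>n\<ge>N. nrm (?A m * x n - ?A n * x n) \<le> 1 / real (Suc m) * nrm (x n)" by blast
    qed (use Lambda_properties(2)[OF x(1)] F(2)[OF x(1)] in simp_all)
    also have "\<dots> \<le> 1 / real (Suc m) * 1" using X(2) by (intro mult_left_mono) auto
    finally show "H_dist (Lambda U (?A m) X) (F X) \<le> 1 / real (Suc m)" by simp
  qed
  have "limitin mtopology (\<lambda>m. Lambda U (?A m)) F sequentially"
    unfolding limitin_metric_dist_null
  proof (intro conjI F(1) always_eventually allI Lambda_properties(1))
    show "(\<lambda>m. H_ops_dist U (Lambda U (?A m)) F) \<longlonglongrightarrow> 0"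
    proof (rule Lim_null_comparison)
      show "eventually (\<lambda>m. norm (H_ops_dist U (Lambda U (?A m)) F) \<le> 1 / real (Suc m)) sequentially"
        unfolding real_norm_def using dist nonneg by (intro always_eventually allI) simp
      show "(\<lambda>m. 1 / real (Suc m)) \<longlonglongrightarrow> 0" by (rule LIMSEQ_Suc) (rule lim_1_over_n)
    qed
  qed
  from limitin_closedin[OF this closed] have "F \<in> range (Lambda U :: 'k kp_op \<Rightarrow> _)" by simp
  then obtain B where B: "F = Lambda U B" by blast
  \<comment> \<open>The bound is uniform over all \<open>J\<close> of seminorm at most 1; below,
    \<open>J\<close> depends on the exceptional set of indices.\<close>
  have close: "nrm ((?A m - B) * J) \<le> 1 / real (Suc m)" if J: "nrm J \<le> 1" for m J
  proof -
    have norm: "H_norm U (cls (\<lambda>n. T)) = nrm T" for T :: "'k kp_op"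
      using LIMSEQ_unique[OF H_norm_cls[OF ks_cauchy_const[of T]] tendsto_const] .
    have "H_norm U (cls (\<lambda>n. J)) \<le> 1" using J by (simp add: norm)
    from order_trans[OF H_ops_dist_ge[OF Lambda_properties(1) F(1) cls_in_H[OF ks_cauchy_const] this] dist]
    have "H_dist (Lambda U (?A m) (cls (\<lambda>n. J))) (F (cls (\<lambda>n. J))) \<le> 1 / real (Suc m)" .
    also have "Lambda U (?A m) (cls (\<lambda>n. J)) = cls (\<lambda>n. ?A m * J)" using Lambda_properties(2)[OF ks_cauchy_const] by blast
    also have "F (cls (\<lambda>n. J)) = cls (\<lambda>n. B * J)" unfolding B using Lambda_properties(2)[OF ks_cauchy_const] by blast
    also have "H_dist (cls (\<lambda>n. ?A m * J)) (cls (\<lambda>n. B * J)) = nrm (?A m * J - B * J)"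
      unfolding H_dist_cls(3)[OF ks_cauchy_const ks_cauchy_const] norm ..
    finally show ?thesis by (simp add: left_diff_distrib)
  qed
  show False
  proof (rule walsh_op_no_limit[of B])
    fix \<delta> :: real assume "\<delta> > 0"
    then obtain p where p: "1 / real (Suc p) < \<delta>" using nat_approx_posE by blast
    have "eventually (\<lambda>n. kp_norm (kp_apply (B - ?A m) (kp_unit n)) \<le> \<delta>) sequentially" if "m \<ge> p" for m
    proof (rule ccontr)
      assume neg: "\<not> ?thesis"
      define S where "S = {n. \<delta> \<le> kp_norm (kp_apply (B - ?A m) (kp_unit n))}"
      have "infinite S"
        unfolding infinite_nat_iff_unbounded_le
      proof
        fix k
        from neg obtain n where "n \<ge> k" "\<not> kp_norm (kp_apply (B - ?A m) (kp_unit n)) \<le> \<delta>"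
          unfolding eventually_sequentially by blast
        then show "\<exists>n\<ge>k. n \<in> S" unfolding S_def by (intro exI[of _ n]) simp
      qed
      then obtain r :: "nat \<Rightarrow> nat" where r: "strict_mono r" "\<And>i. r i \<in> S" using infinite_subsequence by metis
      \<comment> \<open>The ultrafilter might ignore the infinite set of bad indices.
        \<open>J\<close> carries every e_n to a bad index, so the limit along \<open>U\<close> for
        the product with \<open>J\<close> must notice them; this turns a bound along
        \<open>U\<close> into one for all large n.\<close>
      obtain J :: "'k kp_op" where J: "\<And>n. kp_apply J (kp_unit n) = kp_unit (r n)"
        using subsequence_embedding[OF r(1)] by metis
      have "((\<lambda>n. 1) \<longlongrightarrow> nrm J) U" using ultra_norm_tendsto[OF U, of J] by (simp add: J kp_norm_unit)
      then have "nrm J = 1" using tendsto_unique[OF U_nonbot[OF U] _ tendsto_const] by metis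
      then have "nrm ((?A m - B) * J) \<le> 1 / real (Suc m)" by (intro close) simp
      also have "\<dots> \<le> 1 / real (Suc p)" using that by (intro divide_left_mono) auto
      also have "\<dots> < \<delta>" by (rule p)
      also have "\<delta> \<le> nrm ((?A m - B) * J)"
      proof (rule tendsto_lowerbound[OF ultra_norm_tendsto[OF U] _ U_nonbot[OF U]])
        have "\<delta> \<le> kp_norm (kp_apply ((?A m - B) * J) (kp_unit n))" for n
          using r(2)[of n] kp_norm_minus_commute[of "kp_apply B (kp_unit (r n))" "kp_apply (?A m) (kp_unit (r n))"]
          by (simp add: S_def times_kp_op.rep_eq J kp_apply_minus)
        then show "eventually (\<lambda>n. \<delta> \<le> kp_norm (kp_apply ((?A m - B) * J) (kp_unit n))) U"
          by (intro always_eventually allI)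
      qed
      finally show False by simp
    qed
    then show "\<exists>m0. \<forall>m\<ge>m0. eventually (\<lambda>n. kp_norm (kp_apply (B - ?A m) (kp_unit n)) \<le> \<delta>) sequentially" by blast
  qed
qed

end

theorem corollary6p29:
  shows "\<not> Metric_space.mcomplete (ss_quotient :: 'k::rc_field kp_op set set) ss_quotient_dist \<and>
    (\<forall>U :: nat filter. nontrivial_ultrafilter U \<longrightarrow>
      \<not> closedin (Metric_space.mtopology (H_ops U) (H_ops_dist U)) (range (Lambda U :: 'k kp_op \<Rightarrow> _)))"
  using ss_quotient_not_mcomplete Lambda_range_not_closedin by blast

end
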